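(* Let $n\ge 1$ and $1\le p<\infty$. There is a constant $C_7$ depending only on $n$ and $p$ with the following property. Let $U\subset\mathbb{R}^{2n}$ be an open, bounded, connected set with Lipschitz boundary, and let $u\in W^{1,\infty}(U,\mathbb{R}^{2n})$ be essentially injective with $\operatorname{diam}u(U)\le d$ and $0<\lambda\le\det Du(x)\le\Lambda$ for a.e. $x\in U$. Then there exists $S\in W^{1,\infty}(U,\mathbb{R}^{2n})$ essentially injective with $DS(x)^TJ\,DS(x)=J$ for a.e. $x\in U$ such that $$\int_U|u-S|^p\,dx\le C\int_U|Du^TJ\,Du-J|^p\,dx,$$ where $$C=C_7\left(1+(1+\Lambda)^{2n-1}\left(\frac{d}{\lambda^{1/n}}\right)^p\left(1+\frac1{\lambda^p}\left(\frac\Lambda\lambda\right)^{2p-2}\right)\right).$$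
   Context: $J=\begin{bmatrix}0_{n\times n}&-1_{n\times n}\\1_{n\times n}&0_{n\times n}\end{bmatrix}$, where $1_{n\times n}$ is the identity matrix. $|\cdot|$ on matrices is the Frobenius norm. Functions in $W^{1,\infty}(U,\mathbb{R}^{2n})$ are identified with their continuous representatives. A map $u:U\to\mathbb{R}^{2n}$ is essentially injective if the multiplicity function $y\mapsto\mathcal{H}^0(U\cap u^{-1}\{y\})\in[0,\infty]$ has $L^\infty(\mathbb{R}^{2n})$-norm equal to $1$. *)

theory Defs
  imports "HOL-Analysis.Analysis" "HOL-Probability.Essential_Supremum"
begin

text \<open>
  The space \<open>\<real>\<^sup>2\<^sup>n\<close> is rendered as \<open>real ^ ('n + 'n)\<close> with \<open>n = CARD('n)\<close>: the summand \<open>Inl\<close> holds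
  the first \<open>n\<close> coordinates and \<open>Inr\<close> the last \<open>n\<close>. The library norm on \<open>real ^ 'm ^ 'm\<close> is the
  Frobenius norm.
\<close>

definition symplectic_J :: "real ^ ('n::finite + 'n) ^ ('n + 'n)" where
  "symplectic_J = (\<chi> i j.
     case i of
       Inl a \<Rightarrow> (case j of Inl b \<Rightarrow> 0 | Inr b \<Rightarrow> if a = b then - 1 else 0)
     | Inr a \<Rightarrow> (case j of Inl b \<Rightarrow> if a = b then 1 else 0 | Inr b \<Rightarrow> 0))"

primrec C_k :: "nat \<Rightarrow> (real ^ 'm::finite \<Rightarrow> real) \<Rightarrow> bool" where
  "C_k 0 f \<longleftrightarrow> continuous_on UNIV f"
| "C_k (Suc k) f \<longleftrightarrow>
     (\<forall>x. f differentiable (at x)) \<and>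
     (\<forall>j. C_k k (\<lambda>x. frechet_derivative f (at x) (axis j 1)))"

definition test_function :: "(real ^ 'm::finite) set \<Rightarrow> (real ^ 'm \<Rightarrow> real) \<Rightarrow> bool" where
  "test_function U \<phi> \<longleftrightarrow>
     (\<forall>k. C_k k \<phi>) \<and> compact (closure {x. \<phi> x \<noteq> 0}) \<and> closure {x. \<phi> x \<noteq> 0} \<subseteq> U"

definition locally_integrable ::
    "(real ^ 'm::finite) set \<Rightarrow> (real ^ 'm \<Rightarrow> 'b::euclidean_space) \<Rightarrow> bool" where
  "locally_integrable U f \<longleftrightarrow> (\<forall>K. compact K \<and> K \<subseteq> U \<longrightarrow> f absolutely_integrable_on K)"

text \<open>
  \<open>A\<close> is a representative of the distributional derivative \<open>Du\<close> on \<open>U\<close>, with \<open>A $ i $ j\<close> the weak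
  partial derivative of \<open>u\<^sub>i\<close> in direction \<open>j\<close>. It is unique up to null sets, hence a relation.
\<close>

definition weak_jacobian ::
    "(real ^ 'm::finite) set \<Rightarrow> (real ^ 'm \<Rightarrow> real ^ 'm) \<Rightarrow> (real ^ 'm \<Rightarrow> real ^ 'm ^ 'm) \<Rightarrow> bool" where
  "weak_jacobian U u A \<longleftrightarrow>
     locally_integrable U u \<and> locally_integrable U A \<and>
     (\<forall>\<phi> i j. test_function U \<phi> \<longrightarrow>
        (LINT x|lebesgue_on U. u x $ i * frechet_derivative \<phi> (at x) (axis j 1)) =
        - (LINT x|lebesgue_on U. A x $ i $ j * \<phi> x))"

definition L_infty ::
    "(real ^ 'm::finite) set \<Rightarrow> (real ^ 'm \<Rightarrow> 'b::euclidean_space) set" where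
  "L_infty U = {f. f \<in> borel_measurable (lebesgue_on U) \<and>
                   (\<exists>B. AE x in lebesgue_on U. norm (f x) \<le> B)}"

text \<open>
  Elements of \<open>W\<^sup>1\<^sup>,\<^sup>\<infinity>(U)\<close> are identified with their continuous representatives; values outside \<open>U\<close>
  are irrelevant.
\<close>

definition W_1_infty :: "(real ^ 'm::finite) set \<Rightarrow> (real ^ 'm \<Rightarrow> real ^ 'm) set" where
  "W_1_infty U = {u. continuous_on U u \<and> u \<in> L_infty U \<and>
                     (\<exists>A. weak_jacobian U u A \<and> A \<in> L_infty U)}"

text \<open>
  Near each boundary point \<open>U\<close> is, in coordinates given by a unit vector \<open>\<nu>\<close> and its orthogonal
  complement, the strict epigraph of a Lipschitz function \<open>\<gamma>\<close> on that complement.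
\<close>

definition lipschitz_boundary :: "(real ^ 'm::finite) set \<Rightarrow> bool" where
  "lipschitz_boundary U \<longleftrightarrow>
     (\<forall>z \<in> frontier U. \<exists>r \<nu> \<gamma> L. 0 < r \<and> norm \<nu> = 1 \<and>
        L-lipschitz_on {y. y \<bullet> \<nu> = 0} \<gamma> \<and>
        U \<inter> ball z r = {x \<in> ball z r. \<gamma> (x - (x \<bullet> \<nu>) *\<^sub>R \<nu>) < x \<bullet> \<nu>})"

text \<open>\<open>\<H>\<^sup>0\<close> is the counting measure.\<close>

definition multiplicity_on ::
    "(real ^ 'm::finite) set \<Rightarrow> (real ^ 'm \<Rightarrow> real ^ 'm) \<Rightarrow> real ^ 'm \<Rightarrow> ennreal" where
  "multiplicity_on U u y = emeasure (count_space UNIV) (U \<inter> u -` {y})"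

definition essentially_injective ::
    "(real ^ 'm::finite) set \<Rightarrow> (real ^ 'm \<Rightarrow> real ^ 'm) \<Rightarrow> bool" where
  "essentially_injective U u \<longleftrightarrow> esssup lebesgue (multiplicity_on U u) = 1"

end

(*
  If the defect I = int |Du^T J Du - J|^p vanishes, u itself is admissible. Otherwise an additional
  error I is affordable, and S can be taken to be a C^1 symplectic diffeomorphism of R^2n. Such maps
  are flexible: finitely many time-one maps of Hamiltonians a(x_i) b(x_j) realize every injective
  relabelling of finitely many small cells up to a set of small measure, so approximating u only
  requires room: the cells that u maps into a cube must fit into cells near that cube.

  With f = det Du, the area formula and essential injectivity show that the preimage of a cube
  exceeds the volume of the cube by at most the integral of (1 - f)^+ over it. Restacking each row of
  cubes in one coordinate direction absorbs the excess at cost 2^p (d/lam)^p int ((1 - f)^+)^p, by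
  Jensen's inequality. Since det (M^T J M) = (det M)^2 det J with |det J| = 1, (1 - f)^+ is at most
  C |Du^T J Du - J|. It vanishes if lam >= 1, and if lam < 1 the admissible constant dominates
  (d/lam)^p.
*)

theory Submission
  imports Defs
begin

section \<open>Symplectic diffeomorphisms\<close>

text \<open>The obstacle is a displacement bound that stays fixed while the exceptional set shrinks.
  The natural Hamiltonian for translating slabs \<open>x_i = const\<close> by different amounts is
  \<open>a(x_i) x_j\<close> with a step function \<open>a\<close>. On the ramps of \<open>a\<close>,
  of width \<open>1/q\<close>, its flow also moves points by \<open>a'(x_i) x_j\<close>, of order
  \<open>q\<close>, and an error of order \<open>q^p\<close> on a set of measure \<open>1/q\<close>
  does not vanish. Hence \<open>x_j\<close> is replaced by a wave \<open>b(x_j)\<close> of amplitude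
  \<open>1/q\<close> whose slope is 1 or -1 off a small set. The price is a sign that depends on the
  position inside the cell. For even \<open>q\<close> integer translations preserve these signs, so
  cells are cut into pieces of constant sign pattern, and it remains to see which integer positions
  of finitely many pieces can be reached. Moves are reversible and every configuration can be moved
  to one normal form, so all of them can.

  The area formula needs a pointwise derivative and injectivity on points, whereas \<open>Du\<close>
  is a distributional derivative and the multiplicity bound concerns almost every value; the middle
  sections bridge this gap.\<close>

primrec conjugate :: "'a + 'a \<Rightarrow> 'a + 'a" where
  "conjugate (Inl a) = Inr a"
| "conjugate (Inr a) = Inl a"

primrec conj_sign :: "'a + 'a \<Rightarrow> int" where
  "conj_sign (Inl a) = 1"
| "conj_sign (Inr a) = -1"

lemma conjugate_conjugate [simp]: "conjugate (conjugate i) = i"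
  by (cases i) auto

lemma conjugate_neq [simp]: "conjugate i \<noteq> i" "i \<noteq> conjugate i"
  by (cases i; auto)+

lemma conj_sign_mult_self [simp]: "conj_sign i * conj_sign i = 1" "conj_sign i * (conj_sign i * z) = z"
  by (cases i; simp)+

lemma conj_sign_conjugate [simp]: "conj_sign (conjugate i) = - conj_sign i"
  by (cases i) auto

lemma symplectic_J_axis:
  "symplectic_J *v axis j 1 = of_int (conj_sign j) *\<^sub>R axis (conjugate j) (1::real)"
  unfolding matrix_vector_mult_basis
  by (cases j) (auto simp: vec_eq_iff column_def symplectic_J_def axis_def split: sum.split)

lemma symplectic_J_nth:
  "(symplectic_J *v v) $ i = - of_int (conj_sign i) * v $ conjugate i"
proof -
  have "(symplectic_J *v v) $ i = (\<Sum>j\<in>UNIV. symplectic_J $ i $ j * v $ j)"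
    by (simp add: matrix_vector_mult_def)
  also have "\<dots> = (\<Sum>j\<in>UNIV. if j = conjugate i then - of_int (conj_sign i) * v $ j else 0)"
    by (rule sum.cong) (auto simp: symplectic_J_def split: sum.split)
  finally show ?thesis by simp
qed

lemma symplectic_J_square: "symplectic_J *v (symplectic_J *v v) = - v"
proof -
  have s: "real_of_int (conj_sign i) * real_of_int (conj_sign i) = 1" for i :: "'n + 'n"
    by (cases i) auto
  show ?thesis
    by (simp add: vec_eq_iff symplectic_J_nth mult.assoc[symmetric] s)
qed

lemma inner_symplectic_J: "v \<bullet> (symplectic_J *v w) = - (symplectic_J *v v) \<bullet> w"
proof -
  have "v \<bullet> (symplectic_J *v w) = (\<Sum>i\<in>UNIV. v $ i * (- of_int (conj_sign i) * w $ conjugate i))"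
    by (simp add: inner_vec_def symplectic_J_nth)
  also have "\<dots> = (\<Sum>i\<in>UNIV. v $ conjugate i * (of_int (conj_sign i) * w $ i))"
    by (rule sum.reindex_bij_witness[of _ conjugate conjugate]) auto
  also have "\<dots> = - (symplectic_J *v v) \<bullet> w"
    by (simp add: inner_vec_def symplectic_J_nth sum_negf mult_ac)
  finally show ?thesis .
qed

text \<open>Read as invariance of the bilinear form \<open>v \<bullet> (symplectic_J *v w)\<close>,
  the condition passes to products without matrix algebra and can be checked on a derivative given
  as a linear map.\<close>

lemma symplectic_matrix_iff:
  fixes M :: "real ^ ('n::finite + 'n) ^ ('n + 'n)"
  shows "transpose M ** symplectic_J ** M = symplectic_J \<longleftrightarrow>
    (\<forall>v w. (M *v v) \<bullet> (symplectic_J *v (M *v w)) = v \<bullet> (symplectic_J *v w))"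
proof -
  have *: "(M *v v) \<bullet> (symplectic_J *v (M *v w)) = v \<bullet> ((transpose M ** symplectic_J ** M) *v w)" for v w
    by (simp add: matrix_vector_mul_assoc[symmetric] transpose_matrix_vector inner_commute[of v] dot_lmul_matrix)
      (simp add: inner_commute)
  show ?thesis
  proof
    assume "transpose M ** symplectic_J ** M = symplectic_J"
    then show "\<forall>v w. (M *v v) \<bullet> (symplectic_J *v (M *v w)) = v \<bullet> (symplectic_J *v w)"
      by (simp only: *) simp
  next
    assume "\<forall>v w. (M *v v) \<bullet> (symplectic_J *v (M *v w)) = v \<bullet> (symplectic_J *v w)"
    then have "\<forall>v. v \<bullet> ((transpose M ** symplectic_J ** M) *v w) = v \<bullet> (symplectic_J *v w)" for w
      by (simp only: *) simp
    then have "\<forall>w. (transpose M ** symplectic_J ** M) *v w = symplectic_J *v w"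
      by (simp only: vector_eq_ldot) simp
    then show "transpose M ** symplectic_J ** M = symplectic_J"
      by (simp only: matrix_eq) simp
  qed
qed

text \<open>Continuity of the inverse makes images of open sets open, from which the multiplicity of
  the restriction to \<open>U\<close> is read off. The derivative is carried as a continuous matrix
  field, ready to serve as a weak Jacobian.\<close>

definition symplectic_diffeo :: "(real ^ ('n::finite + 'n) \<Rightarrow> real ^ ('n + 'n)) \<Rightarrow> bool" where
  "symplectic_diffeo \<Phi> \<longleftrightarrow> bij \<Phi> \<and> continuous_on UNIV (inv \<Phi>) \<and>
     (\<exists>D. (\<forall>x. (\<Phi> has_derivative (\<lambda>v. D x *v v)) (at x)) \<and> continuous_on UNIV D \<and>
        (\<forall>x. transpose (D x) ** symplectic_J ** D x = symplectic_J))"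

lemma matrix_vector_mat_1: "(*v) (mat 1 :: real ^ 'm::finite ^ 'm) = (\<lambda>v. v)"
  by (simp add: fun_eq_iff)

lemma symplectic_diffeo_id: "symplectic_diffeo (\<lambda>x. x)"
  unfolding symplectic_diffeo_def
  by (auto intro!: exI[of _ "\<lambda>_. mat 1"] bij_id[unfolded id_def] continuous_on_const
      simp: matrix_vector_mat_1 inv_id[unfolded id_def])

lemma continuous_on_matrix_mult:
  fixes f :: "'a::topological_space \<Rightarrow> real ^ 'm::finite ^ 'l::finite" and g :: "'a \<Rightarrow> real ^ 'k::finite ^ 'm"
  assumes "continuous_on S f" "continuous_on S g"
  shows "continuous_on S (\<lambda>x. f x ** g x)"
  unfolding matrix_matrix_mult_def using assms
  by (intro continuous_on_vec_lambda continuous_on_sum continuous_on_mult continuous_on_component)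

lemma symplectic_diffeo_compose:
  assumes "symplectic_diffeo \<Phi>" "symplectic_diffeo \<Psi>"
  shows "symplectic_diffeo (\<lambda>x. \<Psi> (\<Phi> x))"
proof -
  obtain D where D: "\<And>x. (\<Phi> has_derivative (\<lambda>v. D x *v v)) (at x)" "continuous_on UNIV D"
    "\<And>x. transpose (D x) ** symplectic_J ** D x = symplectic_J"
    and b1: "bij \<Phi>" "continuous_on UNIV (inv \<Phi>)"
    using assms(1) unfolding symplectic_diffeo_def by blast
  obtain E where E: "\<And>x. (\<Psi> has_derivative (\<lambda>v. E x *v v)) (at x)" "continuous_on UNIV E"
    "\<And>x. transpose (E x) ** symplectic_J ** E x = symplectic_J"
    and b2: "bij \<Psi>" "continuous_on UNIV (inv \<Psi>)"
    using assms(2) unfolding symplectic_diffeo_def by blast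
  have c: "continuous_on UNIV \<Phi>"
    using D(1) by (meson continuous_at_imp_continuous_on has_derivative_continuous)
  have bij: "bij (\<lambda>x. \<Psi> (\<Phi> x))"
    using bij_comp[OF b1(1) b2(1)] by (simp add: comp_def)
  have "inv (\<lambda>x. \<Psi> (\<Phi> x)) = (\<lambda>y. inv \<Phi> (inv \<Psi> y))"
    using o_inv_distrib[OF b2(1) b1(1)] by (simp add: comp_def)
  then have inv: "continuous_on UNIV (inv (\<lambda>x. \<Psi> (\<Phi> x)))"
    using continuous_on_compose2[OF b1(2) b2(2)] by simp
  have der: "((\<lambda>x. \<Psi> (\<Phi> x)) has_derivative (\<lambda>v. (E (\<Phi> x) ** D x) *v v)) (at x)" for x
    using has_derivative_compose[OF D(1) E(1)] by (simp add: matrix_vector_mul_assoc)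
  have cont: "continuous_on UNIV (\<lambda>x. E (\<Phi> x) ** D x)"
    by (intro continuous_on_matrix_mult continuous_on_compose2[OF E(2) c] D(2)) auto
  have "transpose (E (\<Phi> x) ** D x) ** symplectic_J ** (E (\<Phi> x) ** D x) = symplectic_J" for x
    using D(3)[of x] E(3)[of "\<Phi> x"] unfolding symplectic_matrix_iff
    by (simp add: matrix_vector_mul_assoc[symmetric])
  with bij inv der cont show ?thesis
    unfolding symplectic_diffeo_def
    by (intro conjI exI[of _ "\<lambda>x. E (\<Phi> x) ** D x"] allI) auto
qed

text \<open>The two dilations cancel in the derivative. Maps built for the integer lattice can
  therefore be used on a lattice of any mesh \<open>h\<close>, with displacements multiplied by
  \<open>h\<close>.\<close>

lemma symplectic_diffeo_scale:
  assumes "symplectic_diffeo \<Phi>" "h > 0"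
  shows "symplectic_diffeo (\<lambda>x. h *\<^sub>R \<Phi> ((1/h) *\<^sub>R x))"
proof -
  obtain D where D: "\<And>x. (\<Phi> has_derivative (\<lambda>v. D x *v v)) (at x)" "continuous_on UNIV D"
    "\<And>x. transpose (D x) ** symplectic_J ** D x = symplectic_J"
    and b1: "bij \<Phi>" "continuous_on UNIV (inv \<Phi>)"
    using assms(1) unfolding symplectic_diffeo_def by blast
  let ?F = "\<lambda>x. h *\<^sub>R \<Phi> ((1/h) *\<^sub>R x)" and ?G = "\<lambda>y. h *\<^sub>R inv \<Phi> ((1/h) *\<^sub>R y)"
  have GF: "?G (?F x) = x" "?F (?G x) = x" for x
    using assms(2) b1(1) by (auto simp: bij_is_inj bij_is_surj surj_f_inv_f)
  then have bij: "bij ?F" and inv: "inv ?F = ?G"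
    by (auto intro!: bij_betw_byWitness[of _ ?G] inv_equality)
  have "continuous_on UNIV ?G"
    by (intro continuous_intros continuous_on_compose2[OF b1(2)]) auto
  moreover have "(?F has_derivative (\<lambda>v. D ((1/h) *\<^sub>R x) *v v)) (at x)" for x
  proof -
    have "((\<lambda>x. \<Phi> ((1/h) *\<^sub>R x)) has_derivative (\<lambda>v. D ((1/h) *\<^sub>R x) *v ((1/h) *\<^sub>R v))) (at x)"
      by (rule has_derivative_compose[OF _ D(1)]) (auto intro!: derivative_eq_intros)
    from has_derivative_scaleR_right[OF this, of h] show ?thesis
      using assms(2) by (simp add: matrix_vector_mult_scaleR)
  qed
  moreover have "continuous_on UNIV (\<lambda>x. D ((1/h) *\<^sub>R x))"
    by (intro continuous_on_compose2[OF D(2)] continuous_intros) auto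
  ultimately show ?thesis
    unfolding symplectic_diffeo_def using bij inv D(3) by (auto intro!: exI[of _ "\<lambda>x. D ((1/h) *\<^sub>R x)"])
qed

text \<open>
  The time-one map of the Hamiltonian \<open>a(x\<^sub>i) b(x\<^sub>j)\<close>, whose flow is explicit because \<open>x\<^sub>i\<close> and \<open>x\<^sub>j\<close> are
  constant along it when \<open>i \<noteq> conjugate j\<close>; \<open>a'\<close> and \<open>b'\<close> are meant to be the derivatives.
\<close>

definition pair_shear ::
    "(real \<Rightarrow> real) \<Rightarrow> (real \<Rightarrow> real) \<Rightarrow> (real \<Rightarrow> real) \<Rightarrow> (real \<Rightarrow> real) \<Rightarrow>
     'n + 'n \<Rightarrow> 'n + 'n \<Rightarrow> real ^ ('n::finite + 'n) \<Rightarrow> real ^ ('n + 'n)" where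
  "pair_shear a a' b b' i j x =
     x + (a' (x $ i) * b (x $ j)) *\<^sub>R (symplectic_J *v axis i 1)
       + (a (x $ i) * b' (x $ j)) *\<^sub>R (symplectic_J *v axis j 1)"

lemma pair_shear_nth:
  assumes "i \<noteq> conjugate j"
  shows "pair_shear a a' b b' i j x $ i = x $ i" "pair_shear a a' b b' i j x $ j = x $ j"
  unfolding pair_shear_def symplectic_J_axis using assms by (auto simp: axis_def)

text \<open>The inverse is the flow run backwards, the shear of \<open>- a\<close>, because both
  maps keep \<open>x_i\<close> and \<open>x_j\<close>. The derivative adds multiples of
  \<open>J e_i\<close> and \<open>J e_j\<close>; the form survives because these multiples come from
  a symmetric Hessian and because \<open>e_i\<close> and \<open>e_j\<close> span an isotropic
  subspace when \<open>i \<noteq> conjugate j\<close>.\<close>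

lemma symplectic_pair_shear:
  fixes i j :: "'n::finite + 'n"
  assumes ij: "i \<noteq> conjugate j"
    and a: "\<And>t. (a has_real_derivative a' t) (at t)" "\<And>t. (a' has_real_derivative a'' t) (at t)"
      "continuous_on UNIV a''"
    and b: "\<And>t. (b has_real_derivative b' t) (at t)" "\<And>t. (b' has_real_derivative b'' t) (at t)"
      "continuous_on UNIV b''"
  shows "symplectic_diffeo (pair_shear a a' b b' i j)"
proof -
  let ?F = "pair_shear a a' b b' i j" and ?G = "pair_shear (\<lambda>t. - a t) (\<lambda>t. - a' t) b b' i j"
  let ?J = "\<lambda>v. (symplectic_J :: real ^ ('n + 'n) ^ ('n + 'n)) *v v"
  have G: "?G y = y - (a' (y $ i) * b (y $ j)) *\<^sub>R ?J (axis i 1) - (a (y $ i) * b' (y $ j)) *\<^sub>R ?J (axis j 1)" for y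
    by (simp add: pair_shear_def)
  have F: "?F y = y + (a' (y $ i) * b (y $ j)) *\<^sub>R ?J (axis i 1) + (a (y $ i) * b' (y $ j)) *\<^sub>R ?J (axis j 1)" for y
    by (simp add: pair_shear_def)
  have GF: "?G (?F x) = x" "?F (?G x) = x" for x
    by (simp add: G[of "?F x"] pair_shear_nth[OF ij], simp add: F)
      (simp add: F[of "?G x"] pair_shear_nth[OF ij], simp add: G)
  then have bij: "bij ?F" and inv: "inv ?F = ?G"
    by (auto intro!: bij_betw_byWitness[of _ ?G] inv_equality)
  have ca: "continuous_on UNIV a" "continuous_on UNIV a'" "continuous_on UNIV b" "continuous_on UNIV b'"
    using a b by (meson DERIV_isCont continuous_at_imp_continuous_on)+
  note cc = continuous_on_compose2[OF ca(1)] continuous_on_compose2[OF ca(2)]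
    continuous_on_compose2[OF ca(3)] continuous_on_compose2[OF ca(4)]
    continuous_on_compose2[OF a(3)] continuous_on_compose2[OF b(3)]
  have "continuous_on UNIV ?G"
    unfolding pair_shear_def by (intro continuous_intros cc subset_UNIV)
  \<comment> \<open>\<alpha> and \<beta> collect the second derivatives of
    \<open>a(x_i) b(x_j)\<close> applied to \<open>v\<close>; the mixed entry \<open>a' b'\<close>
    that they share is what makes the correction terms cancel at the end.\<close>
  define \<alpha> where "\<alpha> x v = a'' (x $ i) * b (x $ j) * v $ i + a' (x $ i) * b' (x $ j) * v $ j"
    for x v :: "real ^ ('n + 'n)"
  define \<beta> where "\<beta> x v = a' (x $ i) * b' (x $ j) * v $ i + a (x $ i) * b'' (x $ j) * v $ j"
    for x v :: "real ^ ('n + 'n)"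
  define L where "L x v = v + \<alpha> x v *\<^sub>R ?J (axis i 1) + \<beta> x v *\<^sub>R ?J (axis j 1)" for x v
  have lin: "linear (L x)" for x
    by (rule linearI) (simp_all add: L_def \<alpha>_def \<beta>_def algebra_simps)
  have matL: "matrix (L x) *v v = L x v" for x v
    by (simp add: matrix_works lin)
  have comp: "((\<lambda>x. f (x $ k)) has_derivative (\<lambda>v. f' (x $ k) * v $ k)) (at x)"
    if "\<And>t. (f has_real_derivative f' t) (at t)" for f f' :: "real \<Rightarrow> real" and k and x :: "real ^ ('n + 'n)"
    by (rule has_derivative_compose[of "\<lambda>x. x $ k" "\<lambda>v. v $ k" x UNIV f, simplified])
      (use that in \<open>auto simp: has_field_derivative_def intro!: derivative_intros bounded_linear_imp_has_derivative bounded_linear_vec_nth\<close>)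
  have der: "(?F has_derivative (\<lambda>v. matrix (L x) *v v)) (at x)" for x
  proof -
    have 1: "((\<lambda>x. a' (x $ i) * b (x $ j)) has_derivative \<alpha> x) (at x)"
      unfolding \<alpha>_def
      by (rule has_derivative_eq_rhs[OF has_derivative_mult[OF comp[OF a(2)] comp[OF b(1)]]])
        (simp add: algebra_simps)
    have 2: "((\<lambda>x. a (x $ i) * b' (x $ j)) has_derivative \<beta> x) (at x)"
      unfolding \<beta>_def
      by (rule has_derivative_eq_rhs[OF has_derivative_mult[OF comp[OF a(1)] comp[OF b(2)]]])
        (simp add: algebra_simps)
    show ?thesis
      unfolding matL pair_shear_def L_def
      by (intro has_derivative_add has_derivative_ident has_derivative_scaleR_left 1 2)
  qed
  have cont: "continuous_on UNIV (\<lambda>x. matrix (L x))"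
    unfolding matrix_def L_def \<alpha>_def \<beta>_def
    by (intro continuous_on_vec_lambda continuous_intros cc subset_UNIV)
  have anti: "v \<bullet> ?J (?J w) = - (v \<bullet> w)" "?J v \<bullet> ?J w = v \<bullet> w" "?J v \<bullet> w = - (v \<bullet> ?J w)" for v w :: "real ^ ('n + 'n)"
    by (simp_all add: inner_symplectic_J symplectic_J_square)
  have iso: "axis k 1 \<bullet> ?J (axis l 1) = 0" if "k \<in> {i,j}" "l \<in> {i,j}" for k l
    using that ij by (auto simp: symplectic_J_axis inner_axis_axis)
  have ax: "v \<bullet> axis k 1 = v $ k" "axis k 1 \<bullet> v = v $ k" for v :: "real ^ ('n + 'n)" and k
    by (simp_all add: inner_axis inner_axis')
  have "L x v \<bullet> ?J (L x w) = v \<bullet> ?J w" for x v w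
  proof -
    have "?J (L x w) = ?J w - \<alpha> x w *\<^sub>R axis i 1 - \<beta> x w *\<^sub>R axis j 1"
      by (simp add: L_def matrix_vector_right_distrib matrix_vector_mult_scaleR symplectic_J_square)
    then have "L x v \<bullet> ?J (L x w) = v \<bullet> ?J w - \<alpha> x w * v $ i - \<beta> x w * v $ j
        + \<alpha> x v * w $ i + \<beta> x v * w $ j"
      using iso[of i i] iso[of i j] iso[of j i] iso[of j j]
      by (simp add: L_def inner_add_left inner_diff_right ax anti inner_commute[of "?J _" "axis _ _"])
    then show ?thesis
      by (simp add: \<alpha>_def \<beta>_def algebra_simps)
  qed
  then have "transpose (matrix (L x)) ** symplectic_J ** matrix (L x) = symplectic_J" for x
    by (simp add: symplectic_matrix_iff matL)
  with der cont bij inv \<open>continuous_on UNIV ?G\<close> show ?thesis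
    unfolding symplectic_diffeo_def
    by (intro conjI exI[of _ "\<lambda>x. matrix (L x)"] allI) auto
qed

section \<open>Rearrangement of lattice cells\<close>

text \<open>
  The combinatorial shadow of the shears: a state \<open>x\<close> carries a lattice position \<open>z x\<close>, which the moves
  change, and a vector of signs \<open>s x\<close>, which they do not.
\<close>

inductive reach :: "'x set \<Rightarrow> ('x \<Rightarrow> 'n + 'n \<Rightarrow> int) \<Rightarrow> ('x \<Rightarrow> 'n + 'n \<Rightarrow> int) \<Rightarrow> ('x \<Rightarrow> 'n + 'n \<Rightarrow> int) \<Rightarrow> bool"
  for X s z where
  reach_refl: "reach X s z z"
| reach_step: "\<lbrakk>reach X s z w; i \<noteq> conjugate j;
     \<And>x k. x \<in> X \<Longrightarrow> w' x k = w x k + (if k = conjugate j then conj_sign j * s x j * K (w x i) else 0)\<rbrakk>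
   \<Longrightarrow> reach X s z w'"

lemma reach_trans: "reach X s v w \<Longrightarrow> reach X s z v \<Longrightarrow> reach X s z w"
  by (induction rule: reach.induct) (auto intro: reach.intros)

lemma reach_move:
  assumes "i \<noteq> conjugate j"
    and "\<And>x k. x \<in> X \<Longrightarrow> w' x k = w x k + (if k = conjugate j then conj_sign j * s x j * K (w x i) else 0)"
  shows "reach X s w w'"
  by (rule reach_step[OF reach_refl assms(1)]) (rule assms(2))

text \<open>A move leaves coordinate \<open>i\<close> alone, since
  \<open>i \<noteq> conjugate j\<close>, so the same coordinate steers the move with
  \<open>- K\<close> back.\<close>

lemma reach_sym: "reach X s z w \<Longrightarrow> reach X s w z"
proof (induction rule: reach.induct)
  case (reach_step w i j w' K)
  have "reach X s w' w"
    by (rule reach_move[OF reach_step.hyps(2), of _ _ _ _ "\<lambda>t. - K t"])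
      (use reach_step.hyps in auto)
  then show ?case
    using reach_step.IH reach_trans by blast
qed (rule reach_refl)

text \<open>A step constrains the new positions on \<open>X\<close> only, so the zero move exchanges
  one representative for another.\<close>

lemma reach_cong:
  assumes "reach X s z w" "\<And>x. x \<in> X \<Longrightarrow> w' x = w x"
  shows "reach X s z w'"
proof -
  have "reach X s w w'"
    by (rule reach_move[of "Inl undefined" "Inl undefined" _ _ _ _ "\<lambda>_. 0"]) (use assms(2) in auto)
  then show ?thesis using assms(1) reach_trans by blast
qed

text \<open>A coordinate \<open>i\<close> with distinct values on the states identifies the state,
  so the amount \<open>K\<close> may depend on everything, including the sign by which the move will
  multiply it; multiplying by that sign beforehand removes it.\<close>

lemma reach_set_coordinate:
  fixes s :: "'x \<Rightarrow> 'n::finite + 'n \<Rightarrow> int"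
  assumes sgn: "\<forall>x\<in>X. \<forall>i. s x i = 1 \<or> s x i = -1"
    and inj: "inj_on (\<lambda>x. w x i) X" and "k \<noteq> i"
  shows "reach X s w (\<lambda>x l. if l = k then T x else w x l)"
proof (rule reach_move[of i "conjugate k" _ _ _ _
      "\<lambda>t. let x = the_inv_into X (\<lambda>x. w x i) t in conj_sign (conjugate k) * (s x (conjugate k) * (T x - w x k))"])
  fix x l assume x: "x \<in> X"
  then show "(if l = k then T x else w x l) =
      w x l + (if l = conjugate (conjugate k) then conj_sign (conjugate k) * s x (conjugate k) *
        (let x = the_inv_into X (\<lambda>x. w x i) (w x i)
         in conj_sign (conjugate k) * (s x (conjugate k) * (T x - w x k))) else 0)"
    using bspec[OF sgn x, THEN spec, of "conjugate k"]
    by (cases k) (auto simp: the_inv_into_f_f[OF inj x])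
qed (use assms in auto)

lemma reach_set_coordinates:
  fixes s :: "'x \<Rightarrow> 'n::finite + 'n \<Rightarrow> int"
  assumes sgn: "\<forall>x\<in>X. \<forall>i. s x i = 1 \<or> s x i = -1"
    and inj: "inj_on (\<lambda>x. w x i) X" and "i \<notin> I"
  shows "reach X s w (\<lambda>x l. if l \<in> I then T x l else w x l)"
  using finite[of I] \<open>i \<notin> I\<close>
proof (induction I rule: finite_induct)
  case empty
  then show ?case by (simp add: reach_refl)
next
  case (insert k I)
  let ?w = "\<lambda>x l. if l \<in> I then T x l else w x l"
  have "reach X s ?w (\<lambda>x l. if l = k then T x k else ?w x l)"
    by (rule reach_set_coordinate[OF sgn, where i = i]) (use inj insert in auto)
  then have "reach X s w (\<lambda>x l. if l = k then T x k else ?w x l)"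
    using insert reach_trans by fastforce
  then show ?case
    by (rule reach_cong) (auto simp: fun_eq_iff)
qed

text \<open>Moves with \<open>i = j\<close> are allowed, because no index is its own conjugate. With
  constant \<open>K\<close> they write the hidden sign \<open>s x i\<close> into the visible
  coordinate \<open>conjugate i\<close>.\<close>

lemma reach_expose_signs:
  fixes s :: "'x \<Rightarrow> 'n::finite + 'n \<Rightarrow> int"
  shows "reach X s w (\<lambda>x l. if conjugate l \<in> I then w x l + A * s x (conjugate l) else w x l)"
  using finite[of I]
proof (induction I rule: finite_induct)
  case empty
  then show ?case by (simp add: reach_refl)
next
  case (insert i I)
  let ?w = "\<lambda>x l. if conjugate l \<in> I then w x l + A * s x (conjugate l) else w x l"
  have "reach X s ?w (\<lambda>x l. if conjugate l \<in> insert i I then w x l + A * s x (conjugate l) else w x l)"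
  proof (rule reach_move[of i i _ _ _ _ "\<lambda>_. conj_sign i * A"])
    fix x l
    show "(if conjugate l \<in> insert i I then w x l + A * s x (conjugate l) else w x l) =
      ?w x l + (if l = conjugate i then conj_sign i * s x i * (conj_sign i * A) else 0)"
      using insert.hyps conj_sign_mult_self(1)[of i]
      by (cases "l = conjugate i") (auto simp: algebra_simps)
  qed auto
  with insert.IH show ?case
    using reach_trans by blast
qed

lemma finite_int_bound:
  assumes "finite X"
  obtains M :: int where "M > 0" "\<And>x y. x \<in> X \<Longrightarrow> y \<in> X \<Longrightarrow> \<bar>f x - f y\<bar> < M"
proof -
  let ?S = "(\<lambda>(x,y). \<bar>f x - f y\<bar>) ` (X \<times> X)"
  have fin: "finite (insert 0 ?S)" using assms by simp
  show thesis
  proof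
    show "1 + Max (insert 0 ?S) > 0"
      using Max_ge[OF fin, of 0] by simp
    show "\<bar>f x - f y\<bar> < 1 + Max (insert 0 ?S)" if "x \<in> X" "y \<in> X" for x y
      using Max_ge[OF fin, of "\<bar>f x - f y\<bar>"] that by force
  qed
qed

text \<open>Encoding in mixed radix: adding \<open>L\<close> times coordinate \<open>j\<close> to
  coordinate \<open>conjugate i\<close>, with \<open>L\<close> above all differences of the values
  present there, records coordinate \<open>j\<close> and loses nothing. The move multiplies the
  added term by \<open>s x i\<close>; hypothesis \<open>z\<close> says that this sign is itself
  legible from coordinate \<open>conjugate i\<close>, so it can be divided out.\<close>

lemma reach_encode:
  fixes s :: "'x \<Rightarrow> 'n::finite + 'n \<Rightarrow> int"
  assumes X: "finite X" and sgn: "\<forall>x\<in>X. \<forall>i. s x i = 1 \<or> s x i = -1"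
    and z: "\<forall>x\<in>X. \<forall>y\<in>X. z x (conjugate i) = z y (conjugate i) \<longrightarrow> s x i = s y i"
    and I: "conjugate i \<notin> I"
  shows "\<exists>w. reach X s z w \<and> (\<forall>x\<in>X. \<forall>k. k \<noteq> conjugate i \<longrightarrow> w x k = z x k) \<and>
     (\<forall>x\<in>X. \<forall>y\<in>X. w x (conjugate i) = w y (conjugate i) \<longrightarrow>
        s x i = s y i \<and> z x (conjugate i) = z y (conjugate i) \<and> (\<forall>k\<in>I. z x k = z y k))"
  using finite[of I] I
proof (induction I rule: finite_induct)
  case empty
  show ?case using reach_refl[of X s z] z by (intro exI[of _ z]) blast
next
  case (insert j I)
  have "conjugate i \<notin> I" using insert.prems by simp
  from insert.IH[OF this] obtain w where w: "reach X s z w"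
    and w2: "\<forall>x\<in>X. \<forall>k. k \<noteq> conjugate i \<longrightarrow> w x k = z x k"
    and w3: "\<forall>x\<in>X. \<forall>y\<in>X. w x (conjugate i) = w y (conjugate i) \<longrightarrow>
        s x i = s y i \<and> z x (conjugate i) = z y (conjugate i) \<and> (\<forall>k\<in>I. z x k = z y k)"
    by (elim exE conjE)
  obtain L where L: "L > 0" "\<And>x y. x \<in> X \<Longrightarrow> y \<in> X \<Longrightarrow> \<bar>w x (conjugate i) - w y (conjugate i)\<bar> < L"
    by (rule finite_int_bound[OF X, of "\<lambda>x. w x (conjugate i)"]) blast
  define w' where "w' x k = w x k + (if k = conjugate i then s x i * (L * w x j) else 0)" for x k
  have cs: "conj_sign i * s x i * (conj_sign i * t) = s x i * t" for x t
    by (cases i) auto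
  have "j \<noteq> conjugate i" using insert.prems by auto
  then have "reach X s w w'"
    by (rule reach_move[of j i _ _ _ _ "\<lambda>t. conj_sign i * (L * t)"])
      (simp add: w'_def cs)
  then have r: "reach X s z w'"
    by (rule reach_trans[OF _ w(1)])
  have sep: "s x i = s y i \<and> z x (conjugate i) = z y (conjugate i) \<and> (\<forall>k\<in>insert j I. z x k = z y k)"
    if xy: "x \<in> X" "y \<in> X" and eq: "w' x (conjugate i) = w' y (conjugate i)" for x y
  proof -
    have wz: "w x j = z x j" "w y j = z y j"
      using w2 xy insert.prems by auto
    \<comment> \<open>Two states with equal codes differ, before the move, by a multiple of
      \<open>L\<close> that is smaller than \<open>L\<close>, hence by zero.\<close>
    have "L * (s y i * w y j - s x i * w x j) = w x (conjugate i) - w y (conjugate i)"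
      using eq by (simp add: w'_def algebra_simps)
    then have "L * \<bar>s y i * w y j - s x i * w x j\<bar> < L * 1"
      using L(2)[OF xy] L(1) by (metis abs_mult abs_of_pos mult.right_neutral)
    then have e: "s y i * w y j = s x i * w x j"
      using L(1) by (simp add: mult_less_cancel_left)
    then have "s y i * (L * w y j) = s x i * (L * w x j)"
      by (simp only: mult.left_commute[of _ L])
    then have "w x (conjugate i) = w y (conjugate i)"
      using eq unfolding w'_def by (simp only: refl if_True add_right_cancel)
    then have *: "s x i = s y i \<and> z x (conjugate i) = z y (conjugate i) \<and> (\<forall>k\<in>I. z x k = z y k)"
      using w3 xy by blast
    moreover have "s x i \<noteq> 0"
      using bspec[OF sgn xy(1), THEN spec, of i] by auto
    then have "z x j = z y j"
      using e * unfolding wz by (metis mult_left_cancel)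
    ultimately show ?thesis
      by blast
  qed
  have "\<forall>x\<in>X. \<forall>k. k \<noteq> conjugate i \<longrightarrow> w' x k = z x k"
    using w2 by (simp add: w'_def)
  with r sep show ?case
    by (intro exI[of _ w']) blast
qed

text \<open>One coordinate that separates the states suffices to steer all others. Such a coordinate
  is produced by making the signs visible everywhere and encoding all coordinates in
  \<open>conjugate i\<close>. Only states with equal signs have to start in different positions,
  since the exposed signs distinguish the rest.\<close>

lemma reach_canonical:
  fixes s :: "'x \<Rightarrow> 'n::finite + 'n \<Rightarrow> int"
  assumes X: "finite X" and sgn: "\<forall>x\<in>X. \<forall>i. s x i = 1 \<or> s x i = -1"
    and sep: "\<And>x y. x \<in> X \<Longrightarrow> y \<in> X \<Longrightarrow> s x = s y \<Longrightarrow> z x = z y \<Longrightarrow> x = y"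
    and e: "inj_on e X"
  shows "reach X s z (\<lambda>x k. if k = i then e x else 0)"
proof -
  obtain M where M: "M > 0" "\<And>x y k. x \<in> X \<Longrightarrow> y \<in> X \<Longrightarrow> \<bar>z x k - z y k\<bar> < M"
  proof -
    have "\<exists>M>0. \<forall>x\<in>X. \<forall>y\<in>X. \<bar>z x k - z y k\<bar> < M" for k
      by (rule finite_int_bound[OF X, of "\<lambda>x. z x k"]) blast
    then obtain M where M: "\<And>k. M k > 0" "\<And>k x y. x \<in> X \<Longrightarrow> y \<in> X \<Longrightarrow> \<bar>z x k - z y k\<bar> < M k"
      by metis
    have "M k \<le> (\<Sum>k\<in>UNIV. M k)" for k
      using M(1) by (intro member_le_sum) (auto intro: less_imp_le)
    then show thesis
      using M that[of "\<Sum>k\<in>UNIV. M k"] by (meson order_less_le_trans)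
  qed
  \<comment> \<open>Signs differ by 0 or 2 and positions by less than \<open>M\<close>, so the
    single value \<open>z1 x l\<close> determines both \<open>z x l\<close> and
    \<open>s x (conjugate l)\<close>.\<close>
  define z1 where "z1 x l = z x l + M * s x (conjugate l)" for x l
  have r1: "reach X s z z1"
    using reach_expose_signs[of X s z UNIV M] unfolding z1_def by simp
  have z1: "z x l = z y l \<and> s x (conjugate l) = s y (conjugate l)"
    if "x \<in> X" "y \<in> X" "z1 x l = z1 y l" for x y l
    using M(2)[OF that(1,2), of l] that(3)
      bspec[OF sgn that(1), THEN spec, of "conjugate l"] bspec[OF sgn that(2), THEN spec, of "conjugate l"]
    unfolding z1_def by auto
  let ?r = "conjugate i"
  have si: "\<forall>x\<in>X. \<forall>y\<in>X. z1 x ?r = z1 y ?r \<longrightarrow> s x i = s y i"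
    using z1[of _ _ ?r] unfolding conjugate_conjugate by blast
  have "?r \<notin> - {?r}" by simp
  from reach_encode[where z = z1 and i = i and I = "-{?r}", OF X sgn si this] obtain w where w: "reach X s z1 w"
     "\<forall>x\<in>X. \<forall>y\<in>X. w x ?r = w y ?r \<longrightarrow> s x i = s y i \<and> z1 x ?r = z1 y ?r \<and> (\<forall>k\<in>-{?r}. z1 x k = z1 y k)"
    by (elim exE conjE)
  have inj: "inj_on (\<lambda>x. w x ?r) X"
  proof (rule inj_onI)
    fix x y assume xy: "x \<in> X" "y \<in> X" "w x ?r = w y ?r"
    then have eq: "z1 x k = z1 y k" for k
      using w(2) by (cases "k = ?r") blast+
    have "s x k = s y k" "z x k = z y k" for k
      using z1[OF xy(1,2) eq[of k]] conjunct2[OF z1[OF xy(1,2) eq[of "conjugate k"]]]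
      by (simp_all only: conjugate_conjugate)
    then show "x = y"
      using sep xy by blast
  qed
  \<comment> \<open>The code in coordinate \<open>conjugate i\<close> steers all other coordinates
    to their final values; afterwards the labels \<open>e x\<close>, now in coordinate
    \<open>i\<close>, steer the code itself to 0.\<close>
  define w2 where "w2 x l = (if l \<in> -{?r} then (if l = i then e x else 0) else w x l)" for x l
  have r2: "reach X s w w2"
    unfolding w2_def by (rule reach_set_coordinates[where i = ?r and w = w, OF sgn inj]) auto
  have "reach X s w2 (\<lambda>x l. if l = ?r then 0 else w2 x l)"
    by (rule reach_set_coordinate[OF sgn, where i = i]) (use e in \<open>auto simp: w2_def\<close>)
  moreover have "(\<lambda>x l. if l = ?r then 0 else w2 x l) = (\<lambda>x k. if k = i then e x else 0)"
    by (auto simp: w2_def fun_eq_iff)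
  ultimately show ?thesis
    using r1 r2 w(1) reach_trans by metis
qed

text \<open>Both configurations are connected to the same normal form, for one common choice of
  labels \<open>e\<close>, and moves are reversible.\<close>

lemma reach_any:
  fixes s :: "'x \<Rightarrow> 'n::finite + 'n \<Rightarrow> int"
  assumes X: "finite X" and sgn: "\<forall>x\<in>X. \<forall>i. s x i = 1 \<or> s x i = -1"
    and "\<And>x y. x \<in> X \<Longrightarrow> y \<in> X \<Longrightarrow> s x = s y \<Longrightarrow> z x = z y \<Longrightarrow> x = y"
    and "\<And>x y. x \<in> X \<Longrightarrow> y \<in> X \<Longrightarrow> s x = s y \<Longrightarrow> w x = w y \<Longrightarrow> x = y"
  shows "reach X s z w"
proof -
  obtain e :: "'x \<Rightarrow> nat" where e: "inj_on e X"
    using finite_imp_inj_to_nat_seg[OF X] by blast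
  then have "inj_on (\<lambda>x. int (e x)) X"
    by (auto simp: inj_on_def)
  note inj = this
  have "reach X s z (\<lambda>x k. if k = Inl undefined then int (e x) else 0)"
    by (rule reach_canonical[OF X sgn assms(3) inj])
  moreover have "reach X s w (\<lambda>x k. if k = Inl undefined then int (e x) else 0)"
    by (rule reach_canonical[OF X sgn assms(4) inj])
  ultimately show ?thesis
    using reach_sym reach_trans by metis
qed

section \<open>Smooth steps and square waves of one variable\<close>

lemma has_real_derivative_max_0_square:
  "((\<lambda>t. (max 0 t)\<^sup>2) has_real_derivative 2 * max 0 t) (at t)"
proof -
  consider "t > 0" | "t < 0" | "t = 0" by linarith
  then show ?thesis
  proof cases
    case 1
    have "((\<lambda>t. t\<^sup>2) has_real_derivative 2 * max 0 t) (at t)"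
      using 1 by (auto intro!: derivative_eq_intros)
    moreover have "\<forall>\<^sub>F u in nhds t. (max 0 u)\<^sup>2 = u\<^sup>2"
      using eventually_nhds_in_open[of "{0<..}" t] 1 by (auto elim!: eventually_mono)
    ultimately show ?thesis
      by (subst DERIV_cong_ev[OF refl _ refl])
  next
    case 2
    have "((\<lambda>t. 0) has_real_derivative 2 * max 0 t) (at t)"
      using 2 by (auto intro!: derivative_eq_intros)
    moreover have "\<forall>\<^sub>F u in nhds t. (max 0 u)\<^sup>2 = 0"
      using eventually_nhds_in_open[of "{..<0}" t] 2 by (auto elim!: eventually_mono)
    ultimately show ?thesis
      by (subst DERIV_cong_ev[OF refl _ refl])
  next
    case 3
    have "((\<lambda>h::real. (max 0 h)\<^sup>2 / h) \<longlongrightarrow> 0) (at 0)"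
    proof (rule Lim_null_comparison)
      show "\<forall>\<^sub>F h in at 0. norm ((max 0 h)\<^sup>2 / h) \<le> \<bar>h::real\<bar>"
        by (rule always_eventually) (auto simp: max_def power2_eq_square)
    qed (auto intro!: tendsto_eq_intros)
    with 3 show ?thesis
      by (simp add: DERIV_def)
  qed
qed

lemma continuous_has_antiderivative:
  fixes f :: "real \<Rightarrow> real"
  assumes "continuous_on UNIV f"
  obtains F where "\<And>t. (F has_real_derivative f t) (at t)"
proof -
  have "\<exists>F. \<forall>x. -\<infinity> < ereal x \<longrightarrow> ereal x < \<infinity> \<longrightarrow> (F has_vector_derivative f x) (at x)"
    using assms by (intro einterval_antiderivative) (auto simp: continuous_on_eq_continuous_at)
  then show thesis
    using that by (auto simp: has_real_derivative_iff_has_vector_derivative)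
qed

lemma zero_derivative_constant:
  fixes f :: "real \<Rightarrow> real"
  assumes "\<And>t. (f has_real_derivative 0) (at t)"
  shows "f x = f y"
  using DERIV_isconst_all[of f] assms by blast

text \<open>The normalized primitive of \<open>t^2 (1 - t)^2\<close>, cut off outside the unit
  interval: squares of positive parts are just smooth enough for a continuous second derivative. The
  symmetry about \<open>1/2\<close> is what later makes the square wave odd.\<close>

lemma smooth_step_exists:
  obtains s s' s'' :: "real \<Rightarrow> real" and C where
    "\<And>t. (s has_real_derivative s' t) (at t)" "\<And>t. (s' has_real_derivative s'' t) (at t)"
    "continuous_on UNIV s''"
    "\<And>t. t \<le> 0 \<Longrightarrow> s t = 0" "\<And>t. t \<ge> 1 \<Longrightarrow> s t = 1"
    "\<And>t. t \<le> 0 \<Longrightarrow> s' t = 0" "\<And>t. t \<ge> 1 \<Longrightarrow> s' t = 0"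
    "\<And>t. 0 \<le> s t" "\<And>t. s t \<le> 1" "\<And>t. \<bar>s' t\<bar> \<le> C" "\<And>t. s (1 - t) = 1 - s t"
proof -
  define k :: "real \<Rightarrow> real" where "k t = (max 0 t)\<^sup>2 * (max 0 (1 - t))\<^sup>2" for t
  define k' :: "real \<Rightarrow> real" where
    "k' t = 2 * max 0 t * (max 0 (1 - t))\<^sup>2 - (max 0 t)\<^sup>2 * (2 * max 0 (1 - t))" for t
  have m: "((\<lambda>t. (max 0 (1 - t))\<^sup>2) has_real_derivative - (2 * max 0 (1 - t))) (at t)" for t :: real
  proof -
    have "((\<lambda>t. 1 - t) has_real_derivative -1) (at t)"
      by (auto intro!: derivative_eq_intros)
    from DERIV_chain2[OF has_real_derivative_max_0_square this] show ?thesis by simp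
  qed
  have k': "(k has_real_derivative k' t) (at t)" for t
    unfolding k_def k'_def
    by (rule DERIV_cong[OF DERIV_mult[OF has_real_derivative_max_0_square m]]) simp
  have ck': "continuous_on UNIV k'"
    unfolding k'_def by (intro continuous_intros)
  have "continuous_on UNIV k"
    using k' by (meson DERIV_isCont continuous_at_imp_continuous_on)
  then obtain F where F: "\<And>t. (F has_real_derivative k t) (at t)"
    using continuous_has_antiderivative by blast
  have k0: "k t \<ge> 0" for t by (simp add: k_def)
  have mono: "F a \<le> F b" if "a \<le> b" for a b
    by (rule DERIV_nonneg_imp_nondecreasing[OF that]) (use F k0 in blast)
  have pos: "F 0 < F 1"
  proof -
    have "F (1/4) < F (3/4)"
    proof (rule DERIV_pos_imp_increasing[of "1/4" "3/4" F])
      fix t :: real assume "1/4 \<le> t" "t \<le> 3/4"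
      then have "k t > 0" by (simp add: k_def)
      then show "\<exists>y. (F has_real_derivative y) (at t) \<and> y > 0" using F by blast
    qed simp
    then show ?thesis
      using mono[of 0 "1/4"] mono[of "3/4" 1] by linarith
  qed
  define c where "c = F 1 - F 0"
  have c: "c > 0" using pos by (simp add: c_def)
  define s where "s t = (F t - F 0) / c" for t
  have D: "(s has_real_derivative k t / c) (at t)" for t
    unfolding s_def using F c by (auto intro!: derivative_eq_intros)
  have D2: "((\<lambda>t. k t / c) has_real_derivative k' t / c) (at t)" for t
    using k' c by (auto intro!: derivative_eq_intros)
  have kz: "k t = 0" if "t \<le> 0 \<or> t \<ge> 1" for t
    using that by (auto simp: k_def)
  have F0: "F t = F 0" if "t \<le> 0" for t
  proof (cases "t = 0")
    case False
    with that have "t < 0" by simp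
    from MVT2[OF this F] obtain z where "z < 0" "F 0 - F t = (0 - t) * k z" by blast
    with kz[of z] show ?thesis by simp
  qed simp
  have F1: "F t = F 1" if "t \<ge> 1" for t
  proof (cases "t = 1")
    case False
    with that have "1 < t" by simp
    from MVT2[OF this F] obtain z where "1 < z" "F t - F 1 = (t - 1) * k z" by blast
    with kz[of z] show ?thesis by simp
  qed simp
  have s0: "s t = 0" if "t \<le> 0" for t using F0[OF that] by (simp add: s_def)
  have s1: "s t = 1" if "t \<ge> 1" for t using F1[OF that] c by (simp add: s_def c_def)
  have nonneg: "0 \<le> s t" for t
    using mono[of 0 t] s0[of t] c by (cases "t \<le> 0") (auto simp: s_def)
  have le1: "s t \<le> 1" for t
  proof (cases "t \<ge> 1")
    case False
    then have "F t - F 0 \<le> c" using mono[of t 1] by (simp add: c_def)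
    then show ?thesis using c by (simp add: s_def)
  qed (simp add: s1)
  have "\<bar>k t / c\<bar> \<le> 1 / c" for t
  proof -
    have "k t \<le> 1"
    proof (cases "t \<le> 0 \<or> t \<ge> 1")
      case False
      then have "(max 0 t)\<^sup>2 \<le> 1" "(max 0 (1 - t))\<^sup>2 \<le> 1"
        by (auto simp: abs_square_le_1)
      then show ?thesis unfolding k_def by (simp add: mult_le_one)
    qed (simp add: kz)
    then show ?thesis using c k0[of t] by (simp add: divide_right_mono)
  qed
  moreover have "s (1 - t) = 1 - s t" for t
  proof -
    have "((\<lambda>t. s (1 - t) + s t) has_real_derivative 0) (at t)" for t
    proof -
      have "((\<lambda>t. 1 - t) has_real_derivative -1) (at t)"
        by (auto intro!: derivative_eq_intros)
      from DERIV_add[OF DERIV_chain2[OF D this] D[of t]] show ?thesis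
        by (simp add: k_def mult.commute)
    qed
    from zero_derivative_constant[of "\<lambda>t. s (1 - t) + s t", OF this, of t 0] show ?thesis
      using s0[of 0] s1[of 1] by simp
  qed
  moreover have "continuous_on UNIV (\<lambda>t. k' t / c)"
    using ck' c by (intro continuous_intros) auto
  ultimately show thesis
    using that[of s "\<lambda>t. k t / c" "\<lambda>t. k' t / c" "1 / c"] D D2 s0 s1 nonneg le1 kz by simp
qed

text \<open>The first condition keeps \<open>t\<close> off the ramps of the step functions, of width
  \<open>1/q\<close> at the integers. The second keeps \<open>t\<close> at distance
  \<open>1/q^2\<close> from the multiples of \<open>1/q\<close>, where the wave switches its
  slope.\<close>

definition good_real :: "nat \<Rightarrow> real \<Rightarrow> bool" where
  "good_real q t \<longleftrightarrow> frac t \<in> {1 / q..1 - 1 / q} \<and> frac (q * t) \<in> {1 / q..1 - 1 / q}"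

definition wave_sign :: "nat \<Rightarrow> real \<Rightarrow> int" where
  "wave_sign q t = (if even \<lfloor>q * t\<rfloor> then 1 else -1)"

lemma floor_mult_plus_int: "\<lfloor>real q * (t + of_int m)\<rfloor> = \<lfloor>real q * t\<rfloor> + int q * m"
proof -
  have "real q * (t + of_int m) = real q * t + of_int (int q * m)"
    by (simp add: algebra_simps)
  then show ?thesis by (simp only: floor_add_int)
qed

lemma good_real_plus_int: "good_real q (t + of_int m) \<longleftrightarrow> good_real q t"
proof -
  have "frac (t + of_int m) = frac t"
    by (simp add: frac_def)
  moreover have "frac (real q * (t + of_int m)) = frac (real q * t)"
    unfolding frac_def floor_mult_plus_int by (simp add: algebra_simps)
  ultimately show ?thesis by (simp add: good_real_def)
qed

text \<open>The reason for taking \<open>q\<close> even: translation by \<open>m\<close> changes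
  \<open>\<lfloor>q * t\<rfloor>\<close> by \<open>q * m\<close>, which must not affect its
  parity.\<close>

lemma wave_sign_plus_int: "even q \<Longrightarrow> wave_sign q (t + of_int m) = wave_sign q t"
  by (simp add: wave_sign_def floor_mult_plus_int)

text \<open>\<open>C\<close> is fixed before \<open>q\<close>, \<open>Z\<close> and
  \<open>\<kappa>\<close>, so the slope is seen to grow only linearly in \<open>q\<close>. The crude
  sum over \<open>Z\<close> is harmless, because \<open>Z\<close> and \<open>\<kappa>\<close> stay
  the same while \<open>q\<close> varies.\<close>

lemma step_function_exists:
  obtains C :: real where "C \<ge> 0"
    "\<And>(q::nat) (Z::int set) (\<kappa>::int \<Rightarrow> real). q \<ge> 2 \<Longrightarrow> finite Z \<Longrightarrow>
       \<exists>a a' a''. (\<forall>t. (a has_real_derivative a' t) (at t)) \<and> (\<forall>t. (a' has_real_derivative a'' t) (at t)) \<and>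
         continuous_on UNIV a'' \<and> (\<forall>t. \<bar>a t\<bar> \<le> (\<Sum>z\<in>Z. \<bar>\<kappa> z\<bar>)) \<and> (\<forall>t. \<bar>a' t\<bar> \<le> C * q * (\<Sum>z\<in>Z. \<bar>\<kappa> z\<bar>)) \<and>
         (\<forall>t. good_real q t \<longrightarrow> \<lfloor>t\<rfloor> \<in> Z \<longrightarrow> a t = \<kappa> \<lfloor>t\<rfloor> \<and> a' t = 0)"
proof -
  obtain s s' s'' :: "real \<Rightarrow> real" and C where s:
    "\<And>t. (s has_real_derivative s' t) (at t)" "\<And>t. (s' has_real_derivative s'' t) (at t)"
    "continuous_on UNIV s''"
    "\<And>t. t \<le> 0 \<Longrightarrow> s t = 0" "\<And>t. t \<ge> 1 \<Longrightarrow> s t = 1"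
    "\<And>t. t \<le> 0 \<Longrightarrow> s' t = 0" "\<And>t. t \<ge> 1 \<Longrightarrow> s' t = 0"
    "\<And>t. 0 \<le> s t" "\<And>t. s t \<le> 1" "\<And>t. \<bar>s' t\<bar> \<le> C"
    by (rule smooth_step_exists) blast
  have C: "C \<ge> 0" using s(10)[of 0] by linarith
  show thesis
  proof
    show "2 * C \<ge> 0" using C by simp
    fix q :: nat and Z :: "int set" and \<kappa> :: "int \<Rightarrow> real"
    assume q: "q \<ge> 2" and Z: "finite Z"
    \<comment> \<open>A plateau on the unit interval with ramps of width \<open>1/q\<close> at both
      ends. It vanishes outside, so its integer translates do not interfere with one
      another.\<close>
    define b where "b t = s (q * t) * s (q * (1 - t))" for t :: real
    define b' where "b' t = q * s' (q * t) * s (q * (1 - t)) - s (q * t) * (q * s' (q * (1 - t)))" for t :: real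
    define b'' where "b'' t = q * (q * s'' (q * t)) * s (q * (1 - t)) - q * s' (q * t) * (q * s' (q * (1 - t)))
        - (q * s' (q * t) * (q * s' (q * (1 - t))) - s (q * t) * (q * (q * s'' (q * (1 - t)))))" for t :: real
    have lin: "((\<lambda>t. q * t) has_real_derivative q) (at t)" "((\<lambda>t. q * (1 - t)) has_real_derivative - real q) (at t)" for t :: real
      by (auto intro!: derivative_eq_intros)
    note ds = DERIV_chain2[OF s(1) lin(1)] DERIV_chain2[OF s(1) lin(2)]
      DERIV_chain2[OF s(2) lin(1)] DERIV_chain2[OF s(2) lin(2)]
    have db: "(b has_real_derivative b' t) (at t)" for t
      unfolding b_def b'_def
      by (rule DERIV_cong[OF DERIV_mult[OF ds(1) ds(2)]]) (simp add: algebra_simps)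
    have db': "(b' has_real_derivative b'' t) (at t)" for t
      unfolding b'_def b''_def
      by (rule DERIV_cong[OF DERIV_diff[OF DERIV_mult[OF DERIV_cmult[OF ds(3)] ds(2)] DERIV_mult[OF ds(1) DERIV_cmult[OF ds(4)]]]])
        (simp add: algebra_simps)
    have cs: "continuous_on UNIV s" "continuous_on UNIV s'"
      using s(1,2) by (meson DERIV_isCont continuous_at_imp_continuous_on)+
    have cb'': "continuous_on UNIV b''"
      unfolding b''_def
      by (intro continuous_intros continuous_on_compose2[OF cs(1)] continuous_on_compose2[OF cs(2)]
          continuous_on_compose2[OF s(3)]) auto
    have b0: "0 \<le> b t" "b t \<le> 1" for t
      using s(8,9) by (auto simp: b_def intro!: mult_le_one)
    have bz: "b t = 0" "b' t = 0" if "t \<le> 0 \<or> t \<ge> 1" for t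
    proof -
      have "q * t \<le> 0 \<or> q * (1 - t) \<le> 0"
        using that by (auto simp: mult_le_0_iff)
      then show "b t = 0" "b' t = 0"
        using s(4,6) by (auto simp: b_def b'_def)
    qed
    have bg: "b t = 1" "b' t = 0" if "t \<in> {1/q..1 - 1/q}" for t
    proof -
      have "q * t \<ge> 1" "q * (1 - t) \<ge> 1"
        using that q by (auto simp: field_simps)
      then show "b t = 1" "b' t = 0"
        using s(5,7) by (auto simp: b_def b'_def)
    qed
    have bb: "\<bar>b' t\<bar> \<le> 2 * C * q" for t
    proof -
      have "\<bar>q * s' (q * t) * s (q * (1 - t))\<bar> \<le> q * C * 1"
        unfolding abs_mult using s(8,9,10) C by (intro mult_mono) auto
      moreover have "\<bar>s (q * t) * (q * s' (q * (1 - t)))\<bar> \<le> 1 * (q * C)"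
        unfolding abs_mult using s(8,9,10) C by (intro mult_mono) auto
      ultimately show ?thesis unfolding b'_def by (simp add: algebra_simps)
    qed
    define a where "a t = (\<Sum>z\<in>Z. \<kappa> z * b (t - of_int z))" for t
    define a' where "a' t = (\<Sum>z\<in>Z. \<kappa> z * b' (t - of_int z))" for t
    define a'' where "a'' t = (\<Sum>z\<in>Z. \<kappa> z * b'' (t - of_int z))" for t
    have sh: "((\<lambda>t. t - of_int z) has_real_derivative 1) (at t)" for t :: real and z :: int
      by (auto intro!: derivative_eq_intros)
    have da: "(a has_real_derivative a' t) (at t)" for t
      unfolding a_def a'_def
      by (intro DERIV_sum DERIV_cmult DERIV_cong[OF DERIV_chain2[OF db sh]]) simp
    have da': "(a' has_real_derivative a'' t) (at t)" for t
      unfolding a'_def a''_def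
      by (intro DERIV_sum DERIV_cmult DERIV_cong[OF DERIV_chain2[OF db' sh]]) simp
    have ca: "continuous_on UNIV a''"
      unfolding a''_def by (intro continuous_intros continuous_on_compose2[OF cb'']) auto
    have "\<bar>a t\<bar> \<le> (\<Sum>z\<in>Z. \<bar>\<kappa> z\<bar>)" for t
      unfolding a_def
      by (rule order.trans[OF sum_abs], rule sum_mono) (use b0 in \<open>simp add: abs_mult mult_left_le\<close>)
    moreover have "\<bar>a' t\<bar> \<le> 2 * C * q * (\<Sum>z\<in>Z. \<bar>\<kappa> z\<bar>)" for t
      unfolding a'_def sum_distrib_left
      by (rule order.trans[OF sum_abs], rule sum_mono)
        (use mult_right_mono[OF bb abs_ge_zero] in \<open>simp add: abs_mult mult.commute\<close>)
    moreover have "a t = \<kappa> \<lfloor>t\<rfloor> \<and> a' t = 0" if t: "good_real q t" "\<lfloor>t\<rfloor> \<in> Z" for t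
    proof -
      have z: "t - of_int z \<le> 0 \<or> t - of_int z \<ge> 1" if "z \<noteq> \<lfloor>t\<rfloor>" for z
        using that by linarith
      have fr: "t - of_int \<lfloor>t\<rfloor> \<in> {1/q..1 - 1/q}"
        using t(1) by (simp add: good_real_def frac_def)
      have "a t = (\<Sum>z\<in>Z. if z = \<lfloor>t\<rfloor> then \<kappa> z else 0)" "a' t = (\<Sum>z\<in>Z. 0)"
        unfolding a_def a'_def
      proof -
        show "(\<Sum>x\<in>Z. \<kappa> x * b (t - of_int x)) = (\<Sum>z\<in>Z. if z = \<lfloor>t\<rfloor> then \<kappa> z else 0)"
          by (rule sum.cong) (use bz(1)[OF z] bg(1)[OF fr] in auto)
        show "(\<Sum>x\<in>Z. \<kappa> x * b' (t - of_int x)) = (\<Sum>z\<in>Z. 0)"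
        proof (rule sum.cong)
          show "\<kappa> x * b' (t - of_int x) = 0" for x
            using bz(2)[OF z[of x]] bg(2)[OF fr] by (cases "x = \<lfloor>t\<rfloor>") auto
        qed simp
      qed
      then show ?thesis using t(2) Z by simp
    qed
    ultimately show "\<exists>a a' a''. (\<forall>t. (a has_real_derivative a' t) (at t)) \<and> (\<forall>t. (a' has_real_derivative a'' t) (at t)) \<and>
         continuous_on UNIV a'' \<and> (\<forall>t. \<bar>a t\<bar> \<le> (\<Sum>z\<in>Z. \<bar>\<kappa> z\<bar>)) \<and> (\<forall>t. \<bar>a' t\<bar> \<le> 2 * C * q * (\<Sum>z\<in>Z. \<bar>\<kappa> z\<bar>)) \<and>
         (\<forall>t. good_real q t \<longrightarrow> \<lfloor>t\<rfloor> \<in> Z \<longrightarrow> a t = \<kappa> \<lfloor>t\<rfloor> \<and> a' t = 0)"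
      using da da' ca by blast
  qed
qed

lemma sin_ge_sin_of_between:
  assumes "0 \<le> a" "a \<le> x" "x \<le> pi - a"
  shows "sin a \<le> sin x"
proof (cases "x \<le> pi / 2")
  case True
  then show ?thesis using assms by (intro sin_monotone_2pi_le) auto
next
  case False
  then have "sin a \<le> sin (pi - x)" using assms by (intro sin_monotone_2pi_le) auto
  then show ?thesis by simp
qed

text \<open>The wave is prescribed through its slope: a smooth step applied to a magnified sine is
  constant away from the switches, and \<open>b\<close> is its primitive at frequency
  \<open>q\<close>. The slope is odd and periodic, so the primitive is periodic and hence bounded,
  and compression by \<open>q\<close> leaves an amplitude of at most \<open>2 / q\<close>.\<close>

lemma square_wave_exists:
  fixes q :: nat
  assumes q: "q \<ge> 2"
  obtains b b' b'' where
    "\<And>t. (b has_real_derivative b' t) (at t)" "\<And>t. (b' has_real_derivative b'' t) (at t)"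
    "continuous_on UNIV b''" "\<And>t. \<bar>b t\<bar> \<le> 2 / q" "\<And>t. \<bar>b' t\<bar> \<le> 1"
    "\<And>t. good_real q t \<Longrightarrow> b' t = of_int (wave_sign q t)"
proof -
  obtain s s' s'' :: "real \<Rightarrow> real" and C where s:
    "\<And>t. (s has_real_derivative s' t) (at t)" "\<And>t. (s' has_real_derivative s'' t) (at t)"
    "\<And>t. t \<le> 0 \<Longrightarrow> s t = 0" "\<And>t. t \<ge> 1 \<Longrightarrow> s t = 1"
    "\<And>t. 0 \<le> s t" "\<And>t. s t \<le> 1" "\<And>t. s (1 - t) = 1 - s t"
    by (rule smooth_step_exists) blast
  \<comment> \<open>At distance at least \<open>1/q\<close> from the integers,
    \<open>\<bar>sin (pi * x)\<bar>\<close> is at least \<open>c\<close>, so division by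
    \<open>c\<close> drives the smooth step to its constant ends at all good points.\<close>
  define c where "c = sin (pi / q)"
  have c: "c > 0"
    unfolding c_def using q by (intro sin_gt_zero) (auto simp: field_simps)
  define f where "f t = 2 * s ((sin (pi * t) / c + 1) / 2) - 1" for t
  define f' where "f' t = s' ((sin (pi * t) / c + 1) / 2) * (pi * cos (pi * t) / c)" for t
  have df: "(f has_real_derivative f' t) (at t)" for t
  proof -
    have i: "((\<lambda>t. (sin (pi * t) / c + 1) / 2) has_real_derivative (pi * cos (pi * t) / c) / 2) (at t)"
      using c by (auto intro!: derivative_eq_intros)
    show ?thesis
      unfolding f_def f'_def
      by (rule DERIV_cong[OF DERIV_diff[OF DERIV_cmult[OF DERIV_chain2[OF s(1) i]] DERIV_const]]) simp
  qed
  have cf: "continuous_on UNIV f"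
    using df by (meson DERIV_isCont continuous_at_imp_continuous_on)
  have cs': "continuous_on UNIV s'"
    using s(2) by (meson DERIV_isCont continuous_at_imp_continuous_on)
  have cf': "continuous_on UNIV f'"
    unfolding f'_def by (intro continuous_intros continuous_on_compose2[OF cs']) (use c in auto)
  obtain F where F: "\<And>t. (F has_real_derivative f t) (at t)"
    using continuous_has_antiderivative[OF cf] by blast
  have fodd: "f (- t) = - f t" for t
  proof -
    have "(sin (pi * (- t)) / c + 1) / 2 = 1 - (sin (pi * t) / c + 1) / 2"
      by (simp add: field_simps)
    then show ?thesis unfolding f_def by (simp only: s(7)) simp
  qed
  have fper: "f (t + of_int n * 2) = f t" for t n
  proof -
    have "sin (pi * (t + of_int n * 2)) = sin (pi * t)"
      using sin.plus_of_int[of "pi * t" n] by (simp add: algebra_simps)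
    then show ?thesis by (simp add: f_def)
  qed
  have f1: "\<bar>f t\<bar> \<le> 1" for t
    using s(5)[of "(sin (pi * t) / c + 1) / 2"] s(6)[of "(sin (pi * t) / c + 1) / 2"]
    by (simp add: f_def abs_le_iff)
  have even: "F (- t) = F t" for t
  proof -
    have "((\<lambda>t. F (- t) - F t) has_real_derivative 0) (at t)" for t
      using DERIV_diff[OF DERIV_chain2[OF F DERIV_minus[OF DERIV_ident]] F[of t]] by (simp add: fodd)
    from zero_derivative_constant[of "\<lambda>t. F (- t) - F t", OF this, of t 0] show ?thesis by simp
  qed
  have per: "F (t + of_int n * 2) = F t" for t n
  proof -
    have "((\<lambda>t. F (t + of_int n * 2) - F t) has_real_derivative 0) (at t)" for t
      using DERIV_diff[OF DERIV_chain2[OF F DERIV_add[OF DERIV_ident DERIV_const[of "of_int n * 2"]]] F[of t]]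
      by (simp add: fper)
    \<comment> \<open>The constant increment over \<open>2 n\<close> is evaluated at
      \<open>t = - n\<close>, where evenness of \<open>F\<close> makes it zero.\<close>
    from zero_derivative_constant[of "\<lambda>t. F (t + of_int n * 2) - F t", OF this, of t "- of_int n"]
    show ?thesis using even[of "of_int n"] by simp
  qed
  have bound: "\<bar>F t - F 0\<bar> \<le> 2" for t
  proof -
    define u where "u = t + of_int (- \<lfloor>t / 2\<rfloor>) * 2"
    have u: "0 \<le> u" "u \<le> 2" unfolding u_def by linarith+
    have "\<bar>F u - F 0\<bar> \<le> 1 * \<bar>u - 0\<bar>"
    proof (cases "u = 0")
      case False
      with u have "0 < u" by simp
      from MVT2[OF this F] obtain z where "F u - F 0 = (u - 0) * f z" by blast
      then show ?thesis using f1[of z] by (simp add: abs_mult mult_left_le)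
    qed simp
    moreover have "F u = F t" unfolding u_def by (rule per)
    ultimately show ?thesis using u by simp
  qed
  have fgood: "f (q * t) = of_int (wave_sign q t)" if "good_real q t" for t :: real
  proof -
    let ?x = "q * t"
    have fr: "frac ?x \<in> {1 / q..1 - 1 / q}" using that by (simp add: good_real_def)
    have ge: "c \<le> sin (pi * frac ?x)"
      unfolding c_def
    proof (rule sin_ge_sin_of_between)
      show "pi / q \<le> pi * frac ?x" "pi * frac ?x \<le> pi - pi / q"
        using mult_left_mono[of "1/q" "frac ?x" pi] mult_left_mono[of "frac ?x" "1 - 1/q" pi] fr
        by (auto simp: algebra_simps)
    qed simp
    have x: "pi * ?x = pi * frac ?x + pi * of_int \<lfloor>?x\<rfloor>"
      by (simp add: frac_def algebra_simps)
    show ?thesis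
    proof (cases "even \<lfloor>?x\<rfloor>")
      case True
      then obtain n where n: "\<lfloor>?x\<rfloor> = 2 * n" by blast
      have "sin (pi * ?x) = sin (pi * frac ?x)"
        unfolding x n using sin.plus_of_int[of "pi * frac ?x" n] by (simp add: algebra_simps)
      then have "(sin (pi * ?x) / c + 1) / 2 \<ge> 1" using ge c by (simp add: field_simps)
      then show ?thesis using True s(4) by (simp add: f_def wave_sign_def)
    next
      case False
      then obtain n where n: "\<lfloor>?x\<rfloor> = 2 * n + 1" by (elim oddE)
      have "sin (pi * ?x) = sin (pi * frac ?x + pi)"
        unfolding x n using sin.plus_of_int[of "pi * frac ?x + pi" n] by (simp add: algebra_simps)
      then have "(sin (pi * ?x) / c + 1) / 2 \<le> 0" using ge c by (simp add: field_simps)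
      then show ?thesis using False s(3) by (simp add: f_def wave_sign_def)
    qed
  qed
  have lin: "((\<lambda>t. q * t) has_real_derivative q) (at t)" for t :: real
    by (auto intro!: derivative_eq_intros)
  have 1: "((\<lambda>t. (F (q * t) - F 0) / q) has_real_derivative f (q * t)) (at t)" for t :: real
  proof (rule DERIV_cong)
    show "((\<lambda>t. (F (q * t) - F 0) / q) has_real_derivative (f (q * t) * q - 0) / q) (at t)"
      by (intro DERIV_cdivide DERIV_diff DERIV_chain2[OF F lin] DERIV_const)
  qed (use q in simp)
  have 2: "((\<lambda>t. f (q * t)) has_real_derivative f' (q * t) * q) (at t)" for t :: real
    by (rule DERIV_chain2[OF df lin])
  have 3: "continuous_on UNIV (\<lambda>t. f' (real q * t) * q)"
    by (intro continuous_intros continuous_on_compose2[OF cf']) auto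
  have 4: "\<bar>(F (q * t) - F 0) / q\<bar> \<le> 2 / q" for t :: real
    using bound[of "q * t"] by (simp add: abs_divide divide_right_mono)
  show thesis
    by (rule that[of _ "\<lambda>t. f (q * t)", OF 1 2 3 4 f1 fgood])
qed

definition good_point :: "nat \<Rightarrow> real ^ 'm::finite \<Rightarrow> bool" where
  "good_point q x \<longleftrightarrow> (\<forall>k. good_real q (x $ k))"

text \<open>
  The wave \<open>b\<close> has amplitude of order \<open>1/q\<close>, which compensates the slope of order \<open>q\<close> of the step
  function \<open>a\<close>: hence the displacement bound is uniform in \<open>q\<close>.
\<close>

lemma lattice_move_realization:
  fixes i j :: "'n::finite + 'n" and K :: "int \<Rightarrow> int"
  assumes ij: "i \<noteq> conjugate j" and Z: "finite Z"
  obtains M where "M \<ge> 0"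
    "\<And>q. q \<ge> 2 \<Longrightarrow> \<exists>\<Phi>. symplectic_diffeo \<Phi> \<and> (\<forall>x. norm (\<Phi> x - x) \<le> M) \<and>
       (\<forall>x. good_point q x \<longrightarrow> \<lfloor>x $ i\<rfloor> \<in> Z \<longrightarrow>
          \<Phi> x = x + of_int (conj_sign j * wave_sign q (x $ j) * K \<lfloor>x $ i\<rfloor>) *\<^sub>R axis (conjugate j) 1)"
proof -
  obtain C :: real where C: "C \<ge> 0"
    "\<And>(q::nat) (Z::int set) (\<kappa>::int \<Rightarrow> real). q \<ge> 2 \<Longrightarrow> finite Z \<Longrightarrow>
       \<exists>a a' a''. (\<forall>t. (a has_real_derivative a' t) (at t)) \<and> (\<forall>t. (a' has_real_derivative a'' t) (at t)) \<and>
         continuous_on UNIV a'' \<and> (\<forall>t. \<bar>a t\<bar> \<le> (\<Sum>z\<in>Z. \<bar>\<kappa> z\<bar>)) \<and> (\<forall>t. \<bar>a' t\<bar> \<le> C * q * (\<Sum>z\<in>Z. \<bar>\<kappa> z\<bar>)) \<and>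
         (\<forall>t. good_real q t \<longrightarrow> \<lfloor>t\<rfloor> \<in> Z \<longrightarrow> a t = \<kappa> \<lfloor>t\<rfloor> \<and> a' t = 0)"
    by (rule step_function_exists) blast
  define N where "N = (\<Sum>z\<in>Z. \<bar>real_of_int (K z)\<bar>)"
  have N: "N \<ge> 0" by (simp add: N_def sum_nonneg)
  have nJ: "norm (symplectic_J *v axis k 1 :: real ^ ('n + 'n)) = 1" for k
    by (cases k) (simp_all add: symplectic_J_axis norm_axis_1)
  show thesis
  proof
    show "2 * C * N + N \<ge> 0" using C(1) N by simp
    fix q :: nat assume q: "q \<ge> 2"
    obtain a a' a'' where
      a: "\<And>t. (a has_real_derivative a' t) (at t)" "\<And>t. (a' has_real_derivative a'' t) (at t)"
        "continuous_on UNIV a''"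
      and ab: "\<And>t. \<bar>a t\<bar> \<le> N" "\<And>t. \<bar>a' t\<bar> \<le> C * q * N"
      and ag: "\<And>t. good_real q t \<Longrightarrow> \<lfloor>t\<rfloor> \<in> Z \<Longrightarrow> a t = K \<lfloor>t\<rfloor> \<and> a' t = 0"
      using C(2)[OF q Z, of "\<lambda>z. real_of_int (K z)"] unfolding N_def by blast
    obtain b b' b'' where
      b: "\<And>t. (b has_real_derivative b' t) (at t)" "\<And>t. (b' has_real_derivative b'' t) (at t)"
        "continuous_on UNIV b''"
      and bb: "\<And>t. \<bar>b t\<bar> \<le> 2 / q" "\<And>t. \<bar>b' t\<bar> \<le> 1"
      and bg: "\<And>t. good_real q t \<Longrightarrow> b' t = of_int (wave_sign q t)"
      using square_wave_exists[OF q] by blast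
    let ?\<Phi> = "pair_shear a a' b b' i j"
    have "symplectic_diffeo ?\<Phi>"
      by (rule symplectic_pair_shear[OF ij a b])
    moreover have "norm (?\<Phi> x - x) \<le> 2 * C * N + N" for x
    proof -
      have "norm (?\<Phi> x - x) \<le> norm ((a' (x $ i) * b (x $ j)) *\<^sub>R (symplectic_J *v axis i 1 :: real ^ ('n + 'n)))
          + norm ((a (x $ i) * b' (x $ j)) *\<^sub>R (symplectic_J *v axis j 1 :: real ^ ('n + 'n)))"
        unfolding pair_shear_def by (metis (no_types, lifting) add.assoc add_diff_cancel_left' norm_triangle_ineq)
      also have "\<dots> = \<bar>a' (x $ i)\<bar> * \<bar>b (x $ j)\<bar> + \<bar>a (x $ i)\<bar> * \<bar>b' (x $ j)\<bar>"
        by (simp add: nJ abs_mult)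
      also have "\<dots> \<le> (C * q * N) * (2 / q) + N * 1"
        using ab bb C(1) N by (intro add_mono mult_mono) auto
      also have "\<dots> = 2 * C * N + N" using q by simp
      finally show ?thesis .
    qed
    moreover have "?\<Phi> x = x + of_int (conj_sign j * wave_sign q (x $ j) * K \<lfloor>x $ i\<rfloor>) *\<^sub>R axis (conjugate j) 1"
      if "good_point q x" "\<lfloor>x $ i\<rfloor> \<in> Z" for x
      using that ag[of "x $ i"] bg[of "x $ j"]
      by (simp add: pair_shear_def good_point_def symplectic_J_axis mult_ac)
    ultimately show "\<exists>\<Phi>. symplectic_diffeo \<Phi> \<and> (\<forall>x. norm (\<Phi> x - x) \<le> 2 * C * N + N) \<and>
       (\<forall>x. good_point q x \<longrightarrow> \<lfloor>x $ i\<rfloor> \<in> Z \<longrightarrow>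
          \<Phi> x = x + of_int (conj_sign j * wave_sign q (x $ j) * K \<lfloor>x $ i\<rfloor>) *\<^sub>R axis (conjugate j) 1)"
      by blast
  qed
qed

text \<open>On a good piece every move is an integer translation, so a good point stays good and
  keeps its signs, and the next shear acts on it as prescribed. The bound \<open>M\<close> is
  obtained before \<open>q\<close>: the bad set can later be shrunk by enlarging \<open>q\<close>
  without larger displacements.\<close>

lemma reach_realization:
  fixes s :: "'x \<Rightarrow> 'n::finite + 'n \<Rightarrow> int"
  assumes X: "finite X" and "reach X s z w"
  shows "\<exists>M\<ge>0. \<forall>q\<ge>2. even q \<longrightarrow> (\<exists>\<Phi>. symplectic_diffeo \<Phi> \<and> (\<forall>x. norm (\<Phi> x - x) \<le> M) \<and>
     (\<forall>x. good_point q x \<longrightarrow> (\<forall>a\<in>X. (\<forall>k. \<lfloor>x $ k\<rfloor> = z a k \<and> wave_sign q (x $ k) = s a k) \<longrightarrow>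
        \<Phi> x = x + (\<chi> k. of_int (w a k - z a k)))))"
  using assms(2)
proof (induction rule: reach.induct)
  case reach_refl
  show ?case
    by (intro exI[of _ 0] conjI allI impI exI[of _ "\<lambda>x. x"] symplectic_diffeo_id)
      (auto simp: vec_eq_iff)
next
  case (reach_step w i j w' K)
  obtain M where M: "M \<ge> 0" "\<And>q. q \<ge> 2 \<Longrightarrow> even q \<Longrightarrow> \<exists>\<Phi>. symplectic_diffeo \<Phi> \<and> (\<forall>x. norm (\<Phi> x - x) \<le> M) \<and>
     (\<forall>x. good_point q x \<longrightarrow> (\<forall>a\<in>X. (\<forall>k. \<lfloor>x $ k\<rfloor> = z a k \<and> wave_sign q (x $ k) = s a k) \<longrightarrow>
        \<Phi> x = x + (\<chi> k. of_int (w a k - z a k))))"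
    using reach_step.IH by blast
  \<comment> \<open>Only the finitely many slabs that currently contain a piece have to be moved by
    prescribed amounts.\<close>
  have "finite ((\<lambda>a. w a i) ` X)" using X by simp
  from lattice_move_realization[OF reach_step.hyps(2) this, of K] obtain M' where M': "M' \<ge> 0"
    "\<And>q. q \<ge> 2 \<Longrightarrow> \<exists>\<Phi>. symplectic_diffeo \<Phi> \<and> (\<forall>x. norm (\<Phi> x - x) \<le> M') \<and>
       (\<forall>x. good_point q x \<longrightarrow> \<lfloor>x $ i\<rfloor> \<in> (\<lambda>a. w a i) ` X \<longrightarrow>
          \<Phi> x = x + of_int (conj_sign j * wave_sign q (x $ j) * K \<lfloor>x $ i\<rfloor>) *\<^sub>R axis (conjugate j) 1)"
    by blast
  show ?case
  proof (intro exI[of _ "M + M'"] conjI allI impI)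
    show "0 \<le> M + M'" using M(1) M'(1) by simp
    fix q :: nat assume q: "q \<ge> 2" "even q"
    obtain \<Phi> where \<Phi>: "symplectic_diffeo \<Phi>" "\<And>x. norm (\<Phi> x - x) \<le> M"
      "\<And>x a. good_point q x \<Longrightarrow> a \<in> X \<Longrightarrow> \<forall>k. \<lfloor>x $ k\<rfloor> = z a k \<and> wave_sign q (x $ k) = s a k \<Longrightarrow>
        \<Phi> x = x + (\<chi> k. of_int (w a k - z a k))"
      using M(2)[OF q] by blast
    obtain \<Psi> where \<Psi>: "symplectic_diffeo \<Psi>" "\<And>x. norm (\<Psi> x - x) \<le> M'"
      "\<And>x. good_point q x \<Longrightarrow> \<lfloor>x $ i\<rfloor> \<in> (\<lambda>a. w a i) ` X \<Longrightarrow>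
        \<Psi> x = x + of_int (conj_sign j * wave_sign q (x $ j) * K \<lfloor>x $ i\<rfloor>) *\<^sub>R axis (conjugate j) 1"
      using M'(2)[OF q(1)] by blast
    have "norm (\<Psi> (\<Phi> x) - x) \<le> M + M'" for x
      using norm_triangle_ineq[of "\<Psi> (\<Phi> x) - \<Phi> x" "\<Phi> x - x"] \<Phi>(2)[of x] \<Psi>(2)[of "\<Phi> x"] by simp
    moreover have "\<Psi> (\<Phi> x) = x + (\<chi> k. of_int (w' a k - z a k))"
      if x: "good_point q x" and a: "a \<in> X" and fl: "\<forall>k. \<lfloor>x $ k\<rfloor> = z a k \<and> wave_sign q (x $ k) = s a k" for x a
    proof -
      have y: "\<Phi> x = x + (\<chi> k. of_int (w a k - z a k))" by (rule \<Phi>(3)[OF x a fl])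
      have yk: "\<Phi> x $ k = x $ k + of_int (w a k - z a k)" for k
        by (simp add: y)
      have "\<lfloor>\<Phi> x $ k\<rfloor> = w a k" for k
        using fl floor_add_int[of "x $ k" "w a k - z a k"] unfolding yk by simp
      moreover have "good_point q (\<Phi> x)"
        using x unfolding good_point_def yk good_real_plus_int .
      moreover have "wave_sign q (\<Phi> x $ k) = s a k" for k
        using fl unfolding yk wave_sign_plus_int[OF q(2)] by blast
      ultimately have "\<Psi> (\<Phi> x) = \<Phi> x + of_int (conj_sign j * s a j * K (w a i)) *\<^sub>R axis (conjugate j) 1"
        using \<Psi>(3)[of "\<Phi> x"] a by auto
      moreover have "w' a k = w a k + (if k = conjugate j then conj_sign j * s a j * K (w a i) else 0)" for k
        by (rule reach_step.hyps(3)[OF a])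
      ultimately show ?thesis
        by (simp add: y vec_eq_iff axis_def)
    qed
    ultimately show "\<exists>\<Phi>. symplectic_diffeo \<Phi> \<and> (\<forall>x. norm (\<Phi> x - x) \<le> M + M') \<and>
     (\<forall>x. good_point q x \<longrightarrow> (\<forall>a\<in>X. (\<forall>k. \<lfloor>x $ k\<rfloor> = z a k \<and> wave_sign q (x $ k) = s a k) \<longrightarrow>
        \<Phi> x = x + (\<chi> k. of_int (w' a k - z a k))))"
      by (intro exI[of _ "\<lambda>x. \<Psi> (\<Phi> x)"]) (simp add: symplectic_diffeo_compose[OF \<Phi>(1) \<Psi>(1)])
  qed
qed

text \<open>
  The sign pattern of the waves splits each cell into pieces; the states steered by the moves are the
  pairs of a cell and a pattern.
\<close>

lemma cell_rearrangement:
  fixes c d :: "'a \<Rightarrow> 'n::finite + 'n \<Rightarrow> int"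
  assumes A: "finite A" and c: "inj_on c A" and d: "inj_on d A"
  shows "\<exists>M\<ge>0. \<forall>q\<ge>2. even q \<longrightarrow> (\<exists>\<Phi>. symplectic_diffeo \<Phi> \<and> (\<forall>x. norm (\<Phi> x - x) \<le> M) \<and>
     (\<forall>x. good_point q x \<longrightarrow> (\<forall>a\<in>A. (\<forall>k. \<lfloor>x $ k\<rfloor> = c a k) \<longrightarrow>
        \<Phi> x = x + (\<chi> k. of_int (d a k - c a k)))))"
proof -
  define \<Sigma> :: "('n + 'n \<Rightarrow> int) set" where "\<Sigma> = {\<sigma>. \<forall>k. \<sigma> k = 1 \<or> \<sigma> k = -1}"
  have "\<Sigma> = Pi\<^sub>E UNIV (\<lambda>_. {1, -1})" by (auto simp: \<Sigma>_def PiE_def Pi_def)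
  then have "finite \<Sigma>" by (simp add: finite_PiE)
  then have fin: "finite (A \<times> \<Sigma>)" using A by simp
  \<comment> \<open>Different pieces with the same sign pattern belong to different cells, so
    injectivity of \<open>c\<close> and of \<open>d\<close> on cells is all the separation that the
    reachability result asks for.\<close>
  have inj: "x = y" if "x \<in> A \<times> \<Sigma>" "y \<in> A \<times> \<Sigma>" "snd x = snd y" "f (fst x) = f (fst y)" "inj_on f A"
    for x y and f :: "'a \<Rightarrow> 'n + 'n \<Rightarrow> int"
    using inj_onD[OF that(5,4)] that(1-3) by (simp add: mem_Times_iff prod_eq_iff)
  have sgn: "\<forall>x\<in>A \<times> \<Sigma>. \<forall>i. snd x i = 1 \<or> snd x i = -1"
    by (auto simp: \<Sigma>_def)
  have "reach (A \<times> \<Sigma>) snd (\<lambda>x. c (fst x)) (\<lambda>x. d (fst x))"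
    by (rule reach_any[OF fin sgn]) (erule (3) inj, rule c d)+
  from reach_realization[OF fin this] obtain M where M: "M \<ge> 0"
    and M2: "\<forall>q\<ge>2. even q \<longrightarrow> (\<exists>\<Phi>. symplectic_diffeo \<Phi> \<and> (\<forall>x. norm (\<Phi> x - x) \<le> M) \<and>
     (\<forall>x. good_point q x \<longrightarrow> (\<forall>a\<in>A \<times> \<Sigma>. (\<forall>k. \<lfloor>x $ k\<rfloor> = c (fst a) k \<and> wave_sign q (x $ k) = snd a k) \<longrightarrow>
        \<Phi> x = x + (\<chi> k. of_int (d (fst a) k - c (fst a) k)))))"
    by (elim exE conjE)
  show ?thesis
  proof (intro exI[of _ M] conjI allI impI)
    show "0 \<le> M" by (rule M)
    fix q :: nat assume q: "q \<ge> 2" "even q"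
    obtain \<Phi> where \<Phi>: "symplectic_diffeo \<Phi>" "\<forall>x. norm (\<Phi> x - x) \<le> M"
      "\<forall>x. good_point q x \<longrightarrow> (\<forall>a\<in>A \<times> \<Sigma>. (\<forall>k. \<lfloor>x $ k\<rfloor> = c (fst a) k \<and> wave_sign q (x $ k) = snd a k) \<longrightarrow>
        \<Phi> x = x + (\<chi> k. of_int (d (fst a) k - c (fst a) k)))"
      using M2[rule_format, OF q] by (elim exE conjE)
    have "\<Phi> x = x + (\<chi> k. of_int (d a k - c a k))"
      if "good_point q x" "a \<in> A" "\<forall>k. \<lfloor>x $ k\<rfloor> = c a k" for x a
    proof -
      have "(a, \<lambda>k. wave_sign q (x $ k)) \<in> A \<times> \<Sigma>"
        using that(2) by (simp add: \<Sigma>_def wave_sign_def)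
      from \<Phi>(3)[THEN spec, THEN mp, OF that(1), THEN bspec, OF this] that(3) show ?thesis by simp
    qed
    with \<Phi>(1,2) show "\<exists>\<Phi>. symplectic_diffeo \<Phi> \<and> (\<forall>x. norm (\<Phi> x - x) \<le> M) \<and>
     (\<forall>x. good_point q x \<longrightarrow> (\<forall>a\<in>A. (\<forall>k. \<lfloor>x $ k\<rfloor> = c a k) \<longrightarrow>
        \<Phi> x = x + (\<chi> k. of_int (d a k - c a k))))"
      by (intro exI[of _ \<Phi>] conjI) simp_all
  qed
qed

section \<open>Test functions and weak derivatives\<close>

lemma C_k_SucD: "C_k (Suc k) f \<Longrightarrow> C_k k f"
proof (induction k arbitrary: f)
  case 0
  then show ?case
    by (auto intro!: continuous_at_imp_continuous_on differentiable_imp_continuous_within)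
next
  case (Suc k)
  then show ?case by (simp only: C_k.simps) blast
qed

lemma C_k_const: "C_k k (\<lambda>x. c)"
proof (induction k arbitrary: c)
  case (Suc k)
  then show ?case by (simp add: frechet_derivative_const)
qed simp

lemma C_k_add:
  assumes "C_k k f" "C_k k g"
  shows "C_k k (\<lambda>x. f x + g x)"
  using assms
proof (induction k arbitrary: f g)
  case 0
  then show ?case by (simp add: continuous_on_add)
next
  case (Suc k)
  then have d: "f differentiable (at x)" "g differentiable (at x)" for x by auto
  have "frechet_derivative (\<lambda>x. f x + g x) (at x) = (\<lambda>v. frechet_derivative f (at x) v + frechet_derivative g (at x) v)" for x
    using has_derivative_add[OF d(1)[unfolded frechet_derivative_works] d(2)[unfolded frechet_derivative_works]]
    by (rule frechet_derivative_at[symmetric])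
  with Suc d show ?case by simp
qed

lemma C_k_mult:
  assumes "C_k k f" "C_k k g"
  shows "C_k k (\<lambda>x. f x * g x)"
  using assms
proof (induction k arbitrary: f g)
  case 0
  then show ?case by (simp add: continuous_on_mult)
next
  case (Suc k)
  then have d: "f differentiable (at x)" "g differentiable (at x)" for x by auto
  have "frechet_derivative (\<lambda>x. f x * g x) (at x) = (\<lambda>v. f x * frechet_derivative g (at x) v + frechet_derivative f (at x) v * g x)" for x
    using has_derivative_mult[OF d(1)[unfolded frechet_derivative_works] d(2)[unfolded frechet_derivative_works]]
    by (rule frechet_derivative_at[symmetric])
  moreover have "C_k k f" "C_k k g" using Suc.prems C_k_SucD by blast+
  ultimately show ?case using Suc d by (auto intro!: C_k_add)
qed

lemma C_k_prod:
  assumes "finite I" "\<And>i. i \<in> I \<Longrightarrow> C_k k (f i)"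
  shows "C_k k (\<lambda>x. \<Prod>i\<in>I. f i x)"
  using assms by (induction I rule: finite_induct) (auto intro!: C_k_mult C_k_const)

lemma frechet_derivative_coordinate:
  assumes "\<And>t. (f has_real_derivative f' t) (at t)"
  shows "(\<lambda>x. f (x $ j)) differentiable (at x)"
    "frechet_derivative (\<lambda>x. f (x $ j)) (at x) = (\<lambda>v. f' (x $ j) * v $ j)"
proof -
  have "((\<lambda>x. f (x $ j)) has_derivative (\<lambda>v. f' (x $ j) * v $ j)) (at x)"
    by (rule has_derivative_compose[of "\<lambda>x. x $ j" "\<lambda>v. v $ j" x UNIV f, simplified])
      (use assms in \<open>auto simp: has_field_derivative_def intro!: bounded_linear_imp_has_derivative bounded_linear_vec_nth\<close>)
  then show "(\<lambda>x. f (x $ j)) differentiable (at x)"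
    "frechet_derivative (\<lambda>x. f (x $ j)) (at x) = (\<lambda>v. f' (x $ j) * v $ j)"
    by (auto simp: differentiable_def frechet_derivative_at[symmetric])
qed

lemma C_k_Suc_coordinate:
  assumes "\<And>t. (f has_real_derivative f' t) (at t)" "C_k k (\<lambda>x. f' (x $ j))"
  shows "C_k (Suc k) (\<lambda>x. f (x $ j))"
proof -
  have "C_k k (\<lambda>x. f' (x $ j) * axis i 1 $ j)" for i
    by (intro C_k_mult assms(2) C_k_const)
  then show ?thesis by (simp add: frechet_derivative_coordinate[OF assms(1)])
qed

lemma C_k_coordinate_antiderivative:
  assumes "\<And>t. (f has_real_derivative f' t) (at t)" "\<And>k. C_k k (\<lambda>x. f' (x $ j))"
  shows "C_k k (\<lambda>x. f (x $ j))"
  by (rule C_k_SucD[OF C_k_Suc_coordinate[OF assms]])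

text \<open>Smoothness by listing all derivatives: the family \<open>F\<close> is closed under
  differentiation, so the induction on \<open>k\<close> merely shifts \<open>n\<close>.\<close>

lemma C_k_coordinate:
  assumes "\<And>n t. (F n has_real_derivative F (Suc n) t) (at t)"
  shows "C_k k (\<lambda>x. F n (x $ j))"
proof (induction k arbitrary: n)
  case 0
  have "continuous_on UNIV (F n)"
    using assms by (meson DERIV_isCont continuous_at_imp_continuous_on)
  then show ?case by (auto intro!: continuous_on_compose2[of UNIV "F n"] continuous_intros)
next
  case (Suc k)
  show ?case by (rule C_k_Suc_coordinate[OF assms Suc.IH])
qed

section \<open>Smooth cutoffs built from exp (-1/t)\<close>

lemma tendsto_power_poly_exp_at_top:
  "((\<lambda>y::real. y ^ k * poly p y * exp (- y)) \<longlongrightarrow> 0) at_top"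
proof (induction p arbitrary: k)
  case (pCons a p)
  have "((\<lambda>y::real. a * (y ^ k / exp y) + y ^ Suc k * poly p y * exp (- y)) \<longlongrightarrow> a * 0 + 0) at_top"
    by (intro tendsto_intros tendsto_power_div_exp_0 pCons)
  then show ?case
    by (simp add: algebra_simps exp_minus field_simps)
qed simp

text \<open>The derivatives of \<open>exp (-1/t)\<close> have the form
  \<open>P(1/t) exp (-1/t)\<close>. With \<open>y = 1/t\<close>, differentiation in \<open>t\<close>
  is \<open>- y^2\<close> times differentiation in \<open>y\<close>, which turns \<open>P\<close>
  into \<open>y^2 (P - P')\<close>.\<close>

primrec flat_exp_poly :: "nat \<Rightarrow> real poly" where
  "flat_exp_poly 0 = 1"
| "flat_exp_poly (Suc n) = [:0, 0, 1:] * (flat_exp_poly n - pderiv (flat_exp_poly n))"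

definition flat_exp_deriv :: "nat \<Rightarrow> real \<Rightarrow> real" where
  "flat_exp_deriv n t = (if t > 0 then poly (flat_exp_poly n) (1 / t) * exp (- (1 / t)) else 0)"

definition flat_exp :: "real \<Rightarrow> real" where
  "flat_exp t = (if t > 0 then exp (- (1 / t)) else 0)"

text \<open>At 0 the difference quotient from the right is \<open>y P(y) exp (- y)\<close> with
  \<open>y = 1/t\<close> tending to infinity. It vanishes in the limit for every polynomial, so one
  computation covers all orders.\<close>

lemma has_real_derivative_flat_exp_deriv:
  "(flat_exp_deriv n has_real_derivative flat_exp_deriv (Suc n) t) (at t)"
proof -
  consider "t > 0" | "t < 0" | "t = 0" by linarith
  then show ?thesis
  proof cases
    case 1
    have "((\<lambda>t. poly (flat_exp_poly n) (1 / t) * exp (- (1 / t))) has_real_derivative flat_exp_deriv (Suc n) t) (at t)"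
    proof -
      have i: "((\<lambda>t. 1 / t) has_real_derivative - (1 / t\<^sup>2)) (at t)"
        using 1 by (auto intro!: derivative_eq_intros simp: power2_eq_square)
      show ?thesis
        by (rule DERIV_cong[OF DERIV_mult[OF DERIV_chain2[OF poly_DERIV i] DERIV_chain2[OF DERIV_exp DERIV_minus[OF i]]]])
          (use 1 in \<open>simp add: flat_exp_deriv_def field_simps power2_eq_square\<close>)
    qed
    moreover have "\<forall>\<^sub>F u in nhds t. flat_exp_deriv n u = poly (flat_exp_poly n) (1 / u) * exp (- (1 / u))"
      using eventually_nhds_in_open[of "{0<..}" t] 1 by (auto elim!: eventually_mono simp: flat_exp_deriv_def)
    ultimately show ?thesis by (subst DERIV_cong_ev[OF refl _ refl])
  next
    case 2
    have "\<forall>\<^sub>F u in nhds t. flat_exp_deriv n u = 0"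
      using eventually_nhds_in_open[of "{..<0}" t] 2 by (auto elim!: eventually_mono simp: flat_exp_deriv_def)
    moreover have "((\<lambda>u. 0) has_real_derivative flat_exp_deriv (Suc n) t) (at t)"
      using 2 by (simp add: flat_exp_deriv_def)
    ultimately show ?thesis by (subst DERIV_cong_ev[OF refl _ refl])
  next
    case 3
    have r: "((\<lambda>h. flat_exp_deriv n h / h) \<longlongrightarrow> 0) (at_right 0)"
    proof -
      have "((\<lambda>h. (1 / h) ^ 1 * poly (flat_exp_poly n) (1 / h) * exp (- (1 / h))) \<longlongrightarrow> 0) (at_right 0)"
        using filterlim_compose[OF tendsto_power_poly_exp_at_top[of 1 "flat_exp_poly n"] filterlim_inverse_at_top_right]
        by (simp add: inverse_eq_divide)
      then show ?thesis
        by (rule Lim_transform_eventually)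
          (use eventually_at_right_less[of "0::real"] in \<open>auto elim!: eventually_mono simp: flat_exp_deriv_def\<close>)
    qed
    have "((\<lambda>h. flat_exp_deriv n h / h) \<longlongrightarrow> 0) (at_left 0)"
      by (rule tendsto_eventually) (auto simp: flat_exp_deriv_def eventually_at_left_field intro!: exI[of _ "-1"])
    with r have "((\<lambda>h. flat_exp_deriv n h / h) \<longlongrightarrow> 0) (at 0)"
      by (simp add: filterlim_at_split)
    with 3 show ?thesis by (simp add: DERIV_def flat_exp_deriv_def)
  qed
qed

lemma C_k_flat_exp: "C_k k (\<lambda>x. flat_exp (c * x $ j + d))"
proof -
  have "((\<lambda>t. c ^ n * flat_exp_deriv n (c * t + d)) has_real_derivative c ^ Suc n * flat_exp_deriv (Suc n) (c * t + d)) (at t)" for n t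
  proof -
    have "((\<lambda>t. c * t + d) has_real_derivative c) (at t)"
      by (auto intro!: derivative_eq_intros)
    from DERIV_cmult[OF DERIV_chain2[OF has_real_derivative_flat_exp_deriv[of n] this], of "c ^ n"] show ?thesis
      by (simp add: algebra_simps)
  qed
  from C_k_coordinate[of "\<lambda>n t. c ^ n * flat_exp_deriv n (c * t + d)" k 0, OF this]
  moreover have "flat_exp_deriv 0 = flat_exp"
    by (auto simp: fun_eq_iff flat_exp_deriv_def flat_exp_def)
  ultimately show ?thesis by simp
qed

lemma flat_exp_range: "0 \<le> flat_exp t" "flat_exp t \<le> 1" "flat_exp t = 0 \<longleftrightarrow> t \<le> 0"
  by (auto simp: flat_exp_def)

lemma frechet_derivative_axis:
  assumes "f differentiable (at x)" "((\<lambda>s. f (x + s *\<^sub>R axis j 1)) has_real_derivative D) (at 0)"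
  shows "frechet_derivative f (at x) (axis j 1) = D"
proof -
  let ?f' = "frechet_derivative f (at x)"
  have f': "(f has_derivative ?f') (at x)" using assms(1) by (simp add: frechet_derivative_works)
  then have "(f has_derivative ?f') (at (x + 0 *\<^sub>R axis j 1))" by simp
  moreover have "((\<lambda>s. x + s *\<^sub>R axis j 1) has_derivative (\<lambda>s. s *\<^sub>R axis j 1)) (at 0)"
    by (auto intro!: derivative_eq_intros)
  ultimately have "((\<lambda>s. f (x + s *\<^sub>R axis j 1)) has_derivative (\<lambda>s. ?f' (s *\<^sub>R axis j 1))) (at 0)"
    by (rule has_derivative_compose[rotated])
  moreover have "(\<lambda>s. ?f' (s *\<^sub>R axis j 1)) = (*) (?f' (axis j 1))"
    using has_derivative_linear[OF f'] by (auto simp: linear_cmul fun_eq_iff)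
  ultimately have "((\<lambda>s. f (x + s *\<^sub>R axis j 1)) has_real_derivative ?f' (axis j 1)) (at 0)"
    by (simp add: has_field_derivative_def)
  with assms(2) show ?thesis using DERIV_unique by blast
qed

text \<open>Integration by parts in its barest form: each difference quotient of \<psi> integrates
  to zero by translation invariance of Lebesgue measure, and the quotients converge boundedly with
  supports in one ball.\<close>

lemma integral_partial_derivative_eq_0:
  fixes \<psi> :: "real ^ 'm::finite \<Rightarrow> real"
  assumes K: "compact K" and supp: "\<And>x. x \<notin> K \<Longrightarrow> \<psi> x = 0"
    and der: "\<And>x. ((\<lambda>s. \<psi> (x + s *\<^sub>R axis j 1)) has_real_derivative g x) (at 0)"
    and cont: "continuous_on UNIV \<psi>" "continuous_on UNIV g"
  shows "integral\<^sup>L lborel g = 0"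
proof -
  have der': "((\<lambda>s. \<psi> (x + s *\<^sub>R axis j 1)) has_real_derivative g (x + s *\<^sub>R axis j 1)) (at s)" for x s
  proof -
    have sh: "((\<lambda>t. t - s) has_real_derivative 1) (at s)" by (auto intro!: derivative_eq_intros)
    have "((\<lambda>t. \<psi> (x + s *\<^sub>R axis j 1 + (t - s) *\<^sub>R axis j 1)) has_real_derivative g (x + s *\<^sub>R axis j 1) * 1) (at s)"
      by (rule DERIV_chain2[OF _ sh]) (use der[of "x + s *\<^sub>R axis j 1"] in simp)
    then show ?thesis by (simp add: algebra_simps)
  qed
  obtain R where R: "R > 0" "K \<subseteq> ball 0 R"
    using bounded_subset_ballD[OF compact_imp_bounded[OF K], of 0] by auto
  have g0: "g x = 0" if "x \<notin> ball 0 R" for x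
  proof -
    have "open (- K)" using K by (simp add: compact_imp_closed open_Compl)
    moreover have "x \<in> - K" using that R(2) by auto
    ultimately obtain e where e: "e > 0" "ball x e \<subseteq> - K"
      by (meson open_contains_ball)
    have "\<forall>\<^sub>F s in nhds 0. \<psi> (x + s *\<^sub>R axis j 1) = 0"
      unfolding eventually_nhds_metric
      using e by (intro exI[of _ e]) (auto simp: dist_norm norm_axis_1 subset_iff intro!: supp)
    then have "((\<lambda>s. \<psi> (x + s *\<^sub>R axis j 1)) has_real_derivative 0) (at 0)"
      by (subst DERIV_cong_ev[OF refl _ refl]) auto
    with der show ?thesis using DERIV_unique by blast
  qed
  have "compact (g ` cball 0 R)"
    by (intro compact_continuous_image continuous_on_subset[OF cont(2)]) auto
  from compact_imp_bounded[OF this] obtain G where "\<forall>y\<in>g ` cball 0 R. norm y \<le> G"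
    unfolding bounded_iff by blast
  then have G: "\<And>x. x \<in> cball 0 R \<Longrightarrow> \<bar>g x\<bar> \<le> G" by auto
  have G0: "G \<ge> 0" using G[of 0] R(1) by auto
  have Gx: "\<bar>g x\<bar> \<le> G" for x
    using G[of x] g0[of x] G0 by (cases "x \<in> ball 0 R") auto
  define q where "q n x = real (Suc n) * (\<psi> (x + (1 / Suc n) *\<^sub>R axis j 1) - \<psi> x)" for n x
  have q: "\<exists>s\<in>{0<..<1/Suc n}. q n x = g (x + s *\<^sub>R axis j 1)" for n x
  proof -
    obtain s where s: "0 < s" "s < 1 / Suc n"
      "\<psi> (x + (1 / Suc n) *\<^sub>R axis j 1) - \<psi> (x + 0 *\<^sub>R axis j 1) = (1 / Suc n - 0) * g (x + s *\<^sub>R axis j 1)"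
      using MVT2[of 0 "1 / Suc n" "\<lambda>s. \<psi> (x + s *\<^sub>R axis j 1)" "\<lambda>s. g (x + s *\<^sub>R axis j 1)"] der' by fastforce
    then show ?thesis by (intro bexI[of _ s]) (auto simp: q_def)
  qed
  \<comment> \<open>By the mean value theorem a quotient is a value of \<open>g\<close> at a point
    less than 1 away, so enlarging the ball by 1 contains all supports.\<close>
  have dom: "norm (q n x) \<le> G * indicator (cball 0 (R + 1)) x" for n x
  proof (cases "x \<in> cball 0 (R + 1)")
    case True
    then show ?thesis using q[of n x] Gx by auto
  next
    case False
    obtain s where s: "0 < s" "s < 1 / Suc n" "q n x = g (x + s *\<^sub>R axis j 1)"
      using q[of n x] by auto
    have "1 / Suc n \<le> (1::real)" by simp
    with s(2) have "s \<le> 1" by linarith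
    then have "norm (x + s *\<^sub>R axis j 1) \<ge> norm x - 1"
      using norm_triangle_ineq2[of x "- (s *\<^sub>R axis j 1)"] s(1) by (simp add: norm_axis_1)
    then show ?thesis using False s(3) g0[of "x + s *\<^sub>R axis j 1"] by auto
  qed
  have lim: "(\<lambda>n. integral\<^sup>L lborel (q n)) \<longlonglongrightarrow> integral\<^sup>L lborel g"
  proof (rule integral_dominated_convergence[where w = "\<lambda>x. G * indicator (cball 0 (R + 1)) x"])
    show "g \<in> borel_measurable lborel" using cont(2) by (simp add: borel_measurable_continuous_onI)
    show "q n \<in> borel_measurable lborel" for n
      unfolding q_def using cont(1)
      by (auto intro!: borel_measurable_continuous_onI continuous_intros continuous_on_compose2[OF cont(1)])
    show "integrable lborel (\<lambda>x :: real ^ 'm. G * indicator (cball 0 (R + 1)) x)"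
      using emeasure_bounded_finite[of "cball (0 :: real ^ 'm) (R + 1)"]
      by (intro integrable_mult_right integrable_real_indicator) auto
    show "AE x in lborel. (\<lambda>n. q n x) \<longlonglongrightarrow> g x"
    proof (rule AE_I2)
      fix x
      have "(\<lambda>n. 1 / real (Suc n)) \<longlonglongrightarrow> 0" by (rule LIMSEQ_Suc[OF lim_1_over_n])
      then have l: "filterlim (\<lambda>n. 1 / real (Suc n)) (at 0) sequentially"
        unfolding filterlim_at by auto
      have "((\<lambda>h. (\<psi> (x + h *\<^sub>R axis j 1) - \<psi> x) / h) \<longlongrightarrow> g x) (at 0)"
        using der[of x] by (simp add: DERIV_def)
      from filterlim_compose[OF this l]
      have "(\<lambda>n. (\<psi> (x + (1 / real (Suc n)) *\<^sub>R axis j 1) - \<psi> x) / (1 / real (Suc n))) \<longlonglongrightarrow> g x" .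
      then show "(\<lambda>n. q n x) \<longlonglongrightarrow> g x" by (simp add: q_def mult.commute)
    qed
    show "AE x in lborel. norm (q n x) \<le> G * indicator (cball 0 (R + 1)) x" for n
      using dom by simp
  qed
  have int: "integrable lborel \<psi>"
  proof -
    have "integrable lborel (\<lambda>x. indicator K x *\<^sub>R \<psi> x)"
      by (rule borel_integrable_compact[OF K continuous_on_subset[OF cont(1)]]) auto
    moreover have "(\<lambda>x. indicator K x *\<^sub>R \<psi> x) = \<psi>"
      using supp by (auto simp: fun_eq_iff indicator_def)
    ultimately show ?thesis by simp
  qed
  have "integral\<^sup>L lborel (q n) = 0" for n
  proof -
    let ?a = "(1 / Suc n) *\<^sub>R axis j 1 :: real ^ 'm"
    have mb: "\<psi> \<in> borel_measurable borel" using cont(1) by (rule borel_measurable_continuous_onI)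
    have "integrable (distr lborel borel ((+) ?a)) \<psi>" using int by (simp add: lborel_distr_plus)
    then have i: "integrable lborel (\<lambda>x. \<psi> (x + ?a))"
      by (subst (asm) integrable_distr_eq) (auto simp: mb add.commute)
    have "integral\<^sup>L lborel (\<lambda>x. \<psi> (x + ?a)) = integral\<^sup>L (distr lborel borel ((+) ?a)) \<psi>"
      by (subst integral_distr) (auto simp: mb add.commute)
    also have "\<dots> = integral\<^sup>L lborel \<psi>" by (simp add: lborel_distr_plus)
    finally show ?thesis using i int by (simp add: q_def[abs_def])
  qed
  with lim show ?thesis by (simp add: LIMSEQ_const_iff)
qed

lemma open_sets_lebesgue: "open U \<Longrightarrow> U \<in> sets lebesgue"
  by (simp add: borel_open lborelD)

lemma integrable_on_lebesgue_on_compact_support: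
  fixes f :: "real ^ 'm::finite \<Rightarrow> real"
  assumes U: "open U" and K: "compact K" "K \<subseteq> U" and f: "f absolutely_integrable_on K"
    and g: "continuous_on UNIV g" "\<And>x. x \<notin> K \<Longrightarrow> g x = 0"
  shows "integrable (lebesgue_on U) (\<lambda>x. f x * g x)"
proof -
  have "compact (g ` K)"
    using K(1) g(1) by (intro compact_continuous_image continuous_on_subset[OF g(1)]) auto
  from compact_imp_bounded[OF this] obtain G where G: "\<forall>y\<in>g ` K. norm y \<le> G"
    unfolding bounded_iff by blast
  have mg: "g \<in> borel_measurable lebesgue"
    using borel_measurable_continuous_onI[OF g(1)] by (simp add: measurable_completion)
  have "integrable lebesgue (\<lambda>x. (indicator K x * f x) * g x)"
  proof (rule Bochner_Integration.integrable_bound)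
    have fi: "integrable lebesgue (\<lambda>x. indicator K x * f x)"
      using f by (simp add: set_integrable_def)
    then show "integrable lebesgue (\<lambda>x. G * norm (indicator K x * f x))"
      by (intro integrable_mult_right integrable_norm)
    show "(\<lambda>x. (indicator K x * f x) * g x) \<in> borel_measurable lebesgue"
      using borel_measurable_integrable[OF fi] mg by simp
    show "AE x in lebesgue. norm ((indicator K x * f x) * g x) \<le> norm (G * norm (indicator K x * f x))"
    proof (rule AE_I2)
      fix x
      show "norm ((indicator K x * f x) * g x) \<le> norm (G * norm (indicator K x * f x))"
      proof (cases "x \<in> K")
        case True
        then have "\<bar>g x\<bar> \<le> \<bar>G\<bar>" using G by fastforce
        then show ?thesis using True by (simp add: abs_mult mult.commute[of "\<bar>G\<bar>"] mult_left_mono)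
      qed simp
    qed
  qed
  moreover have "(\<lambda>x. (indicator K x * f x) * g x) = (\<lambda>x. indicator U x *\<^sub>R (f x * g x))"
    using g(2) K(2) by (fastforce simp: indicator_def)
  ultimately show ?thesis
    using open_sets_lebesgue[OF U] by (simp add: integrable_restrict_space)
qed

lemma test_functionD:
  assumes "test_function U \<phi>"
  shows "\<phi> differentiable (at x)" "continuous_on UNIV \<phi>"
    "continuous_on UNIV (\<lambda>x. frechet_derivative \<phi> (at x) (axis j 1))"
    "compact (closure {x. \<phi> x \<noteq> 0})" "closure {x. \<phi> x \<noteq> 0} \<subseteq> U"
    "x \<notin> closure {x. \<phi> x \<noteq> 0} \<Longrightarrow> \<phi> x = 0"
    "x \<notin> closure {x. \<phi> x \<noteq> 0} \<Longrightarrow> frechet_derivative \<phi> (at x) (axis j 1) = 0"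
proof -
  have C: "C_k (Suc 0) \<phi>" and C0: "C_k 0 \<phi>" using assms unfolding test_function_def by blast+
  then show d: "\<phi> differentiable (at x)" for x by simp
  show "continuous_on UNIV \<phi>" using C0 by simp
  show "continuous_on UNIV (\<lambda>x. frechet_derivative \<phi> (at x) (axis j 1))" using C by simp
  show "compact (closure {x. \<phi> x \<noteq> 0})" "closure {x. \<phi> x \<noteq> 0} \<subseteq> U"
    using assms by (auto simp: test_function_def)
  show z: "\<phi> x = 0" if "x \<notin> closure {x. \<phi> x \<noteq> 0}" for x
    using that closure_subset[of "{x. \<phi> x \<noteq> 0}"] by blast
  show "frechet_derivative \<phi> (at x) (axis j 1) = 0" if "x \<notin> closure {x. \<phi> x \<noteq> 0}"
  proof -
    have "open (- closure {x. \<phi> x \<noteq> 0})" by (simp add: open_Compl)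
    moreover have "x \<in> - closure {x. \<phi> x \<noteq> 0}" using that by simp
    moreover have "0 = \<phi> w" if "w \<in> - closure {x. \<phi> x \<noteq> 0}" for w
      using z[of w] that by (metis ComplD)
    ultimately have "(\<phi> has_derivative (\<lambda>_. 0)) (at x)"
      by (rule has_derivative_transform_within_open[OF has_derivative_const])
    then show ?thesis by (simp add: frechet_derivative_at[symmetric])
  qed
qed

lemma locally_integrable_nth:
  assumes "locally_integrable U u"
  shows "locally_integrable U (\<lambda>x. u x $ i)"
  unfolding locally_integrable_def
proof (intro allI impI)
  fix K assume "compact K \<and> K \<subseteq> U"
  then have "u absolutely_integrable_on K" using assms by (simp add: locally_integrable_def)
  from absolutely_integrable_linear[OF this bounded_linear_vec_nth[of i]]
  show "(\<lambda>x. u x $ i) absolutely_integrable_on K" by (simp add: comp_def)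
qed

lemma locally_integrable_test_function:
  fixes f :: "real ^ 'm::finite \<Rightarrow> real"
  assumes "open U" "locally_integrable U f" "test_function U \<phi>"
  shows "integrable (lebesgue_on U) (\<lambda>x. f x * \<phi> x)"
    "integrable (lebesgue_on U) (\<lambda>x. f x * frechet_derivative \<phi> (at x) (axis j 1))"
proof -
  note t = test_functionD[OF assms(3)]
  have f: "f absolutely_integrable_on (closure {x. \<phi> x \<noteq> 0})"
    using assms(2) t(4,5) unfolding locally_integrable_def by blast
  show "integrable (lebesgue_on U) (\<lambda>x. f x * \<phi> x)"
    by (rule integrable_on_lebesgue_on_compact_support[OF assms(1) t(4,5) f t(2) t(6)])
  show "integrable (lebesgue_on U) (\<lambda>x. f x * frechet_derivative \<phi> (at x) (axis j 1))"
    by (rule integrable_on_lebesgue_on_compact_support[OF assms(1) t(4,5) f t(3) t(7)])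
qed

lemma continuous_locally_integrable:
  assumes "continuous_on U f"
  shows "locally_integrable U f"
  unfolding locally_integrable_def
proof (intro allI impI)
  fix K assume K: "compact K \<and> K \<subseteq> U"
  then have i: "integrable lborel (\<lambda>x. indicator K x *\<^sub>R f x)"
    by (intro borel_integrable_compact continuous_on_subset[OF assms]) auto
  show "f absolutely_integrable_on K"
    unfolding set_integrable_def using integrable_completion[OF borel_measurable_integrable[OF i]] i by blast
qed

lemma lebesgue_on_integral_compact_support:
  fixes h :: "real ^ 'm::finite \<Rightarrow> real"
  assumes "open U" "h \<in> borel_measurable borel" "\<And>x. x \<notin> U \<Longrightarrow> h x = 0"
  shows "(LINT x|lebesgue_on U. h x) = integral\<^sup>L lborel h"
proof -
  have "(LINT x|lebesgue_on U. h x) = (LINT x|lebesgue. indicator U x *\<^sub>R h x)"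
    using open_sets_lebesgue[OF assms(1)] by (simp add: integral_restrict_space)
  also have "(\<lambda>x. indicator U x *\<^sub>R h x) = h" using assms(3) by (auto simp: fun_eq_iff indicator_def)
  finally show ?thesis using assms(2) by (simp add: integral_completion)
qed

text \<open>The product \<open>f_i \<phi>\<close> has compact support, so the integral of its
  partial derivative vanishes; the product rule turns this into the defining identity.\<close>

lemma weak_jacobian_C1:
  fixes f :: "real ^ 'm::finite \<Rightarrow> real ^ 'm"
  assumes U: "open U" and D: "\<And>x. (f has_derivative (\<lambda>v. D x *v v)) (at x)" and cD: "continuous_on UNIV D"
  shows "weak_jacobian U f D"
  unfolding weak_jacobian_def
proof (intro conjI allI impI)
  have cf: "continuous_on UNIV f"
    using D by (meson continuous_at_imp_continuous_on has_derivative_continuous)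
  show li: "locally_integrable U f" "locally_integrable U D"
    using cf cD by (auto intro!: continuous_locally_integrable intro: continuous_on_subset)
  fix \<phi> i j assume \<phi>: "test_function U \<phi>"
  note t = test_functionD[OF \<phi>]
  let ?d = "\<lambda>x. frechet_derivative \<phi> (at x) (axis j 1)"
  have "D x *v axis j 1 = column j (D x)" for x by (simp add: matrix_vector_mult_basis)
  have c1: "((\<lambda>s. f (x + s *\<^sub>R axis j 1) $ i) has_real_derivative D x $ i $ j) (at 0)" for x
  proof -
    have "(f has_derivative (\<lambda>v. D x *v v)) (at (x + 0 *\<^sub>R axis j 1))" using D by simp
    moreover have "((\<lambda>s. x + s *\<^sub>R axis j 1) has_derivative (\<lambda>s. s *\<^sub>R axis j 1)) (at 0)"
      by (auto intro!: derivative_eq_intros)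
    ultimately have "((\<lambda>s. f (x + s *\<^sub>R axis j 1)) has_derivative (\<lambda>s. D x *v (s *\<^sub>R axis j 1))) (at 0)"
      by (rule has_derivative_compose[rotated])
    from bounded_linear.has_derivative[OF bounded_linear_vec_nth[of i] this]
    have "((\<lambda>s. f (x + s *\<^sub>R axis j 1) $ i) has_derivative (\<lambda>s. (D x *v (s *\<^sub>R axis j 1)) $ i)) (at 0)" .
    moreover have "(\<lambda>s. (D x *v (s *\<^sub>R axis j 1)) $ i) = (*) (D x $ i $ j)"
      by (auto simp: fun_eq_iff matrix_vector_mult_scaleR matrix_vector_mult_basis column_def)
    ultimately show ?thesis by (simp add: has_field_derivative_def)
  qed
  have c2: "((\<lambda>s. \<phi> (x + s *\<^sub>R axis j 1)) has_real_derivative ?d x) (at 0)" for x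
  proof -
    let ?f' = "frechet_derivative \<phi> (at x)"
    have f': "(\<phi> has_derivative ?f') (at x)" using t(1) by (simp add: frechet_derivative_works)
    then have "(\<phi> has_derivative ?f') (at (x + 0 *\<^sub>R axis j 1))" by simp
    moreover have "((\<lambda>s. x + s *\<^sub>R axis j 1) has_derivative (\<lambda>s. s *\<^sub>R axis j 1)) (at 0)"
      by (auto intro!: derivative_eq_intros)
    ultimately have "((\<lambda>s. \<phi> (x + s *\<^sub>R axis j 1)) has_derivative (\<lambda>s. ?f' (s *\<^sub>R axis j 1))) (at 0)"
      by (rule has_derivative_compose[rotated])
    moreover have "(\<lambda>s. ?f' (s *\<^sub>R axis j 1)) = (*) (?d x)"
      using has_derivative_linear[OF f'] by (auto simp: linear_cmul fun_eq_iff)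
    ultimately show ?thesis by (simp add: has_field_derivative_def)
  qed
  have cfi: "continuous_on UNIV (\<lambda>x. f x $ i)" "continuous_on UNIV (\<lambda>x. D x $ i $ j)"
    using cf cD by (auto intro!: continuous_intros)
  have "integral\<^sup>L lborel (\<lambda>x. f x $ i * ?d x + D x $ i $ j * \<phi> x) = 0"
  proof (rule integral_partial_derivative_eq_0[OF t(4)])
    show "f x $ i * \<phi> x = 0" if "x \<notin> closure {x. \<phi> x \<noteq> 0}" for x
      using t(6)[OF that] by simp
    show "((\<lambda>s. f (x + s *\<^sub>R axis j 1) $ i * \<phi> (x + s *\<^sub>R axis j 1)) has_real_derivative
        f x $ i * ?d x + D x $ i $ j * \<phi> x) (at 0)" for x
      using DERIV_mult[OF c1[of x] c2[of x]] by (simp add: algebra_simps)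
    show "continuous_on UNIV (\<lambda>x. f x $ i * \<phi> x)" "continuous_on UNIV (\<lambda>x. f x $ i * ?d x + D x $ i $ j * \<phi> x)"
      by (intro continuous_on_add continuous_on_mult cfi t(2,3))+
  qed
  moreover have "integral\<^sup>L lborel (\<lambda>x. f x $ i * ?d x + D x $ i $ j * \<phi> x) =
      (LINT x|lebesgue_on U. f x $ i * ?d x + D x $ i $ j * \<phi> x)"
  proof (rule lebesgue_on_integral_compact_support[symmetric, OF U])
    show "(\<lambda>x. f x $ i * ?d x + D x $ i $ j * \<phi> x) \<in> borel_measurable borel"
      by (intro borel_measurable_continuous_onI continuous_on_add continuous_on_mult cfi t(2,3))
    show "f x $ i * ?d x + D x $ i $ j * \<phi> x = 0" if "x \<notin> U" for x
    proof -
      have x: "x \<notin> closure {x. \<phi> x \<noteq> 0}" using t(5) that by blast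
      show ?thesis by (simp add: t(6)[OF x] t(7)[OF x])
    qed
  qed
  moreover have "\<dots> = (LINT x|lebesgue_on U. f x $ i * ?d x) + (LINT x|lebesgue_on U. D x $ i $ j * \<phi> x)"
    by (rule Bochner_Integration.integral_add[OF
          locally_integrable_test_function(2)[OF U locally_integrable_nth[OF li(1)] \<phi>]
          locally_integrable_test_function(1)[OF U locally_integrable_nth[OF locally_integrable_nth[OF li(2)]] \<phi>]])
  ultimately show "(LINT x|lebesgue_on U. f x $ i * ?d x) = - (LINT x|lebesgue_on U. D x $ i $ j * \<phi> x)"
    by linarith
qed

lemma weak_jacobianD:
  assumes "weak_jacobian U u A"
  shows "locally_integrable U u" "locally_integrable U A"
    "test_function U \<phi> \<Longrightarrow> (LINT x|lebesgue_on U. u x $ i * frechet_derivative \<phi> (at x) (axis j 1)) =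
        - (LINT x|lebesgue_on U. A x $ i $ j * \<phi> x)"
proof -
  note * = assms[unfolded weak_jacobian_def]
  show "locally_integrable U u" using * by (elim conjE)
  show "locally_integrable U A" using * by (elim conjE)
  show "(LINT x|lebesgue_on U. u x $ i * frechet_derivative \<phi> (at x) (axis j 1)) =
        - (LINT x|lebesgue_on U. A x $ i $ j * \<phi> x)" if "test_function U \<phi>"
    using *[THEN conjunct2, THEN conjunct2, rule_format, OF that] .
qed

lemma weak_jacobian_diff:
  fixes u v :: "real ^ 'm::finite \<Rightarrow> real ^ 'm"
  assumes U: "open U" and u: "weak_jacobian U u A" and v: "weak_jacobian U v B"
  shows "weak_jacobian U (\<lambda>x. u x - v x) (\<lambda>x. A x - B x)"
  unfolding weak_jacobian_def
proof (intro conjI allI impI)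
  note li = weak_jacobianD(1,2)[OF u] weak_jacobianD(1,2)[OF v]
  show "locally_integrable U (\<lambda>x. u x - v x)" "locally_integrable U (\<lambda>x. A x - B x)"
    using li unfolding locally_integrable_def by (auto intro!: set_integral_diff(1))
  fix \<phi> i j assume \<phi>: "test_function U \<phi>"
  let ?d = "\<lambda>x. frechet_derivative \<phi> (at x) (axis j 1)"
  note i = locally_integrable_test_function[OF U _ \<phi>]
  have 1: "integrable (lebesgue_on U) (\<lambda>x. u x $ i * ?d x)" "integrable (lebesgue_on U) (\<lambda>x. v x $ i * ?d x)"
    "integrable (lebesgue_on U) (\<lambda>x. A x $ i $ j * \<phi> x)" "integrable (lebesgue_on U) (\<lambda>x. B x $ i $ j * \<phi> x)"
    by (rule i(2)[OF locally_integrable_nth[OF li(1)]] i(2)[OF locally_integrable_nth[OF li(3)]]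
        i(1)[OF locally_integrable_nth[OF locally_integrable_nth[OF li(2)]]]
        i(1)[OF locally_integrable_nth[OF locally_integrable_nth[OF li(4)]]])+
  note e = weak_jacobianD(3)[OF u \<phi>, of i j] weak_jacobianD(3)[OF v \<phi>, of i j]
  have "(LINT x|lebesgue_on U. (u x - v x) $ i * ?d x) =
      (LINT x|lebesgue_on U. u x $ i * ?d x) - (LINT x|lebesgue_on U. v x $ i * ?d x)"
    using 1(1,2) by (simp add: left_diff_distrib)
  moreover have "(LINT x|lebesgue_on U. (A x - B x) $ i $ j * \<phi> x) =
      (LINT x|lebesgue_on U. A x $ i $ j * \<phi> x) - (LINT x|lebesgue_on U. B x $ i $ j * \<phi> x)"
    using 1(3,4) by (simp add: left_diff_distrib)
  ultimately show "(LINT x|lebesgue_on U. (u x - v x) $ i * ?d x) = - (LINT x|lebesgue_on U. (A x - B x) $ i $ j * \<phi> x)"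
    unfolding e by linarith
qed

lemma esssup_indicator_open:
  fixes V :: "(real ^ 'm::finite) set"
  assumes "open V" "V \<noteq> {}"
  shows "esssup lebesgue (indicator V :: _ \<Rightarrow> ennreal) = 1"
proof (rule antisym)
  have m: "(indicator V :: _ \<Rightarrow> ennreal) \<in> borel_measurable lebesgue"
    using open_sets_lebesgue[OF assms(1)] by simp
  show "esssup lebesgue (indicator V :: _ \<Rightarrow> ennreal) \<le> 1"
    by (rule esssup_I[OF m]) (auto simp: indicator_def)
  show "1 \<le> esssup lebesgue (indicator V :: _ \<Rightarrow> ennreal)"
  proof (rule ccontr)
    assume "\<not> ?thesis"
    moreover have "AE x in lebesgue. indicator V x \<le> esssup lebesgue (indicator V :: _ \<Rightarrow> ennreal)"
      by (rule esssup_AE)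
    ultimately have "AE x in lebesgue. x \<notin> V"
      by (elim eventually_mono) (auto simp: indicator_def)
    then have "V \<in> null_sets lebesgue"
      using AE_iff_null_sets[OF open_sets_lebesgue[OF assms(1)]] by simp
    then show False
      using assms by (simp add: negligible_iff_null_sets[symmetric] open_not_negligible)
  qed
qed

lemma continuous_L_infty:
  fixes f :: "real ^ 'm::finite \<Rightarrow> 'b::euclidean_space"
  assumes "bounded U" "continuous_on UNIV f"
  shows "f \<in> L_infty U"
proof -
  have "compact (f ` closure U)"
    using assms(1) by (intro compact_continuous_image continuous_on_subset[OF assms(2)]) (auto simp: compact_closure)
  from compact_imp_bounded[OF this] obtain B where "\<forall>y\<in>f ` closure U. norm y \<le> B"
    unfolding bounded_iff by blast
  then have "AE x in lebesgue_on U. norm (f x) \<le> B"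
    using closure_subset[of U] by (intro AE_I2) (auto simp: space_restrict_space)
  moreover have "f \<in> borel_measurable (lebesgue_on U)"
    using borel_measurable_continuous_onI[OF assms(2)] by (simp add: measurable_restrict_space1 measurable_completion)
  ultimately show ?thesis unfolding L_infty_def by blast
qed

text \<open>A bijection has multiplicity 1 on the image of \<open>U\<close> and 0 elsewhere. The
  image is open and nonempty, hence not null, so the essential supremum is exactly 1. Boundedness of
  \<open>U\<close> makes the continuous derivative bounded on it.\<close>

lemma symplectic_diffeo_admissible:
  fixes U :: "(real ^ ('n::finite + 'n)) set"
  assumes U: "open U" "bounded U" "U \<noteq> {}" and \<Phi>: "symplectic_diffeo \<Phi>"
  obtains D where "\<Phi> \<in> W_1_infty U" "weak_jacobian U \<Phi> D" "essentially_injective U \<Phi>"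
    "\<And>x. transpose (D x) ** symplectic_J ** D x = symplectic_J"
proof -
  obtain D where D: "\<And>x. (\<Phi> has_derivative (\<lambda>v. D x *v v)) (at x)" "continuous_on UNIV D"
    "\<And>x. transpose (D x) ** symplectic_J ** D x = symplectic_J"
    and bij: "bij \<Phi>" "continuous_on UNIV (inv \<Phi>)"
    using \<Phi> unfolding symplectic_diffeo_def by blast
  have c: "continuous_on UNIV \<Phi>"
    using D(1) by (meson continuous_at_imp_continuous_on has_derivative_continuous)
  have wj: "weak_jacobian U \<Phi> D" by (rule weak_jacobian_C1[OF U(1) D(1,2)])
  have W: "\<Phi> \<in> W_1_infty U"
    unfolding W_1_infty_def using continuous_L_infty[OF U(2) c] continuous_L_infty[OF U(2) D(2)] wj continuous_on_subset[OF c] by blast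
  have im: "\<Phi> ` U = inv \<Phi> -` U"
    using bij(1) by (metis bij_vimage_eq_inv_image inv_inv_eq bij_imp_bij_inv)
  then have op: "open (\<Phi> ` U)"
    using bij(2) U(1) by (simp add: open_vimage)
  have "multiplicity_on U \<Phi> = indicator (\<Phi> ` U)"
  proof
    fix y
    show "multiplicity_on U \<Phi> y = indicator (\<Phi> ` U) y"
    proof (cases "y \<in> \<Phi> ` U")
      case True
      then obtain x where x: "x \<in> U" "y = \<Phi> x" by blast
      then have "U \<inter> \<Phi> -` {y} = {x}" using bij(1) by (auto simp: bij_def inj_def)
      then show ?thesis using True by (simp add: multiplicity_on_def)
    next
      case False
      then have "U \<inter> \<Phi> -` {y} = {}" by auto
      then show ?thesis using False by (simp add: multiplicity_on_def)
    qed
  qed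
  then have "essentially_injective U \<Phi>"
    using esssup_indicator_open[OF op] U(3) by (simp add: essentially_injective_def)
  with W wj D(3) show thesis using that by blast
qed

section \<open>Bump functions and weak difference quotients\<close>

definition bump :: "real \<Rightarrow> real" where
  "bump s = flat_exp (1 + s) * flat_exp (1 - s)"

lemma bump_bounds: "0 \<le> bump s" "bump s \<le> 1"
  using flat_exp_range by (auto simp: bump_def intro!: mult_nonneg_nonneg mult_le_one)

lemma bump_eq_0: "\<bar>s\<bar> \<ge> 1 \<Longrightarrow> bump s = 0"
  using flat_exp_range(3)[of "1 + s"] flat_exp_range(3)[of "1 - s"] by (auto simp: bump_def abs_if split: if_splits)

lemma bump_ge: "\<bar>s\<bar> \<le> 1/2 \<Longrightarrow> bump s \<ge> exp (-4)"
proof -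
  have "flat_exp t \<ge> exp (-2)" if "t \<ge> 1/2" for t
    using that by (simp add: flat_exp_def field_simps)
  moreover assume "\<bar>s\<bar> \<le> 1/2"
  then have "1 + s \<ge> 1/2" "1 - s \<ge> 1/2" by linarith+
  ultimately have "exp (-2) * exp (-2) \<le> bump s"
    unfolding bump_def using flat_exp_range(1) by (intro mult_mono) auto
  then show ?thesis by (simp add: exp_add[symmetric])
qed

lemma C_k_bump: "C_k k (\<lambda>x. bump ((x $ j - c) / \<delta>))"
proof -
  have "1 + (t - c) / \<delta> = (1/\<delta>) * t + (1 - c / \<delta>)" "1 - (t - c) / \<delta> = (-1/\<delta>) * t + (1 + c / \<delta>)" for t
    by (auto simp: diff_divide_distrib)
  then show ?thesis
    unfolding bump_def by (simp only:) (intro C_k_mult C_k_flat_exp)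
qed

text \<open>Only increments of the primitive matter: they are at most 2, because
  \<open>bump \<le> 1\<close> lives on an interval of length 2, and zero over intervals that avoid
  the support.\<close>

lemma bump_antiderivative_exists:
  obtains X where "\<And>t. (X has_real_derivative bump t) (at t)"
    "\<And>a b. b \<le> a \<Longrightarrow> 0 \<le> X a - X b \<and> X a - X b \<le> 2"
    "\<And>a b. b \<le> a \<Longrightarrow> 1 \<le> b \<or> a \<le> -1 \<Longrightarrow> X a - X b = 0"
proof -
  have "flat_exp_deriv 0 = flat_exp"
    by (auto simp: fun_eq_iff flat_exp_deriv_def flat_exp_def)
  then have c: "continuous_on UNIV flat_exp"
    using has_real_derivative_flat_exp_deriv[of 0] by (metis DERIV_isCont continuous_at_imp_continuous_on)
  have "continuous_on UNIV bump"
    unfolding bump_def[abs_def]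
    by (intro continuous_on_mult continuous_on_compose2[OF c] continuous_on_add continuous_on_diff
        continuous_on_const continuous_on_id) auto
  then obtain X where X: "\<And>t. (X has_real_derivative bump t) (at t)"
    using continuous_has_antiderivative by blast
  have mono: "X b \<le> X a" if "b \<le> a" for a b
    by (rule DERIV_nonneg_imp_nondecreasing[OF that]) (use X bump_bounds in blast)
  have const: "X a = X b" if "b \<le> a" "1 \<le> b \<or> a \<le> -1" for a b
  proof (cases "a = b")
    case False
    with that have "b < a" by simp
    from MVT2[OF this X] obtain z where "b < z" "z < a" "X a - X b = (a - b) * bump z" by blast
    moreover have "\<bar>z\<bar> \<ge> 1" using calculation that(2) by linarith
    ultimately show ?thesis by (simp add: bump_eq_0)
  qed simp
  have "(-1::real) < 1" by simp
  from MVT2[OF this X] obtain z where "X 1 - X (-1) = (1 - (-1)) * bump z" by blast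
  then have two: "X 1 - X (-1) \<le> 2" using bump_bounds(2)[of z] by simp
  have up: "X a \<le> X 1" for a
  proof (cases "a \<le> 1")
    case False
    then show ?thesis using const[of 1 a] by simp
  qed (rule mono)
  have low: "X (-1) \<le> X a" for a
  proof (cases "-1 \<le> a")
    case False
    then show ?thesis using const[of a "-1"] by simp
  qed (rule mono)
  show thesis
  proof (rule that[of X])
    show "0 \<le> X a - X b \<and> X a - X b \<le> 2" if "b \<le> a" for a b
      using mono[OF that] up[of a] low[of b] two by linarith
    show "X a - X b = 0" if "b \<le> a" "1 \<le> b \<or> a \<le> -1" for a b
      using const[OF that] by linarith
  qed (rule X)
qed

definition cube_bump :: "real \<Rightarrow> real ^ 'm::finite \<Rightarrow> real ^ 'm \<Rightarrow> real" where
  "cube_bump \<delta> y w = (\<Prod>i\<in>UNIV. bump ((w $ i - y $ i) / \<delta>))"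

text \<open>The box swept out by the cube of half side \<delta> about \<open>y\<close> while its
  centre moves to \<open>y + t *\<^sub>R axis j 1\<close>; the vector \<open>1\<close> has all
  entries 1.\<close>

definition tube :: "real \<Rightarrow> real ^ 'm::finite \<Rightarrow> 'm \<Rightarrow> real \<Rightarrow> (real ^ 'm) set" where
  "tube \<delta> y j t = cbox (y - \<delta> *\<^sub>R 1) (y + \<delta> *\<^sub>R 1 + t *\<^sub>R axis j 1)"

lemma mem_tube:
  "w \<in> tube \<delta> y j t \<longleftrightarrow> (\<forall>i. y $ i - \<delta> \<le> w $ i \<and> w $ i \<le> y $ i + \<delta> + (if i = j then t else 0))"
  by (auto simp: tube_def mem_box_cart axis_def)

lemma cube_bump_bounds: "0 \<le> cube_bump \<delta> y w" "cube_bump \<delta> y w \<le> 1"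
  unfolding cube_bump_def using bump_bounds by (auto intro!: prod_nonneg prod_le_1)

lemma cube_bump_eq_0:
  assumes "\<delta> > 0" "w \<notin> cbox (y - \<delta> *\<^sub>R 1) (y + \<delta> *\<^sub>R 1)"
  shows "cube_bump \<delta> y w = 0"
proof -
  obtain i where "\<not> (y $ i - \<delta> \<le> w $ i \<and> w $ i \<le> y $ i + \<delta>)"
    using assms(2) unfolding mem_box_cart by auto
  then have "\<bar>(w $ i - y $ i) / \<delta>\<bar> \<ge> 1"
    using assms(1) by (auto simp: field_simps abs_if)
  then have "bump ((w $ i - y $ i) / \<delta>) = 0" by (rule bump_eq_0)
  then show ?thesis unfolding cube_bump_def by (auto intro!: prod_zero)
qed

lemma continuous_cube_bump: "continuous_on UNIV (cube_bump \<delta> y)"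
proof -
  have "C_k 0 (\<lambda>w. \<Prod>i\<in>UNIV. bump ((w $ i - y $ i) / \<delta>))"
    by (intro C_k_prod C_k_bump) auto
  then show ?thesis unfolding cube_bump_def by simp
qed

text \<open>A bump minus its translate in direction \<open>j\<close> is the \<open>j\<close>-th
  partial derivative of a test function supported in the tube between them. Tested with it, a weak
  derivative compares averages of a function about the two ends without any limit process.\<close>

lemma weak_difference:
  fixes U :: "(real ^ 'm::finite) set"
  assumes \<delta>: "\<delta> > 0" and t: "t \<ge> 0" and T: "tube \<delta> y j t \<subseteq> U"
  obtains \<phi> where "test_function U \<phi>" "\<And>w. 0 \<le> \<phi> w" "\<And>w. \<phi> w \<le> 2 * \<delta>"
    "\<And>w. w \<notin> tube \<delta> y j t \<Longrightarrow> \<phi> w = 0"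
    "\<And>w. frechet_derivative \<phi> (at w) (axis j 1) = cube_bump \<delta> y w - cube_bump \<delta> (y + t *\<^sub>R axis j 1) w"
proof -
  obtain X where X: "\<And>t. (X has_real_derivative bump t) (at t)"
    "\<And>a b. b \<le> a \<Longrightarrow> 0 \<le> X a - X b \<and> X a - X b \<le> 2"
    "\<And>a b. b \<le> a \<Longrightarrow> 1 \<le> b \<or> a \<le> -1 \<Longrightarrow> X a - X b = 0"
    by (rule bump_antiderivative_exists) blast
  define P where "P w = (\<Prod>i\<in>UNIV - {j}. bump ((w $ i - y $ i) / \<delta>))" for w
  \<comment> \<open>The primitive, in coordinate \<open>j\<close>, of the difference of the two
    bumps. As \<delta> times an increment of \<open>X\<close> it is nonnegative, at most
    \<open>2 * \<delta>\<close>, and zero beyond both ends of the tube.\<close>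
  define Y where "Y s = \<delta> * X ((s - y $ j) / \<delta>) + (- \<delta>) * X ((s - (y $ j + t)) / \<delta>)" for s
  define \<phi> where "\<phi> w = P w * Y (w $ j)" for w
  have dX: "((\<lambda>s. X ((s - c) / \<delta>)) has_real_derivative bump ((s - c) / \<delta>) * (1 / \<delta>)) (at s)" for c s
    by (rule DERIV_chain2[OF X(1)]) (use \<delta> in \<open>auto intro!: derivative_eq_intros\<close>)
  have dY: "(Y has_real_derivative bump ((s - y $ j) / \<delta>) - bump ((s - (y $ j + t)) / \<delta>)) (at s)" for s
    unfolding Y_def
    by (rule DERIV_cong[OF DERIV_add[OF DERIV_cmult[OF dX] DERIV_cmult[OF dX]]]) (use \<delta> in simp)
  have CX: "C_k k (\<lambda>w. X ((w $ j - c) / \<delta>))" for k c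
    by (rule C_k_coordinate_antiderivative[OF dX]) (intro C_k_mult C_k_bump C_k_const)
  have C\<phi>: "C_k k \<phi>" for k
    unfolding \<phi>_def P_def Y_def by (intro C_k_mult C_k_prod C_k_bump C_k_add C_k_const CX) auto
  have P01: "0 \<le> P w" "P w \<le> 1" for w
    unfolding P_def using bump_bounds by (auto intro!: prod_nonneg prod_le_1)
  have Yd: "Y s = \<delta> * (X ((s - y $ j) / \<delta>) - X ((s - (y $ j + t)) / \<delta>))" for s
    by (simp add: Y_def algebra_simps)
  have le: "(s - (y $ j + t)) / \<delta> \<le> (s - y $ j) / \<delta>" for s
    using t \<delta> by (simp add: divide_right_mono)
  have Y02: "0 \<le> Y s" "Y s \<le> 2 * \<delta>" for s
    unfolding Yd using X(2)[OF le[of s]] \<delta> by (auto simp: mult.commute[of 2])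
  have z: "\<phi> w = 0" if wn: "w \<notin> tube \<delta> y j t" for w
  proof -
    obtain i where i: "\<not> (y $ i - \<delta> \<le> w $ i \<and> w $ i \<le> y $ i + \<delta> + (if i = j then t else 0))"
      using wn unfolding mem_tube by blast
    show ?thesis
    proof (cases "i = j")
      case True
      then have "1 \<le> (w $ j - (y $ j + t)) / \<delta> \<or> (w $ j - y $ j) / \<delta> \<le> -1"
        using i \<delta> by (auto simp: field_simps)
      then show ?thesis unfolding \<phi>_def Yd using X(3)[OF le] by simp
    next
      case False
      then have "\<bar>(w $ i - y $ i) / \<delta>\<bar> \<ge> 1"
        using i \<delta> by (auto simp: field_simps abs_if)
      then have "bump ((w $ i - y $ i) / \<delta>) = 0" by (rule bump_eq_0)
      then have "P w = 0" using False unfolding P_def by (auto intro!: prod_zero)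
      then show ?thesis by (simp add: \<phi>_def)
    qed
  qed
  have cl: "closure {w. \<phi> w \<noteq> 0} \<subseteq> tube \<delta> y j t"
  proof (rule closure_minimal)
    show "{w. \<phi> w \<noteq> 0} \<subseteq> tube \<delta> y j t" using z by blast
  qed (unfold tube_def, rule closed_cbox)
  have "bounded (tube \<delta> y j t)" unfolding tube_def by (rule bounded_cbox)
  then have "bounded {w. \<phi> w \<noteq> 0}" by (rule bounded_subset) (use z in blast)
  then have "compact (closure {w. \<phi> w \<noteq> 0})" by (simp only: compact_closure)
  then have test: "test_function U \<phi>"
    unfolding test_function_def using C\<phi> order.trans[OF cl T] by (intro conjI allI)
  have Psplit: "cube_bump \<delta> (y + s *\<^sub>R axis j 1) w = P w * bump ((w $ j - (y $ j + s)) / \<delta>)" for s w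
  proof -
    have "cube_bump \<delta> (y + s *\<^sub>R axis j 1) w = bump ((w $ j - (y $ j + s)) / \<delta>) *
        (\<Prod>i\<in>UNIV - {j}. bump ((w $ i - (y + s *\<^sub>R axis j 1) $ i) / \<delta>))"
      unfolding cube_bump_def by (subst prod.remove[of _ j]) auto
    also have "(\<Prod>i\<in>UNIV - {j}. bump ((w $ i - (y + s *\<^sub>R axis j 1) $ i) / \<delta>)) = P w"
      unfolding P_def by (rule prod.cong) (auto simp: axis_def)
    finally show ?thesis by simp
  qed
  have fd: "frechet_derivative \<phi> (at w) (axis j 1) = cube_bump \<delta> y w - cube_bump \<delta> (y + t *\<^sub>R axis j 1) w" for w
  proof (rule frechet_derivative_axis)
    show "\<phi> differentiable (at w)" using C\<phi>[of "Suc 0"] by simp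
    have P: "P (w + s *\<^sub>R axis j 1) = P w" for s
      unfolding P_def by (rule prod.cong) (auto simp: axis_def)
    have sh: "((\<lambda>s. w $ j + s) has_real_derivative 1) (at 0)"
      by (auto intro!: derivative_eq_intros)
    have "((\<lambda>s. Y (w $ j + s)) has_real_derivative bump ((w $ j - y $ j) / \<delta>) - bump ((w $ j - (y $ j + t)) / \<delta>)) (at 0)"
      using DERIV_chain2[OF dY sh] by simp
    from DERIV_cmult[OF this, of "P w"]
    show "((\<lambda>s. \<phi> (w + s *\<^sub>R axis j 1)) has_real_derivative cube_bump \<delta> y w - cube_bump \<delta> (y + t *\<^sub>R axis j 1) w) (at 0)"
      using Psplit[of 0 w] Psplit[of t w] unfolding \<phi>_def P by (simp add: algebra_simps)
  qed
  show thesis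
  proof (rule that[OF test _ _ z fd])
    show "0 \<le> \<phi> w" "\<phi> w \<le> 2 * \<delta>" for w
      using P01[of w] Y02[of "w $ j"] mult_mono[of "P w" 1 "Y (w $ j)" "2 * \<delta>"] by (auto simp: \<phi>_def)
  qed
qed

lemma measure_cbox_cube:
  fixes y :: "real ^ 'm::finite"
  assumes "\<delta> \<ge> 0"
  shows "measure lebesgue (cbox (y - \<delta> *\<^sub>R 1) (y + \<delta> *\<^sub>R 1)) = (2 * \<delta>) ^ CARD('m)"
proof -
  have "(y - \<delta> *\<^sub>R 1) $ i \<le> (y + \<delta> *\<^sub>R 1) $ i" for i using assms by simp
  then have "cbox (y - \<delta> *\<^sub>R 1) (y + \<delta> *\<^sub>R 1) \<noteq> {}"
    using interval_ne_empty_cart(1)[of "y - \<delta> *\<^sub>R 1" "y + \<delta> *\<^sub>R 1"] by blast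
  then have "measure lborel (cbox (y - \<delta> *\<^sub>R 1) (y + \<delta> *\<^sub>R 1)) = (2 * \<delta>) ^ CARD('m)"
    by (subst content_cbox_cart) (auto simp: prod_constant)
  then show ?thesis by simp
qed

text \<open>On the concentric cube of half the size, of volume \<delta> to the dimension, every
  factor of the bump is at least \<open>exp (-4)\<close>.\<close>

lemma integral_cube_bump_ge:
  fixes y :: "real ^ 'm::finite"
  assumes U: "open U" and \<delta>: "\<delta> > 0" and Q: "cbox (y - \<delta> *\<^sub>R 1) (y + \<delta> *\<^sub>R 1) \<subseteq> U"
  shows "integrable (lebesgue_on U) (cube_bump \<delta> y)"
    "(LINT w|lebesgue_on U. cube_bump \<delta> y w) \<ge> (exp (-4) * \<delta>) ^ CARD('m)"
proof -
  have "(\<lambda>_. 1 :: real) absolutely_integrable_on cbox (y - \<delta> *\<^sub>R 1) (y + \<delta> *\<^sub>R 1)"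
    by (simp add: absolutely_integrable_on_const)
  from integrable_on_lebesgue_on_compact_support[OF U compact_cbox Q this continuous_cube_bump[of \<delta> y]]
  have "integrable (lebesgue_on U) (\<lambda>w. 1 * cube_bump \<delta> y w)"
    using cube_bump_eq_0[OF \<delta>] by blast
  then show int: "integrable (lebesgue_on U) (cube_bump \<delta> y)" by (simp only: mult_1)
  let ?q = "cbox (y - (\<delta>/2) *\<^sub>R 1) (y + (\<delta>/2) *\<^sub>R 1)"
  have qQ: "?q \<subseteq> cbox (y - \<delta> *\<^sub>R 1) (y + \<delta> *\<^sub>R 1)"
  proof
    fix w assume w: "w \<in> ?q"
    have "y $ i - \<delta> \<le> w $ i \<and> w $ i \<le> y $ i + \<delta>" for i
    proof -
      have "y $ i - \<delta>/2 \<le> w $ i \<and> w $ i \<le> y $ i + \<delta>/2"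
        using w by (simp add: mem_box_cart)
      then show ?thesis using \<delta> by linarith
    qed
    then show "w \<in> cbox (y - \<delta> *\<^sub>R 1) (y + \<delta> *\<^sub>R 1)" by (simp add: mem_box_cart)
  qed
  have ge: "exp (-4) ^ CARD('m) * indicator ?q w \<le> cube_bump \<delta> y w" for w
  proof (cases "w \<in> ?q")
    case True
    then have *: "y $ i - \<delta>/2 \<le> w $ i \<and> w $ i \<le> y $ i + \<delta>/2" for i
      by (simp add: mem_box_cart)
    have **: "\<bar>w $ i - y $ i\<bar> \<le> \<delta> / 2" for i using *[of i] by linarith
    have "\<bar>(w $ i - y $ i) / \<delta>\<bar> \<le> 1/2" for i
      using \<delta> **[of i] by (simp add: abs_divide divide_le_eq)
    then have "(\<Prod>i\<in>(UNIV :: 'm set). exp (-4)) \<le> cube_bump \<delta> y w"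
      unfolding cube_bump_def by (intro prod_mono conjI bump_ge) auto
    then show ?thesis using True by (simp add: prod_constant)
  qed (simp add: cube_bump_bounds)
  have eqf: "(\<lambda>w. indicator U w *\<^sub>R indicator ?q w) = (indicator ?q :: _ \<Rightarrow> real)"
    using qQ Q by (auto simp: fun_eq_iff indicator_def)
  have "(LINT w|lebesgue_on U. exp (-4) ^ CARD('m) * indicator ?q w) \<le> (LINT w|lebesgue_on U. cube_bump \<delta> y w)"
  proof (rule integral_mono[OF _ int])
    have "integrable lebesgue (\<lambda>w. indicator ?q w :: real)"
      by (intro integrable_real_indicator) (auto simp: emeasure_lborel_cbox_eq)
    then have "integrable lebesgue (\<lambda>w. indicator U w *\<^sub>R (indicator ?q w :: real))"
      unfolding eqf .
    then show "integrable (lebesgue_on U) (\<lambda>w. exp (-4) ^ CARD('m) * indicator ?q w :: real)"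
      using open_sets_lebesgue[OF U] by (intro integrable_mult_right) (simp add: integrable_restrict_space)
  qed (rule ge)
  moreover have "(LINT w|lebesgue_on U. exp (-4) ^ CARD('m) * indicator ?q w) = exp (-4) ^ CARD('m) * \<delta> ^ CARD('m)"
  proof -
    have "(LINT w|lebesgue_on U. indicator ?q w :: real) = (LINT w|lebesgue. indicator U w *\<^sub>R indicator ?q w)"
      by (subst integral_restrict_space) (use open_sets_lebesgue[OF U] in auto)
    also note eqf
    also have "(LINT w|lebesgue. indicator ?q w :: real) = \<delta> ^ CARD('m)"
      using measure_cbox_cube[of "\<delta>/2" y] \<delta> by simp
    finally show ?thesis by (simp only: integral_mult_right_zero)
  qed
  ultimately show "(LINT w|lebesgue_on U. cube_bump \<delta> y w) \<ge> (exp (-4) * \<delta>) ^ CARD('m)"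
    unfolding power_mult_distrib by (simp only:)
qed

section \<open>Differentiability almost everywhere\<close>

lemma abs_integral_le_integral:
  fixes f g :: "'a \<Rightarrow> real"
  assumes "integrable M f" "integrable M g" "\<And>x. \<bar>f x\<bar> \<le> g x"
  shows "\<bar>integral\<^sup>L M f\<bar> \<le> integral\<^sup>L M g"
  using order.trans[OF integral_abs_bound[of M f] integral_mono[OF integrable_abs[OF assms(1)] assms(2,3)]] by simp

lemma integrable_indicator_abs:
  fixes f :: "real ^ 'm::finite \<Rightarrow> real"
  assumes U: "open U" and K: "K \<subseteq> U" and f: "f absolutely_integrable_on K"
  shows "integrable (lebesgue_on U) (\<lambda>x. indicator K x * \<bar>f x\<bar>)"
proof -
  have "integrable lebesgue (\<lambda>x. norm (indicator K x *\<^sub>R f x))"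
    using f unfolding set_integrable_def by (rule integrable_norm)
  moreover have "(\<lambda>x. norm (indicator K x *\<^sub>R f x)) = (\<lambda>x. indicator U x *\<^sub>R (indicator K x * \<bar>f x\<bar>))"
    using K by (auto simp: fun_eq_iff indicator_def)
  ultimately show ?thesis
    using open_sets_lebesgue[OF U] by (subst integrable_restrict_space) auto
qed

lemma cube_subset_tube:
  assumes "t \<ge> 0" "\<delta> \<ge> 0"
  shows "cbox (y - \<delta> *\<^sub>R 1) (y + \<delta> *\<^sub>R 1) \<subseteq> tube \<delta> y j t"
    "cbox (y + t *\<^sub>R axis j 1 - \<delta> *\<^sub>R 1) (y + t *\<^sub>R axis j 1 + \<delta> *\<^sub>R 1) \<subseteq> tube \<delta> y j t"
proof -
  show "cbox (y - \<delta> *\<^sub>R 1) (y + \<delta> *\<^sub>R 1) \<subseteq> tube \<delta> y j t"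
  proof
    fix w assume w: "w \<in> cbox (y - \<delta> *\<^sub>R 1) (y + \<delta> *\<^sub>R 1)"
    have "y $ i - \<delta> \<le> w $ i \<and> w $ i \<le> y $ i + \<delta> + (if i = j then t else 0)" for i
    proof -
      have "y $ i - \<delta> \<le> w $ i \<and> w $ i \<le> y $ i + \<delta>" using w by (simp add: mem_box_cart)
      then show ?thesis using assms(1) by auto
    qed
    then show "w \<in> tube \<delta> y j t" unfolding mem_tube by blast
  qed
  show "cbox (y + t *\<^sub>R axis j 1 - \<delta> *\<^sub>R 1) (y + t *\<^sub>R axis j 1 + \<delta> *\<^sub>R 1) \<subseteq> tube \<delta> y j t"
  proof
    fix w assume w: "w \<in> cbox (y + t *\<^sub>R axis j 1 - \<delta> *\<^sub>R 1) (y + t *\<^sub>R axis j 1 + \<delta> *\<^sub>R 1)"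
    have "y $ i - \<delta> \<le> w $ i \<and> w $ i \<le> y $ i + \<delta> + (if i = j then t else 0)" for i
    proof -
      have "y $ i + (if i = j then t else 0) - \<delta> \<le> w $ i \<and> w $ i \<le> y $ i + (if i = j then t else 0) + \<delta>"
        using w[unfolded mem_box_cart, rule_format, of i] by (simp add: axis_def split: if_splits)
      then show ?thesis using assms(1) by (auto split: if_splits)
    qed
    then show "w \<in> tube \<delta> y j t" unfolding mem_tube by blast
  qed
qed

text \<open>The averages of \<open>v_i\<close> against two translated bumps differ by the integral
  of \<open>A_ij\<close> against the test function, which is at most \<open>2 * \<delta>\<close>.
  Each average is within \<omega> of the value at its centre. Division by the common mass of the
  bumps, with its lower bound, gives the quotient on the right.\<close>

lemma increment_estimate:
  fixes v :: "real ^ 'm::finite \<Rightarrow> real ^ 'm"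
  assumes U: "open U" and wj: "weak_jacobian U v A" and cont: "continuous_on U v"
    and \<delta>: "\<delta> > 0" and t: "t \<ge> 0" and T: "tube \<delta> y j t \<subseteq> U"
    and os1: "\<And>w. w \<in> cbox (y - \<delta> *\<^sub>R 1) (y + \<delta> *\<^sub>R 1) \<Longrightarrow> \<bar>v w $ i - v y $ i\<bar> \<le> \<omega>"
    and os2: "\<And>w. w \<in> cbox (y + t *\<^sub>R axis j 1 - \<delta> *\<^sub>R 1) (y + t *\<^sub>R axis j 1 + \<delta> *\<^sub>R 1) \<Longrightarrow>
       \<bar>v w $ i - v (y + t *\<^sub>R axis j 1) $ i\<bar> \<le> \<omega>"
  shows "\<bar>v (y + t *\<^sub>R axis j 1) $ i - v y $ i\<bar> \<le> 2 * \<omega> + 2 * \<delta> / (exp (-4) * \<delta>) ^ CARD('m) *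
     (LINT x|lebesgue_on U. indicator (tube \<delta> y j t) x * \<bar>A x $ i $ j\<bar>)"
proof -
  let ?y = "y + t *\<^sub>R axis j 1" and ?M = "lebesgue_on U"
  let ?\<eta> = "cube_bump \<delta> y" and ?\<eta>' = "cube_bump \<delta> ?y"
  note sub = cube_subset_tube[OF t less_imp_le[OF \<delta>], of y j]
  have Q: "cbox (y - \<delta> *\<^sub>R 1) (y + \<delta> *\<^sub>R 1) \<subseteq> U" "cbox (?y - \<delta> *\<^sub>R 1) (?y + \<delta> *\<^sub>R 1) \<subseteq> U"
    using order.trans[OF sub(1) T] order.trans[OF sub(2) T] by auto
  note i1 = integral_cube_bump_ge[OF U \<delta> Q(1)] and i2 = integral_cube_bump_ge[OF U \<delta> Q(2)]
  obtain \<phi> where \<phi>: "test_function U \<phi>" "\<And>w. 0 \<le> \<phi> w" "\<And>w. \<phi> w \<le> 2 * \<delta>"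
    and \<phi>0: "\<And>w. w \<notin> tube \<delta> y j t \<Longrightarrow> \<phi> w = 0"
    and fd: "\<And>w. frechet_derivative \<phi> (at w) (axis j 1) = ?\<eta> w - ?\<eta>' w"
    by (rule weak_difference[OF \<delta> t T]) blast
  have lv: "locally_integrable U (\<lambda>x. v x $ i)"
    by (rule locally_integrable_nth[OF weak_jacobianD(1)[OF wj]])
  have lA: "locally_integrable U (\<lambda>x. A x $ i $ j)"
    by (rule locally_integrable_nth[OF locally_integrable_nth[OF weak_jacobianD(2)[OF wj]]])
  have v\<eta>: "integrable ?M (\<lambda>x. v x $ i * cube_bump \<delta> p x)"
    if "cbox (p - \<delta> *\<^sub>R 1) (p + \<delta> *\<^sub>R 1) \<subseteq> U" for p
  proof (rule integrable_on_lebesgue_on_compact_support[OF U compact_cbox that _ continuous_cube_bump])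
    show "(\<lambda>x. v x $ i) absolutely_integrable_on cbox (p - \<delta> *\<^sub>R 1) (p + \<delta> *\<^sub>R 1)"
      using lv that unfolding locally_integrable_def by (simp only: compact_cbox simp_thms)
  qed (rule cube_bump_eq_0[OF \<delta>])
  note iv = v\<eta>[OF Q(1)] v\<eta>[OF Q(2)]
  let ?I = "LINT x|?M. ?\<eta> x"
  \<comment> \<open>Equality of the two masses is read off from the constant function 1, whose weak
    derivative is zero.\<close>
  have e0: "(LINT x|?M. ?\<eta>' x) = ?I"
  proof -
    have "weak_jacobian U (\<lambda>_. 1 :: real ^ 'm) (\<lambda>_. 0)"
      by (rule weak_jacobian_C1[OF U]) (simp_all add: matrix_vector_mult_0)
    from weak_jacobianD(3)[OF this \<phi>(1), of i j] have "(LINT x|?M. ?\<eta> x - ?\<eta>' x) = 0"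
      by (simp add: fd)
    then show ?thesis using i1(1) i2(1) by simp
  qed
  have e1: "(LINT x|?M. v x $ i * ?\<eta> x) - (LINT x|?M. v x $ i * ?\<eta>' x) = - (LINT x|?M. A x $ i $ j * \<phi> x)"
  proof -
    have "(LINT x|?M. v x $ i * ?\<eta> x) - (LINT x|?M. v x $ i * ?\<eta>' x) = (LINT x|?M. v x $ i * ?\<eta> x - v x $ i * ?\<eta>' x)"
      by (rule Bochner_Integration.integral_diff[symmetric, OF iv])
    also have "\<dots> = (LINT x|?M. v x $ i * frechet_derivative \<phi> (at x) (axis j 1))"
      by (simp only: fd right_diff_distrib)
    also have "\<dots> = - (LINT x|?M. A x $ i $ j * \<phi> x)"
      by (rule weak_jacobianD(3)[OF wj \<phi>(1)])
    finally show ?thesis .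
  qed
  have osc: "\<bar>(LINT x|?M. v x $ i * cube_bump \<delta> p x) - v p $ i * (LINT x|?M. cube_bump \<delta> p x)\<bar>
      \<le> \<omega> * (LINT x|?M. cube_bump \<delta> p x)"
    if p: "cbox (p - \<delta> *\<^sub>R 1) (p + \<delta> *\<^sub>R 1) \<subseteq> U"
      and o: "\<And>w. w \<in> cbox (p - \<delta> *\<^sub>R 1) (p + \<delta> *\<^sub>R 1) \<Longrightarrow> \<bar>v w $ i - v p $ i\<bar> \<le> \<omega>" for p
  proof -
    note j1 = v\<eta>[OF p] and j2 = integral_cube_bump_ge(1)[OF U \<delta> p]
    have j3: "integrable ?M (\<lambda>x. v p $ i * cube_bump \<delta> p x)" using j2 by simp
    have "(LINT x|?M. v x $ i * cube_bump \<delta> p x) - v p $ i * (LINT x|?M. cube_bump \<delta> p x)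
        = (LINT x|?M. v x $ i * cube_bump \<delta> p x - v p $ i * cube_bump \<delta> p x)"
      using Bochner_Integration.integral_diff[OF j1 j3] by simp
    moreover have "\<bar>LINT x|?M. v x $ i * cube_bump \<delta> p x - v p $ i * cube_bump \<delta> p x\<bar>
        \<le> (LINT x|?M. \<omega> * cube_bump \<delta> p x)"
    proof (rule abs_integral_le_integral)
      show "integrable ?M (\<lambda>x. v x $ i * cube_bump \<delta> p x - v p $ i * cube_bump \<delta> p x)"
        by (rule Bochner_Integration.integrable_diff[OF j1 j3])
      show "integrable ?M (\<lambda>x. \<omega> * cube_bump \<delta> p x)" using j2 by simp
      fix x
      have "v x $ i * cube_bump \<delta> p x - v p $ i * cube_bump \<delta> p x = (v x $ i - v p $ i) * cube_bump \<delta> p x"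
        by (simp add: algebra_simps)
      then show "\<bar>v x $ i * cube_bump \<delta> p x - v p $ i * cube_bump \<delta> p x\<bar> \<le> \<omega> * cube_bump \<delta> p x"
        using o[of x] cube_bump_eq_0[OF \<delta>, of x p] cube_bump_bounds(1)[of \<delta> p x]
        by (cases "x \<in> cbox (p - \<delta> *\<^sub>R 1) (p + \<delta> *\<^sub>R 1)") (simp_all add: abs_mult mult_right_mono)
    qed
    ultimately show ?thesis by simp
  qed
  let ?J = "LINT x|?M. indicator (tube \<delta> y j t) x * \<bar>A x $ i $ j\<bar>"
  have iA: "integrable ?M (\<lambda>x. indicator (tube \<delta> y j t) x * \<bar>A x $ i $ j\<bar>)"
  proof (rule integrable_indicator_abs[OF U T])
    have "compact (tube \<delta> y j t)" unfolding tube_def by (rule compact_cbox)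
    then show "(\<lambda>x. A x $ i $ j) absolutely_integrable_on tube \<delta> y j t"
      using lA T unfolding locally_integrable_def by blast
  qed
  have J: "\<bar>LINT x|?M. A x $ i $ j * \<phi> x\<bar> \<le> 2 * \<delta> * ?J"
  proof -
    have "\<bar>LINT x|?M. A x $ i $ j * \<phi> x\<bar> \<le> (LINT x|?M. 2 * \<delta> * (indicator (tube \<delta> y j t) x * \<bar>A x $ i $ j\<bar>))"
    proof (rule abs_integral_le_integral)
      show "integrable ?M (\<lambda>x. A x $ i $ j * \<phi> x)"
        by (rule locally_integrable_test_function(1)[OF U lA \<phi>(1)])
      show "integrable ?M (\<lambda>x. 2 * \<delta> * (indicator (tube \<delta> y j t) x * \<bar>A x $ i $ j\<bar>))"
        by (rule integrable_mult_right[OF iA])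
      show "\<bar>A x $ i $ j * \<phi> x\<bar> \<le> 2 * \<delta> * (indicator (tube \<delta> y j t) x * \<bar>A x $ i $ j\<bar>)" for x
      proof (cases "x \<in> tube \<delta> y j t")
        case True
        then show ?thesis using mult_right_mono[OF \<phi>(3)[of x], of "\<bar>A x $ i $ j\<bar>"] \<phi>(2)[of x]
          by (simp add: abs_mult mult.commute)
      next
        case False
        then show ?thesis by (simp add: \<phi>0[OF False])
      qed
    qed
    then show ?thesis by simp
  qed
  have J0: "?J \<ge> 0" by (rule Bochner_Integration.integral_nonneg) simp
  define \<kappa> where "\<kappa> = (exp (-4) * \<delta>) ^ CARD('m)"
  have \<kappa>: "\<kappa> > 0" "?I \<ge> \<kappa>" using i1(2) \<delta> by (simp_all add: \<kappa>_def)
  have o1: "\<bar>(LINT x|?M. v x $ i * ?\<eta> x) - v y $ i * ?I\<bar> \<le> \<omega> * ?I"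
    by (rule osc[OF Q(1) os1])
  have o2: "\<bar>(LINT x|?M. v x $ i * ?\<eta>' x) - v ?y $ i * ?I\<bar> \<le> \<omega> * ?I"
    using osc[OF Q(2) os2] unfolding e0 .
  have "\<bar>v ?y $ i - v y $ i\<bar> * ?I = \<bar>v ?y $ i * ?I - v y $ i * ?I\<bar>"
    using \<kappa> by (simp add: left_diff_distrib[symmetric] abs_mult)
  also have "\<dots> \<le> 2 * \<omega> * ?I + 2 * \<delta> * ?J"
    using o1 o2 e1 J by linarith
  also have "\<dots> \<le> (2 * \<omega> + 2 * \<delta> / \<kappa> * ?J) * ?I"
  proof -
    have "2 * \<delta> * ?J = 2 * \<delta> / \<kappa> * ?J * \<kappa>" using \<kappa> by simp
    also have "\<dots> \<le> 2 * \<delta> / \<kappa> * ?J * ?I"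
      using \<kappa> \<delta> J0 by (intro mult_left_mono) auto
    finally show ?thesis by (simp add: distrib_right)
  qed
  finally have "\<bar>v ?y $ i - v y $ i\<bar> \<le> 2 * \<omega> + 2 * \<delta> / \<kappa> * ?J"
    using \<kappa> by (simp add: mult_le_cancel_right)
  then show ?thesis by (simp only: \<kappa>_def)
qed

text \<open>The coordinates are switched from \<open>y\<close> to \<open>z\<close> one at a time;
  the intermediate points are mixtures of the two and stay in every box that contains both.\<close>

lemma coordinate_chain:
  fixes f :: "real ^ 'm::finite \<Rightarrow> real"
  assumes step: "\<And>I k. k \<notin> I \<Longrightarrow>
     \<bar>f (\<chi> l. if l \<in> insert k I then z $ l else y $ l) - f (\<chi> l. if l \<in> I then z $ l else y $ l)\<bar> \<le> c k"
  shows "\<bar>f z - f y\<bar> \<le> (\<Sum>k\<in>UNIV. c k)"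
proof -
  have "\<bar>f (\<chi> l. if l \<in> I then z $ l else y $ l) - f y\<bar> \<le> (\<Sum>k\<in>I. c k)" for I
    using finite[of I]
  proof (induction I rule: finite_induct)
    case empty
    have "(\<chi> l. y $ l) = y" by (simp add: vec_eq_iff)
    then show ?case by simp
  next
    case (insert k I)
    have "(\<Sum>k\<in>insert k I. c k) = c k + (\<Sum>k\<in>I. c k)" using insert.hyps by simp
    with insert.IH step[OF insert.hyps(2)] show ?case by linarith
  qed
  from this[of UNIV] show ?thesis by (simp add: vec_eq_iff)
qed

text \<open>The factor \<open>2 * \<delta>\<close> is the bound of the test function; with it the
  volume shows the full power of \<open>2 * \<delta>\<close> that matches the lower bound for the
  mass of a bump.\<close>

lemma measure_tube:
  fixes y :: "real ^ 'm::finite"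
  assumes "\<delta> > 0" "t \<ge> 0"
  shows "2 * \<delta> * measure lborel (tube \<delta> y j t) = (2 * \<delta>) ^ CARD('m) * (2 * \<delta> + t)"
proof -
  let ?b = "y + \<delta> *\<^sub>R 1 + t *\<^sub>R axis j 1"
  have "(y - \<delta> *\<^sub>R 1) $ i \<le> ?b $ i" for i using assms by (simp add: axis_def)
  then have "cbox (y - \<delta> *\<^sub>R 1) ?b \<noteq> {}"
    using interval_ne_empty_cart(1)[of "y - \<delta> *\<^sub>R 1" ?b] by blast
  then have "measure lborel (tube \<delta> y j t) = (\<Prod>i\<in>UNIV. ?b $ i - (y - \<delta> *\<^sub>R 1) $ i)"
    unfolding tube_def by (rule content_cbox_cart)
  also have "\<dots> = (2 * \<delta> + t) * (\<Prod>i\<in>UNIV - {j}. ?b $ i - (y - \<delta> *\<^sub>R 1) $ i)"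
    by (subst prod.remove[of _ j]) (auto simp: axis_def)
  also have "(\<Prod>i\<in>UNIV - {j}. ?b $ i - (y - \<delta> *\<^sub>R 1) $ i) = (\<Prod>i\<in>UNIV - {j}. 2 * \<delta>)"
    by (rule prod.cong) (auto simp: axis_def)
  also have "\<dots> = (2 * \<delta>) ^ (CARD('m) - 1)" by (simp add: prod_constant card_Diff_singleton)
  finally have "2 * \<delta> * measure lborel (tube \<delta> y j t) = (2 * \<delta>) * (2 * \<delta>) ^ (CARD('m) - 1) * (2 * \<delta> + t)"
    by (simp only: mult_ac)
  also have "(2 * \<delta>) * (2 * \<delta>) ^ (CARD('m) - 1) = (2 * \<delta>) ^ CARD('m)"
    by (metis power_eq_if zero_less_card_finite less_irrefl)
  finally show ?thesis .
qed

text \<open>Let \<delta> tend to 0 in the increment estimate: the oscillation vanishes by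
  continuity, and the integral over the tube is at most \<open>B\<close> times its volume. The ratio
  of the cube volume to the lower bound for the mass of a bump leaves the factor
  \<open>(2 * exp 4) ^ CARD('m)\<close>, far from sharp but independent of \<open>v\<close>.\<close>

lemma increment_bound:
  fixes v :: "real ^ 'm::finite \<Rightarrow> real ^ 'm"
  assumes U: "open U" and wj: "weak_jacobian U v A" and cont: "continuous_on U v"
    and B: "AE x in lebesgue_on U. norm (A x) \<le> B"
    and r: "r > 0" and t: "t \<ge> 0" and T: "tube r y j t \<subseteq> U"
  shows "\<bar>v (y + t *\<^sub>R axis j 1) $ i - v y $ i\<bar> \<le> (2 * exp 4) ^ CARD('m) * B * t"
proof -
  let ?y = "y + t *\<^sub>R axis j 1"
  let ?C = "(2 * exp 4) ^ CARD('m) * B"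
  have yT: "y \<in> U" "?y \<in> U"
    using T cube_subset_tube[OF t less_imp_le[OF r], of y j] r by (auto simp: mem_box_cart subset_iff)
  have "\<bar>v ?y $ i - v y $ i\<bar> \<le> ?C * t + e" if e: "e > 0" for e
  proof -
    have ctn: "\<exists>s>0. \<forall>w. dist w p < s \<longrightarrow> \<bar>v w $ i - v p $ i\<bar> < e / 4" if "p \<in> U" for p
    proof -
      have "isCont v p" using cont U that by (simp add: continuous_on_eq_continuous_at)
      then have "isCont (\<lambda>w. v w $ i) p" by (intro continuous_intros)
      moreover have "e / 4 > 0" using e by simp
      ultimately show ?thesis
        unfolding continuous_at_eps_delta dist_real_def by blast
    qed
    obtain s1 where s1: "s1 > 0" "\<And>w. dist w y < s1 \<Longrightarrow> \<bar>v w $ i - v y $ i\<bar> < e / 4" using ctn[OF yT(1)] by blast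
    obtain s2 where s2: "s2 > 0" "\<And>w. dist w ?y < s2 \<Longrightarrow> \<bar>v w $ i - v ?y $ i\<bar> < e / 4" using ctn[OF yT(2)] by blast
    define m where "m = real CARD('m)"
    have m: "m \<ge> 1" unfolding m_def by (simp add: Suc_le_eq)
    \<comment> \<open>The last entry keeps the surplus \<open>2 * (?C * \<delta>)\<close>, caused by
      the tube being longer than \<open>t\<close>, below \<open>e / 2\<close>; the oscillation at
      the two ends takes the other half of \<open>e\<close>.\<close>
    define \<delta> where "\<delta> = Min {r, s1 / (2 * m), s2 / (2 * m), e / (4 * (\<bar>?C\<bar> + 1))}"
    have \<delta>: "\<delta> > 0" "\<delta> \<le> r" "\<delta> \<le> s1 / (2 * m)" "\<delta> \<le> s2 / (2 * m)" "\<delta> \<le> e / (4 * (\<bar>?C\<bar> + 1))"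
      unfolding \<delta>_def using r s1(1) s2(1) e m by auto
    have near: "dist w p \<le> m * \<delta>" if "w \<in> cbox (p - \<delta> *\<^sub>R 1) (p + \<delta> *\<^sub>R 1)" for w p :: "real ^ 'm"
    proof -
      have "\<bar>(w - p) $ k\<bar> \<le> \<delta>" for k
        using that by (auto simp: mem_box_cart abs_le_iff algebra_simps)
      then have "(\<Sum>k\<in>UNIV. \<bar>(w - p) $ k\<bar>) \<le> m * \<delta>"
        unfolding m_def by (intro sum_bounded_above[of UNIV, simplified]) auto
      then show ?thesis using norm_le_l1_cart[of "w - p"] by (simp add: dist_norm)
    qed
    have md: "m * \<delta> < s1" "m * \<delta> < s2"
    proof -
      have "m * \<delta> \<le> s1 / 2" using mult_left_mono[OF \<delta>(3), of m] m by simp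
      then show "m * \<delta> < s1" using s1(1) by linarith
      have "m * \<delta> \<le> s2 / 2" using mult_left_mono[OF \<delta>(4), of m] m by simp
      then show "m * \<delta> < s2" using s2(1) by linarith
    qed
    have sub: "tube \<delta> y j t \<subseteq> tube r y j t"
    proof
      fix w assume w: "w \<in> tube \<delta> y j t"
      have "y $ i - r \<le> w $ i \<and> w $ i \<le> y $ i + r + (if i = j then t else 0)" for i
        using w[unfolded mem_tube, rule_format, of i] \<delta>(2) by linarith
      then show "w \<in> tube r y j t" unfolding mem_tube by blast
    qed
    then have TU: "tube \<delta> y j t \<subseteq> U" using T by blast
    let ?J = "LINT x|lebesgue_on U. indicator (tube \<delta> y j t) x * \<bar>A x $ i $ j\<bar>"
    have est: "\<bar>v ?y $ i - v y $ i\<bar> \<le> 2 * (e / 4) + 2 * \<delta> / (exp (-4) * \<delta>) ^ CARD('m) * ?J"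
    proof (rule increment_estimate[OF U wj cont \<delta>(1) t TU])
      show "\<bar>v w $ i - v y $ i\<bar> \<le> e / 4" if "w \<in> cbox (y - \<delta> *\<^sub>R 1) (y + \<delta> *\<^sub>R 1)" for w
        using s1(2)[of w] near[OF that] md(1) by linarith
      show "\<bar>v w $ i - v ?y $ i\<bar> \<le> e / 4" if "w \<in> cbox (?y - \<delta> *\<^sub>R 1) (?y + \<delta> *\<^sub>R 1)" for w
        using s2(2)[of w] near[OF that] md(2) by linarith
    qed
    have J: "?J \<le> B * measure lborel (tube \<delta> y j t)"
    proof -
      have lA: "locally_integrable U (\<lambda>x. A x $ i $ j)"
        by (rule locally_integrable_nth[OF locally_integrable_nth[OF weak_jacobianD(2)[OF wj]]])
      have cT: "compact (tube \<delta> y j t)" unfolding tube_def by (rule compact_cbox)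
      then have ab: "(\<lambda>x. A x $ i $ j) absolutely_integrable_on tube \<delta> y j t"
        using lA TU unfolding locally_integrable_def by blast
      have one: "(\<lambda>x. 1 :: real) absolutely_integrable_on tube \<delta> y j t"
        unfolding tube_def by (rule absolutely_integrable_on_const) simp
      have "?J \<le> (LINT x|lebesgue_on U. B * (indicator (tube \<delta> y j t) x * \<bar>1::real\<bar>))"
      proof (rule integral_mono_AE[OF integrable_indicator_abs[OF U TU ab] integrable_mult_right[OF integrable_indicator_abs[OF U TU one]]])
        show "AE x in lebesgue_on U. indicator (tube \<delta> y j t) x * \<bar>A x $ i $ j\<bar> \<le> B * (indicator (tube \<delta> y j t) x * \<bar>1::real\<bar>)"
          using B
        proof (rule eventually_mono)
          fix x assume "norm (A x) \<le> B"
          then have "\<bar>A x $ i $ j\<bar> \<le> B"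
            using component_le_norm_cart[of "A x $ i" j] Finite_Cartesian_Product.norm_nth_le[of "A x" i] by linarith
          then show "indicator (tube \<delta> y j t) x * \<bar>A x $ i $ j\<bar> \<le> B * (indicator (tube \<delta> y j t) x * \<bar>1::real\<bar>)"
            by (simp add: indicator_def)
        qed
      qed
      also have "\<dots> = B * (LINT x|lebesgue_on U. indicator (tube \<delta> y j t) x)" by simp
      also have "(LINT x|lebesgue_on U. indicator (tube \<delta> y j t) x) = measure lborel (tube \<delta> y j t)"
      proof -
        have bm: "tube \<delta> y j t \<in> sets borel" unfolding tube_def by simp
        have "(LINT x|lebesgue_on U. indicator (tube \<delta> y j t) x :: real) = integral\<^sup>L lborel (indicator (tube \<delta> y j t))"
          by (rule lebesgue_on_integral_compact_support[OF U]) (use bm TU in \<open>auto simp: indicator_def\<close>)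
        then show ?thesis using bm by simp
      qed
      finally show ?thesis .
    qed
    have "2 * \<delta> / (exp (-4) * \<delta>) ^ CARD('m) * ?J \<le> 2 * \<delta> / (exp (-4) * \<delta>) ^ CARD('m) * (B * measure lborel (tube \<delta> y j t))"
      using J \<delta>(1) by (intro mult_left_mono) auto
    also have "\<dots> = B * (2 * \<delta> * measure lborel (tube \<delta> y j t)) / (exp (-4) * \<delta>) ^ CARD('m)"
      by simp
    also have "\<dots> = B * ((2 * \<delta>) ^ CARD('m) / (exp (-4) * \<delta>) ^ CARD('m)) * (2 * \<delta> + t)"
      unfolding measure_tube[OF \<delta>(1) t] by simp
    also have "(2 * \<delta>) ^ CARD('m) / (exp (-4) * \<delta>) ^ CARD('m) = (2 * exp 4) ^ CARD('m)"
    proof -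
      have "2 * \<delta> / (exp (-4) * \<delta>) = 2 * exp 4" using \<delta>(1) by (simp add: exp_minus field_simps)
      then show ?thesis by (simp only: power_divide[symmetric])
    qed
    also have "B * (2 * exp 4) ^ CARD('m) * (2 * \<delta> + t) = ?C * t + 2 * (?C * \<delta>)"
      by (simp add: algebra_simps)
    also have "?C * \<delta> \<le> e / 4"
    proof -
      have "?C * \<delta> \<le> (\<bar>?C\<bar> + 1) * \<delta>" using \<delta>(1) by (intro mult_right_mono) auto
      also have "\<dots> \<le> (\<bar>?C\<bar> + 1) * (e / (4 * (\<bar>?C\<bar> + 1)))" using \<delta>(5) by (intro mult_left_mono) auto
      also have "\<dots> = e / 4"
      proof -
        have "\<bar>?C\<bar> + 1 \<noteq> 0" by linarith
        then show ?thesis by (simp add: field_simps)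
      qed
      finally show ?thesis .
    qed
    finally show ?thesis using est by linarith
  qed
  then show ?thesis by (rule field_le_epsilon)
qed

text \<open>The margin \<open>r\<close> between the two cubes keeps tubes of half width
  \<open>r\<close> inside \<open>U\<close>; for negative \<open>s\<close> the tube starts at the
  other end point.\<close>

lemma increment_bound_in_cube:
  fixes v :: "real ^ 'm::finite \<Rightarrow> real ^ 'm"
  assumes U: "open U" and wj: "weak_jacobian U v A" and cont: "continuous_on U v"
    and B: "AE x in lebesgue_on U. norm (A x) \<le> B"
    and r: "r > 0" and Q: "cbox (x - (2 * r) *\<^sub>R 1) (x + (2 * r) *\<^sub>R 1) \<subseteq> U"
    and p: "p \<in> cbox (x - r *\<^sub>R 1) (x + r *\<^sub>R 1)" and p': "p + s *\<^sub>R axis k 1 \<in> cbox (x - r *\<^sub>R 1) (x + r *\<^sub>R 1)"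
  shows "\<bar>v (p + s *\<^sub>R axis k 1) $ i - v p $ i\<bar> \<le> (2 * exp 4) ^ CARD('m) * B * \<bar>s\<bar>"
proof -
  have tub: "tube r y k t \<subseteq> U" if y: "y \<in> cbox (x - r *\<^sub>R 1) (x + r *\<^sub>R 1)"
    and y': "y + t *\<^sub>R axis k 1 \<in> cbox (x - r *\<^sub>R 1) (x + r *\<^sub>R 1)" for y t
  proof -
    have "tube r y k t \<subseteq> cbox (x - (2 * r) *\<^sub>R 1) (x + (2 * r) *\<^sub>R 1)"
    proof
      fix w assume w: "w \<in> tube r y k t"
      have "x $ l - 2 * r \<le> w $ l \<and> w $ l \<le> x $ l + 2 * r" for l
      proof -
        have "x $ l - r \<le> y $ l" "y $ l \<le> x $ l + r" using y by (simp_all add: mem_box_cart)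
        moreover have "y $ l + (if l = k then t else 0) \<le> x $ l + r"
          using y'[unfolded mem_box_cart, rule_format, of l] by (simp add: axis_def split: if_splits)
        moreover have "y $ l - r \<le> w $ l \<and> w $ l \<le> y $ l + r + (if l = k then t else 0)"
          using w unfolding mem_tube by blast
        ultimately show ?thesis by linarith
      qed
      then show "w \<in> cbox (x - (2 * r) *\<^sub>R 1) (x + (2 * r) *\<^sub>R 1)" by (simp add: mem_box_cart)
    qed
    then show ?thesis using Q by blast
  qed
  show ?thesis
  proof (cases "s \<ge> 0")
    case True
    from increment_bound[OF U wj cont B r True tub[OF p p']] show ?thesis using True by simp
  next
    case False
    let ?y = "p + s *\<^sub>R axis k 1"
    have e: "?y + (- s) *\<^sub>R axis k 1 = p" by simp
    have s: "- s \<ge> 0" using False by simp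
    have "tube r ?y k (- s) \<subseteq> U" by (rule tub[OF p']) (simp only: e p)
    from increment_bound[OF U wj cont B r s this, of i]
    have "\<bar>v p $ i - v ?y $ i\<bar> \<le> (2 * exp 4) ^ CARD('m) * B * (- s)" unfolding e .
    then show ?thesis using False by (simp add: abs_minus_commute)
  qed
qed

lemma path_point_step:
  fixes y z :: "real ^ 'm::finite"
  assumes "k \<notin> I"
  shows "(\<chi> l. if l \<in> insert k I then z $ l else y $ l) =
    (\<chi> l. if l \<in> I then z $ l else y $ l) + (z $ k - y $ k) *\<^sub>R axis k 1"
  using assms by (auto simp: vec_eq_iff axis_def)

lemma path_point_in_cube:
  fixes y z :: "real ^ 'm::finite"
  assumes "y \<in> cbox a b" "z \<in> cbox a b"
  shows "(\<chi> l. if l \<in> I then z $ l else y $ l) \<in> cbox a b"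
  using assms by (simp add: mem_box_cart)

lemma lipschitz_in_cube:
  fixes v :: "real ^ 'm::finite \<Rightarrow> real ^ 'm"
  assumes U: "open U" and wj: "weak_jacobian U v A" and cont: "continuous_on U v"
    and B: "AE x in lebesgue_on U. norm (A x) \<le> B"
    and r: "r > 0" and Q: "cbox (x - (2 * r) *\<^sub>R 1) (x + (2 * r) *\<^sub>R 1) \<subseteq> U"
    and y: "y \<in> cbox (x - r *\<^sub>R 1) (x + r *\<^sub>R 1)" and z: "z \<in> cbox (x - r *\<^sub>R 1) (x + r *\<^sub>R 1)"
  shows "\<bar>v z $ i - v y $ i\<bar> \<le> (\<Sum>k\<in>UNIV. (2 * exp 4) ^ CARD('m) * B * \<bar>z $ k - y $ k\<bar>)"
proof (rule coordinate_chain[where f = "\<lambda>w. v w $ i"])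
  fix I k assume k: "k \<notin> (I :: 'm set)"
  note q = path_point_in_cube[OF y z, of I] path_point_in_cube[OF y z, of "insert k I"]
  show "\<bar>v (\<chi> l. if l \<in> insert k I then z $ l else y $ l) $ i - v (\<chi> l. if l \<in> I then z $ l else y $ l) $ i\<bar>
      \<le> (2 * exp 4) ^ CARD('m) * B * \<bar>z $ k - y $ k\<bar>"
    unfolding path_point_step[OF k]
    by (rule increment_bound_in_cube[OF U wj cont B r Q q(1) q(2)[unfolded path_point_step[OF k]]])
qed

lemma cube_sum_bound:
  fixes w p :: "real ^ 'm::finite"
  assumes "w \<in> cbox (p - \<delta> *\<^sub>R 1) (p + \<delta> *\<^sub>R 1)"
  shows "(\<Sum>k\<in>UNIV. \<bar>w $ k - p $ k\<bar>) \<le> real CARD('m) * \<delta>"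
proof -
  have "\<bar>w $ k - p $ k\<bar> \<le> \<delta>" for k
    using assms by (auto simp: mem_box_cart abs_le_iff algebra_simps)
  then show ?thesis by (intro sum_bounded_above[of UNIV, simplified]) auto
qed

text \<open>After subtraction of the linear map \<open>A x\<close> the weak derivative has small
  mean near \<open>x\<close>. At scale \<open>\<rho> = norm h\<close> the increment estimate is used
  with mollification radius \<open>\<delta> = \<tau> * \<rho>\<close>: the local Lipschitz bound
  makes the oscillation of order \<open>\<tau> * \<rho>\<close>, and the Lebesgue point property
  controls the integral.\<close>

lemma has_derivative_at_lebesgue_point:
  fixes u :: "real ^ 'm::finite \<Rightarrow> real ^ 'm"
  assumes U: "open U" and wj: "weak_jacobian U u A" and cont: "continuous_on U u"
    and B: "AE x in lebesgue_on U. norm (A x) \<le> B" and x: "x \<in> U"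
    and leb: "\<And>e. e > 0 \<Longrightarrow> \<exists>R>0. \<forall>r. 0 < r \<and> r < R \<longrightarrow>
      (LINT w|lebesgue_on U. indicator (cbox (x - r *\<^sub>R 1) (x + r *\<^sub>R 1)) w * norm (A w - A x)) \<le> e * r ^ CARD('m)"
  shows "(u has_derivative (\<lambda>h. A x *v h)) (at x)"
proof -
  define m where "m = real CARD('m)"
  have m: "m \<ge> 1" unfolding m_def by (simp add: Suc_le_eq)
  define v where "v w = u w - A x *v w" for w
  have wv: "weak_jacobian U v (\<lambda>w. A w - A x)"
    unfolding v_def
    by (rule weak_jacobian_diff[OF U wj weak_jacobian_C1[OF U]])
      (auto intro!: bounded_linear_imp_has_derivative matrix_vector_mul_bounded_linear)
  have cv: "continuous_on U v"
    unfolding v_def by (intro continuous_on_diff cont matrix_vector_mult_linear_continuous_on)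
  define B' where "B' = B + norm (A x)"
  have Bv: "AE w in lebesgue_on U. norm (A w - A x) \<le> B'"
    using B by (rule eventually_mono) (use norm_triangle_ineq4 in \<open>fastforce simp: B'_def intro: order.trans\<close>)
  define L where "L = \<bar>(2 * exp 4) ^ CARD('m) * B'\<bar> + 1"
  have L: "L > 0" unfolding L_def by linarith
  obtain r0 where r0: "r0 > 0" "cbox (x - (2 * r0) *\<^sub>R 1) (x + (2 * r0) *\<^sub>R 1) \<subseteq> U"
  proof -
    obtain e where e: "e > 0" "ball x e \<subseteq> U" using U x by (meson open_contains_ball)
    have "cbox (x - (2 * (e / (4 * m))) *\<^sub>R 1) (x + (2 * (e / (4 * m))) *\<^sub>R 1) \<subseteq> ball x e"
    proof
      fix w assume "w \<in> cbox (x - (2 * (e / (4 * m))) *\<^sub>R 1) (x + (2 * (e / (4 * m))) *\<^sub>R 1)"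
      from cube_sum_bound[OF this] have "(\<Sum>k\<in>UNIV. \<bar>(w - x) $ k\<bar>) \<le> m * (2 * (e / (4 * m)))"
        by (simp add: m_def)
      moreover have "m * (2 * (e / (4 * m))) = e / 2" using m by simp
      ultimately have "dist w x \<le> e / 2" using norm_le_l1_cart[of "w - x"] by (simp add: dist_norm)
      then show "w \<in> ball x e" using e(1) by (simp add: dist_commute)
    qed
    then show thesis using that[of "e / (4 * m)"] e m by auto
  qed
  have lip: "\<bar>v z $ i - v y $ i\<bar> \<le> L * (\<Sum>k\<in>UNIV. \<bar>z $ k - y $ k\<bar>)"
    if "y \<in> cbox (x - r0 *\<^sub>R 1) (x + r0 *\<^sub>R 1)" "z \<in> cbox (x - r0 *\<^sub>R 1) (x + r0 *\<^sub>R 1)" for y z i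
  proof -
    have "\<bar>v z $ i - v y $ i\<bar> \<le> (\<Sum>k\<in>UNIV. (2 * exp 4) ^ CARD('m) * B' * \<bar>z $ k - y $ k\<bar>)"
      by (rule lipschitz_in_cube[OF U wv cv Bv r0 that])
    also have "\<dots> \<le> (\<Sum>k\<in>UNIV. L * \<bar>z $ k - y $ k\<bar>)"
      by (intro sum_mono mult_right_mono) (auto simp: L_def)
    finally show ?thesis by (simp only: sum_distrib_left)
  qed
  have key: "\<exists>d>0. \<forall>h. norm h < d \<longrightarrow> norm (v (x + h) - v x) \<le> \<epsilon> * norm h" if \<epsilon>: "\<epsilon> > 0" for \<epsilon>
  proof -
    \<comment> \<open>The order of choices matters: \<tau> depends on \<epsilon> and the Lipschitz
      constant and gives half of the error to the oscillation; \<open>K\<close>, the factor by which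
      the mean is amplified, blows up for small \<tau>; only then is \<open>e\<close> fixed.\<close>
    define \<tau> where "\<tau> = min 1 (\<epsilon> / (4 * L * m * m\<^sup>2))"
    have \<tau>: "\<tau> > 0" "\<tau> \<le> 1" "2 * (L * (m * \<tau>)) \<le> \<epsilon> / (2 * m\<^sup>2)"
    proof -
      show "\<tau> > 0" "\<tau> \<le> 1" using \<epsilon> L m by (auto simp: \<tau>_def)
      have "\<tau> \<le> \<epsilon> / (4 * L * m * m\<^sup>2)" by (simp add: \<tau>_def)
      then have "(2 * L * m) * \<tau> \<le> (2 * L * m) * (\<epsilon> / (4 * L * m * m\<^sup>2))"
        using L m by (intro mult_left_mono) auto
      also have "\<dots> = \<epsilon> / (2 * m\<^sup>2)" using L m by (simp add: field_simps)
      finally show "2 * (L * (m * \<tau>)) \<le> \<epsilon> / (2 * m\<^sup>2)" by (simp add: mult_ac)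
    qed
    define K where "K = 2 * \<tau> / (exp (-4) * \<tau>) ^ CARD('m) * 2 ^ CARD('m)"
    have K: "K > 0" using \<tau>(1) by (simp add: K_def)
    define e where "e = \<epsilon> / (2 * m\<^sup>2 * K)"
    have e: "e > 0" "K * e = \<epsilon> / (2 * m\<^sup>2)" using \<epsilon> m K by (auto simp: e_def)
    obtain R where R: "R > 0" "\<And>r. 0 < r \<Longrightarrow> r < R \<Longrightarrow>
      (LINT w|lebesgue_on U. indicator (cbox (x - r *\<^sub>R 1) (x + r *\<^sub>R 1)) w * norm (A w - A x)) \<le> e * r ^ CARD('m)"
      using leb[OF e(1)] by blast
    define d where "d = min (R / 2) (r0 / 2)"
    have d: "d > 0" using R r0 by (simp add: d_def)
    have "norm (v (x + h) - v x) \<le> \<epsilon> * norm h" if h: "norm h < d" for h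
    proof (cases "h = 0")
      case False
      define \<rho> where "\<rho> = norm h"
      have \<rho>: "\<rho> > 0" "2 * \<rho> < R" "2 * \<rho> < r0" using False h by (auto simp: \<rho>_def d_def)
      define \<delta> where "\<delta> = \<tau> * \<rho>"
      have \<delta>: "\<delta> > 0" "\<delta> \<le> \<rho>" using \<tau> \<rho> by (auto simp: \<delta>_def mult_left_le_one_le)
      let ?Q = "\<lambda>r. cbox (x - r *\<^sub>R 1) (x + r *\<^sub>R 1)"
      have Qmono: "?Q s \<subseteq> ?Q t" if "s \<le> t" for s t
      proof
        fix w assume w: "w \<in> ?Q s"
        have "x $ l - t \<le> w $ l \<and> w $ l \<le> x $ l + t" for l
        proof -
          have "x $ l - s \<le> w $ l \<and> w $ l \<le> x $ l + s" using w by (simp add: mem_box_cart)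
          then show ?thesis using that by linarith
        qed
        then show "w \<in> ?Q t" by (simp add: mem_box_cart)
      qed
      have QU: "?Q (2 * \<rho>) \<subseteq> U" using Qmono[of "2 * \<rho>" "2 * r0"] \<rho>(3) r0 by auto
      have Qr0: "?Q (2 * \<rho>) \<subseteq> ?Q r0" using Qmono[of "2 * \<rho>" r0] \<rho>(3) by auto
      have cubes: "cbox (y - \<delta> *\<^sub>R 1) (y + \<delta> *\<^sub>R 1) \<subseteq> ?Q (2 * \<rho>)" if y: "y \<in> ?Q \<rho>" for y
      proof
        fix w assume w: "w \<in> cbox (y - \<delta> *\<^sub>R 1) (y + \<delta> *\<^sub>R 1)"
        have "x $ l - 2 * \<rho> \<le> w $ l \<and> w $ l \<le> x $ l + 2 * \<rho>" for l
        proof -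
          have "y $ l - \<delta> \<le> w $ l \<and> w $ l \<le> y $ l + \<delta>" "x $ l - \<rho> \<le> y $ l \<and> y $ l \<le> x $ l + \<rho>"
            using w y by (simp_all add: mem_box_cart)
          then show ?thesis using \<delta>(2) by linarith
        qed
        then show "w \<in> ?Q (2 * \<rho>)" by (simp add: mem_box_cart)
      qed
      have osc: "\<bar>v w $ i - v y $ i\<bar> \<le> L * (m * \<delta>)" if y: "y \<in> ?Q \<rho>" and w: "w \<in> cbox (y - \<delta> *\<^sub>R 1) (y + \<delta> *\<^sub>R 1)" for w y i
      proof -
        have "y \<in> ?Q r0" using y Qmono[of \<rho> r0] \<rho> by auto
        moreover have "w \<in> ?Q r0" using cubes[OF y] Qr0 w by blast
        ultimately have "\<bar>v w $ i - v y $ i\<bar> \<le> L * (\<Sum>k\<in>UNIV. \<bar>w $ k - y $ k\<bar>)" by (rule lip)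
        also have "\<dots> \<le> L * (m * \<delta>)"
          unfolding m_def using L by (intro mult_left_mono cube_sum_bound[OF w]) auto
        finally show ?thesis .
      qed
      have inc0: "\<bar>v (y + t *\<^sub>R axis k 1) $ i - v y $ i\<bar> \<le> \<epsilon> / m\<^sup>2 * \<rho>"
        if t: "t \<ge> 0" and y: "y \<in> ?Q \<rho>" and y': "y + t *\<^sub>R axis k 1 \<in> ?Q \<rho>" for y t k i
      proof -
        have sub: "tube \<delta> y k t \<subseteq> ?Q (2 * \<rho>)"
        proof
          fix w assume w: "w \<in> tube \<delta> y k t"
          have "x $ l - 2 * \<rho> \<le> w $ l \<and> w $ l \<le> x $ l + 2 * \<rho>" for l
          proof -
            have "x $ l - \<rho> \<le> y $ l" "y $ l \<le> x $ l + \<rho>" using y by (simp_all add: mem_box_cart)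
            moreover have "y $ l + (if l = k then t else 0) \<le> x $ l + \<rho>"
              using y'[unfolded mem_box_cart, rule_format, of l] by (simp add: axis_def split: if_splits)
            moreover have "y $ l - \<delta> \<le> w $ l \<and> w $ l \<le> y $ l + \<delta> + (if l = k then t else 0)"
              using w unfolding mem_tube by blast
            ultimately show ?thesis using \<delta>(2) by linarith
          qed
          then show "w \<in> ?Q (2 * \<rho>)" by (simp add: mem_box_cart)
        qed
        let ?J = "LINT w|lebesgue_on U. indicator (tube \<delta> y k t) w * \<bar>(A w - A x) $ i $ k\<bar>"
        have est: "\<bar>v (y + t *\<^sub>R axis k 1) $ i - v y $ i\<bar> \<le> 2 * (L * (m * \<delta>)) + 2 * \<delta> / (exp (-4) * \<delta>) ^ CARD('m) * ?J"
          by (rule increment_estimate[OF U wv cv \<delta>(1) t order.trans[OF sub QU] osc[OF y] osc[OF y']])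
        have li: "locally_integrable U (\<lambda>w. A w - A x)" by (rule weak_jacobianD(2)[OF wv])
        have J: "?J \<le> e * (2 * \<rho>) ^ CARD('m)"
        proof -
          have ct: "compact (tube \<delta> y k t)" unfolding tube_def by (rule compact_cbox)
          have tU: "tube \<delta> y k t \<subseteq> U" using sub QU by blast
          have i1: "integrable (lebesgue_on U) (\<lambda>w. indicator (tube \<delta> y k t) w * \<bar>(A w - A x) $ i $ k\<bar>)"
            using locally_integrable_nth[OF locally_integrable_nth[OF li]] ct tU unfolding locally_integrable_def
            by (intro integrable_indicator_abs[OF U tU]) blast
          have "(\<lambda>w. A w - A x) absolutely_integrable_on ?Q (2 * \<rho>)"
            using li QU unfolding locally_integrable_def by (meson compact_cbox)
          then have "(\<lambda>w. norm (A w - A x)) absolutely_integrable_on ?Q (2 * \<rho>)"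
            by (rule absolutely_integrable_norm[unfolded comp_def])
          from integrable_indicator_abs[OF U QU this]
          have i2: "integrable (lebesgue_on U) (\<lambda>w. indicator (?Q (2 * \<rho>)) w * norm (A w - A x))" by simp
          have "?J \<le> (LINT w|lebesgue_on U. indicator (?Q (2 * \<rho>)) w * norm (A w - A x))"
          proof (rule integral_mono[OF i1 i2])
            fix w
            have "\<bar>(A w - A x) $ i $ k\<bar> \<le> norm (A w - A x)"
              using component_le_norm_cart[of "(A w - A x) $ i" k] Finite_Cartesian_Product.norm_nth_le[of "A w - A x" i] by linarith
            then show "indicator (tube \<delta> y k t) w * \<bar>(A w - A x) $ i $ k\<bar> \<le> indicator (?Q (2 * \<rho>)) w * norm (A w - A x)"
              using sub by (intro mult_mono) (auto simp: indicator_def)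
          qed
          also have "\<dots> \<le> e * (2 * \<rho>) ^ CARD('m)" by (rule R(2)) (use \<rho> in auto)
          finally show ?thesis .
        qed
        have "2 * \<delta> / (exp (-4) * \<delta>) ^ CARD('m) * ?J \<le> 2 * \<delta> / (exp (-4) * \<delta>) ^ CARD('m) * (e * (2 * \<rho>) ^ CARD('m))"
          using J \<delta>(1) by (intro mult_left_mono) auto
        also have "\<dots> = K * e * \<rho>"
        proof -
          have "\<rho> ^ CARD('m) \<noteq> 0" using \<rho>(1) by simp
          then show ?thesis unfolding K_def \<delta>_def by (simp add: power_mult_distrib field_simps)
        qed
        also have "\<dots> = \<epsilon> / (2 * m\<^sup>2) * \<rho>" by (simp only: e(2))
        finally have 1: "2 * \<delta> / (exp (-4) * \<delta>) ^ CARD('m) * ?J \<le> \<epsilon> / (2 * m\<^sup>2) * \<rho>" .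
        have "2 * (L * (m * \<delta>)) = 2 * (L * (m * \<tau>)) * \<rho>" by (simp add: \<delta>_def)
        also have "\<dots> \<le> \<epsilon> / (2 * m\<^sup>2) * \<rho>" using \<tau>(3) \<rho>(1) by (intro mult_right_mono) auto
        finally have 2: "2 * (L * (m * \<delta>)) \<le> \<epsilon> / (2 * m\<^sup>2) * \<rho>" .
        have "\<epsilon> / m\<^sup>2 * \<rho> = \<epsilon> / (2 * m\<^sup>2) * \<rho> + \<epsilon> / (2 * m\<^sup>2) * \<rho>" by simp
        with est 1 2 show ?thesis by linarith
      qed
      have inc: "\<bar>v (y + s *\<^sub>R axis k 1) $ i - v y $ i\<bar> \<le> \<epsilon> / m\<^sup>2 * \<rho>"
        if y: "y \<in> ?Q \<rho>" and y': "y + s *\<^sub>R axis k 1 \<in> ?Q \<rho>" for y s k i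
      proof (cases "s \<ge> 0")
        case True
        show ?thesis by (rule inc0[OF True y y'])
      next
        case False
        let ?y = "y + s *\<^sub>R axis k 1"
        have eq: "?y + (- s) *\<^sub>R axis k 1 = y" by simp
        have "\<bar>v (?y + (- s) *\<^sub>R axis k 1) $ i - v ?y $ i\<bar> \<le> \<epsilon> / m\<^sup>2 * \<rho>"
        proof (rule inc0[OF _ y'])
          show "0 \<le> - s" using False by simp
          show "?y + (- s) *\<^sub>R axis k 1 \<in> ?Q \<rho>" unfolding eq by (rule y)
        qed
        then show ?thesis unfolding eq by (simp only: abs_minus_commute)
      qed
      have xq: "x \<in> ?Q \<rho>" "x + h \<in> ?Q \<rho>"
      proof -
        show "x \<in> ?Q \<rho>" using \<rho>(1) by (simp add: mem_box_cart)
        have "- \<rho> \<le> h $ l \<and> h $ l \<le> \<rho>" for l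
          using component_le_norm_cart[of h l] unfolding \<rho>_def by linarith
        then have "x $ l - \<rho> \<le> x $ l + h $ l \<and> x $ l + h $ l \<le> x $ l + \<rho>" for l
          by (metis add_left_mono diff_conv_add_uminus)
        then show "x + h \<in> ?Q \<rho>" by (simp add: mem_box_cart)
      qed
      \<comment> \<open>A path of \<open>m\<close> coordinate steps leads to \<open>x + h\<close>,
        and the norm sums \<open>m\<close> components: this is why a single step was estimated with
        \<open>\<epsilon>\<close> divided by \<open>m\<close> twice.\<close>
      have comp: "\<bar>v (x + h) $ i - v x $ i\<bar> \<le> \<epsilon> / m * \<rho>" for i
      proof -
        have "\<bar>v (x + h) $ i - v x $ i\<bar> \<le> (\<Sum>k\<in>(UNIV :: 'm set). \<epsilon> / m\<^sup>2 * \<rho>)"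
        proof (rule coordinate_chain[where f = "\<lambda>w. v w $ i"])
          fix I k assume k: "k \<notin> (I :: 'm set)"
          note q = path_point_in_cube[OF xq, of I] path_point_in_cube[OF xq, of "insert k I"]
          show "\<bar>v (\<chi> l. if l \<in> insert k I then (x + h) $ l else x $ l) $ i - v (\<chi> l. if l \<in> I then (x + h) $ l else x $ l) $ i\<bar>
              \<le> \<epsilon> / m\<^sup>2 * \<rho>"
            unfolding path_point_step[OF k] by (rule inc[OF q(1) q(2)[unfolded path_point_step[OF k]]])
        qed
        also have "\<dots> = m * (\<epsilon> / m\<^sup>2 * \<rho>)" by (simp add: m_def)
        also have "\<dots> = \<epsilon> / m * \<rho>" using m by (simp add: power2_eq_square)
        finally show ?thesis .
      qed
      have "norm (v (x + h) - v x) \<le> (\<Sum>i\<in>UNIV. \<bar>(v (x + h) - v x) $ i\<bar>)" by (rule norm_le_l1_cart)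
      also have "\<dots> \<le> (\<Sum>i\<in>(UNIV :: 'm set). \<epsilon> / m * \<rho>)" by (rule sum_mono) (use comp in simp)
      also have "\<dots> = \<epsilon> * \<rho>" using m by (simp add: m_def)
      finally show ?thesis by (simp add: \<rho>_def)
    qed simp
    then show ?thesis using d by blast
  qed
  have split: "u y - u x - A x *v (y - x) = v (x + (y - x)) - v x" for y
    by (simp add: v_def matrix_vector_mult_diff_distrib)
  show ?thesis
    unfolding has_derivative_within_alt
  proof (intro conjI allI impI)
    show "bounded_linear ((*v) (A x))" by (rule matrix_vector_mul_bounded_linear)
    fix \<epsilon> :: real assume "\<epsilon> > 0"
    from key[OF this] obtain d where d: "d > 0" "\<And>h. norm h < d \<Longrightarrow> norm (v (x + h) - v x) \<le> \<epsilon> * norm h" by blast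
    show "\<exists>d>0. \<forall>y\<in>UNIV. norm (y - x) < d \<longrightarrow> norm (u y - u x - A x *v (y - x)) \<le> \<epsilon> * norm (y - x)"
      unfolding split by (intro exI[of _ d] conjI ballI impI d)
  qed
qed

text \<open>Vitali covering selects disjoint balls of the given kind inside an open \<open>V\<close>
  containing \<open>E\<close>. Their total volume is at most \<open>C\<close> times the volume of
  \<open>V - E\<close>, which is as small as desired. This is the Lebesgue density theorem with a
  fixed threshold \<open>1 / C\<close>.\<close>

lemma negligible_low_density:
  fixes E :: "'a::euclidean_space set" and C :: real
  assumes E: "E \<in> sets lebesgue" and C: "C > 0"
  shows "negligible {x \<in> E. \<forall>R>0. \<exists>r. 0 < r \<and> r < R \<and>
     emeasure lebesgue (ball x r) \<le> ennreal C * emeasure lebesgue (ball x r - E)}" (is "negligible ?N")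
  unfolding negligible_outer_le
proof (intro allI impI)
  fix e :: real assume e: "e > 0"
  obtain V where V: "open V" "E \<subseteq> V" "emeasure lebesgue (V - E) < ennreal (e / C)"
  proof -
    have "e / C > 0" using e C by simp
    from sets_lebesgue_outer_open[OF E this] show thesis using that by blast
  qed
  have mV: "V \<in> sets lebesgue" using V(1) by (simp add: borel_open lborelD)
  define K where "K = {p. 0 < snd p \<and> ball (fst p) (snd p) \<subseteq> V \<and>
     emeasure lebesgue (ball (fst p) (snd p)) \<le> ennreal C * emeasure lebesgue (ball (fst p) (snd p) - E)}"
  have cov: "\<exists>p. p \<in> K \<and> x \<in> ball (fst p) (snd p) \<and> snd p < d" if x: "x \<in> ?N" and d: "0 < d" for x d
  proof -
    have "x \<in> V" using x V(2) by blast
    then obtain s where s: "s > 0" "ball x s \<subseteq> V" using V(1) by (meson open_contains_ball)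
    have "min s d > 0" using s d by simp
    with x obtain r where r: "0 < r" "r < min s d"
      "emeasure lebesgue (ball x r) \<le> ennreal C * emeasure lebesgue (ball x r - E)" by blast
    have "ball x r \<subseteq> V" using subset_ball[of r s x] r(2) s(2) by auto
    then have "(x, r) \<in> K" using r by (simp add: K_def)
    then show ?thesis using r by (intro exI[of _ "(x, r)"]) auto
  qed
  obtain D where D: "countable D" "D \<subseteq> K"
    "pairwise (\<lambda>p q. disjnt (ball (fst p) (snd p)) (ball (fst q) (snd q))) D"
    "negligible (?N - (\<Union>p\<in>D. ball (fst p) (snd p)))"
    by (rule Vitali_covering_theorem_balls[of ?N K fst snd, OF cov]) blast+
  let ?B = "\<lambda>p :: 'a \<times> real. ball (fst p) (snd p)"
  have mB: "?B p \<in> sets lebesgue" for p by (simp add: borel_open lborelD)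
  have dj: "disjoint_family_on ?B D"
    using D(3) unfolding disjoint_family_on_def pairwise_def disjnt_def by blast
  have dj': "disjoint_family_on (\<lambda>p. ?B p - E) D"
    using dj unfolding disjoint_family_on_def by blast
  have "emeasure lebesgue (\<Union>p\<in>D. ?B p) = (\<integral>\<^sup>+p. emeasure lebesgue (?B p) \<partial>count_space D)"
    by (rule emeasure_UN_countable[OF mB D(1) dj])
  also have "\<dots> \<le> (\<integral>\<^sup>+p. ennreal C * emeasure lebesgue (?B p - E) \<partial>count_space D)"
    by (rule nn_integral_mono) (use D(2) in \<open>auto simp: K_def\<close>)
  also have "\<dots> = ennreal C * (\<integral>\<^sup>+p. emeasure lebesgue (?B p - E) \<partial>count_space D)"
    by (rule nn_integral_cmult) simp
  also have "(\<integral>\<^sup>+p. emeasure lebesgue (?B p - E) \<partial>count_space D) = emeasure lebesgue (\<Union>p\<in>D. ?B p - E)"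
    by (rule emeasure_UN_countable[symmetric]) (use mB E D(1) dj' in auto)
  also have "\<dots> \<le> emeasure lebesgue (V - E)"
    by (rule emeasure_mono) (use D(2) mV E in \<open>auto simp: K_def\<close>)
  also have "\<dots> \<le> ennreal (e / C)" using V(3) by simp
  finally have le: "emeasure lebesgue (\<Union>p\<in>D. ?B p) \<le> ennreal e"
    using C e by (simp add: mult_left_mono ennreal_mult[symmetric])
  have mU: "(\<Union>p\<in>D. ?B p) \<in> sets lebesgue" using mB D(1) by blast
  have lm: "(\<Union>p\<in>D. ?B p) \<in> lmeasurable"
    by (rule fmeasurableI[OF mU]) (use order_le_less_trans[OF le ennreal_less_top] in \<open>simp only: infinity_ennreal_def\<close>)
  show "\<exists>T. ?N \<subseteq> T \<and> T \<in> lmeasurable \<and> measure lebesgue T \<le> e"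
  proof (intro exI conjI)
    let ?T = "(\<Union>p\<in>D. ?B p) \<union> (?N - (\<Union>p\<in>D. ?B p))"
    show "?N \<subseteq> ?T" by blast
    have n: "?N - (\<Union>p\<in>D. ?B p) \<in> lmeasurable" "measure lebesgue (?N - (\<Union>p\<in>D. ?B p)) = 0"
      using negligible_imp_measurable[OF D(4)] negligible_imp_measure0[OF D(4)] by auto
    show "?T \<in> lmeasurable" using lm n(1) by (rule fmeasurable.Un)
    have "measure lebesgue ?T \<le> measure lebesgue (\<Union>p\<in>D. ?B p) + 0"
      using measure_Un_le[of "\<Union>p\<in>D. ?B p" lebesgue "?N - (\<Union>p\<in>D. ?B p)"] mU n fmeasurableD by auto
    also have "\<dots> \<le> e" using le lm e by (simp add: emeasure_eq_measure2)
    finally show "measure lebesgue ?T \<le> e" .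
  qed
qed

lemma AE_lebesgue_iff_negligible: "(AE x in lebesgue. P x) \<longleftrightarrow> negligible {x. \<not> P x}"
  by (simp add: eventually_ae_filter_negligible) (metis (mono_tags, lifting) mem_Collect_eq negligible_subset subsetI)

lemma AE_lebesgue_on_iff_negligible:
  assumes "U \<in> sets lebesgue"
  shows "(AE x in lebesgue_on U. P x) \<longleftrightarrow> negligible {x \<in> U. \<not> P x}"
proof -
  have "(AE x in lebesgue_on U. P x) \<longleftrightarrow> (AE x in lebesgue. x \<in> U \<longrightarrow> P x)"
    using assms by (subst AE_restrict_space_iff) auto
  then show ?thesis by (simp add: AE_lebesgue_iff_negligible)
qed

text \<open>Countably many level sets \<open>E n d\<close> localize the values of \<open>A\<close>,
  which reduces the claim to densities of sets: on \<open>E n d\<close> the difference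
  \<open>A w - A x\<close> is at most \<open>2 / Suc n\<close>, and on the rest, of proportion at
  most \<open>1 / Suc k\<close> in small balls, it is at most \<open>2 * B\<close>.\<close>

lemma lebesgue_points_AE:
  fixes A :: "real ^ 'm::finite \<Rightarrow> 'b::euclidean_space"
  assumes U: "open U" "bounded U" and mA: "A \<in> borel_measurable (lebesgue_on U)"
    and B: "AE x in lebesgue_on U. norm (A x) \<le> B"
  shows "AE x in lebesgue_on U. \<forall>e>0. \<exists>R>0. \<forall>r. 0 < r \<and> r < R \<longrightarrow>
      (LINT w|lebesgue_on U. indicator (cbox (x - r *\<^sub>R 1) (x + r *\<^sub>R 1)) w * norm (A w - A x)) \<le> e * r ^ CARD('m)"
proof -
  have sU: "U \<in> sets lebesgue" by (rule open_sets_lebesgue[OF U(1)])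
  obtain D :: "'b set" where D: "countable D" "\<And>X. open X \<Longrightarrow> X \<noteq> {} \<Longrightarrow> \<exists>d\<in>D. d \<in> X"
    by (rule countable_dense_setE) blast
  define E where "E n d = {x \<in> U. norm (A x - d) < 1 / Suc n}" for n :: nat and d
  have mE: "E n d \<in> sets lebesgue" for n d
  proof -
    have "(\<lambda>x. norm (A x - d)) \<in> borel_measurable (lebesgue_on U)" using mA by simp
    then have "{x \<in> space (lebesgue_on U). norm (A x - d) < 1 / Suc n} \<in> sets (lebesgue_on U)"
      by (intro borel_measurable_less) auto
    then show ?thesis
      using sU by (simp add: E_def sets_restrict_space_iff space_restrict_space)
  qed
  define N where "N n d k = {x \<in> E n d. \<forall>R>0. \<exists>r. 0 < r \<and> r < R \<and>
     emeasure lebesgue (ball x r) \<le> ennreal (Suc k) * emeasure lebesgue (ball x r - E n d)}" for n d and k :: nat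
  define Z where "Z = {x \<in> U. \<not> norm (A x) \<le> B} \<union> (\<Union>n. \<Union>k. \<Union>d\<in>D. N n d k)"
  have "negligible (N n d k)" for n d k
    unfolding N_def by (rule negligible_low_density[OF mE]) simp
  then have negN: "negligible (\<Union>n. \<Union>k. \<Union>d\<in>D. N n d k)"
    using D(1) by (intro negligible_Union_nat negligible_countable_Union) auto
  have negB: "negligible {x \<in> U. \<not> norm (A x) \<le> B}"
    using B unfolding AE_lebesgue_on_iff_negligible[OF sU] .
  have negZ: "negligible Z" unfolding Z_def by (rule negligible_Un[OF negB negN])
  define \<omega> where "\<omega> = unit_ball_vol (real CARD('m))"
  have \<omega>: "\<omega> > 0" by (simp add: \<omega>_def)
  define m where "m = real CARD('m)"
  have m: "m \<ge> 1" unfolding m_def by (simp add: Suc_le_eq)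
  have ballm: "measure lebesgue (ball x \<rho>) = \<omega> * \<rho> ^ CARD('m)" if "\<rho> \<ge> 0" for x :: "real ^ 'm" and \<rho>
    using content_ball[OF that, of x] by (simp add: \<omega>_def)
  have good: "\<exists>R>0. \<forall>r. 0 < r \<and> r < R \<longrightarrow>
      (LINT w|lebesgue_on U. indicator (cbox (x - r *\<^sub>R 1) (x + r *\<^sub>R 1)) w * norm (A w - A x)) \<le> e * r ^ CARD('m)"
    if x: "x \<in> U" "x \<notin> Z" and e: "e > 0" for x e
  proof -
    have Bx: "norm (A x) \<le> B" using x by (simp add: Z_def)
    then have B0: "B \<ge> 0" using norm_ge_zero order.trans by blast
    \<comment> \<open>The cube of half side \<open>r\<close> lies in the ball of radius
      \<open>2 * m * r\<close>, whose volume is \<mu> times the power of \<open>r\<close>. The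
      choices of \<open>n\<close> and \<open>k\<close> then give half of \<open>e\<close> to each of
      the two errors.\<close>
    define \<mu> where "\<mu> = \<omega> * (2 * m) ^ CARD('m)"
    have \<mu>: "\<mu> > 0" using \<omega> m by (simp add: \<mu>_def)
    obtain n :: nat where n: "2 / Suc n * \<mu> \<le> e / 2"
    proof -
      obtain n :: nat where "4 * \<mu> / e < n" using reals_Archimedean2 by blast
      then have "4 * \<mu> \<le> e * real (Suc n)" using e by (simp add: field_simps)
      then have "2 / Suc n * \<mu> \<le> e / 2" by (simp add: field_simps)
      then show thesis by (rule that)
    qed
    obtain k :: nat where k: "2 * B / Suc k * \<mu> \<le> e / 2"
    proof -
      obtain k :: nat where "4 * B * \<mu> / e < k" using reals_Archimedean2 by blast
      then have "4 * B * \<mu> \<le> e * real (Suc k)" using e by (simp add: field_simps)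
      then have "2 * B / Suc k * \<mu> \<le> e / 2" by (simp add: field_simps)
      then show thesis by (rule that)
    qed
    have "ball (A x) (1 / Suc n) \<noteq> {}" by simp
    from D(2)[OF open_ball this] obtain d where d: "d \<in> D" "norm (A x - d) < 1 / Suc n"
      by (auto simp: dist_norm)
    let ?E = "E n d"
    have "x \<notin> N n d k" using x d(1) by (auto simp: Z_def)
    moreover have xE: "x \<in> ?E" using x d by (simp add: E_def)
    ultimately obtain R where R: "R > 0" "\<And>r. 0 < r \<Longrightarrow> r < R \<Longrightarrow>
        ennreal (Suc k) * emeasure lebesgue (ball x r - ?E) < emeasure lebesgue (ball x r)"
      unfolding N_def by (auto simp: not_le)
    obtain R' where R': "R' > 0" "ball x R' \<subseteq> U" using U(1) x(1) by (meson open_contains_ball)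
    show ?thesis
    proof (intro exI[of _ "min R R' / (2 * m)"] conjI allI impI)
      show "min R R' / (2 * m) > 0" using R R' m by simp
      fix r assume r: "0 < r \<and> r < min R R' / (2 * m)"
      define \<rho> where "\<rho> = 2 * m * r"
      have \<rho>: "\<rho> > 0" "\<rho> < R" "\<rho> < R'" using r m by (auto simp: \<rho>_def field_simps)
      let ?Q = "cbox (x - r *\<^sub>R 1) (x + r *\<^sub>R 1)" and ?ball = "ball x \<rho>"
      have QB: "?Q \<subseteq> ?ball"
      proof
        fix w assume "w \<in> ?Q"
        from cube_sum_bound[OF this] have "(\<Sum>k\<in>UNIV. \<bar>(w - x) $ k\<bar>) \<le> m * r" by (simp add: m_def)
        then have "dist w x \<le> m * r" using norm_le_l1_cart[of "w - x"] by (simp add: dist_norm)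
        also have "m * r < \<rho>" using r m by (simp add: \<rho>_def)
        finally show "w \<in> ?ball" by (simp add: dist_commute)
      qed
      have BU: "?ball \<subseteq> U" using subset_ball[of \<rho> R' x] \<rho>(3) R'(2) by auto
      have lmb: "?ball \<in> lmeasurable" by (rule lmeasurable_ball)
      have lmd: "?ball - ?E \<in> lmeasurable" using fmeasurable_Diff[OF lmb mE] .
      have dm: "real (Suc k) * measure lebesgue (?ball - ?E) \<le> measure lebesgue ?ball"
      proof -
        have "ennreal (Suc k) * ennreal (measure lebesgue (?ball - ?E)) \<le> ennreal (measure lebesgue ?ball)"
          using R(2)[OF \<rho>(1,2)] lmb lmd by (simp add: emeasure_eq_measure2 less_imp_le)
        then have "ennreal (real (Suc k) * measure lebesgue (?ball - ?E)) \<le> ennreal (measure lebesgue ?ball)"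
          by (subst ennreal_mult) auto
        then show ?thesis by (subst (asm) ennreal_le_iff) auto
      qed
      have ind: "integrable (lebesgue_on U) (indicator S :: _ \<Rightarrow> real)"
        "(LINT w|lebesgue_on U. indicator S w :: real) = measure lebesgue S"
        if S: "S \<in> lmeasurable" "S \<subseteq> U" for S
      proof -
        have eq: "(\<lambda>w. indicator U w *\<^sub>R indicator S w) = (indicator S :: _ \<Rightarrow> real)"
          using S(2) by (auto simp: fun_eq_iff indicator_def)
        have "integrable lebesgue (indicator S :: _ \<Rightarrow> real)"
          using S(1) by (intro integrable_real_indicator) (auto simp: fmeasurable_def)
        then show "integrable (lebesgue_on U) (indicator S :: _ \<Rightarrow> real)"
          using sU by (subst integrable_restrict_space) (simp_all add: eq del: real_scaleR_def)
        have "(LINT w|lebesgue_on U. indicator S w :: real) = (LINT w|lebesgue. indicator U w *\<^sub>R indicator S w)"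
          using sU by (subst integral_restrict_space) simp_all
        then show "(LINT w|lebesgue_on U. indicator S w :: real) = measure lebesgue S"
          unfolding eq using S(1) fmeasurableD by simp
      qed
      note ib = ind[OF lmb BU] and id = ind[OF lmd, OF order.trans[OF Diff_subset BU]]
      let ?g = "\<lambda>w. 2 / Suc n * indicator ?ball w + 2 * B * indicator (?ball - ?E) w :: real"
      have ig: "integrable (lebesgue_on U) ?g"
        by (intro Bochner_Integration.integrable_add integrable_mult_right ib(1) id(1))
      have ae: "AE w in lebesgue_on U. indicator ?Q w * norm (A w - A x) \<le> ?g w"
        using B
      proof (rule eventually_mono)
        fix w assume w: "norm (A w) \<le> B"
        show "indicator ?Q w * norm (A w - A x) \<le> ?g w"
        proof (cases "w \<in> ?Q")
          case wQ: True
          then have wb: "w \<in> ?ball" using QB by blast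
          show ?thesis
          proof (cases "w \<in> ?E")
            case True
            then have "norm (A w - d) < 1 / Suc n" by (simp add: E_def)
            then have "norm (A w - A x) \<le> 2 / Suc n"
              using d(2) norm_triangle_ineq4[of "A w - d" "A x - d"] by simp
            then show ?thesis using wb B0 by (simp add: indicator_def)
          next
            case False
            have "norm (A w - A x) \<le> 2 * B" using norm_triangle_ineq4[of "A w" "A x"] w Bx by linarith
            moreover have "0 \<le> 2 / real (Suc n)" by simp
            moreover have gw: "?g w = 2 / Suc n + 2 * B" and qw: "indicator ?Q w = (1::real)" using wb False wQ by simp_all
            ultimately show ?thesis unfolding gw qw by linarith
          qed
        next
          case False
          have "0 \<le> ?g w" using B0 by (intro add_nonneg_nonneg mult_nonneg_nonneg) auto
          then show ?thesis using False by simp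
        qed
      qed
      have "(LINT w|lebesgue_on U. indicator ?Q w * norm (A w - A x)) \<le> (LINT w|lebesgue_on U. ?g w)"
      proof (rule integral_mono_AE[OF _ ig ae])
        show "integrable (lebesgue_on U) (\<lambda>w. indicator ?Q w * norm (A w - A x))"
        proof (rule Bochner_Integration.integrable_bound[OF ig])
          have "indicator ?Q \<in> borel_measurable (lebesgue_on U)"
            by (intro measurable_restrict_space1 borel_measurable_indicator) (simp add: lborelD)
          then show "(\<lambda>w. indicator ?Q w * norm (A w - A x)) \<in> borel_measurable (lebesgue_on U)"
            using mA by (intro borel_measurable_times borel_measurable_norm borel_measurable_diff) auto
          show "AE w in lebesgue_on U. norm (indicator ?Q w * norm (A w - A x)) \<le> norm (?g w)"
            using ae by (rule eventually_mono) (simp add: abs_mult)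
        qed
      qed
      also have "\<dots> = 2 / Suc n * measure lebesgue ?ball + 2 * B * measure lebesgue (?ball - ?E)"
        using ib id by (subst Bochner_Integration.integral_add) auto
      also have "\<dots> \<le> 2 / Suc n * measure lebesgue ?ball + 2 * B * (measure lebesgue ?ball / Suc k)"
        using dm B0 by (intro add_left_mono mult_left_mono) (auto simp: field_simps)
      also have "measure lebesgue ?ball = \<mu> * r ^ CARD('m)"
        using ballm[of \<rho> x] \<rho>(1) by (simp add: \<mu>_def \<rho>_def power_mult_distrib)
      also have "2 / Suc n * (\<mu> * r ^ CARD('m)) + 2 * B * ((\<mu> * r ^ CARD('m)) / Suc k) =
          (2 / Suc n * \<mu> + 2 * B / Suc k * \<mu>) * r ^ CARD('m)"
        by (simp add: algebra_simps)
      also have "\<dots> \<le> e * r ^ CARD('m)"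
        using n k r by (intro mult_right_mono) auto
      finally show "(LINT w|lebesgue_on U. indicator ?Q w * norm (A w - A x)) \<le> e * r ^ CARD('m)" .
    qed
  qed
  have "{x \<in> U. \<not> (\<forall>e>0. \<exists>R>0. \<forall>r. 0 < r \<and> r < R \<longrightarrow>
      (LINT w|lebesgue_on U. indicator (cbox (x - r *\<^sub>R 1) (x + r *\<^sub>R 1)) w * norm (A w - A x)) \<le> e * r ^ CARD('m))} \<subseteq> Z"
    using good by blast
  then show ?thesis
    unfolding AE_lebesgue_on_iff_negligible[OF sU] using negligible_subset[OF negZ] by blast
qed

section \<open>Uniqueness of the weak derivative\<close>

lemma AE_zero_of_box_integrals:
  fixes g :: "'a::euclidean_space \<Rightarrow> real"
  assumes g: "integrable lebesgue g" and box: "\<And>a b. (LINT x|lebesgue. indicator (box a b) x * g x) = 0"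
  shows "AE x in lebesgue. g x = 0"
proof -
  obtain h where h: "h \<in> borel_measurable lborel" "AE x in lborel. g x = h x"
    using completion_ex_borel_measurable_real[OF borel_measurable_integrable[OF g]] by blast
  have gh: "AE x in lebesgue. g x = h x" by (rule AE_completion[OF h(2)])
  have hm: "h \<in> borel_measurable lebesgue" using h(1) by (rule measurable_completion)
  have hl: "integrable lebesgue h"
    using integrable_cong_AE[OF borel_measurable_integrable[OF g] hm gh] g by simp
  then have hi: "integrable lborel h" using integrable_completion[OF h(1)] by simp
  have hbox: "(LINT x|lborel. indicator (box a b) x * h x) = 0" for a b
  proof -
    have "(LINT x|lebesgue. indicator (box a b) x * h x) = (LINT x|lebesgue. indicator (box a b) x * g x)"
    proof (rule integral_cong_AE)
      have "indicator (box a b) \<in> borel_measurable (lebesgue :: 'a measure)"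
        by (intro borel_measurable_indicator) (simp add: lborelD)
      then show "(\<lambda>x. indicator (box a b) x * h x) \<in> borel_measurable lebesgue"
        "(\<lambda>x. indicator (box a b) x * g x) \<in> borel_measurable lebesgue"
        using hm borel_measurable_integrable[OF g] by (auto intro!: borel_measurable_times)
      show "AE x in lebesgue. indicator (box a b) x * h x = indicator (box a b) x * g x"
        using gh by (rule eventually_mono) simp
    qed
    moreover have "(LINT x|lebesgue. indicator (box a b) x * h x) = (LINT x|lborel. indicator (box a b) x * h x)"
      by (rule integral_completion) (use h(1) in simp)
    ultimately show ?thesis using box by simp
  qed
  \<comment> \<open>Since \<open>ennreal\<close> truncates at 0, these measures have the positive
    and the negative part of \<open>h\<close> as densities. They agree on the intersection-stable
    family of boxes, hence everywhere, and equality of the two parts forces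
    \<open>h = 0\<close>.\<close>
  let ?P = "density lborel (\<lambda>x. ennreal (h x))" and ?N = "density lborel (\<lambda>x. ennreal (- h x))"
  have em: "emeasure ?P (box a b) = (\<integral>\<^sup>+x. ennreal (indicator (box a b) x * h x) \<partial>lborel)"
    "emeasure ?N (box a b) = (\<integral>\<^sup>+x. ennreal (- (indicator (box a b) x * h x)) \<partial>lborel)" for a b
  proof -
    have "emeasure ?P (box a b) = (\<integral>\<^sup>+x. ennreal (h x) * indicator (box a b) x \<partial>lborel)"
      by (rule emeasure_density) (use h(1) in auto)
    also have "\<dots> = (\<integral>\<^sup>+x. ennreal (indicator (box a b) x * h x) \<partial>lborel)"
      by (rule nn_integral_cong) (simp split: split_indicator)
    finally show "emeasure ?P (box a b) = (\<integral>\<^sup>+x. ennreal (indicator (box a b) x * h x) \<partial>lborel)" .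
    have "emeasure ?N (box a b) = (\<integral>\<^sup>+x. ennreal (- h x) * indicator (box a b) x \<partial>lborel)"
      by (rule emeasure_density) (use h(1) in auto)
    also have "\<dots> = (\<integral>\<^sup>+x. ennreal (- (indicator (box a b) x * h x)) \<partial>lborel)"
      by (rule nn_integral_cong) (simp split: split_indicator)
    finally show "emeasure ?N (box a b) = (\<integral>\<^sup>+x. ennreal (- (indicator (box a b) x * h x)) \<partial>lborel)" .
  qed
  have ib: "integrable lborel (\<lambda>x. indicator (box a b) x * h x)" for a b
    using integrable_mult_indicator[OF _ hi, of "box a b"] by simp
  have fin: "(\<integral>\<^sup>+x. ennreal (indicator (box a b) x * h x) \<partial>lborel) < \<infinity>"
    "(\<integral>\<^sup>+x. ennreal (- (indicator (box a b) x * h x)) \<partial>lborel) < \<infinity>" for a b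
    using ib[of a b] unfolding real_integrable_def by (simp_all add: less_top infinity_ennreal_def)
  have eq: "emeasure ?P (box a b) = emeasure ?N (box a b)" for a b
  proof -
    have "enn2real (\<integral>\<^sup>+x. ennreal (indicator (box a b) x * h x) \<partial>lborel) =
        enn2real (\<integral>\<^sup>+x. ennreal (- (indicator (box a b) x * h x)) \<partial>lborel)"
      using hbox[of a b] unfolding real_lebesgue_integral_def[OF ib] by simp
    then show ?thesis
      unfolding em using fin[of a b] by (metis ennreal_enn2real infinity_ennreal_def)
  qed
  have PN: "?P = ?N"
  proof (rule measure_eqI_generator_eq)
    let ?E = "range (\<lambda>(a, b). box a b :: 'a set)"
    show "Int_stable ?E" by (auto simp: Int_stable_def box_Int_box)
    show "?E \<subseteq> Pow UNIV" by simp
    show "emeasure ?P X = emeasure ?N X" if "X \<in> ?E" for X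
      using that eq by auto
    show "sets ?P = sigma_sets UNIV ?E" "sets ?N = sigma_sets UNIV ?E"
      by (simp_all add: borel_eq_box)
    let ?A = "\<lambda>n::nat. box (- (real n *\<^sub>R One)) (real n *\<^sub>R One) :: 'a set"
    show "range ?A \<subseteq> ?E" by auto
    show "(\<Union>i. ?A i) = UNIV" by (rule UN_box_eq_UNIV)
    show "emeasure ?P (?A i) \<noteq> \<infinity>" for i
      unfolding em using fin by (metis less_irrefl)
  qed
  have "AE x in lborel. ennreal (h x) = ennreal (- h x)"
    by (rule sigma_finite_measure.density_unique[OF sigma_finite_lborel _ _ PN]) (use h(1) in auto)
  then have "AE x in lborel. h x = 0"
  proof (rule eventually_mono)
    fix x assume e: "ennreal (h x) = ennreal (- h x)"
    show "h x = 0"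
    proof (rule ccontr)
      assume "h x \<noteq> 0"
      then consider "h x > 0" | "h x < 0" by linarith
      then show False
      proof cases
        case 1
        then have "ennreal (- h x) = 0" by (simp add: ennreal_neg)
        with e 1 show False by simp
      next
        case 2
        then have "ennreal (h x) = 0" by (simp add: ennreal_neg)
        with e 2 show False by (metis ennreal_eq_0_iff neg_le_0_iff_le not_le)
      qed
    qed
  qed
  then have "AE x in lebesgue. h x = 0" by (rule AE_completion)
  with gh show ?thesis by eventually_elim simp
qed

lemma tendsto_flat_exp_mult:
  "(\<lambda>k. flat_exp (real k * s)) \<longlonglongrightarrow> (if s > 0 then 1 else 0)"
proof (cases "s > 0")
  case True
  have "(\<lambda>k. exp (- ((1 / s) * inverse (real k)))) \<longlonglongrightarrow> exp (- ((1 / s) * 0))"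
    by (intro tendsto_intros lim_inverse_n)
  then have "(\<lambda>k. exp (- ((1 / s) * inverse (real k)))) \<longlonglongrightarrow> 1" by simp
  moreover have "\<forall>\<^sub>F k in sequentially. exp (- ((1 / s) * inverse (real k))) = flat_exp (real k * s)"
    using eventually_gt_at_top[of 0]
  proof (rule eventually_mono)
    fix k :: nat assume "0 < k"
    then show "exp (- ((1 / s) * inverse (real k))) = flat_exp (real k * s)"
      using True by (simp add: flat_exp_def field_simps)
  qed
  ultimately have "(\<lambda>k. flat_exp (real k * s)) \<longlonglongrightarrow> 1" by (rule Lim_transform_eventually)
  then show ?thesis using True by simp
next
  case False
  then have "flat_exp (real k * s) = 0" for k
    by (simp add: flat_exp_range(3) mult_nonneg_nonpos)
  then show ?thesis using False by simp
qed

text \<open>Products of ever steeper flat exponentials, one for each face, are test functions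
  supported in \<open>cbox a b\<close> that converge pointwise to the indicator of the open box.
  They lie between 0 and 1, so \<open>f\<close> on the closed box dominates.\<close>

lemma box_integral_eq_0:
  fixes f :: "real ^ 'm::finite \<Rightarrow> real"
  assumes U: "open U" and f: "locally_integrable U f"
    and zero: "\<And>\<phi>. test_function U \<phi> \<Longrightarrow> (LINT x|lebesgue_on U. f x * \<phi> x) = 0"
    and Q: "cbox a b \<subseteq> U"
  shows "(LINT x|lebesgue_on U. f x * indicator (box a b) x) = 0"
proof -
  define \<phi> where "\<phi> k x = (\<Prod>i\<in>UNIV. flat_exp (real k * (x $ i - a $ i)) * flat_exp (real k * (b $ i - x $ i)))"
    for k :: nat and x :: "real ^ 'm"
  have C: "C_k n (\<phi> k)" for n k
  proof -
    have "C_k n (\<lambda>x. flat_exp (real k * x $ i + (- (real k * a $ i))) * flat_exp ((- real k) * x $ i + real k * b $ i))" for i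
      by (intro C_k_mult C_k_flat_exp)
    moreover have "real k * x $ i + (- (real k * a $ i)) = real k * (x $ i - a $ i)"
      "(- real k) * x $ i + real k * b $ i = real k * (b $ i - x $ i)" for x :: "real ^ 'm" and i
      by (simp_all add: algebra_simps)
    ultimately have "C_k n (\<lambda>x. flat_exp (real k * (x $ i - a $ i)) * flat_exp (real k * (b $ i - x $ i)))" for i
      by simp
    then show ?thesis unfolding \<phi>_def by (intro C_k_prod) auto
  qed
  have z: "\<phi> k x = 0" if out: "x \<notin> cbox a b" for k x
  proof -
    obtain i where "\<not> (a $ i \<le> x $ i \<and> x $ i \<le> b $ i)"
      using out unfolding mem_box_cart by blast
    then have "flat_exp (real k * (x $ i - a $ i)) * flat_exp (real k * (b $ i - x $ i)) = 0"
      using flat_exp_range(3)[of "real k * (x $ i - a $ i)"] flat_exp_range(3)[of "real k * (b $ i - x $ i)"]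
      by (auto simp: mult_nonneg_nonpos not_le)
    then show ?thesis unfolding \<phi>_def by (intro prod_zero) auto
  qed
  have range: "0 \<le> \<phi> k x" "\<phi> k x \<le> 1" for k x
    unfolding \<phi>_def using flat_exp_range(1,2) by (auto intro!: prod_nonneg prod_le_1 mult_nonneg_nonneg mult_le_one)
  have test: "test_function U (\<phi> k)" for k
  proof -
    have "{x. \<phi> k x \<noteq> 0} \<subseteq> cbox a b" using z by blast
    then have cl: "closure {x. \<phi> k x \<noteq> 0} \<subseteq> cbox a b"
      by (rule closure_minimal) (rule closed_cbox)
    have "bounded {x. \<phi> k x \<noteq> 0}"
      by (rule bounded_subset[OF bounded_cbox[of a b]]) (use z in blast)
    then have "compact (closure {x. \<phi> k x \<noteq> 0})" by (simp only: compact_closure)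
    then show ?thesis
      unfolding test_function_def using C order.trans[OF cl Q] by (intro conjI allI)
  qed
  have lim: "(\<lambda>k. \<phi> k x) \<longlonglongrightarrow> indicator (box a b) x" for x
  proof -
    have "(\<lambda>k. \<phi> k x) \<longlonglongrightarrow> (\<Prod>i\<in>UNIV. (if x $ i - a $ i > 0 then 1 else 0) * (if b $ i - x $ i > 0 then 1 else 0))"
      unfolding \<phi>_def by (intro tendsto_prod tendsto_mult tendsto_flat_exp_mult)
    also have "(\<Prod>i\<in>UNIV. (if x $ i - a $ i > 0 then 1 else 0) * (if b $ i - x $ i > 0 then 1 else 0)) = (indicator (box a b) x :: real)"
    proof (cases "x \<in> box a b")
      case True
      then have "\<forall>i. a $ i < x $ i \<and> x $ i < b $ i" unfolding mem_box_cart .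
      then show ?thesis using True by simp
    next
      case False
      then obtain i where "\<not> (a $ i < x $ i \<and> x $ i < b $ i)" unfolding mem_box_cart by blast
      then have "(if x $ i - a $ i > 0 then 1 else 0) * (if b $ i - x $ i > 0 then 1 else 0) = (0::real)" by auto
      then have "(\<Prod>i\<in>UNIV. (if x $ i - a $ i > 0 then 1 else 0) * (if b $ i - x $ i > 0 then 1 else 0)) = (0::real)"
        by (rule prod_zero[OF finite bexI[OF _ UNIV_I]])
      then show ?thesis using False by simp
    qed
    finally show ?thesis .
  qed
  have fQ: "f absolutely_integrable_on cbox a b"
    using f Q unfolding locally_integrable_def by (meson compact_cbox)
  have w: "integrable (lebesgue_on U) (\<lambda>x. indicator (cbox a b) x * \<bar>f x\<bar>)"
    by (rule integrable_indicator_abs[OF U Q fQ])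
  have mfQ: "(\<lambda>x. indicator (cbox a b) x * f x) \<in> borel_measurable (lebesgue_on U)"
    using borel_measurable_integrable[OF fQ[unfolded set_integrable_def]] by (simp add: measurable_restrict_space1)
  have "(\<lambda>k. LINT x|lebesgue_on U. f x * \<phi> k x) \<longlonglongrightarrow> (LINT x|lebesgue_on U. f x * indicator (box a b) x)"
  proof (rule integral_dominated_convergence[OF _ _ w])
    have e: "(\<lambda>x. f x * indicator (box a b) x) = (\<lambda>x. (indicator (cbox a b) x * f x) * indicator (box a b) x)"
      using box_subset_cbox[of a b] by (auto simp: fun_eq_iff indicator_def)
    have mi: "indicator (box a b) \<in> borel_measurable (lebesgue_on U)"
      by (intro measurable_restrict_space1 borel_measurable_indicator) (simp add: lborelD)
    show "(\<lambda>x. f x * indicator (box a b) x) \<in> borel_measurable (lebesgue_on U)"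
      unfolding e by (rule borel_measurable_times[OF mfQ mi])
    show "(\<lambda>x. f x * \<phi> k x) \<in> borel_measurable (lebesgue_on U)" for k
      by (rule borel_measurable_integrable[OF locally_integrable_test_function(1)[OF U f test]])
    show "AE x in lebesgue_on U. (\<lambda>k. f x * \<phi> k x) \<longlonglongrightarrow> f x * indicator (box a b) x"
      by (intro AE_I2 tendsto_mult tendsto_const lim)
    show "AE x in lebesgue_on U. norm (f x * \<phi> k x) \<le> indicator (cbox a b) x * \<bar>f x\<bar>" for k
    proof (rule AE_I2)
      fix x
      show "norm (f x * \<phi> k x) \<le> indicator (cbox a b) x * \<bar>f x\<bar>"
      proof (cases "x \<in> cbox a b")
        case True
        then show ?thesis using range[of k x] by (simp add: abs_mult mult_left_le)
      next
        case False
        then show ?thesis using z[OF False] by simp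
      qed
    qed
  qed
  moreover have "(LINT x|lebesgue_on U. f x * \<phi> k x) = 0" for k by (rule zero[OF test])
  ultimately show ?thesis by (simp add: LIMSEQ_const_iff)
qed

text \<open>\<open>U\<close> is a countable union of closed boxes on which \<open>f\<close> is
  integrable. On each of them it suffices that integrals over boxes vanish; intersections of boxes
  are boxes, and their boundaries are null.\<close>

lemma fundamental_lemma:
  fixes f :: "real ^ 'm::finite \<Rightarrow> real"
  assumes U: "open U" and f: "locally_integrable U f"
    and zero: "\<And>\<phi>. test_function U \<phi> \<Longrightarrow> (LINT x|lebesgue_on U. f x * \<phi> x) = 0"
  shows "AE x in lebesgue_on U. f x = 0"
proof -
  have sU: "U \<in> sets lebesgue" by (rule open_sets_lebesgue[OF U])
  obtain \<D> where D: "countable \<D>" "\<D> \<subseteq> Pow U" "\<And>X. X \<in> \<D> \<Longrightarrow> \<exists>a b. X = cbox a b" "\<Union>\<D> = U"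
    by (rule open_countable_Union_open_cbox[OF U]) blast
  have neg: "negligible {x \<in> X. f x \<noteq> 0}" if X: "X \<in> \<D>" for X
  proof -
    obtain a b where ab: "X = cbox a b" using D(3)[OF X] by blast
    have Q: "cbox a b \<subseteq> U" using D(2) X ab by blast
    have fQ: "f absolutely_integrable_on cbox a b"
      using f Q unfolding locally_integrable_def by (meson compact_cbox)
    let ?g = "\<lambda>x. indicator (cbox a b) x * f x"
    have g: "integrable lebesgue ?g" using fQ by (simp add: set_integrable_def)
    have "(LINT x|lebesgue. indicator (box c d) x * ?g x) = 0" for c d
    proof -
      \<comment> \<open>The corners are coordinatewise maxima and minima; the closed box with the
        same corners stays inside \<open>cbox a b\<close>, so test functions for it are supported in
        \<open>U\<close>.\<close>
      obtain p q where pq: "box c d \<inter> box a b = box p q" "cbox p q \<subseteq> U \<or> box p q = {}"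
      proof -
        let ?p = "(\<chi> i. max (c $ i) (a $ i))" and ?q = "(\<chi> i. min (d $ i) (b $ i))"
        have "box c d \<inter> box a b = box ?p ?q" by (auto simp: mem_box_cart)
        moreover have "cbox ?p ?q \<subseteq> cbox a b" by (auto simp: mem_box_cart)
        ultimately show thesis using that[of ?p ?q] Q by blast
      qed
      have z: "(LINT x|lebesgue_on U. f x * indicator (box p q) x) = 0"
      proof (cases "box p q = {}")
        case False
        with pq(2) have "cbox p q \<subseteq> U" by blast
        then show ?thesis using box_integral_eq_0[OF U f, of p q] zero by blast
      qed simp
      have mb: "box c d \<in> sets lebesgue" "box p q \<in> sets lebesgue" by (simp_all add: lborelD)
      have nb: "negligible (cbox a b - box a b)"
        using negligible_frontier_interval by blast
      have "(LINT x|lebesgue. indicator (box c d) x * ?g x) = (LINT x|lebesgue. indicator U x *\<^sub>R (f x * indicator (box p q) x))"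
      proof (rule integral_cong_AE)
        show "(\<lambda>x. indicator (box c d) x * ?g x) \<in> borel_measurable lebesgue"
          by (rule borel_measurable_times[OF borel_measurable_indicator[OF mb(1)] borel_measurable_integrable[OF g]])
        have "(\<lambda>x. indicator U x *\<^sub>R (f x * indicator (box p q) x)) = (\<lambda>x. indicator (box p q) x * ?g x)"
          using pq(1) Q box_subset_cbox[of a b] by (auto simp: fun_eq_iff indicator_def)
        then show "(\<lambda>x. indicator U x *\<^sub>R (f x * indicator (box p q) x)) \<in> borel_measurable lebesgue"
          using borel_measurable_times[OF borel_measurable_indicator[OF mb(2)] borel_measurable_integrable[OF g]] by (simp only:)
        show "AE x in lebesgue. indicator (box c d) x * ?g x = indicator U x *\<^sub>R (f x * indicator (box p q) x)"
        proof -
          have "indicator (box c d) x * ?g x = indicator U x *\<^sub>R (f x * indicator (box p q) x)"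
            if x: "x \<notin> cbox a b - box a b" for x
            using x Q box_subset_cbox[of a b] unfolding pq(1)[symmetric] by (auto simp: indicator_def)
          then show ?thesis
            unfolding eventually_ae_filter_negligible using nb by blast
        qed
      qed
      also have "\<dots> = (LINT x|lebesgue_on U. f x * indicator (box p q) x)"
        using sU by (subst integral_restrict_space) simp_all
      finally show ?thesis using z by simp
    qed
    from AE_zero_of_box_integrals[OF g this] have "negligible {x. ?g x \<noteq> 0}"
      by (simp only: AE_lebesgue_iff_negligible)
    then show ?thesis
      unfolding ab by (rule negligible_subset) auto
  qed
  have "{x \<in> U. f x \<noteq> 0} = (\<Union>X\<in>\<D>. {x \<in> X. f x \<noteq> 0})" using D(4) by blast
  then have "negligible {x \<in> U. f x \<noteq> 0}"
    using negligible_countable_Union[of "(\<lambda>X. {x \<in> X. f x \<noteq> 0}) ` \<D>"] neg D(1) by auto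
  then show ?thesis using AE_lebesgue_on_iff_negligible[OF sU] by simp
qed

text \<open>Membership in \<open>W_1_infty\<close> provides some essentially bounded weak Jacobian;
  uniqueness transfers measurability and the bound to the representative that is given.\<close>

lemma weak_jacobian_unique:
  fixes u :: "real ^ 'm::finite \<Rightarrow> real ^ 'm"
  assumes U: "open U" and A: "weak_jacobian U u A" and D: "weak_jacobian U u D"
  shows "AE x in lebesgue_on U. A x = D x"
proof -
  have w: "weak_jacobian U (\<lambda>x. u x - u x) (\<lambda>x. A x - D x)" by (rule weak_jacobian_diff[OF U A D])
  have "AE x in lebesgue_on U. (A x - D x) $ i $ j = 0" for i j
  proof (rule fundamental_lemma[OF U])
    show "locally_integrable U (\<lambda>x. (A x - D x) $ i $ j)"
      by (rule locally_integrable_nth[OF locally_integrable_nth[OF weak_jacobianD(2)[OF w]]])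
    show "(LINT x|lebesgue_on U. (A x - D x) $ i $ j * \<phi> x) = 0" if "test_function U \<phi>" for \<phi>
      using weak_jacobianD(3)[OF w that, of i j] by simp
  qed
  then have "AE x in lebesgue_on U. \<forall>i j. (A x - D x) $ i $ j = 0"
    by (simp add: AE_all_countable)
  then show ?thesis
    by (rule eventually_mono) (simp add: vec_eq_iff)
qed

section \<open>The area inequality\<close>

lemma measurable_lebesgue_on_AE_eq:
  assumes U: "U \<in> sets lebesgue" and f: "f \<in> borel_measurable (lebesgue_on U)"
    and eq: "AE x in lebesgue_on U. f x = g x"
  shows "g \<in> borel_measurable (lebesgue_on U)"
proof (rule borel_measurableI)
  fix S :: "'b set" assume "open S"
  have neg: "negligible {x \<in> U. f x \<noteq> g x}"
    using eq unfolding AE_lebesgue_on_iff_negligible[OF U] .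
  have s: "sets (lebesgue_on U) = {X. X \<subseteq> U \<and> X \<in> sets lebesgue}"
    using U by (auto simp: sets_restrict_space_iff)
  have sp: "space (lebesgue_on U) = U" by (simp add: space_restrict_space)
  have "f -` S \<inter> U \<in> sets lebesgue"
    using measurable_sets[OF f, of S] \<open>open S\<close> unfolding s sp by auto
  moreover have "negligible (f -` S \<inter> U - g -` S)" "negligible ((g -` S \<inter> U) - f -` S)"
    by (rule negligible_subset[OF neg], force)+
  moreover have "g -` S \<inter> U = ((f -` S \<inter> U) - (f -` S \<inter> U - g -` S)) \<union> ((g -` S \<inter> U) - f -` S)"
    by blast
  ultimately have "g -` S \<inter> U \<in> sets lebesgue"
    by (metis negligible_imp_sets sets.Diff sets.Un)
  then show "g -` S \<inter> space (lebesgue_on U) \<in> sets (lebesgue_on U)"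
    unfolding s sp by blast
qed

lemma borel_measurable_det:
  fixes D :: "'a \<Rightarrow> real ^ 'm::finite ^ 'm"
  assumes "D \<in> borel_measurable M"
  shows "(\<lambda>x. det (D x)) \<in> borel_measurable M"
proof -
  have "(\<lambda>x. D x $ i $ j) \<in> borel_measurable M" for i j
  proof -
    have "(\<lambda>A :: real ^ 'm ^ 'm. A $ i $ j) \<in> borel_measurable borel"
      by (intro borel_measurable_continuous_onI continuous_intros)
    from measurable_compose[OF assms this] show ?thesis .
  qed
  then show ?thesis
    unfolding det_def by (intro borel_measurable_sum borel_measurable_times borel_measurable_prod borel_measurable_const)
qed

text \<open>Where the derivative is invertible, \<open>u\<close> stretches small distances from
  below. On each of countably many pieces this holds uniformly, so \<open>u\<close> has a Lipschitz
  inverse there, and Lipschitz maps carry null sets to null sets.\<close>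

lemma negligible_of_negligible_image:
  fixes u :: "real ^ 'm::finite \<Rightarrow> real ^ 'm"
  assumes der: "\<And>x. x \<in> G \<Longrightarrow> (u has_derivative (\<lambda>h. D x *v h)) (at x)"
    and det: "\<And>x. x \<in> G \<Longrightarrow> det (D x) \<noteq> 0" and neg: "negligible (u ` G)"
  shows "negligible G"
proof -
  \<comment> \<open>The index \<open>k\<close> controls both the radius and the stretching factor.
    Balls of radius \<open>1 / (2 * real (Suc k))\<close> then cut \<open>H k\<close> into pieces on
    which the bound holds for every pair of points.\<close>
  define H where "H k = {x \<in> G. \<forall>y. dist y x < 1 / real (Suc k) \<longrightarrow> dist y x \<le> real (Suc k) * dist (u y) (u x)}" for k
  have H: "\<exists>k. x \<in> H k" if x: "x \<in> G" for x
  proof -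
    have "invertible (D x)" using det[OF x] by (simp add: invertible_det_nz)
    then have "inj ((*v) (D x))" by (simp add: invertible_eq_bij bij_is_inj)
    then obtain c where c: "c > 0" "\<And>h. c * norm h \<le> norm (D x *v h)"
      using linear_inj_bounded_below_pos[of "(*v) (D x)"] by auto
    obtain d where d: "d > 0" "\<And>y. norm (y - x) < d \<Longrightarrow> norm (u y - u x - D x *v (y - x)) \<le> c / 2 * norm (y - x)"
      using der[OF x] c(1) unfolding has_derivative_within_alt by (metis UNIV_I half_gt_zero)
    obtain k :: nat where k: "max (1 / d) (2 / c) < real k" using reals_Archimedean2 by blast
    have k1: "1 / real (Suc k) < d" "2 / c \<le> real (Suc k)"
    proof -
      have "1 / d < real (Suc k)" using k by linarith
      then show "1 / real (Suc k) < d" using d(1) by (simp add: field_simps)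
      show "2 / c \<le> real (Suc k)" using k by linarith
    qed
    have "dist y x \<le> real (Suc k) * dist (u y) (u x)" if y: "dist y x < 1 / real (Suc k)" for y
    proof -
      have "norm (y - x) < d" using y k1(1) by (simp add: dist_norm)
      then have "norm (u y - u x - D x *v (y - x)) \<le> c / 2 * norm (y - x)" by (rule d(2))
      moreover have "c * norm (y - x) \<le> norm (D x *v (y - x))" by (rule c(2))
      moreover have "norm (D x *v (y - x)) \<le> norm (u y - u x) + norm (u y - u x - D x *v (y - x))"
        using norm_triangle_ineq4[of "u y - u x" "u y - u x - D x *v (y - x)"] by simp
      ultimately have "c / 2 * norm (y - x) \<le> norm (u y - u x)" by linarith
      then have "norm (y - x) \<le> 2 / c * norm (u y - u x)" using c(1) by (simp add: field_simps)
      also have "\<dots> \<le> real (Suc k) * norm (u y - u x)" using k1(2) by (intro mult_right_mono) auto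
      finally show ?thesis by (simp add: dist_norm)
    qed
    with x show ?thesis unfolding H_def by blast
  qed
  obtain Q :: "(real ^ 'm) set" where Q: "countable Q" "\<And>X. open X \<Longrightarrow> X \<noteq> {} \<Longrightarrow> \<exists>q\<in>Q. q \<in> X"
    by (rule countable_dense_setE) blast
  define P where "P k q = H k \<inter> ball q (1 / (2 * real (Suc k)))" for k q
  have negP: "negligible (P k q)" for k q
  proof -
    have lip: "dist y x \<le> real (Suc k) * dist (u y) (u x)" if "x \<in> P k q" "y \<in> P k q" for x y
    proof -
      have "dist y x \<le> dist q y + dist q x" by (metis dist_commute dist_triangle)
      also have "\<dots> < 1 / (2 * real (Suc k)) + 1 / (2 * real (Suc k))"
        using that by (auto simp: P_def)
      also have "\<dots> = 1 / real (Suc k)" by (simp add: field_simps)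
      finally show ?thesis using that(1) by (simp add: P_def H_def)
    qed
    have inj: "inj_on u (P k q)"
    proof (rule inj_onI)
      fix x y assume "x \<in> P k q" "y \<in> P k q" "u x = u y"
      then show "x = y" using lip[of x y] by simp
    qed
    let ?g = "inv_into (P k q) u"
    have sub: "u ` P k q \<subseteq> u ` G" by (auto simp: P_def H_def)
    have "negligible (?g ` (u ` P k q))"
    proof (rule negligible_locally_Lipschitz_image)
      show "negligible (u ` P k q)" by (rule negligible_subset[OF neg sub])
      fix y assume y: "y \<in> u ` P k q"
      show "\<exists>T B. open T \<and> y \<in> T \<and> (\<forall>z\<in>u ` P k q \<inter> T. norm (?g z - ?g y) \<le> B * norm (z - y))"
      proof (intro exI[of _ UNIV] exI[of _ "real (Suc k)"] conjI ballI)
        fix z assume "z \<in> u ` P k q \<inter> UNIV"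
        then have z: "z \<in> u ` P k q" by simp
        have "dist (?g z) (?g y) \<le> real (Suc k) * dist (u (?g z)) (u (?g y))"
          by (rule lip[OF inv_into_into[OF y] inv_into_into[OF z]])
        then show "norm (?g z - ?g y) \<le> real (Suc k) * norm (z - y)"
          by (simp only: f_inv_into_f[OF y] f_inv_into_f[OF z] dist_norm)
      qed simp_all
    qed simp
    moreover have "?g ` (u ` P k q) = P k q"
      by (rule inv_into_image_cancel[OF inj order_refl])
    ultimately show ?thesis by simp
  qed
  have "negligible (\<Union>k. \<Union>q\<in>Q. P k q)"
    using Q(1) negP by (intro negligible_Union_nat negligible_countable_Union) auto
  moreover have "G \<subseteq> (\<Union>k. \<Union>q\<in>Q. P k q)"
  proof
    fix x assume "x \<in> G"
    then obtain k where k: "x \<in> H k" using H by blast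
    have "ball x (1 / (2 * real (Suc k))) \<noteq> {}" by simp
    from Q(2)[OF open_ball this] obtain q where "q \<in> Q" "q \<in> ball x (1 / (2 * real (Suc k)))" by blast
    then have "x \<in> P k q" using k by (simp add: P_def dist_commute)
    then show "x \<in> (\<Union>k. \<Union>q\<in>Q. P k q)" using \<open>q \<in> Q\<close> by blast
  qed
  ultimately show ?thesis by (rule negligible_subset)
qed

text \<open>Essential injectivity concerns almost every value, whereas change of variables needs
  injectivity on a set of points. The values taken more than once form a null set \<open>N\<close>,
  and the points of differentiability above \<open>N\<close> are null because the determinant does
  not vanish there. On the remaining points above \<open>A\<close> the formula is exact, and their
  image lies in \<open>A\<close>.\<close>

lemma area_inequality:
  fixes u :: "real ^ 'm::{finite,wellorder} \<Rightarrow> real ^ 'm::_"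
  assumes U: "open U" "bounded U" and cont: "continuous_on U u" and inj: "essentially_injective U u"
    and mD: "D \<in> borel_measurable (lebesgue_on U)"
    and der: "AE x in lebesgue_on U. (u has_derivative (\<lambda>h. D x *v h)) (at x)"
    and lam: "lam > 0" and det: "AE x in lebesgue_on U. lam \<le> det (D x) \<and> det (D x) \<le> Lam"
    and A: "A \<in> sets borel" "A \<in> lmeasurable"
  shows "(LINT x|lebesgue_on U. indicator A (u x) * det (D x)) \<le> measure lebesgue A"
    "integrable (lebesgue_on U) (\<lambda>x. indicator A (u x) * det (D x))"
proof -
  have sU: "U \<in> sets lebesgue" by (rule open_sets_lebesgue[OF U(1)])
  define P where "P x \<longleftrightarrow> (u has_derivative (\<lambda>h. D x *v h)) (at x) \<and> lam \<le> det (D x) \<and> det (D x) \<le> Lam" for x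
  have "AE x in lebesgue_on U. P x"
    using der det unfolding P_def by eventually_elim blast
  then have negP: "negligible {x \<in> U. \<not> P x}"
    unfolding AE_lebesgue_on_iff_negligible[OF sU] .
  define N where "N = {y. \<not> multiplicity_on U u y \<le> 1}"
  have "AE y in lebesgue. multiplicity_on U u y \<le> 1"
    using esssup_AE[of "multiplicity_on U u" lebesgue] inj by (simp add: essentially_injective_def)
  then have negN: "negligible N"
    unfolding N_def by (simp only: AE_lebesgue_iff_negligible)
  define G where "G = {x \<in> U. P x}"
  define G2 where "G2 = {x \<in> G. u x \<in> N}"
  have negG2: "negligible G2"
  proof (rule negligible_of_negligible_image)
    show "(u has_derivative (\<lambda>h. D x *v h)) (at x)" if "x \<in> G2" for x
      using that by (simp add: G2_def G_def P_def)
    show "det (D x) \<noteq> 0" if "x \<in> G2" for x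
      using that lam by (auto simp: G2_def G_def P_def)
    show "negligible (u ` G2)"
      by (rule negligible_subset[OF negN]) (auto simp: G2_def)
  qed
  define W where "W = {x \<in> U. u x \<in> A}"
  have "u \<in> borel_measurable (restrict_space borel U)"
    by (rule borel_measurable_continuous_on_restrict[OF cont])
  from measurable_sets[OF this A(1)] have "u -` A \<inter> U \<in> sets borel"
    using U(1) by (simp add: space_restrict_space sets_restrict_space_iff borel_open)
  moreover have "u -` A \<inter> U = W" by (auto simp: W_def)
  ultimately have sW: "W \<in> sets lebesgue" by (simp add: lborelD)
  define G1 where "G1 = W - ({x \<in> U. \<not> P x} \<union> G2)"
  have negB: "negligible ({x \<in> U. \<not> P x} \<union> G2)" by (rule negligible_Un[OF negP negG2])
  have sG1: "G1 \<in> sets lebesgue"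
    unfolding G1_def using sW negligible_imp_sets[OF negB] by (rule sets.Diff)
  have G1: "x \<in> U" "P x" "u x \<in> A" "u x \<notin> N" if "x \<in> G1" for x
    using that by (auto simp: G1_def W_def G2_def G_def)
  have derG: "(u has_derivative (\<lambda>h. D x *v h)) (at x within G1)" if "x \<in> G1" for x
    using G1(2)[OF that] by (auto simp: P_def intro: has_derivative_at_withinI)
  have injG: "inj_on u G1"
  proof (rule inj_onI)
    fix x y assume xy: "x \<in> G1" "y \<in> G1" "u x = u y"
    show "x = y"
    proof (rule ccontr)
      assume ne: "x \<noteq> y"
      have "emeasure (count_space UNIV) {x, y} \<le> emeasure (count_space UNIV) (U \<inter> u -` {u x})"
        using xy G1(1) by (intro emeasure_mono) auto
      moreover have "emeasure (count_space UNIV) {x, y} = 2"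
        using ne by (simp add: emeasure_count_space)
      ultimately have "2 \<le> multiplicity_on U u (u x)" by (simp add: multiplicity_on_def)
      moreover have "multiplicity_on U u (u x) \<le> 1" using G1(4)[OF xy(1)] by (simp add: N_def)
      ultimately have "(2::ennreal) \<le> 1" by (rule order.trans)
      then show False by simp
    qed
  qed
  have G1U: "G1 \<subseteq> U" using G1(1) by blast
  have lmG1: "G1 \<in> lmeasurable"
    using sG1 bounded_subset[OF U(2) G1U] by (simp add: bounded_set_imp_lmeasurable)
  have lam0: "0 \<le> Lam \<or> G1 = {}" using G1(2) lam by (force simp: P_def)
  have mdet: "(\<lambda>x. det (D x)) \<in> borel_measurable (lebesgue_on U)" by (rule borel_measurable_det[OF mD])
  have m1: "(\<lambda>x. indicator G1 x * det (D x)) \<in> borel_measurable (lebesgue_on U)"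
    by (rule borel_measurable_times[OF measurable_restrict_space1[OF borel_measurable_indicator[OF sG1]] mdet])
  have ind1: "integrable (lebesgue_on U) (\<lambda>x. Lam * indicator G1 x)"
  proof -
    have eq: "(\<lambda>w. indicator U w *\<^sub>R indicator G1 w) = (indicator G1 :: _ \<Rightarrow> real)"
      using G1U by (auto simp: fun_eq_iff indicator_def)
    have "integrable lebesgue (indicator G1 :: _ \<Rightarrow> real)"
      using lmG1 by (intro integrable_real_indicator) (auto simp: fmeasurable_def)
    then have "integrable (lebesgue_on U) (indicator G1 :: _ \<Rightarrow> real)"
      using sU by (subst integrable_restrict_space) (simp_all add: eq del: real_scaleR_def)
    then show ?thesis by (rule integrable_mult_right)
  qed
  have int1: "integrable (lebesgue_on U) (\<lambda>x. indicator G1 x * det (D x))"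
  proof (rule Bochner_Integration.integrable_bound[OF ind1 m1])
    show "AE x in lebesgue_on U. norm (indicator G1 x * det (D x)) \<le> norm (Lam * indicator G1 x)"
    proof (rule AE_I2)
      fix x
      show "norm (indicator G1 x * det (D x)) \<le> norm (Lam * indicator G1 x)"
        using G1(2)[of x] lam by (cases "x \<in> G1") (auto simp: P_def)
    qed
  qed
  have eqf: "(\<lambda>x. indicator U x *\<^sub>R (indicator G1 x * det (D x))) = (\<lambda>x. indicator G1 x *\<^sub>R det (D x))"
    using G1U by (auto simp: fun_eq_iff indicator_def)
  have si: "set_integrable lebesgue G1 (\<lambda>x. det (D x))"
    using int1 sU unfolding set_integrable_def
    by (subst (asm) integrable_restrict_space) (simp_all add: eqf del: real_scaleR_def)
  have L1: "(LINT x|lebesgue_on U. indicator G1 x * det (D x)) = integral G1 (\<lambda>x. det (D x))"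
  proof -
    have "(LINT x|lebesgue_on U. indicator G1 x * det (D x)) = (LINT x|lebesgue. indicator G1 x *\<^sub>R det (D x))"
      using sU by (subst integral_restrict_space) (simp_all add: eqf del: real_scaleR_def)
    also have "\<dots> = integral G1 (\<lambda>x. det (D x))"
      using set_lebesgue_integral_eq_integral(2)[OF si] by (simp add: set_lebesgue_integral_def)
    finally show ?thesis .
  qed
  have absd: "det (D x) = \<bar>det (D x)\<bar>" if "x \<in> G1" for x
    using G1(2)[OF that] lam by (simp add: P_def)
  have mat: "matrix (\<lambda>h. D x *v h) = D x" for x by (rule matrix_of_matrix_vector_mul)
  have hi: "((\<lambda>x. det (D x)) has_integral integral G1 (\<lambda>x. det (D x))) G1"
    using set_lebesgue_integral_eq_integral(1)[OF si] by (rule integrable_integral)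
  then have "((\<lambda>x. \<bar>det (matrix (\<lambda>h. D x *v h))\<bar>) has_integral integral G1 (\<lambda>x. det (D x))) G1"
    unfolding mat by (rule has_integral_eq[rotated]) (rule absd)
  then have im: "u ` G1 \<in> lmeasurable" "measure lebesgue (u ` G1) = integral G1 (\<lambda>x. det (D x))"
    using has_measure_differentiable_image[OF sG1 derG injG] by blast+
  have "measure lebesgue (u ` G1) \<le> measure lebesgue A"
    using G1(3) im(1) A(2) by (intro measure_mono_fmeasurable) (auto simp: fmeasurableD)
  with L1 im have fin: "(LINT x|lebesgue_on U. indicator G1 x * det (D x)) \<le> measure lebesgue A" by simp
  have ae: "AE x in lebesgue_on U. indicator G1 x * det (D x) = indicator A (u x) * det (D x)"
    unfolding AE_lebesgue_on_iff_negligible[OF sU]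
    by (rule negligible_subset[OF negB]) (auto simp: G1_def W_def indicator_def split: if_splits)
  have m2: "(\<lambda>x. indicator A (u x) * det (D x)) \<in> borel_measurable (lebesgue_on U)"
    by (rule measurable_lebesgue_on_AE_eq[OF sU m1 ae])
  show "integrable (lebesgue_on U) (\<lambda>x. indicator A (u x) * det (D x))"
    using integrable_cong_AE[OF m1 m2 ae] int1 by blast
  show "(LINT x|lebesgue_on U. indicator A (u x) * det (D x)) \<le> measure lebesgue A"
    using integral_cong_AE[OF m1 m2 ae] fin by simp
qed

text \<open>
  The library's change of variables theorem needs a well-ordered index type; the order itself is
  immaterial.
\<close>

instantiation sum :: (finite, finite) wellorder
begin

definition less_eq_sum :: "'a + 'b \<Rightarrow> 'a + 'b \<Rightarrow> bool" where
  "less_eq_sum x y \<longleftrightarrow> to_nat x \<le> to_nat y"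

definition less_sum :: "'a + 'b \<Rightarrow> 'a + 'b \<Rightarrow> bool" where
  "less_sum x y \<longleftrightarrow> to_nat x < to_nat y"

instance
proof
  fix x y z :: "'a + 'b"
  show "x < y \<longleftrightarrow> x \<le> y \<and> \<not> y \<le> x" "x \<le> x" "x \<le> y \<or> y \<le> x"
    by (auto simp: less_eq_sum_def less_sum_def)
  show "x \<le> y \<Longrightarrow> y \<le> z \<Longrightarrow> x \<le> z" by (simp add: less_eq_sum_def)
  show "x \<le> y \<Longrightarrow> y \<le> x \<Longrightarrow> x = y" by (simp add: less_eq_sum_def)
next
  fix P :: "'a + 'b \<Rightarrow> bool" and a
  assume step: "\<And>x. (\<And>y. y < x \<Longrightarrow> P y) \<Longrightarrow> P x"
  show "P a"
  proof (rule measure_induct_rule[where f = to_nat and P = P and a = a])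
    fix x :: "'a + 'b" assume IH: "\<And>y. to_nat y < to_nat x \<Longrightarrow> P y"
    show "P x"
      by (rule step, rule IH) (simp only: less_sum_def)
  qed
qed

end

section \<open>Approximation by symplectic diffeomorphisms\<close>

text \<open>The intervals of the second kind are about \<open>q\<close> times as numerous as those
  of the first, but \<open>q\<close> times as short, so both kinds together have measure of order
  \<open>1/q\<close>.\<close>

lemma not_good_real_cases:
  fixes t r :: real and q :: nat
  assumes q: "q \<ge> 2" and t: "\<bar>t\<bar> \<le> r" and bad: "\<not> good_real q t"
  shows "(\<exists>z\<in>{-\<lceil>r\<rceil> - 1..\<lceil>r\<rceil> + 1}. \<bar>t - of_int z\<bar> \<le> 1 / q) \<or>
    (\<exists>z\<in>{-\<lceil>q * r\<rceil> - 1..\<lceil>q * r\<rceil> + 1}. \<bar>t - of_int z / q\<bar> \<le> 1 / q\<^sup>2)"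
proof -
  have near: "\<exists>z\<in>{-\<lceil>R\<rceil> - 1..\<lceil>R\<rceil> + 1}. \<bar>x - of_int z\<bar> \<le> e"
    if "\<bar>x\<bar> \<le> R" "frac x \<notin> {e..1 - e}" for x R e :: real
  proof -
    have fl: "of_int \<lfloor>x\<rfloor> \<le> x" "x < of_int \<lfloor>x\<rfloor> + 1" by linarith+
    have fr: "frac x = x - of_int \<lfloor>x\<rfloor>" by (simp add: frac_def)
    have R: "-\<lceil>R\<rceil> - 1 \<le> \<lfloor>x\<rfloor>" "\<lfloor>x\<rfloor> + 1 \<le> \<lceil>R\<rceil> + 1" using that(1) by linarith+
    show ?thesis
    proof (cases "frac x < e")
      case True
      then show ?thesis using R fl fr by (intro bexI[of _ "\<lfloor>x\<rfloor>"]) auto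
    next
      case False
      then have "frac x > 1 - e" using that(2) by auto
      then show ?thesis using R fl fr by (intro bexI[of _ "\<lfloor>x\<rfloor> + 1"]) auto
    qed
  qed
  from bad consider "frac t \<notin> {1 / q..1 - 1 / q}" | "frac (q * t) \<notin> {1 / q..1 - 1 / q}"
    unfolding good_real_def by blast
  then show ?thesis
  proof cases
    case 1
    from near[OF t this] show ?thesis by blast
  next
    case 2
    have "\<bar>q * t\<bar> \<le> q * r" using t by (simp add: abs_mult mult_left_mono)
    from near[OF this 2] obtain z where z: "z \<in> {-\<lceil>q * r\<rceil> - 1..\<lceil>q * r\<rceil> + 1}" "\<bar>q * t - of_int z\<bar> \<le> 1 / q" by blast
    have "t - of_int z / q = (q * t - of_int z) / q" using q by (simp add: field_simps)
    then have "\<bar>t - of_int z / q\<bar> = \<bar>q * t - of_int z\<bar> / q" by simp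
    also have "\<dots> \<le> (1 / q) / q" using z(2) by (intro divide_right_mono) auto
    finally have "\<bar>t - of_int z / q\<bar> \<le> 1 / q\<^sup>2" by (simp add: power2_eq_square)
    with z(1) show ?thesis by blast
  qed
qed

lemma measure_slab_le:
  fixes i :: "'m::finite"
  assumes "w \<ge> 0" "\<rho> \<ge> 0"
  shows "cbox (\<chi> l. if l = i then a - w else - \<rho>) (\<chi> l. if l = i then a + w else \<rho>) \<in> lmeasurable"
    "measure lebesgue (cbox (\<chi> l. if l = i then a - w else - \<rho>) (\<chi> l. if l = i then a + w else \<rho>)) = 2 * w * (2 * \<rho>) ^ (CARD('m) - 1)"
proof -
  let ?a = "(\<chi> l. if l = i then a - w else - \<rho>) :: real ^ 'm" and ?b = "(\<chi> l. if l = i then a + w else \<rho>) :: real ^ 'm"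
  show "cbox ?a ?b \<in> lmeasurable" by (rule lmeasurable_cbox)
  have "?a $ l \<le> ?b $ l" for l using assms by auto
  then have "cbox ?a ?b \<noteq> {}" using interval_ne_empty_cart(1)[of ?a ?b] by blast
  then have "measure lborel (cbox ?a ?b) = (\<Prod>l\<in>UNIV. ?b $ l - ?a $ l)" by (rule content_cbox_cart)
  also have "\<dots> = (2 * w) * (\<Prod>l\<in>UNIV - {i}. ?b $ l - ?a $ l)"
    by (subst prod.remove[of _ i]) auto
  also have "(\<Prod>l\<in>UNIV - {i}. ?b $ l - ?a $ l) = (\<Prod>l\<in>UNIV - {i}. 2 * \<rho>)"
    by (rule prod.cong) auto
  also have "\<dots> = (2 * \<rho>) ^ (CARD('m) - 1)" by (simp add: prod_constant card_Diff_singleton)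
  finally show "measure lebesgue (cbox ?a ?b) = 2 * w * (2 * \<rho>) ^ (CARD('m) - 1)" by simp
qed

lemma bad_points_small:
  fixes \<rho> h \<eta> :: real
  assumes \<rho>: "\<rho> > 0" and h: "h > 0" and \<eta>: "\<eta> > 0"
  shows "\<exists>q T. q \<ge> 2 \<and> even q \<and> T \<in> lmeasurable \<and> measure lebesgue T \<le> \<eta> \<and>
     {x :: real ^ 'm::finite. norm x \<le> \<rho> \<and> \<not> good_point q ((1 / h) *\<^sub>R x)} \<subseteq> T"
proof -
  define r where "r = \<rho> / h"
  have r: "r > 0" using \<rho> h by (simp add: r_def)
  define P where "P = (2 * \<rho>) ^ (CARD('m) - 1)"
  have P: "P > 0" using \<rho> by (simp add: P_def)
  \<comment> \<open>Each coordinate direction has at most \<open>2 * r + 5\<close> slabs at integers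
    and \<open>2 * (q * r) + 5\<close> at multiples of \<open>1/q\<close>. Weighted by their widths
    they add up to \<open>4 * r + 5 + 5 / q\<close>, which \<open>4 * r + 12\<close>
    absorbs.\<close>
  define C where "C = real CARD('m) * (2 * h * P) * (4 * r + 12)"
  obtain q0 :: nat where q0: "C / \<eta> < q0" using reals_Archimedean2 by blast
  define q where "q = 2 * (q0 + 1)"
  have q: "q \<ge> 2" "even q" and qC: "C / q \<le> \<eta>"
  proof -
    show "q \<ge> 2" "even q" by (auto simp: q_def)
    have "C < \<eta> * q0" using q0 \<eta> by (simp add: field_simps)
    also have "\<dots> \<le> \<eta> * q" using \<eta> by (intro mult_left_mono) (auto simp: q_def)
    finally show "C / q \<le> \<eta>" using \<open>q \<ge> 2\<close> by (simp add: field_simps)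
  qed
  define S where "S i a w = cbox (\<chi> l. if l = i then a - w else - \<rho>) ((\<chi> l. if l = i then a + w else \<rho>) :: real ^ 'm)" for i a w
  define Z1 where "Z1 = {-\<lceil>r\<rceil> - 1..\<lceil>r\<rceil> + 1}"
  define Z2 where "Z2 = {-\<lceil>q * r\<rceil> - 1..\<lceil>q * r\<rceil> + 1}"
  define T where "T = (\<Union>i. (\<Union>z\<in>Z1. S i (h * of_int z) (h / q)) \<union> (\<Union>z\<in>Z2. S i (h * (of_int z / q)) (h / q\<^sup>2)))"
  have mS: "S i a w \<in> lmeasurable" "measure lebesgue (S i a w) = 2 * w * P" if "w \<ge> 0" for i a w
    unfolding S_def P_def using measure_slab_le[OF that less_imp_le[OF \<rho>]] by auto
  have w: "h / q \<ge> 0" "h / q\<^sup>2 \<ge> 0" using h by auto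
  have fZ: "finite Z1" "finite Z2" by (auto simp: Z1_def Z2_def)
  have c1: "real (card Z1) \<le> 2 * r + 5"
  proof -
    have "real (card Z1) = of_int (2 * \<lceil>r\<rceil> + 3)" using r by (simp add: Z1_def)
    also have "\<dots> \<le> 2 * r + 5" by linarith
    finally show ?thesis .
  qed
  have c2: "real (card Z2) \<le> 2 * (q * r) + 5"
  proof -
    have "q * r \<ge> 0" using r by simp
    then have "real (card Z2) = of_int (2 * \<lceil>q * r\<rceil> + 3)" by (simp add: Z2_def)
    also have "\<dots> \<le> 2 * (q * r) + 5" by linarith
    finally show ?thesis .
  qed
  have u1: "(\<Union>z\<in>Z1. S i (h * of_int z) (h / q)) \<in> lmeasurable"
    "measure lebesgue (\<Union>z\<in>Z1. S i (h * of_int z) (h / q)) \<le> real (card Z1) * (2 * (h / q) * P)" for i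
  proof -
    show "(\<Union>z\<in>Z1. S i (h * of_int z) (h / q)) \<in> lmeasurable"
      using fZ mS(1)[OF w(1)] by (intro fmeasurable.finite_UN) auto
    have "measure lebesgue (\<Union>z\<in>Z1. S i (h * of_int z) (h / q)) \<le> (\<Sum>z\<in>Z1. measure lebesgue (S i (h * of_int z) (h / q)))"
      by (rule measure_UNION_le[OF fZ(1)]) (use mS(1)[OF w(1)] fmeasurableD in blast)
    then show "measure lebesgue (\<Union>z\<in>Z1. S i (h * of_int z) (h / q)) \<le> real (card Z1) * (2 * (h / q) * P)"
      by (simp only: mS(2)[OF w(1)] sum_constant)
  qed
  have u2: "(\<Union>z\<in>Z2. S i (h * (of_int z / q)) (h / q\<^sup>2)) \<in> lmeasurable"
    "measure lebesgue (\<Union>z\<in>Z2. S i (h * (of_int z / q)) (h / q\<^sup>2)) \<le> real (card Z2) * (2 * (h / q\<^sup>2) * P)" for i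
  proof -
    show "(\<Union>z\<in>Z2. S i (h * (of_int z / q)) (h / q\<^sup>2)) \<in> lmeasurable"
      using fZ mS(1)[OF w(2)] by (intro fmeasurable.finite_UN) auto
    have "measure lebesgue (\<Union>z\<in>Z2. S i (h * (of_int z / q)) (h / q\<^sup>2)) \<le> (\<Sum>z\<in>Z2. measure lebesgue (S i (h * (of_int z / q)) (h / q\<^sup>2)))"
      by (rule measure_UNION_le[OF fZ(2)]) (use mS(1)[OF w(2)] fmeasurableD in blast)
    then show "measure lebesgue (\<Union>z\<in>Z2. S i (h * (of_int z / q)) (h / q\<^sup>2)) \<le> real (card Z2) * (2 * (h / q\<^sup>2) * P)"
      by (simp only: mS(2)[OF w(2)] sum_constant)
  qed
  let ?Ti = "\<lambda>i. (\<Union>z\<in>Z1. S i (h * of_int z) (h / q)) \<union> (\<Union>z\<in>Z2. S i (h * (of_int z / q)) (h / q\<^sup>2))"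
  have mi: "?Ti i \<in> lmeasurable" for i by (rule fmeasurable.Un[OF u1(1) u2(1)])
  have mle: "measure lebesgue (?Ti i) \<le> (2 * h * P) * (4 * r + 12) / q" for i
  proof -
    have qp: "real q > 0" "real q \<ge> 2" using q(1) by auto
    have "measure lebesgue (?Ti i) \<le> measure lebesgue (\<Union>z\<in>Z1. S i (h * of_int z) (h / q))
        + measure lebesgue (\<Union>z\<in>Z2. S i (h * (of_int z / q)) (h / q\<^sup>2))"
      using u1(1) u2(1) by (intro measure_Un_le fmeasurableD)
    also have "\<dots> \<le> real (card Z1) * (2 * (h / q) * P) + real (card Z2) * (2 * (h / q\<^sup>2) * P)"
      by (rule add_mono[OF u1(2) u2(2)])
    also have "\<dots> \<le> (2 * r + 5) * (2 * (h / q) * P) + (2 * (q * r) + 5) * (2 * (h / q\<^sup>2) * P)"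
      using c1 c2 h P by (intro add_mono mult_right_mono) auto
    also have "\<dots> = (2 * h * P) * (4 * r + 5 + 5 / q) / q"
      using qp by (simp add: field_simps power2_eq_square)
    also have "\<dots> \<le> (2 * h * P) * (4 * r + 12) / q"
    proof -
      have "5 / real q \<le> 5 / 2" using qp by (intro divide_left_mono) auto
      then show ?thesis using h P qp by (intro divide_right_mono mult_left_mono) auto
    qed
    finally show ?thesis .
  qed
  have T: "T \<in> lmeasurable" unfolding T_def using mi by (intro fmeasurable.finite_UN) auto
  have "measure lebesgue T \<le> (\<Sum>i\<in>(UNIV :: 'm set). measure lebesgue (?Ti i))"
    unfolding T_def by (rule measure_UNION_le[OF finite]) (use mi fmeasurableD in blast)
  also have "\<dots> \<le> (\<Sum>i\<in>(UNIV :: 'm set). (2 * h * P) * (4 * r + 12) / q)"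
    by (rule sum_mono) (rule mle)
  also have "\<dots> = C / q" by (simp add: C_def)
  finally have "measure lebesgue T \<le> \<eta>" using qC by linarith
  moreover have "{x :: real ^ 'm. norm x \<le> \<rho> \<and> \<not> good_point q ((1 / h) *\<^sub>R x)} \<subseteq> T"
  proof
    fix x :: "real ^ 'm" assume "x \<in> {x. norm x \<le> \<rho> \<and> \<not> good_point q ((1 / h) *\<^sub>R x)}"
    then have x: "norm x \<le> \<rho>" "\<not> good_point q ((1 / h) *\<^sub>R x)" by auto
    have xl: "\<bar>x $ l\<bar> \<le> \<rho>" for l using component_le_norm_cart[of x l] x(1) by linarith
    have xl': "- \<rho> \<le> x $ l" for l using xl[of l] by linarith
    obtain i where i: "\<not> good_real q (x $ i / h)" using x(2) unfolding good_point_def by auto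
    have "\<bar>x $ i / h\<bar> \<le> r" using xl[of i] h by (simp add: r_def divide_right_mono)
    have scl: "\<bar>x $ i - h * t\<bar> = h * \<bar>x $ i / h - t\<bar>" for t
    proof -
      have "x $ i - h * t = h * (x $ i / h - t)" using h by (simp add: right_diff_distrib)
      then show ?thesis using h by (simp add: abs_mult)
    qed
    note nr = not_good_real_cases[OF q(1) \<open>\<bar>x $ i / h\<bar> \<le> r\<close> i]
    consider z where "z \<in> Z1" "\<bar>x $ i / h - of_int z\<bar> \<le> 1 / q" | z where "z \<in> Z2" "\<bar>x $ i / h - of_int z / q\<bar> \<le> 1 / q\<^sup>2"
      using nr unfolding Z1_def Z2_def by blast
    then show "x \<in> T"
    proof cases
      case 1
      have "\<bar>x $ i - h * of_int z\<bar> = h * \<bar>x $ i / h - of_int z\<bar>"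
        using scl[of "of_int z"] .
      also have "\<dots> \<le> h * (1 / q)" using 1(2) h by (intro mult_left_mono) auto
      finally have "\<bar>x $ i - h * of_int z\<bar> \<le> h / q" by simp
      then have "x \<in> S i (h * of_int z) (h / q)"
        using xl xl' by (auto simp: S_def mem_box_cart abs_le_iff)
      then show ?thesis unfolding T_def using 1(1) by blast
    next
      case 2
      have "\<bar>x $ i - h * (of_int z / q)\<bar> = h * \<bar>x $ i / h - of_int z / q\<bar>"
        using scl[of "of_int z / q"] .
      also have "\<dots> \<le> h * (1 / q\<^sup>2)" using 2(2) h by (intro mult_left_mono) auto
      finally have "\<bar>x $ i - h * (of_int z / q)\<bar> \<le> h / q\<^sup>2" by simp
      then have "x \<in> S i (h * (of_int z / q)) (h / q\<^sup>2)"
        using xl xl' by (auto simp: S_def mem_box_cart abs_le_iff)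
      then show ?thesis unfolding T_def using 2(1) by blast
    qed
  qed
  ultimately show ?thesis using q T by blast
qed

section \<open>Lattice cells of mesh h\<close>

definition cell_index :: "real \<Rightarrow> real ^ 'm::finite \<Rightarrow> 'm \<Rightarrow> int" where
  "cell_index h x i = \<lfloor>x $ i / h\<rfloor>"

lemma cell_index_bounds:
  assumes "h > 0"
  shows "h * of_int (cell_index h x i) \<le> x $ i" "x $ i < h * of_int (cell_index h x i) + h"
proof -
  have 1: "of_int (cell_index h x i) \<le> x $ i / h" "x $ i / h < of_int (cell_index h x i) + 1"
    unfolding cell_index_def by linarith+
  then show "h * of_int (cell_index h x i) \<le> x $ i" using assms by (simp add: field_simps)
  have "x $ i < (of_int (cell_index h x i) + 1) * h" using 1(2) assms by (simp add: pos_divide_less_eq)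
  then show "x $ i < h * of_int (cell_index h x i) + h" by (simp add: algebra_simps)
qed

lemma dist_same_cell:
  fixes x y :: "real ^ 'm::finite"
  assumes h: "h > 0" and eq: "cell_index h x = cell_index h y"
  shows "dist x y \<le> real CARD('m) * h"
proof -
  have "\<bar>(x - y) $ i\<bar> \<le> h" for i
    using cell_index_bounds[OF h, of x i] cell_index_bounds[OF h, of y i] eq by (simp add: abs_le_iff)
  then have "(\<Sum>i\<in>UNIV. \<bar>(x - y) $ i\<bar>) \<le> real CARD('m) * h"
    by (intro sum_bounded_above[of UNIV, simplified]) auto
  then show ?thesis using norm_le_l1_cart[of "x - y"] by (simp add: dist_norm)
qed

lemma cell_box:
  fixes c :: "'m::finite \<Rightarrow> int"
  assumes h: "h > 0"
  shows "box (\<chi> i. h * of_int (c i)) (\<chi> i. h * of_int (c i) + h) \<subseteq> {x. cell_index h x = c}"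
proof
  fix x assume x: "x \<in> box (\<chi> i. h * of_int (c i)) (\<chi> i. h * of_int (c i) + h)"
  have "cell_index h x i = c i" for i
  proof -
    have "h * of_int (c i) < x $ i" "x $ i < h * of_int (c i) + h"
      using x unfolding mem_box_cart by auto
    then have "of_int (c i) \<le> x $ i / h" "x $ i / h < of_int (c i) + 1"
      using h by (auto simp: field_simps)
    then show ?thesis unfolding cell_index_def by (rule floor_unique)
  qed
  then show "x \<in> {x. cell_index h x = c}" by (auto simp: fun_eq_iff)
qed

text \<open>The open boxes inside the cells are disjoint and lie in \<open>V\<close>. This is how
  comparisons of volumes become comparisons of numbers of cells.\<close>

lemma card_cells_le:
  fixes I :: "('m::finite \<Rightarrow> int) set"
  assumes h: "h > 0" and I: "finite I" and V: "V \<in> lmeasurable" "\<And>x. cell_index h x \<in> I \<Longrightarrow> x \<in> V"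
  shows "real (card I) * h ^ CARD('m) \<le> measure lebesgue V"
proof -
  let ?B = "\<lambda>c. box (\<chi> i. h * of_int (c i)) ((\<chi> i. h * of_int (c i) + h) :: real ^ 'm)"
  have mB: "measure lebesgue (?B c) = h ^ CARD('m)" for c
  proof -
    let ?a = "(\<chi> i. h * of_int (c i)) :: real ^ 'm" and ?b = "(\<chi> i. h * of_int (c i) + h) :: real ^ 'm"
    have "?a $ l \<le> ?b $ l" for l using h by auto
    then have "cbox ?a ?b \<noteq> {}" using interval_ne_empty_cart(1)[of ?a ?b] by blast
    then have "measure lborel (cbox ?a ?b) = (\<Prod>l\<in>UNIV. ?b $ l - ?a $ l)" by (rule content_cbox_cart)
    also have "\<dots> = h ^ CARD('m)" by (simp add: prod_constant)
    finally have "measure lborel (cbox ?a ?b) = h ^ CARD('m)" .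
    moreover have "measure lborel (box ?a ?b) = measure lborel (cbox ?a ?b)"
      by (simp only: measure_lborel_box_eq measure_lborel_cbox_eq)
    ultimately show ?thesis by simp
  qed
  have lm: "?B c \<in> lmeasurable" for c by (rule lmeasurable_box)
  have dj: "disjoint_family_on ?B I"
    unfolding disjoint_family_on_def using cell_box[OF h] by blast
  have "real (card I) * h ^ CARD('m) = (\<Sum>c\<in>I. measure lebesgue (?B c))" by (simp add: mB)
  also have "\<dots> = measure lebesgue (\<Union>c\<in>I. ?B c)"
  proof (rule measure_finite_Union[symmetric, OF I _ dj])
    show "?B ` I \<subseteq> sets lebesgue" using fmeasurableD[OF lm] by blast
    show "\<And>c. c \<in> I \<Longrightarrow> emeasure lebesgue (?B c) \<noteq> \<infinity>" using fmeasurableD2[OF lm] by simp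
  qed
  also have "\<dots> \<le> measure lebesgue V"
  proof (rule measure_mono_fmeasurable[OF _ _ V(1)])
    show "(\<Union>c\<in>I. ?B c) \<subseteq> V" using V(2) cell_box[OF h] by blast
    show "(\<Union>c\<in>I. ?B c) \<in> sets lebesgue" using I lm fmeasurableD by blast
  qed
  finally show ?thesis .
qed

lemma finite_cell_index_image:
  fixes S :: "(real ^ 'm::finite) set"
  assumes h: "h > 0" and S: "\<And>x. x \<in> S \<Longrightarrow> norm x \<le> \<rho>"
  shows "finite (cell_index h ` S)"
proof (rule finite_subset)
  show "cell_index h ` S \<subseteq> Pi\<^sub>E UNIV (\<lambda>_. {\<lfloor>- \<rho> / h\<rfloor>..\<lfloor>\<rho> / h\<rfloor>})"
  proof
    fix c assume "c \<in> cell_index h ` S"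
    then obtain x where x: "x \<in> S" "c = cell_index h x" by blast
    have "\<bar>x $ i\<bar> \<le> \<rho>" for i using component_le_norm_cart[of x i] S[OF x(1)] by linarith
    then have "- \<rho> \<le> x $ i \<and> x $ i \<le> \<rho>" for i
      unfolding abs_le_iff by (metis minus_le_iff)
    then have "- \<rho> / h \<le> x $ i / h \<and> x $ i / h \<le> \<rho> / h" for i
      using divide_right_mono[of "- \<rho>" "x $ i" h] divide_right_mono[of "x $ i" \<rho> h] h by simp
    then show "c \<in> Pi\<^sub>E UNIV (\<lambda>_. {\<lfloor>- \<rho> / h\<rfloor>..\<lfloor>\<rho> / h\<rfloor>})"
      by (simp add: x(2) cell_index_def floor_mono PiE_iff)
  qed
  show "finite (Pi\<^sub>E (UNIV :: 'm set) (\<lambda>_. {\<lfloor>- \<rho> / h\<rfloor>..\<lfloor>\<rho> / h\<rfloor>}))"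
    by (intro finite_PiE) auto
qed

lemma integral_indicator_lebesgue_on:
  assumes U: "U \<in> sets lebesgue" and S: "S \<in> lmeasurable" "S \<subseteq> U"
  shows "integrable (lebesgue_on U) (indicator S :: _ \<Rightarrow> real)"
    "(LINT w|lebesgue_on U. indicator S w :: real) = measure lebesgue S"
proof -
  have eq: "(\<lambda>w. indicator U w *\<^sub>R indicator S w) = (indicator S :: _ \<Rightarrow> real)"
    using S(2) by (auto simp: fun_eq_iff indicator_def)
  have "integrable lebesgue (indicator S :: _ \<Rightarrow> real)"
    using S(1) by (intro integrable_real_indicator) (auto simp: fmeasurable_def)
  then show "integrable (lebesgue_on U) (indicator S :: _ \<Rightarrow> real)"
    using U by (subst integrable_restrict_space) (simp_all add: eq del: real_scaleR_def)
  have "(LINT w|lebesgue_on U. indicator S w :: real) = (LINT w|lebesgue. indicator U w *\<^sub>R indicator S w)"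
    using U by (subst integral_restrict_space) simp_all
  then show "(LINT w|lebesgue_on U. indicator S w :: real) = measure lebesgue S"
    unfolding eq using S(1) fmeasurableD by simp
qed

text \<open>
  Only the volumes of the target sets matter: fine cells meeting the compact core of \<open>W k\<close> are sent
  injectively into \<open>D k\<close>, and the few remaining cells are moved out of the way by a fixed shift.
\<close>

lemma approximation_by_symplectic_diffeo:
  fixes U :: "(real ^ ('n::finite + 'n)) set" and u :: "real ^ ('n + 'n) \<Rightarrow> real ^ ('n + 'n)"
    and W :: "'k \<Rightarrow> (real ^ ('n + 'n)) set" and b :: "'k \<Rightarrow> real"
  assumes U: "U \<in> sets lebesgue" and \<rho>: "\<rho> > 0" "\<And>x. x \<in> U \<Longrightarrow> norm x \<le> \<rho>"
    and R: "\<And>x. x \<in> U \<Longrightarrow> norm (u x) \<le> R"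
    and KK: "finite KK" and W: "\<And>k. k \<in> KK \<Longrightarrow> W k \<in> sets lebesgue" "disjoint_family_on W KK"
      "U = (\<Union>k\<in>KK. W k)" "\<And>k. k \<in> KK \<Longrightarrow> W k \<noteq> {}"
    and b: "\<And>k. k \<in> KK \<Longrightarrow> b k \<ge> 0" and e: "e > 0" and p: "p > 0" and \<tau>: "\<tau> > 0"
    and targets: "\<And>h0. h0 > 0 \<Longrightarrow> \<exists>h D. 0 < h \<and> h < h0 \<and> (\<forall>k\<in>KK. finite (D k)) \<and> disjoint_family_on D KK \<and>
      (\<forall>k\<in>KK. measure lebesgue (W k) + e \<le> real (card (D k)) * h ^ CARD('n + 'n)) \<and>
      (\<forall>k\<in>KK. \<forall>x\<in>W k. \<forall>z. cell_index h z \<in> D k \<longrightarrow> norm (z - u x) \<le> b k)"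
  shows "\<exists>\<Phi>. symplectic_diffeo \<Phi> \<and>
     (LINT x|lebesgue_on U. norm (u x - \<Phi> x) powr p) \<le> (\<Sum>k\<in>KK. b k powr p * measure lebesgue (W k)) + \<tau>"
proof (cases "KK = {}")
  case True
  then have "U = {}" using W(3) by simp
  then have "(LINT x|lebesgue_on U. norm (u x - x) powr p) = 0"
    by (simp add: integral_restrict_space)
  then show ?thesis using True \<tau> by (intro exI[of _ "\<lambda>x. x"]) (simp add: symplectic_diffeo_id)
next
  case False
  define m where "m = real CARD('n + 'n)"
  have m: "m \<ge> 1" using zero_less_card_finite[where 'a="'n + 'n"] unfolding m_def by linarith
  define Bm where "Bm = (\<Sum>k\<in>KK. b k)"
  have Bm: "b k \<le> Bm" "Bm \<ge> 0" if "k \<in> KK" for k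
    unfolding Bm_def using b KK that by (auto intro!: member_le_sum sum_nonneg)
  obtain k0 where k0: "k0 \<in> KK" using False by blast
  have R0: "R \<ge> 0" using W(4)[OF k0] W(3) k0 R norm_ge_zero order.trans by blast
  \<comment> \<open>\<open>R1\<close> bounds all points of target cells. \<open>R2\<close> bounds
    \<open>norm (u x - \<Phi> x)\<close> at all good points, including those in cells shifted aside
    by at most \<open>R1 + \<rho> + 4\<close>.\<close>
  define R1 where "R1 = R + Bm + 1"
  define R2 where "R2 = 2 * R1 + 2 * \<rho> + 5 + R"
  have R12: "R1 \<ge> 1" "R2 \<ge> R + R1" "R2 \<ge> 1" using R0 Bm(2)[OF k0] \<rho>(1) by (auto simp: R1_def R2_def)
  \<comment> \<open>\<open>e1\<close> is charged twice: as extra volume of \<open>V k\<close>, to be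
    covered by the reserve \<open>e\<close> when cells are counted, and as measure of
    \<open>W k - C k\<close>, where only the bound \<open>R2\<close> is available.\<close>
  define e1 where "e1 = min (e / 2) (\<tau> / (2 * real (card KK) * (R2 powr p)))"
  have cK: "real (card KK) > 0" using KK False by (simp add: card_gt_0_iff)
  have R2p: "R2 powr p > 0" using R12 by simp
  have e1: "e1 > 0" "2 * e1 \<le> e" "real (card KK) * (R2 powr p * e1) \<le> \<tau> / 2"
  proof -
    show "e1 > 0" "2 * e1 \<le> e" using e \<tau> cK R2p by (auto simp: e1_def)
    have "e1 \<le> \<tau> / (2 * real (card KK) * (R2 powr p))" by (simp add: e1_def)
    then show "real (card KK) * (R2 powr p * e1) \<le> \<tau> / 2"
      using cK R2p by (simp add: field_simps)
  qed
  have WU: "W k \<subseteq> U" if "k \<in> KK" for k using W(3) that by blast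
  have bdU: "bounded U" using \<rho>(2) by (auto simp: bounded_iff)
  have lmW: "W k \<in> lmeasurable" if "k \<in> KK" for k
    using W(1)[OF that] bounded_subset[OF bdU WU[OF that]] by (simp add: bounded_set_imp_lmeasurable)
  have "\<exists>C. compact C \<and> C \<subseteq> W k \<and> measure lebesgue (W k - C) \<le> e1" if k: "k \<in> KK" for k
  proof -
    obtain C where C: "closed C" "C \<subseteq> W k" "W k - C \<in> lmeasurable" "emeasure lebesgue (W k - C) < ennreal e1"
      using sets_lebesgue_inner_closed[OF W(1)[OF k] e1(1)] by blast
    have "compact C"
      using C(1) bounded_subset[OF bdU order.trans[OF C(2) WU[OF k]]] by (simp add: compact_eq_bounded_closed)
    moreover have "measure lebesgue (W k - C) \<le> e1"
      using C(3,4) e1(1) by (simp add: emeasure_eq_measure2 ennreal_less_iff)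
    ultimately show ?thesis using C(2) by blast
  qed
  then obtain C where C: "\<And>k. k \<in> KK \<Longrightarrow> compact (C k)" "\<And>k. k \<in> KK \<Longrightarrow> C k \<subseteq> W k"
    "\<And>k. k \<in> KK \<Longrightarrow> measure lebesgue (W k - C k) \<le> e1" by metis
  have lmC: "C k \<in> lmeasurable" if "k \<in> KK" for k using C(1)[OF that] by (rule lmeasurable_compact)
  have Cdis: "C k \<inter> C l = {}" if "k \<in> KK" "l \<in> KK" "k \<noteq> l" for k l
    using W(2) C(2) that unfolding disjoint_family_on_def by blast
  \<comment> \<open>Keeping \<open>V k\<close> away from the other cores ensures that, for fine
    meshes, no cell meets two cores, so the target class of a cell is well defined.\<close>
  have "\<exists>V. open V \<and> C k \<subseteq> V \<and> V \<in> lmeasurable \<and> measure lebesgue V \<le> measure lebesgue (C k) + e1 \<and>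
      (\<forall>l\<in>KK. l \<noteq> k \<longrightarrow> V \<inter> C l = {})" if k: "k \<in> KK" for k
  proof -
    obtain O' where O12: "open O'" "C k \<subseteq> O'" "O' - C k \<in> lmeasurable" "emeasure lebesgue (O' - C k) < ennreal e1"
      using sets_lebesgue_outer_open[OF fmeasurableD[OF lmC[OF k]] e1(1)] by blast
    have Oeq: "O' = C k \<union> (O' - C k)" using O12(2) by blast
    have O3: "O' \<in> lmeasurable" using fmeasurable.Un[OF lmC[OF k] O12(3)] Oeq by simp
    have "measure lebesgue O' \<le> measure lebesgue (C k) + measure lebesgue (O' - C k)"
      using measure_Un_le[OF fmeasurableD[OF lmC[OF k]] fmeasurableD[OF O12(3)]] Oeq by simp
    moreover have "measure lebesgue (O' - C k) \<le> e1"
      using O12(3,4) e1(1) by (simp add: emeasure_eq_measure2 ennreal_less_iff)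
    ultimately have O4: "measure lebesgue O' \<le> measure lebesgue (C k) + e1" by linarith
    note O = O12(1,2) O3 O4
    let ?V = "O' - (\<Union>l\<in>KK - {k}. C l)"
    have cl: "closed (\<Union>l\<in>KK - {k}. C l)" using KK C(1) by (intro closed_UN) (auto simp: compact_imp_closed)
    have V: "open ?V" using O(1) cl by (rule open_Diff)
    have CV: "C k \<subseteq> ?V" using O(2) Cdis k by blast
    have lmV: "?V \<in> lmeasurable" using O(3) cl by (intro fmeasurable_Diff) (auto intro!: borel_closed sets_completionI_sets)
    have "measure lebesgue ?V \<le> measure lebesgue O'"
      by (rule measure_mono_fmeasurable[OF _ _ O(3)]) (use lmV fmeasurableD in auto)
    then show ?thesis using V CV lmV O(4) by (intro exI[of _ ?V]) auto
  qed
  then have "\<forall>k\<in>KK. \<exists>V. open V \<and> C k \<subseteq> V \<and> V \<in> lmeasurable \<and> measure lebesgue V \<le> measure lebesgue (C k) + e1 \<and>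
      (\<forall>l\<in>KK. l \<noteq> k \<longrightarrow> V \<inter> C l = {})" by (rule ballI)
  from bchoice[OF this] obtain V where V0: "\<forall>k\<in>KK. open (V k) \<and> C k \<subseteq> V k \<and> V k \<in> lmeasurable \<and>
      measure lebesgue (V k) \<le> measure lebesgue (C k) + e1 \<and> (\<forall>l\<in>KK. l \<noteq> k \<longrightarrow> V k \<inter> C l = {})" by (elim exE) (rule that)
  have V: "open (V k)" "C k \<subseteq> V k" "V k \<in> lmeasurable"
    "measure lebesgue (V k) \<le> measure lebesgue (C k) + e1"
    "l \<in> KK \<Longrightarrow> l \<noteq> k \<Longrightarrow> V k \<inter> C l = {}" if "k \<in> KK" for k l
    using bspec[OF V0 that] by blast+
  have "\<exists>s>0. \<forall>x\<in>C k. ball x s \<subseteq> V k" if k: "k \<in> KK" for k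
  proof -
    obtain s where "s > 0" "(\<Union>x\<in>C k. ball x s) \<subseteq> V k"
      using compact_subset_open_imp_ball_epsilon_subset[OF C(1)[OF k] V(1)[OF k] V(2)[OF k]] by blast
    then show ?thesis by blast
  qed
  then obtain s where s: "\<And>k. k \<in> KK \<Longrightarrow> s k > 0" "\<And>k x. k \<in> KK \<Longrightarrow> x \<in> C k \<Longrightarrow> ball x (s k) \<subseteq> V k" by metis
  \<comment> \<open>Below this mesh, two points of one cell are less than \<open>s k\<close> apart,
    so a cell meeting \<open>C k\<close> lies in \<open>V k\<close>. The entry 1 bounds the cell
    size in the estimates for the shift.\<close>
  define h0 where "h0 = Min (insert 1 ((\<lambda>k. s k / m) ` KK))"
  have h0: "h0 > 0" "h0 \<le> 1" "\<And>k. k \<in> KK \<Longrightarrow> m * h0 \<le> s k"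
  proof -
    have fin: "finite (insert 1 ((\<lambda>k. s k / m) ` KK))" using KK by simp
    show "h0 > 0" unfolding h0_def using s(1) m fin by (subst Min_gr_iff) auto
    show "h0 \<le> 1" unfolding h0_def using fin by (intro Min_le) auto
    show "m * h0 \<le> s k" if "k \<in> KK" for k
    proof -
      have "h0 \<le> s k / m" unfolding h0_def using fin that by (intro Min_le) auto
      then show ?thesis using m by (simp add: field_simps)
    qed
  qed
  obtain h D where h: "0 < h" "h < h0" and D: "\<forall>k\<in>KK. finite (D k)" "disjoint_family_on D KK"
    "\<forall>k\<in>KK. measure lebesgue (W k) + e \<le> real (card (D k)) * h ^ CARD('n + 'n)"
    "\<forall>k\<in>KK. \<forall>x\<in>W k. \<forall>z. cell_index h z \<in> D k \<longrightarrow> norm (z - u x) \<le> b k"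
    using targets[OF h0(1)] by blast
  have h1: "h < 1" using h h0 by linarith
  define I where "I k = cell_index h ` C k" for k
  have IV: "x \<in> V k" if k: "k \<in> KK" and x: "cell_index h x \<in> I k" for x k
  proof -
    obtain y where y: "y \<in> C k" "cell_index h x = cell_index h y" using x by (auto simp: I_def)
    have "dist y x \<le> m * h" using dist_same_cell[OF h(1) y(2)[symmetric]] by (simp add: m_def)
    also have "\<dots> < s k" using h(2) h0(3)[OF k] m by (meson mult_strict_left_mono less_le_trans zero_less_one)
    finally show ?thesis using s(2)[OF k y(1)] by auto
  qed
  have finI: "finite (I k)" if k: "k \<in> KK" for k
    unfolding I_def by (rule finite_cell_index_image[OF h(1), of _ \<rho>]) (use C(2)[OF k] WU[OF k] \<rho>(2) in blast)
  \<comment> \<open>Here the surplus volume of the targets is spent: the cells meeting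
    \<open>C k\<close> fit into \<open>V k\<close>, whose volume exceeds that of \<open>W k\<close>
    by at most \<open>e\<close>.\<close>
  have cardI: "card (I k) \<le> card (D k)" if k: "k \<in> KK" for k
  proof -
    have "real (card (I k)) * h ^ CARD('n + 'n) \<le> measure lebesgue (V k)"
      by (rule card_cells_le[OF h(1) finI[OF k] V(3)[OF k] IV[OF k]])
    also have "\<dots> \<le> measure lebesgue (W k) + e"
      using V(4)[OF k] measure_mono_fmeasurable[OF C(2)[OF k] fmeasurableD[OF lmC[OF k]] lmW[OF k]] e1 by linarith
    also have "\<dots> \<le> real (card (D k)) * h ^ CARD('n + 'n)" using D(3) k by blast
    finally have "real (card (I k)) \<le> real (card (D k))"
      using h(1) by (simp add: mult_le_cancel_right)
    then show ?thesis by simp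
  qed
  have "\<exists>g. inj_on g (I k) \<and> g ` I k \<subseteq> D k" if k: "k \<in> KK" for k
  proof -
    obtain f where "f ` I k \<subseteq> D k" "inj_on f (I k)"
      using card_le_inj[OF finI[OF k] D(1)[rule_format, OF k] cardI[OF k]] by (elim exE conjE) (rule that)
    then show ?thesis by (intro exI[of _ f] conjI)
  qed
  then obtain g where g: "\<And>k. k \<in> KK \<Longrightarrow> inj_on (g k) (I k)" "\<And>k. k \<in> KK \<Longrightarrow> g k ` I k \<subseteq> D k" by metis
  have Idis: "k = l" if kl: "k \<in> KK" "l \<in> KK" "c \<in> I k" "c \<in> I l" for k l c
  proof (rule ccontr)
    assume "k \<noteq> l"
    obtain y where y: "y \<in> C l" "c = cell_index h y" using kl(4) by (auto simp: I_def)
    then have "y \<in> V k" using IV[OF kl(1)] kl(3) by blast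
    then show False using V(5)[OF kl(1,2)] \<open>k \<noteq> l\<close> y(1) by blast
  qed
  define i1 :: "'n + 'n" where "i1 = Inl undefined"
  \<comment> \<open>The shift carries every cell of \<open>U\<close> beyond \<open>R1\<close> in
    direction \<open>i1\<close>, so shifted cells cannot collide with targets; \<rho> accounts for
    the position of \<open>U\<close>, the constant 3 for the size of a cell.\<close>
  define T where "T = \<lceil>(R1 + \<rho> + 3) / h\<rceil>"
  have T: "R1 + \<rho> + 3 \<le> h * of_int T" "h * of_int T \<le> R1 + \<rho> + 4"
  proof -
    have "(R1 + \<rho> + 3) / h \<le> of_int T" "of_int T \<le> (R1 + \<rho> + 3) / h + 1" unfolding T_def by linarith+
    then show "R1 + \<rho> + 3 \<le> h * of_int T" using h(1) by (simp add: field_simps)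
    have "h * of_int T \<le> h * ((R1 + \<rho> + 3) / h + 1)"
      using \<open>of_int T \<le> (R1 + \<rho> + 3) / h + 1\<close> h(1) by (intro mult_left_mono) auto
    also have "\<dots> = R1 + \<rho> + 3 + h" using h(1) by (simp add: field_simps)
    finally show "h * of_int T \<le> R1 + \<rho> + 4" using h1 by linarith
  qed
  define d where "d c = (if \<exists>k\<in>KK. c \<in> I k then g (THE k. k \<in> KK \<and> c \<in> I k) c else c(i1 := c i1 + T))" for c
  have dI: "d c = g k c" if "k \<in> KK" "c \<in> I k" for k c
  proof -
    have "(THE k. k \<in> KK \<and> c \<in> I k) = k" by (rule the_equality) (use that Idis in blast)+
    then show ?thesis using that by (auto simp: d_def)
  qed
  have dN: "d c = c(i1 := c i1 + T)" if "\<not> (\<exists>k\<in>KK. c \<in> I k)" for c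
    using that by (simp add: d_def)
  define \<A> where "\<A> = cell_index h ` U"
  have finA: "finite \<A>" unfolding \<A>_def by (rule finite_cell_index_image[OF h(1) \<rho>(2)])
  have Dbound: "norm z \<le> R1" if k: "k \<in> KK" and z: "cell_index h z \<in> D k" for k z
  proof -
    obtain x where x: "x \<in> W k" using W(4)[OF k] by blast
    have "norm (z - u x) \<le> b k" using D(4) k x z by blast
    moreover have "norm (u x) \<le> R" using R WU[OF k] x by blast
    ultimately show ?thesis
      using norm_triangle_ineq[of "z - u x" "u x"] Bm(1)[OF k] by (simp add: R1_def)
  qed
  \<comment> \<open>The norm bound is applied to the lower corner of the cell, which belongs to it
    because cells are half-open.\<close>
  have Dle: "h * of_int (c i1) \<le> R1" if k: "k \<in> KK" and c: "c \<in> D k" for k c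
  proof -
    define z :: "real ^ ('n + 'n)" where "z = (\<chi> i. h * of_int (c i))"
    have "cell_index h z = c" using h(1) by (simp add: fun_eq_iff cell_index_def z_def)
    then have "norm z \<le> R1" using Dbound[OF k] c by blast
    then show ?thesis using component_le_norm_cart[of z i1] by (simp add: z_def)
  qed
  have shift_gt: "h * of_int (c i1 + T) > R1" if c: "c \<in> \<A>" for c
  proof -
    obtain x where x: "x \<in> U" "c = cell_index h x" using c by (auto simp: \<A>_def)
    have "x $ i1 \<ge> - \<rho>" using component_le_norm_cart[of x i1] \<rho>(2)[OF x(1)] by linarith
    moreover have "x $ i1 < h * of_int (c i1) + h" unfolding x(2) by (rule cell_index_bounds(2)[OF h(1)])
    ultimately have "h * of_int (c i1) + h * of_int T > R1" using T(1) h1 by linarith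
    then show ?thesis by (simp add: algebra_simps)
  qed
  have mixed: "d c \<noteq> d c'" if "k \<in> KK" "c \<in> I k" "c' \<in> \<A>" "\<not> (\<exists>k\<in>KK. c' \<in> I k)" for c c' k
  proof
    assume "d c = d c'"
    moreover have "d c \<in> D k" using dI[OF that(1,2)] g(2)[OF that(1)] that(2) by auto
    ultimately have "h * of_int (d c' i1) \<le> R1" using Dle[OF that(1)] by metis
    then show False using shift_gt[OF that(3)] dN[OF that(4)] by simp
  qed
  have inj_d: "inj_on d \<A>"
  proof (rule inj_onI)
    fix c c' assume cc: "c \<in> \<A>" "c' \<in> \<A>" and eq: "d c = d c'"
    show "c = c'"
    proof (cases "\<exists>k\<in>KK. c \<in> I k")
      case True
      then obtain k where k: "k \<in> KK" "c \<in> I k" by blast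
      have "\<exists>l\<in>KK. c' \<in> I l" using mixed[OF k cc(2)] eq by blast
      then obtain l where l: "l \<in> KK" "c' \<in> I l" by blast
      have "d c \<in> D k" "d c' \<in> D l" using dI k l g(2) by (auto simp: image_subset_iff)
      then have "k = l" using D(2) k(1) l(1) eq unfolding disjoint_family_on_def by fastforce
      then show ?thesis using eq dI[OF k] dI[OF l] g(1)[OF k(1)] k(2) l(2) by (simp add: inj_on_def)
    next
      case False
      have "\<not> (\<exists>k\<in>KK. c' \<in> I k)"
      proof
        assume "\<exists>k\<in>KK. c' \<in> I k"
        then obtain l where "l \<in> KK" "c' \<in> I l" by blast
        from mixed[OF this cc(1) False] eq show False by simp
      qed
      then have "c(i1 := c i1 + T) = c'(i1 := c' i1 + T)" using eq dN False by simp
      then show ?thesis by (metis add_right_cancel fun_upd_same fun_upd_triv fun_upd_upd)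
    qed
  qed
  obtain M where M: "M \<ge> 0" "\<forall>q\<ge>2. even q \<longrightarrow> (\<exists>\<Phi>. symplectic_diffeo \<Phi> \<and> (\<forall>x. norm (\<Phi> x - x) \<le> M) \<and>
     (\<forall>x. good_point q x \<longrightarrow> (\<forall>a\<in>\<A>. (\<forall>k. \<lfloor>x $ k\<rfloor> = a k) \<longrightarrow>
        \<Phi> x = x + (\<chi> k. of_int (d a k - a k)))))"
    using cell_rearrangement[OF finA inj_on_id2 inj_d] by blast
  \<comment> \<open>A bound on all of \<open>U\<close>, bad points included. It involves
    \<open>M\<close>, which was obtained before \<open>q\<close>, so \<open>q\<close> can now be
    taken so large that the bad points cost at most \<open>\<tau> / 2\<close>.\<close>
  define R3 where "R3 = R + \<rho> + h * M"
  have R3: "R3 > 0" using R0 \<rho>(1) h(1) M(1) by (simp add: R3_def add_nonneg_pos add_pos_nonneg)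
  have "\<tau> / (2 * R3 powr p) > 0" using \<tau> R3 by simp
  from bad_points_small[OF \<rho>(1) h(1) this] obtain q B where q: "q \<ge> 2" "even q" and B: "B \<in> lmeasurable"
    "measure lebesgue B \<le> \<tau> / (2 * R3 powr p)" "{x :: real ^ ('n + 'n). norm x \<le> \<rho> \<and> \<not> good_point q ((1 / h) *\<^sub>R x)} \<subseteq> B"
    by blast
  obtain \<Phi>0 where \<Phi>0: "symplectic_diffeo \<Phi>0" "\<And>x. norm (\<Phi>0 x - x) \<le> M"
    "\<forall>x. good_point q x \<longrightarrow> (\<forall>a\<in>\<A>. (\<forall>k. \<lfloor>x $ k\<rfloor> = a k) \<longrightarrow> \<Phi>0 x = x + (\<chi> k. of_int (d a k - a k)))"
    using M(2) q by blast
  define \<Phi> where "\<Phi> x = h *\<^sub>R \<Phi>0 ((1 / h) *\<^sub>R x)" for x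
  have sympl: "symplectic_diffeo \<Phi>" unfolding \<Phi>_def by (rule symplectic_diffeo_scale[OF \<Phi>0(1) h(1)])
  have disp: "norm (\<Phi> x - x) \<le> h * M" for x
  proof -
    have "\<Phi> x - x = h *\<^sub>R (\<Phi>0 ((1 / h) *\<^sub>R x) - (1 / h) *\<^sub>R x)"
      using h(1) by (simp add: \<Phi>_def scaleR_diff_right)
    then have "norm (\<Phi> x - x) = h * norm (\<Phi>0 ((1 / h) *\<^sub>R x) - (1 / h) *\<^sub>R x)" using h(1) by simp
    then show ?thesis using \<Phi>0(2) h(1) by (simp add: mult_left_mono)
  qed
  have good: "\<Phi> x = x + h *\<^sub>R (\<chi> i. of_int (d (cell_index h x) i - cell_index h x i))"
    if x: "x \<in> U" and gd: "good_point q ((1 / h) *\<^sub>R x)" for x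
  proof -
    have "cell_index h x \<in> \<A>" using x by (simp add: \<A>_def)
    moreover have "\<forall>k. \<lfloor>((1 / h) *\<^sub>R x) $ k\<rfloor> = cell_index h x k" by (simp add: cell_index_def)
    ultimately have "\<Phi>0 ((1 / h) *\<^sub>R x) = (1 / h) *\<^sub>R x + (\<chi> i. of_int (d (cell_index h x) i - cell_index h x i))"
      using \<Phi>0(3) gd by blast
    then show ?thesis using h(1) by (simp add: \<Phi>_def scaleR_add_right)
  qed
  have good_cell: "cell_index h (\<Phi> x) = d (cell_index h x)"
    if x: "x \<in> U" and gd: "good_point q ((1 / h) *\<^sub>R x)" for x
  proof
    fix i
    have "\<Phi> x $ i / h = x $ i / h + of_int (d (cell_index h x) i - cell_index h x i)"
      unfolding good[OF x gd] using h(1) by (simp add: add_divide_distrib)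
    then have "cell_index h (\<Phi> x) i = cell_index h x i + (d (cell_index h x) i - cell_index h x i)"
      unfolding cell_index_def[of h "\<Phi> x"] by (simp only: floor_add_int) (simp add: cell_index_def)
    then show "cell_index h (\<Phi> x) i = d (cell_index h x) i" by simp
  qed
  have est_core: "norm (u x - \<Phi> x) \<le> b k"
    if k: "k \<in> KK" and x: "x \<in> C k" and gd: "good_point q ((1 / h) *\<^sub>R x)" for x k
  proof -
    have xW: "x \<in> W k" "x \<in> U" using x C(2)[OF k] WU[OF k] by auto
    have cI: "cell_index h x \<in> I k" using x by (simp add: I_def)
    then have "cell_index h (\<Phi> x) \<in> D k"
      using good_cell[OF xW(2) gd] dI[OF k cI] g(2)[OF k] by auto
    then have "norm (\<Phi> x - u x) \<le> b k" using D(4) k xW(1) by blast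
    then show ?thesis by (simp add: norm_minus_commute)
  qed
  have est_good: "norm (u x - \<Phi> x) \<le> R2" if x: "x \<in> U" and gd: "good_point q ((1 / h) *\<^sub>R x)" for x
  proof (cases "\<exists>k\<in>KK. cell_index h x \<in> I k")
    case True
    then obtain k where k: "k \<in> KK" "cell_index h x \<in> I k" by blast
    have "cell_index h (\<Phi> x) \<in> D k"
      using good_cell[OF x gd] dI[OF k] g(2)[OF k(1)] k(2) by auto
    then have "norm (\<Phi> x) \<le> R1" by (rule Dbound[OF k(1)])
    then show ?thesis using norm_triangle_ineq4[of "u x" "\<Phi> x"] R[OF x] R12(2) by linarith
  next
    case False
    have "h *\<^sub>R (\<chi> i. of_int (d (cell_index h x) i - cell_index h x i)) = (h * of_int T) *\<^sub>R axis i1 (1::real)"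
      unfolding dN[OF False] by (auto simp: vec_eq_iff axis_def)
    then have "\<Phi> x = x + (h * of_int T) *\<^sub>R axis i1 1" using good[OF x gd] by simp
    then have "norm (\<Phi> x) \<le> norm x + \<bar>h * of_int T\<bar>"
      using norm_triangle_ineq[of x "(h * of_int T) *\<^sub>R axis i1 1"] by (simp add: norm_axis_1)
    also have "\<dots> \<le> \<rho> + (R1 + \<rho> + 4)" using \<rho> x T R12(1) by (intro add_mono) auto
    finally show ?thesis using norm_triangle_ineq4[of "u x" "\<Phi> x"] R[OF x] R12(1) by (simp add: R2_def)
  qed
  have est_bad: "norm (u x - \<Phi> x) \<le> R3" if x: "x \<in> U" for x
    using norm_triangle_ineq4[of "u x" "\<Phi> x"] norm_triangle_ineq[of "\<Phi> x - x" x] R[OF x] \<rho>(2)[OF x] disp[of x]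
    by (simp add: R3_def)
  \<comment> \<open>Core points pay \<open>b k\<close>, points of \<open>W k - C k\<close> pay
    \<open>R2\<close>, bad points pay \<open>R3\<close>; the last two contributions integrate to at
    most \<open>\<tau> / 2\<close> each.\<close>
  let ?f = "\<lambda>x. (\<Sum>k\<in>KK. b k powr p * indicator (W k) x) + (\<Sum>k\<in>KK. R2 powr p * indicator (W k - C k) x)
      + R3 powr p * indicator (B \<inter> U) x"
  have pw: "norm (u x - \<Phi> x) powr p \<le> ?f x" if x: "x \<in> U" for x
  proof -
    have nn1: "0 \<le> (\<Sum>k\<in>KK. b k powr p * indicator (W k) x)" "0 \<le> (\<Sum>k\<in>KK. R2 powr p * indicator (W k - C k) x)"
      "0 \<le> R3 powr p * indicator (B \<inter> U) x" by (auto intro!: sum_nonneg)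
    obtain k where k: "k \<in> KK" "x \<in> W k" using x W(3) by blast
    show ?thesis
    proof (cases "good_point q ((1 / h) *\<^sub>R x)")
      case False
      then have "x \<in> B \<inter> U" using B(3) \<rho>(2)[OF x] x by blast
      then have "R3 powr p * indicator (B \<inter> U) x = R3 powr p" by simp
      moreover have "norm (u x - \<Phi> x) powr p \<le> R3 powr p"
        using est_bad[OF x] p by (intro powr_mono2) auto
      ultimately show ?thesis using nn1 by linarith
    next
      case gd: True
      show ?thesis
      proof (cases "x \<in> C k")
        case True
        have "norm (u x - \<Phi> x) powr p \<le> b k powr p"
          using est_core[OF k(1) True gd] p by (intro powr_mono2) auto
        also have "\<dots> = b k powr p * indicator (W k) x" using k(2) by simp
        also have "\<dots> \<le> (\<Sum>k\<in>KK. b k powr p * indicator (W k) x)"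
          using KK k(1) by (intro member_le_sum) auto
        finally show ?thesis using nn1 by linarith
      next
        case False
        have "norm (u x - \<Phi> x) powr p \<le> R2 powr p"
          using est_good[OF x gd] p by (intro powr_mono2) auto
        also have "\<dots> = R2 powr p * indicator (W k - C k) x" using k(2) False by simp
        also have "\<dots> \<le> (\<Sum>k\<in>KK. R2 powr p * indicator (W k - C k) x)"
          using KK k(1) by (intro member_le_sum) auto
        finally show ?thesis using nn1 by linarith
      qed
    qed
  qed
  note ind = integral_indicator_lebesgue_on[OF U]
  have lm2: "W k - C k \<in> lmeasurable" if "k \<in> KK" for k
    using lmW[OF that] fmeasurableD[OF lmC[OF that]] by (rule fmeasurable_Diff)
  have lm3: "B \<inter> U \<in> lmeasurable" using B(1) U by (simp add: fmeasurable_Int_fmeasurable)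
  note i1 = ind[OF lmW WU] and i2 = ind[OF lm2 order.trans[OF Diff_subset WU]] and i3 = ind[OF lm3 Int_lower2]
  have g1: "integrable (lebesgue_on U) (\<lambda>x. \<Sum>k\<in>KK. b k powr p * indicator (W k) x)"
    "(LINT x|lebesgue_on U. (\<Sum>k\<in>KK. b k powr p * indicator (W k) x)) = (\<Sum>k\<in>KK. b k powr p * measure lebesgue (W k))"
    using i1 by (simp_all add: Bochner_Integration.integral_sum)
  have g2: "integrable (lebesgue_on U) (\<lambda>x. \<Sum>k\<in>KK. R2 powr p * indicator (W k - C k) x)"
    "(LINT x|lebesgue_on U. (\<Sum>k\<in>KK. R2 powr p * indicator (W k - C k) x)) = (\<Sum>k\<in>KK. R2 powr p * measure lebesgue (W k - C k))"
    using i2 by (simp_all add: Bochner_Integration.integral_sum)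
  have g3: "integrable (lebesgue_on U) (\<lambda>x. R3 powr p * indicator (B \<inter> U) x)"
    "(LINT x|lebesgue_on U. R3 powr p * indicator (B \<inter> U) x) = R3 powr p * measure lebesgue (B \<inter> U)"
    using i3 by simp_all
  have "(LINT x|lebesgue_on U. norm (u x - \<Phi> x) powr p) \<le> (LINT x|lebesgue_on U. ?f x)"
  proof (rule Bochner_Integration.integral_mono')
    show "integrable (lebesgue_on U) ?f"
      by (rule Bochner_Integration.integrable_add[OF Bochner_Integration.integrable_add[OF g1(1) g2(1)] g3(1)])
    fix x assume "x \<in> space (lebesgue_on U)"
    then show "norm (u x - \<Phi> x) powr p \<le> ?f x" using pw by (simp add: space_restrict_space)
    show "0 \<le> ?f x" by (auto intro!: add_nonneg_nonneg sum_nonneg)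
  qed
  also have "\<dots> = (\<Sum>k\<in>KK. b k powr p * measure lebesgue (W k)) + (\<Sum>k\<in>KK. R2 powr p * measure lebesgue (W k - C k))
      + R3 powr p * measure lebesgue (B \<inter> U)"
    unfolding Bochner_Integration.integral_add[OF Bochner_Integration.integrable_add[OF g1(1) g2(1)] g3(1)]
      Bochner_Integration.integral_add[OF g1(1) g2(1)] g1(2) g2(2) g3(2) ..
  also have "(\<Sum>k\<in>KK. R2 powr p * measure lebesgue (W k - C k)) \<le> (\<Sum>k\<in>KK. R2 powr p * e1)"
    using C(3) by (intro sum_mono mult_left_mono) auto
  also have "(\<Sum>k\<in>KK. R2 powr p * e1) \<le> \<tau> / 2" using e1(3) by simp
  also have "R3 powr p * measure lebesgue (B \<inter> U) \<le> \<tau> / 2"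
  proof -
    have "measure lebesgue (B \<inter> U) \<le> measure lebesgue B"
      using B(1) lm3 fmeasurableD by (intro measure_mono_fmeasurable) auto
    then have "R3 powr p * measure lebesgue (B \<inter> U) \<le> R3 powr p * (\<tau> / (2 * R3 powr p))"
      using B(2) by (intro mult_left_mono) auto
    also have "\<dots> = \<tau> / 2" using R3 by simp
    finally show ?thesis .
  qed
  finally have "(LINT x|lebesgue_on U. norm (u x - \<Phi> x) powr p) \<le> (\<Sum>k\<in>KK. b k powr p * measure lebesgue (W k)) + \<tau> / 2 + \<tau> / 2"
    by simp
  then show ?thesis using sympl by (intro exI[of _ \<Phi>]) simp
qed

section \<open>Restacking cubes\<close>

text \<open>A cube of the coarse lattice is \<open>N\<close> fine cells wide; cube \<open>k\<close>
  receives \<open>n k\<close> layers instead of \<open>N\<close>, piled up in direction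
  \<open>i1\<close> within its row. \<open>F k\<close> is the height already occupied by the cubes
  of the row below \<open>k\<close>. Counting them from 0 is the reason for the restriction
  \<open>0 \<le> k i1\<close>.\<close>

lemma stacked_cells:
  fixes n :: "('m::finite \<Rightarrow> int) \<Rightarrow> nat" and \<beta> :: "'m \<Rightarrow> int" and N :: nat and i1 :: 'm
  defines "F \<equiv> \<lambda>k. \<Sum>j\<in>{0..<k i1}. int (n (k(i1 := j)))"
  defines "D \<equiv> \<lambda>k. Pi\<^sub>E UNIV (\<lambda>i. if i = i1 then {\<beta> i1 + F k..<\<beta> i1 + F k + int (n k)}
    else {\<beta> i + int N * k i..<\<beta> i + int N * k i + int N})"
  shows "finite (D k)" "card (D k) = N ^ (CARD('m) - 1) * n k" "disjoint_family_on D {k. 0 \<le> k i1}"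
proof -
  show "finite (D k)" unfolding D_def by (intro finite_PiE) auto
  let ?T = "\<lambda>i. if i = i1 then {\<beta> i1 + F k..<\<beta> i1 + F k + int (n k)}
    else {\<beta> i + int N * k i..<\<beta> i + int N * k i + int N}"
  have "card (D k) = (\<Prod>i\<in>UNIV. card (?T i))" unfolding D_def by (rule card_PiE) simp
  also have "\<dots> = card (?T i1) * (\<Prod>i\<in>UNIV - {i1}. card (?T i))" by (rule prod.remove) auto
  also have "(\<Prod>i\<in>UNIV - {i1}. card (?T i)) = (\<Prod>i\<in>UNIV - {i1}. N)" by (rule prod.cong) auto
  also have "\<dots> = N ^ (CARD('m) - 1)" by (simp add: card_Diff_singleton)
  also have "card (?T i1) = n k" by simp
  finally show "card (D k) = N ^ (CARD('m) - 1) * n k" by (simp add: mult.commute)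
  have F_step: "F k + int (n k) \<le> F k'" if "0 \<le> k i1" "k i1 < k' i1" "\<forall>i. i \<noteq> i1 \<longrightarrow> k i = k' i" for k k'
  proof -
    have upd: "k'(i1 := j) = k(i1 := j)" for j using that(3) by (auto simp: fun_eq_iff)
    have "F k + int (n k) = (\<Sum>j\<in>insert (k i1) {0..<k i1}. int (n (k(i1 := j))))" by (simp add: F_def)
    also have "\<dots> \<le> (\<Sum>j\<in>{0..<k' i1}. int (n (k(i1 := j))))" using that(1,2) by (intro sum_mono2) auto
    finally show ?thesis by (simp add: F_def upd)
  qed
  have lt: False if "c \<in> D k" "c \<in> D k'" "i \<noteq> i1" "k i < k' i" for c k k' i
  proof -
    have "c i < \<beta> i + int N * k i + int N" "\<beta> i + int N * k' i \<le> c i"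
      using PiE_mem[OF that(1)[unfolded D_def], of i] PiE_mem[OF that(2)[unfolded D_def], of i] that(3) by auto
    moreover have "int N * (k i + 1) \<le> int N * k' i" using that(4) by (intro mult_left_mono) auto
    ultimately show False by (simp add: distrib_left)
  qed
  have i1: "\<beta> i1 + F k \<le> c i1" "c i1 < \<beta> i1 + F k + int (n k)" if "c \<in> D k" for c k
    using PiE_mem[OF that[unfolded D_def], of i1] by auto
  have eq: "k = k'" if c: "c \<in> D k" "c \<in> D k'" and pos: "0 \<le> k i1" "0 \<le> k' i1" for c k k'
  proof -
    have ne: "k i = k' i" if "i \<noteq> i1" for i
      using lt[OF c that] lt[OF c(2,1) that] by (meson linorder_neqE)
    have "k i1 = k' i1"
    proof (rule ccontr)
      assume "k i1 \<noteq> k' i1"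
      then consider "k i1 < k' i1" | "k' i1 < k i1" by linarith
      then show False
      proof cases
        case 1
        have "F k + int (n k) \<le> F k'" by (rule F_step) (use pos 1 ne in auto)
        then show ?thesis using i1[OF c(1)] i1[OF c(2)] by linarith
      next
        case 2
        have "F k' + int (n k') \<le> F k" by (rule F_step) (use pos 2 ne in auto)
        then show ?thesis using i1[OF c(1)] i1[OF c(2)] by linarith
      qed
    qed
    then show ?thesis using ne by (metis ext)
  qed
  show "disjoint_family_on D {k. 0 \<le> k i1}"
    unfolding disjoint_family_on_def using eq by blast
qed

text \<open>Along a row the piles drift by \<open>l\<close> times the accumulated relative excesses
  \<open>g\<close>. Rounding up costs at most one layer of height \<open>h\<close> per cube, hence
  at most \<open>K * h \<le> l\<close> in the row, because \<open>K \<le> N\<close>. The cube widths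
  and offsets, together with this rounding, account for \<open>2 * l\<close> in each
  coordinate.\<close>

lemma stacked_cells_distance:
  fixes i1 :: "'m::finite" and N :: nat and k :: "'m::finite \<Rightarrow> int" and g :: "('m \<Rightarrow> int) \<Rightarrow> real" and \<alpha> :: "'m \<Rightarrow> real" and y z :: "real ^ 'm"
  defines "F \<equiv> \<lambda>k. \<Sum>j\<in>{0..<k i1}. int (nat \<lceil>real N * (1 + g (k(i1 := j)))\<rceil>)"
  assumes h: "h > 0" and l: "l = real N * h" and N: "K \<le> N" and k: "0 \<le> k i1" "k i1 < int K"
    and g: "\<And>k. g k \<ge> 0"
    and y: "\<And>i. \<alpha> i + l * of_int (k i) \<le> y $ i" "\<And>i. y $ i \<le> \<alpha> i + l * of_int (k i) + l"
    and z: "cell_index h z \<in> Pi\<^sub>E UNIV (\<lambda>i. if i = i1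
      then {\<lfloor>\<alpha> i1 / h\<rfloor> + F k..<\<lfloor>\<alpha> i1 / h\<rfloor> + F k + int (nat \<lceil>real N * (1 + g k)\<rceil>)}
      else {\<lfloor>\<alpha> i / h\<rfloor> + int N * k i..<\<lfloor>\<alpha> i / h\<rfloor> + int N * k i + int N})"
  shows "norm (z - y) \<le> l * (\<Sum>j\<in>{0..<int K}. g (k(i1 := j))) + 2 * real CARD('m) * l"
proof -
  define c where "c = cell_index h z"
  define G where "G = (\<Sum>j\<in>{0..<int K}. g (k(i1 := j)))"
  define nn where "nn k = nat \<lceil>real N * (1 + g k)\<rceil>" for k
  have K: "K \<ge> 1" using k by linarith
  have l0: "l > 0" "h \<le> l" "real K * h \<le> l"
  proof -
    have "1 * h \<le> real N * h" "real K * h \<le> real N * h" using K N h by (intro mult_right_mono; simp)+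
    then show "l > 0" "h \<le> l" "real K * h \<le> l" using l h by auto
  qed
  have G0: "G \<ge> 0" unfolding G_def by (intro sum_nonneg g)
  have zb: "h * of_int (c i) \<le> z $ i" "z $ i \<le> h * of_int (c i) + h" for i
    using cell_index_bounds[OF h, of z i] by (auto simp: c_def)
  have \<beta>: "h * of_int \<lfloor>\<alpha> i / h\<rfloor> \<le> \<alpha> i" "\<alpha> i \<le> h * of_int \<lfloor>\<alpha> i / h\<rfloor> + h" for i
  proof -
    have "of_int \<lfloor>\<alpha> i / h\<rfloor> \<le> \<alpha> i / h" "\<alpha> i / h \<le> of_int \<lfloor>\<alpha> i / h\<rfloor> + 1" by linarith+
    then show "h * of_int \<lfloor>\<alpha> i / h\<rfloor> \<le> \<alpha> i" "\<alpha> i \<le> h * of_int \<lfloor>\<alpha> i / h\<rfloor> + h"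
      using h mult_left_mono[of "of_int \<lfloor>\<alpha> i / h\<rfloor>" "\<alpha> i / h" h]
        mult_left_mono[of "\<alpha> i / h" "of_int \<lfloor>\<alpha> i / h\<rfloor> + 1" h] by (simp_all add: distrib_left)
  qed
  have nb: "l \<le> h * real (nn k)" "h * real (nn k) \<le> l + l * g k + h" for k
  proof -
    have "0 \<le> real N * (1 + g k)" using g[of k] by simp
    then have "real N * (1 + g k) \<le> real (nn k)" "real (nn k) \<le> real N * (1 + g k) + 1"
      unfolding nn_def by linarith+
    then have "h * (real N * (1 + g k)) \<le> h * real (nn k)" "h * real (nn k) \<le> h * (real N * (1 + g k) + 1)"
      using h by (intro mult_left_mono; simp)+
    moreover have "h * (real N * (1 + g k)) = l + l * g k" by (simp add: l algebra_simps)
    moreover have "l * g k \<ge> 0" using l0(1) g[of k] by simp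
    ultimately show "l \<le> h * real (nn k)" "h * real (nn k) \<le> l + l * g k + h" by (simp_all add: algebra_simps)
  qed
  have coord: "\<bar>z $ i - y $ i\<bar> \<le> (if i = i1 then l * G else 0) + 2 * l" for i
  proof (cases "i = i1")
    case False
    have "\<lfloor>\<alpha> i / h\<rfloor> + int N * k i \<le> c i" "c i + 1 \<le> \<lfloor>\<alpha> i / h\<rfloor> + int N * k i + int N"
      using PiE_mem[OF z, of i] False by (auto simp: c_def)
    then have "real_of_int (\<lfloor>\<alpha> i / h\<rfloor> + int N * k i) \<le> of_int (c i)"
      "real_of_int (c i + 1) \<le> of_int (\<lfloor>\<alpha> i / h\<rfloor> + int N * k i + int N)" by (simp_all only: of_int_le_iff)
    then have "h * real_of_int (\<lfloor>\<alpha> i / h\<rfloor> + int N * k i) \<le> h * of_int (c i)"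
      "h * real_of_int (c i + 1) \<le> h * of_int (\<lfloor>\<alpha> i / h\<rfloor> + int N * k i + int N)"
      using h by (intro mult_left_mono; simp)+
    then have "h * of_int \<lfloor>\<alpha> i / h\<rfloor> + l * of_int (k i) \<le> h * of_int (c i)"
      "h * of_int (c i) + h \<le> h * of_int \<lfloor>\<alpha> i / h\<rfloor> + l * of_int (k i) + l"
      by (simp_all add: l algebra_simps)
    then show ?thesis using zb[of i] \<beta>[of i] y[of i] l0 False by (simp add: abs_le_iff)
  next
    case True
    define s where "s = (\<Sum>j\<in>{0..<k i1}. h * real (nn (k(i1 := j))))"
    have hF: "h * of_int (F k) = s" unfolding F_def s_def nn_def by (simp only: of_int_sum of_int_of_nat_eq sum_distrib_left)
    have s1: "l * of_int (k i1) \<le> s"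
    proof -
      have "l * of_int (k i1) = (\<Sum>j\<in>{0..<k i1}. l)" using k by simp
      also have "\<dots> \<le> s" unfolding s_def by (intro sum_mono nb)
      finally show ?thesis .
    qed
    have s2: "s + h * real (nn k) \<le> l * of_int (k i1) + l + l * G + l"
    proof -
      have ins: "{0..<k i1 + 1} = insert (k i1) {0..<k i1}" using k by auto
      have "s + h * real (nn k) = (\<Sum>j\<in>{0..<k i1 + 1}. h * real (nn (k(i1 := j))))"
        unfolding ins s_def by simp
      also have "\<dots> \<le> (\<Sum>j\<in>{0..<k i1 + 1}. l + l * g (k(i1 := j)) + h)" by (intro sum_mono nb)
      also have "\<dots> = (of_int (k i1) + 1) * (l + h) + l * (\<Sum>j\<in>{0..<k i1 + 1}. g (k(i1 := j)))"
        using k by (simp add: sum.distrib sum_distrib_left algebra_simps)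
      also have "(\<Sum>j\<in>{0..<k i1 + 1}. g (k(i1 := j))) \<le> G"
        unfolding G_def using k g by (intro sum_mono2) auto
      also have "(of_int (k i1) + 1) * (l + h) \<le> l * of_int (k i1) + l + l"
      proof -
        have "real_of_int (k i1) + 1 \<le> real K" using k by linarith
        then have "(real_of_int (k i1) + 1) * h \<le> real K * h" using h by (intro mult_right_mono) auto
        then show ?thesis using l0(3) by (simp add: algebra_simps)
      qed
      finally show ?thesis using l0(1) by simp
    qed
    have "\<lfloor>\<alpha> i1 / h\<rfloor> + F k \<le> c i1" "c i1 + 1 \<le> \<lfloor>\<alpha> i1 / h\<rfloor> + F k + int (nn k)"
      using PiE_mem[OF z, of i1] by (auto simp: c_def nn_def)
    then have "real_of_int (\<lfloor>\<alpha> i1 / h\<rfloor> + F k) \<le> of_int (c i1)"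
      "real_of_int (c i1 + 1) \<le> of_int (\<lfloor>\<alpha> i1 / h\<rfloor> + F k + int (nn k))" by (simp_all only: of_int_le_iff)
    then have "h * real_of_int (\<lfloor>\<alpha> i1 / h\<rfloor> + F k) \<le> h * of_int (c i1)"
      "h * real_of_int (c i1 + 1) \<le> h * of_int (\<lfloor>\<alpha> i1 / h\<rfloor> + F k + int (nn k))"
      using h by (intro mult_left_mono; simp)+
    then have "h * of_int \<lfloor>\<alpha> i1 / h\<rfloor> + s \<le> h * of_int (c i1)"
      "h * of_int (c i1) + h \<le> h * of_int \<lfloor>\<alpha> i1 / h\<rfloor> + s + h * real (nn k)"
      by (simp_all add: distrib_left hF)
    moreover have "l * G \<ge> 0" using l0(1) G0 by simp
    ultimately have "\<bar>z $ i1 - y $ i1\<bar> \<le> l * G + 2 * l"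
      using zb[of i1] \<beta>[of i1] y[of i1] l0 s1 s2 by (simp add: abs_le_iff)
    then show ?thesis using True by simp
  qed
  have "norm (z - y) \<le> (\<Sum>i\<in>UNIV. \<bar>(z - y) $ i\<bar>)" by (rule norm_le_l1_cart)
  also have "\<dots> \<le> (\<Sum>i\<in>UNIV. (if i = i1 then l * G else 0) + 2 * l)"
    using coord by (intro sum_mono) simp
  also have "\<dots> = l * G + 2 * real CARD('m) * l" by (simp add: sum.distrib)
  finally show ?thesis by (simp add: G_def)
qed

section \<open>Convexity of powers and Jensen's inequality\<close>

lemma powr_tangent_le:
  fixes x y p :: real
  assumes "p \<ge> 1" "x \<ge> 0" "y \<ge> 0"
  shows "y powr p + p * y powr (p - 1) * (x - y) \<le> x powr p"
proof (cases "y = 0")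
  case True
  then show ?thesis using assms by simp
next
  case False
  then have y: "y > 0" using assms by simp
  have yp: "y powr (p - 1) * y = y powr p" using y by (simp add: powr_diff)
  show ?thesis
  proof (cases "x = 0")
    case True
    have "y powr p \<le> p * y powr p" using assms(1) by (simp add: mult_le_cancel_right1)
    then show ?thesis using True yp by (simp add: mult.assoc)
  next
    case False
    then have x: "x > 0" using assms by simp
    \<comment> \<open>Young's inequality for \<open>x powr p\<close> and \<open>y powr p\<close>
      with weights \<open>1 / p\<close> and \<open>1 - 1 / p\<close> becomes the tangent inequality
      after multiplication by \<open>p\<close>.\<close>
    have "(x powr p) powr (1 / p) * (y powr p) powr (1 - 1 / p) \<le> 1 / p * x powr p + (1 - 1 / p) * y powr p"
      using assms x y by (intro Youngs_inequality_0) auto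
    moreover have "(x powr p) powr (1 / p) = x" "(y powr p) powr (1 - 1 / p) = y powr (p - 1)"
      using assms(1) x y by (simp_all add: powr_powr right_diff_distrib)
    ultimately have "x * y powr (p - 1) \<le> 1 / p * x powr p + (1 - 1 / p) * y powr p" by simp
    then have "p * (x * y powr (p - 1)) \<le> p * (1 / p * x powr p + (1 - 1 / p) * y powr p)"
      using assms(1) by (intro mult_left_mono) auto
    also have "\<dots> = x powr p + (p - 1) * y powr p" using assms(1) by (simp add: field_simps)
    finally show ?thesis using yp by (simp add: algebra_simps)
  qed
qed

lemma powr_add_le:
  fixes a b p :: real
  assumes "a \<ge> 0" "b \<ge> 0" "p \<ge> 0"
  shows "(a + b) powr p \<le> 2 powr p * (a powr p + b powr p)"
proof -
  have "(a + b) powr p \<le> (2 * max a b) powr p" using assms by (intro powr_mono2) auto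
  also have "\<dots> = 2 powr p * max a b powr p" using assms by (simp add: powr_mult)
  also have "max a b powr p \<le> a powr p + b powr p" by (simp add: max_def)
  finally show ?thesis by simp
qed

lemma integrable_indicator_mult_unit:
  assumes U: "U \<in> sets lebesgue" and S: "S \<in> lmeasurable" "S \<subseteq> U"
    and s: "s \<in> borel_measurable (lebesgue_on U)" "\<And>x. 0 \<le> s x" "\<And>x. s x \<le> (1::real)"
  shows "integrable (lebesgue_on U) (\<lambda>x. indicator S x * s x)"
proof (rule Bochner_Integration.integrable_bound[OF integral_indicator_lebesgue_on(1)[OF U S]])
  show "(\<lambda>x. indicator S x * s x) \<in> borel_measurable (lebesgue_on U)"
    using borel_measurable_integrable[OF integral_indicator_lebesgue_on(1)[OF U S]] s(1)
    by (rule borel_measurable_times)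
  show "AE x in lebesgue_on U. norm (indicator S x * s x) \<le> norm (indicator S x :: real)"
    using s(2,3) by (intro AE_I2) (simp add: indicator_def)
qed

text \<open>Jensen's inequality, by integrating the tangent of \<open>t powr p\<close> at
  \<open>y = \<nu> / H\<close>. An upper bound \<open>H\<close> of the volume is enough, since the
  constant term \<open>y powr p - p * y powr p\<close> of the tangent is not positive.\<close>

lemma integral_powr_le:
  assumes U: "U \<in> sets lebesgue" and S: "S \<in> lmeasurable" "S \<subseteq> U" "measure lebesgue S \<le> H" and H: "H > 0"
    and s: "s \<in> borel_measurable (lebesgue_on U)" "\<And>x. 0 \<le> s x" "\<And>x. s x \<le> (1::real)" and p: "p \<ge> 1"
  shows "(LINT x|lebesgue_on U. indicator S x * s x) powr p * H \<le>
    H powr p * (LINT x|lebesgue_on U. indicator S x * s x powr p)"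
proof -
  define \<nu> where "\<nu> = (LINT x|lebesgue_on U. indicator S x * s x)"
  define y where "y = \<nu> / H"
  have nn: "0 \<le> indicator S x * s x" "0 \<le> indicator S x * s x powr p" for x using s(2) by auto
  have \<nu>: "\<nu> \<ge> 0" unfolding \<nu>_def by (rule Bochner_Integration.integral_nonneg[OF nn(1)])
  show ?thesis
  proof (cases "\<nu> = 0")
    case True
    then show ?thesis
      using Bochner_Integration.integral_nonneg[OF nn(2)] by (simp add: \<nu>_def[symmetric])
  next
    case False
    have y: "y > 0" using \<nu> False H by (simp add: y_def)
    have yp: "y powr (p - 1) * y = y powr p" using y by (simp add: powr_diff)
    note i1 = integral_indicator_lebesgue_on[OF U S(1,2)]
    have i2: "integrable (lebesgue_on U) (\<lambda>x. indicator S x * s x)"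
      by (rule integrable_indicator_mult_unit[OF U S(1,2) s])
    have i3: "integrable (lebesgue_on U) (\<lambda>x. indicator S x * s x powr p)"
    proof (rule integrable_indicator_mult_unit[OF U S(1,2)])
      show "(\<lambda>x. s x powr p) \<in> borel_measurable (lebesgue_on U)" using s(1) by measurable
      show "0 \<le> s x powr p" "s x powr p \<le> 1" for x
        using powr_mono2[of p "s x" 1] s(2,3) p by auto
    qed
    have a: "integrable (lebesgue_on U) (\<lambda>x. (y powr p - p * y powr p) * indicator S x)"
      "integrable (lebesgue_on U) (\<lambda>x. (p * y powr (p - 1)) * (indicator S x * s x))"
      using i1(1) i2 by (auto intro: Bochner_Integration.integrable_mult_right)
    have "y powr p * H = (y powr p - p * y powr p) * H + (p * y powr (p - 1)) * \<nu>"
    proof -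
      have "(p * y powr (p - 1)) * \<nu> = p * (y powr (p - 1) * y) * H" using H by (simp add: y_def)
      then show ?thesis unfolding yp by (simp add: left_diff_distrib)
    qed
    also have "\<dots> \<le> (y powr p - p * y powr p) * measure lebesgue S + (p * y powr (p - 1)) * \<nu>"
    proof -
      have "1 * y powr p \<le> p * y powr p" using p by (intro mult_right_mono) auto
      then show ?thesis using mult_left_mono_neg[OF S(3), of "y powr p - p * y powr p"] by simp
    qed
    also have "\<dots> = (LINT x|lebesgue_on U. (y powr p - p * y powr p) * indicator S x + (p * y powr (p - 1)) * (indicator S x * s x))"
    proof -
      have "(LINT x|lebesgue_on U. (y powr p - p * y powr p) * indicator S x) = (y powr p - p * y powr p) * measure lebesgue S"
        by (simp only: integral_mult_right_zero i1(2))
      moreover have "(LINT x|lebesgue_on U. (p * y powr (p - 1)) * (indicator S x * s x)) = (p * y powr (p - 1)) * \<nu>"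
        by (simp add: \<nu>_def)
      ultimately show ?thesis unfolding Bochner_Integration.integral_add[OF a] by (simp only:)
    qed
    also have "\<dots> \<le> (LINT x|lebesgue_on U. indicator S x * s x powr p)"
    proof (rule Bochner_Integration.integral_mono[OF Bochner_Integration.integrable_add[OF a] i3])
      fix x
      have "indicator S x * (y powr p + p * y powr (p - 1) * (s x - y)) \<le> indicator S x * s x powr p"
        using powr_tangent_le[OF p s(2)] y by (intro mult_left_mono) auto
      moreover have "y powr p + p * y powr (p - 1) * (s x - y) = y powr p - p * y powr p + p * y powr (p - 1) * s x"
        using yp by (simp add: right_diff_distrib mult.assoc)
      ultimately show "(y powr p - p * y powr p) * indicator S x + (p * y powr (p - 1)) * (indicator S x * s x)
          \<le> indicator S x * s x powr p"
        by (cases "x \<in> S") simp_all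
    qed
    finally have *: "y powr p * H \<le> (LINT x|lebesgue_on U. indicator S x * s x powr p)" .
    have "y powr p = \<nu> powr p / H powr p" using \<nu> H by (simp add: y_def powr_divide)
    then have "\<nu> powr p * H = H powr p * (y powr p * H)" using H by simp
    also have "\<dots> \<le> H powr p * (LINT x|lebesgue_on U. indicator S x * s x powr p)"
      using * by (intro mult_left_mono) auto
    finally show ?thesis by (simp add: \<nu>_def)
  qed
qed

section \<open>Pointwise consequences of the regularity of u\<close>

lemma weak_jacobian_essentially_bounded:
  fixes u :: "real ^ 'm::finite \<Rightarrow> real ^ 'm"
  assumes U: "open U" and u: "u \<in> W_1_infty U" and D: "weak_jacobian U u D"
  obtains B where "D \<in> borel_measurable (lebesgue_on U)" "AE x in lebesgue_on U. norm (D x) \<le> B"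
proof -
  obtain A B where A: "weak_jacobian U u A" "A \<in> borel_measurable (lebesgue_on U)"
    "AE x in lebesgue_on U. norm (A x) \<le> B"
    using u unfolding W_1_infty_def L_infty_def by blast
  have eq: "AE x in lebesgue_on U. A x = D x" by (rule weak_jacobian_unique[OF U A(1) D])
  show thesis
  proof
    show "D \<in> borel_measurable (lebesgue_on U)"
      by (rule measurable_lebesgue_on_AE_eq[OF open_sets_lebesgue[OF U] A(2) eq])
    show "AE x in lebesgue_on U. norm (D x) \<le> B" using A(3) eq by eventually_elim simp
  qed
qed

lemma weak_jacobian_has_derivative_AE:
  fixes u :: "real ^ 'm::finite \<Rightarrow> real ^ 'm"
  assumes U: "open U" "bounded U" and u: "u \<in> W_1_infty U" and D: "weak_jacobian U u D"
  shows "AE x in lebesgue_on U. (u has_derivative (\<lambda>h. D x *v h)) (at x)"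
proof -
  obtain B where B: "D \<in> borel_measurable (lebesgue_on U)" "AE x in lebesgue_on U. norm (D x) \<le> B"
    by (rule weak_jacobian_essentially_bounded[OF U(1) u D])
  have cont: "continuous_on U u" using u by (simp add: W_1_infty_def)
  have "AE x in lebesgue_on U. x \<in> U" by (intro AE_I2) (simp add: space_restrict_space)
  then show ?thesis using lebesgue_points_AE[OF U B]
  proof eventually_elim
    case (elim x)
    show ?case by (rule has_derivative_at_lebesgue_point[OF U(1) D cont B(2) elim(1) elim(2)[rule_format]])
  qed
qed

text \<open>For the continuous representative the set where the essential bound fails is open, and
  an open null set is empty.\<close>

lemma W_1_infty_bounded:
  fixes u :: "real ^ 'm::finite \<Rightarrow> real ^ 'm"
  assumes U: "open U" and u: "u \<in> W_1_infty U"
  obtains R where "\<forall>x\<in>U. norm (u x) \<le> R"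
proof -
  obtain R where R: "AE x in lebesgue_on U. norm (u x) \<le> R" and cont: "continuous_on U u"
    using u unfolding W_1_infty_def L_infty_def by blast
  have "negligible {x \<in> U. \<not> norm (u x) \<le> R}"
    using R unfolding AE_lebesgue_on_iff_negligible[OF open_sets_lebesgue[OF U]] .
  moreover have "open {x \<in> U. \<not> norm (u x) \<le> R}"
  proof -
    have "continuous_on U (\<lambda>x. norm (u x))" using cont by (rule continuous_on_norm)
    then have "open (U \<inter> (\<lambda>x. norm (u x)) -` {R<..})" using U by (rule continuous_open_preimage) simp
    moreover have "U \<inter> (\<lambda>x. norm (u x)) -` {R<..} = {x \<in> U. \<not> norm (u x) \<le> R}" by auto
    ultimately show ?thesis by simp
  qed
  ultimately have "{x \<in> U. \<not> norm (u x) \<le> R} = {}" using open_not_negligible by blast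
  then show thesis using that by blast
qed

text \<open>In the expansion over permutations, a product changes by at most the sum of the changes
  of its factors, provided that all factors have modulus at most 1.\<close>

lemma abs_det_add_diff_le:
  fixes A B :: "real ^ 'm::finite ^ 'm"
  assumes A: "\<And>i j. \<bar>A $ i $ j\<bar> \<le> 1" and B: "norm B \<le> 1"
  shows "\<bar>det (A + B) - det A\<bar> \<le> real (card {q. q permutes (UNIV :: 'm set)}) * (2 ^ CARD('m) * real CARD('m)) * norm B"
proof -
  let ?m = "CARD('m)" and ?P = "{q. q permutes (UNIV :: 'm set)}"
  have b: "\<bar>B $ i $ j\<bar> \<le> norm B" for i j
    using Finite_Cartesian_Product.norm_nth_le[of "B $ i" j] Finite_Cartesian_Product.norm_nth_le[of B i] by simp
  have prd: "\<bar>(\<Prod>i\<in>UNIV. (A + B) $ i $ q i) - (\<Prod>i\<in>UNIV. A $ i $ q i)\<bar> \<le> 2 ^ ?m * real ?m * norm B" for q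
  proof -
    \<comment> \<open>Entries of \<open>A + B\<close> can reach 2. Halving all factors brings them
      into the unit interval at the cost of \<open>2 ^ ?m\<close>.\<close>
    let ?z = "\<lambda>i. (A + B) $ i $ q i / 2" and ?w = "\<lambda>i. A $ i $ q i / 2"
    have z: "norm (?z i) \<le> 1" for i
    proof -
      have "\<bar>A $ i $ q i + B $ i $ q i\<bar> \<le> 2"
        using abs_triangle_ineq[of "A $ i $ q i" "B $ i $ q i"] A[of i "q i"] b[of i "q i"] B by linarith
      then show ?thesis by simp
    qed
    have w: "norm (?w i) \<le> 1" for i using A[of i "q i"] by simp
    have "\<bar>(\<Prod>i\<in>UNIV. ?z i) - (\<Prod>i\<in>UNIV. ?w i)\<bar> \<le> (\<Sum>i\<in>UNIV. norm (?z i - ?w i))"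
      using norm_prod_diff[of UNIV ?z ?w] z w by simp
    also have "\<dots> \<le> (\<Sum>i\<in>(UNIV :: 'm set). norm B)"
    proof (rule sum_mono)
      fix i
      have "?z i - ?w i = B $ i $ q i / 2" by (simp add: add_divide_distrib)
      moreover have "norm (B $ i $ q i / 2) \<le> norm B" using b[of i "q i"] by simp
      ultimately show "norm (?z i - ?w i) \<le> norm B" by (simp only:)
    qed
    also have "\<dots> = real ?m * norm B" by simp
    finally have "2 ^ ?m * \<bar>(\<Prod>i\<in>UNIV. ?z i) - (\<Prod>i\<in>UNIV. ?w i)\<bar> \<le> 2 ^ ?m * (real ?m * norm B)"
      by (intro mult_left_mono) auto
    moreover have "(\<Prod>i\<in>UNIV. ?z i) = (\<Prod>i\<in>UNIV. (A + B) $ i $ q i) / 2 ^ ?m"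
      "(\<Prod>i\<in>UNIV. ?w i) = (\<Prod>i\<in>UNIV. A $ i $ q i) / 2 ^ ?m"
      by (simp_all only: prod_dividef prod_constant)
    moreover have cancel: "c * \<bar>X / c - Y / c\<bar> = \<bar>X - Y\<bar>" if "c > 0" for c X Y :: real
      using that by (simp add: diff_divide_distrib[symmetric])
    ultimately show ?thesis by (simp only: cancel zero_less_power zero_less_numeral mult.assoc)
  qed
  have sgn: "\<bar>real_of_int (sign q)\<bar> = 1" for q :: "'m \<Rightarrow> 'm" by (simp add: sign_def)
  have "det (A + B) - det A = (\<Sum>q\<in>?P. of_int (sign q) * ((\<Prod>i\<in>UNIV. (A + B) $ i $ q i) - (\<Prod>i\<in>UNIV. A $ i $ q i)))"
    unfolding det_def by (simp only: right_diff_distrib sum_subtractf)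
  also have "\<bar>\<dots>\<bar> \<le> (\<Sum>q\<in>?P. \<bar>of_int (sign q) * ((\<Prod>i\<in>UNIV. (A + B) $ i $ q i) - (\<Prod>i\<in>UNIV. A $ i $ q i))\<bar>)"
    by (rule sum_abs)
  also have "\<dots> \<le> (\<Sum>q\<in>?P. 2 ^ ?m * real ?m * norm B)"
    by (rule sum_mono) (simp only: abs_mult sgn mult_1_left prd)
  also have "\<dots> = real (card ?P) * (2 ^ ?m * real ?m) * norm B" by simp
  finally show ?thesis .
qed

lemma abs_det_symplectic_J: "\<bar>det (symplectic_J :: real ^ ('n::finite + 'n) ^ ('n + 'n))\<bar> = 1"
proof -
  let ?J = "symplectic_J :: real ^ ('n + 'n) ^ ('n + 'n)"
  have "transpose ?J ** ?J = mat 1"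
    unfolding matrix_eq
  proof
    fix v :: "real ^ ('n + 'n)"
    have "w \<bullet> (transpose ?J *v (?J *v v)) = w \<bullet> v" for w
    proof -
      have "w \<bullet> (transpose ?J *v (?J *v v)) = (?J *v w) \<bullet> (?J *v v)"
        by (simp add: transpose_matrix_vector inner_commute[of w] dot_lmul_matrix) (simp add: inner_commute)
      also have "\<dots> = - (?J *v (?J *v w)) \<bullet> v" by (rule inner_symplectic_J)
      finally show ?thesis by (simp add: symplectic_J_square)
    qed
    then have "transpose ?J *v (?J *v v) = v" by (rule iffD1[OF vector_eq_ldot, OF allI])
    then show "(transpose ?J ** ?J) *v v = mat 1 *v v"
      by (simp only: matrix_vector_mul_assoc[symmetric] matrix_vector_mul_lid)
  qed
  then have "orthogonal_matrix ?J" by (simp add: orthogonal_matrix)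
  then show ?thesis using det_orthogonal_matrix by fastforce
qed

text \<open>The Lipschitz bound for the determinant is used for defects of norm at most 1. A larger
  defect already dominates \<open>1 - det M \<le> 1\<close>; that case is the reason for the summand
  1 in the constant.\<close>

lemma one_minus_det_le:
  fixes M :: "real ^ ('n::finite + 'n) ^ ('n + 'n)"
  assumes "det M \<ge> 0"
  shows "1 - det M \<le> (real (card {q. q permutes (UNIV :: ('n + 'n) set)}) * (2 ^ CARD('n + 'n) * real CARD('n + 'n)) + 1)
    * norm (transpose M ** symplectic_J ** M - symplectic_J)"
proof -
  let ?J = "symplectic_J :: real ^ ('n + 'n) ^ ('n + 'n)"
  let ?C = "real (card {q. q permutes (UNIV :: ('n + 'n) set)}) * (2 ^ CARD('n + 'n) * real CARD('n + 'n))"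
  define B where "B = transpose M ** ?J ** M - ?J"
  have C: "?C \<ge> 0" by simp
  have "1 - det M \<le> (?C + 1) * norm B"
  proof (cases "norm B \<le> 1")
    case False
    then have "1 * 1 \<le> (?C + 1) * norm B" using C by (intro mult_mono) auto
    then show ?thesis using assms by linarith
  next
    case True
    have "\<bar>?J $ i $ j\<bar> \<le> 1" for i j by (auto simp: symplectic_J_def split: sum.split)
    then have "\<bar>det (?J + B) - det ?J\<bar> \<le> ?C * norm B" using True by (rule abs_det_add_diff_le)
    moreover have "det (?J + B) = (det M)\<^sup>2 * det ?J"
      by (simp add: B_def det_mul power2_eq_square)
    ultimately have "\<bar>((det M)\<^sup>2 - 1) * det ?J\<bar> \<le> ?C * norm B" by (simp add: algebra_simps)
    then have *: "\<bar>(det M)\<^sup>2 - 1\<bar> \<le> ?C * norm B" by (simp only: abs_mult abs_det_symplectic_J mult_1_right)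
    show ?thesis
    proof (cases "det M \<le> 1")
      case True
      \<comment> \<open>Squaring decreases numbers in the unit interval, so control of one minus the
        squared determinant gives control of \<open>1 - det M\<close>.\<close>
      then have "(det M)\<^sup>2 \<le> det M" using assms by (simp add: power2_eq_square mult_left_le)
      then have "1 - det M \<le> ?C * norm B" using * by linarith
      then show ?thesis by (simp add: distrib_right add_increasing2)
    next
      case False
      then show ?thesis using C by (simp add: order.trans[of _ 0])
    qed
  qed
  then show ?thesis by (simp add: B_def)
qed

text \<open>
  The values of \<open>u\<close> are sorted into cubes of side \<open>l\<close>. The part of \<open>U\<close> mapped into a cube exceeds the
  volume of that cube by at most the integral of \<open>1 - f\<close> over it; the excess is absorbed by
  restacking each row of cubes in one fixed coordinate direction.
\<close>

lemma symplectic_approximation_at_scale: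
  fixes U :: "(real ^ ('n::finite + 'n)) set" and u :: "real ^ ('n + 'n) \<Rightarrow> real ^ ('n + 'n)"
    and f :: "real ^ ('n + 'n) \<Rightarrow> real" and K :: nat
  assumes U: "open U" "bounded U" "U \<noteq> {}" and cont: "continuous_on U u" and R: "\<forall>x\<in>U. norm (u x) \<le> R"
    and f: "f \<in> borel_measurable (lebesgue_on U)" and lam: "lam > 0" and lf: "AE x in lebesgue_on U. lam \<le> f x"
    and area: "\<And>A. A \<in> sets borel \<Longrightarrow> A \<in> lmeasurable \<Longrightarrow> integrable (lebesgue_on U) (\<lambda>x. indicator A (u x) * f x)"
      "\<And>A. A \<in> sets borel \<Longrightarrow> A \<in> lmeasurable \<Longrightarrow> (LINT x|lebesgue_on U. indicator A (u x) * f x) \<le> measure lebesgue A"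
    and p: "p \<ge> 1" and diam: "diameter (u ` U) \<le> d" and K: "K \<ge> 1" and \<tau>: "\<tau> > 0"
  defines "s \<equiv> \<lambda>x. min 1 (max 0 (1 - f x))"
  shows "\<exists>\<Phi>. symplectic_diffeo \<Phi> \<and> (LINT x|lebesgue_on U. norm (u x - \<Phi> x) powr p) \<le>
    2 powr p * (((d + 1 / K) / lam) powr p * (LINT x|lebesgue_on U. s x powr p) +
      ((2 * CARD('n + 'n) + 1) * ((d + 1 / K) / K)) powr p * measure lebesgue U) + \<tau>"
proof -
  define m where "m = CARD('n + 'n)"
  have m: "m \<ge> 1" using zero_less_card_finite[where 'a="'n + 'n"] unfolding m_def by linarith
  have sU: "U \<in> sets lebesgue" by (rule open_sets_lebesgue[OF U(1)])
  have lmU: "U \<in> lmeasurable" using sU U(2) by (simp add: bounded_set_imp_lmeasurable)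
  have bdu: "bounded (u ` U)" using R by (auto simp: bounded_iff)
  have d: "d \<ge> 0" using diameter_ge_0[OF bdu] diam by linarith
  \<comment> \<open>The extra \<open>1 / real K\<close> makes the box of \<open>K\<close> cubes per
    direction strictly wider than the range of \<open>u\<close>, so half-open cubes cover it, and
    keeps \<open>l\<close> positive when \<open>d = 0\<close>.\<close>
  define l where "l = (d + 1 / real K) / real K"
  have rK: "real K > 0" using K by simp
  have lK: "l * real K = d + 1 / real K" using rK by (simp add: l_def)
  have l: "l > 0" unfolding l_def using d rK by (intro divide_pos_pos add_nonneg_pos) auto
  define \<alpha> where "\<alpha> i = Inf ((\<lambda>x. u x $ i) ` U)" for i
  have \<alpha>1: "\<alpha> i \<le> u x $ i" if x: "x \<in> U" for x i
    unfolding \<alpha>_def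
  proof (rule cInf_lower)
    show "u x $ i \<in> (\<lambda>x. u x $ i) ` U" using x by blast
    have "- R \<le> u w $ i" if "w \<in> U" for w
      using R that component_le_norm_cart[of "u w" i] by fastforce
    then show "bdd_below ((\<lambda>x. u x $ i) ` U)" by (intro bdd_belowI[of _ "- R"]) auto
  qed
  have \<alpha>2: "u x $ i - d \<le> \<alpha> i" if x: "x \<in> U" for x i
    unfolding \<alpha>_def
  proof (rule cInf_greatest)
    show "(\<lambda>x. u x $ i) ` U \<noteq> {}" using U(3) by blast
    fix t assume "t \<in> (\<lambda>x. u x $ i) ` U"
    then obtain w where w: "w \<in> U" "t = u w $ i" by blast
    have "(u x - u w) $ i \<le> norm (u x - u w)" using component_le_norm_cart[of "u x - u w" i] by linarith
    also have "\<dots> \<le> diameter (u ` U)"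
      using diameter_bounded_bound[OF bdu imageI[OF x] imageI[OF w(1)]] by (simp add: dist_norm)
    finally show "u x $ i - d \<le> t" using diam w(2) by simp
  qed
  define \<kappa> where "\<kappa> x = (\<lambda>i. \<lfloor>(u x $ i - \<alpha> i) / l\<rfloor>)" for x
  have \<kappa>0: "0 \<le> \<kappa> x i" "\<kappa> x i < int K" if x: "x \<in> U" for x i
  proof -
    have "0 \<le> (u x $ i - \<alpha> i) / l" using \<alpha>1[OF x, of i] l by simp
    then show "0 \<le> \<kappa> x i" by (simp add: \<kappa>_def)
    have "u x $ i - \<alpha> i < l * real K" using \<alpha>2[OF x, of i] lK rK
      by (smt (verit) zero_less_divide_1_iff)
    then have "(u x $ i - \<alpha> i) / l < real K" using l by (simp add: field_simps)
    then show "\<kappa> x i < int K" unfolding \<kappa>_def by linarith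
  qed
  define E where "E k = {z :: real ^ ('n + 'n). \<forall>i. \<alpha> i + l * of_int (k i) \<le> z $ i \<and> z $ i < \<alpha> i + l * of_int (k i) + l}" for k
  define W where "W k = {x \<in> U. \<kappa> x = k}" for k
  have uE: "u x \<in> E (\<kappa> x)" for x
    unfolding E_def
  proof (intro CollectI allI conjI)
    fix i
    have "of_int (\<kappa> x i) \<le> (u x $ i - \<alpha> i) / l" "(u x $ i - \<alpha> i) / l < of_int (\<kappa> x i) + 1"
      unfolding \<kappa>_def by linarith+
    then have "l * of_int (\<kappa> x i) \<le> l * ((u x $ i - \<alpha> i) / l)" "l * ((u x $ i - \<alpha> i) / l) < l * (of_int (\<kappa> x i) + 1)"
      using l by (intro mult_left_mono mult_strict_left_mono; simp)+
    then show "\<alpha> i + l * of_int (\<kappa> x i) \<le> u x $ i" "u x $ i < \<alpha> i + l * of_int (\<kappa> x i) + l"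
      using l by (simp_all add: distrib_left)
  qed
  have Eu: "\<kappa> x = k" if "u x \<in> E k" for x k
  proof
    fix i
    have *: "\<alpha> i + l * of_int (k i) \<le> u x $ i" "u x $ i < \<alpha> i + l * of_int (k i) + l"
      using that by (auto simp: E_def)
    show "\<kappa> x i = k i"
      unfolding \<kappa>_def
    proof (rule floor_unique)
      show "of_int (k i) \<le> (u x $ i - \<alpha> i) / l" using *(1) l by (simp add: pos_le_divide_eq mult.commute)
      show "(u x $ i - \<alpha> i) / l < of_int (k i) + 1" using *(2) l by (simp add: pos_divide_less_eq algebra_simps)
    qed
  qed
  have WE: "W k = U \<inter> u -` E k" for k using uE Eu by (auto simp: W_def)
  have borE: "E k \<in> sets borel" for k
  proof -
    have "E k = (\<Inter>i\<in>UNIV. {z. \<alpha> i + l * of_int (k i) \<le> z $ i} \<inter> {z. z $ i < \<alpha> i + l * of_int (k i) + l})"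
      by (auto simp: E_def)
    also have "\<dots> \<in> sets borel"
      by (intro sets.countable_INT'' sets.Int borel_closed borel_open closed_Collect_le open_Collect_less continuous_intros) auto
    finally show ?thesis .
  qed
  have measE: "E k \<in> lmeasurable" "measure lebesgue (E k) \<le> l ^ m" for k
  proof -
    let ?a = "(\<chi> i. \<alpha> i + l * of_int (k i)) :: real ^ ('n + 'n)" and ?b = "(\<chi> i. \<alpha> i + l * of_int (k i) + l) :: real ^ ('n + 'n)"
    have sub: "E k \<subseteq> cbox ?a ?b" by (auto simp: E_def mem_box_cart less_imp_le)
    show lm: "E k \<in> lmeasurable"
      using bounded_subset[OF bounded_cbox sub] borE sets_completionI_sets[of "E k" lborel]
      by (intro bounded_set_imp_lmeasurable) auto
    have "?a $ i \<le> ?b $ i" for i using l by auto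
    then have "cbox ?a ?b \<noteq> {}" using interval_ne_empty_cart(1)[of ?a ?b] by blast
    then have "measure lborel (cbox ?a ?b) = (\<Prod>i\<in>UNIV. ?b $ i - ?a $ i)" by (rule content_cbox_cart)
    also have "\<dots> = l ^ m" by (simp add: m_def prod_constant)
    finally show "measure lebesgue (E k) \<le> l ^ m"
      using measure_mono_fmeasurable[OF sub fmeasurableD[OF lm] lmeasurable_cbox] by simp
  qed
  have mu: "u \<in> borel_measurable (lebesgue_on U)"
    by (rule continuous_imp_measurable_on_sets_lebesgue[OF cont sU])
  have WU: "W k \<subseteq> U" for k by (auto simp: W_def)
  have sW: "W k \<in> sets lebesgue" for k
  proof -
    have "u -` E k \<inter> space (lebesgue_on U) \<in> sets (lebesgue_on U)" by (rule measurable_sets[OF mu borE])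
    then have "u -` E k \<inter> U \<in> sets lebesgue" using sU by (simp add: sets_restrict_space_iff space_restrict_space)
    then show ?thesis by (simp add: WE Int_commute)
  qed
  have lmS: "S \<in> lmeasurable" if "S \<in> sets lebesgue" "S \<subseteq> U" for S
    using that bounded_subset[OF U(2)] by (intro bounded_set_imp_lmeasurable) auto
  note lmW = lmS[OF sW WU]
  \<comment> \<open>Truncation at 1 changes nothing almost everywhere, because \<open>f\<close> is
    positive there, but it makes \<open>s\<close> bounded everywhere.\<close>
  have s: "s \<in> borel_measurable (lebesgue_on U)" "\<And>x. 0 \<le> s x" "\<And>x. s x \<le> 1"
    using f by (auto simp: s_def)
  have sp: "(\<lambda>x. s x powr p) \<in> borel_measurable (lebesgue_on U)" "\<And>x. 0 \<le> s x powr p" "\<And>x. s x powr p \<le> 1"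
  proof -
    show "(\<lambda>x. s x powr p) \<in> borel_measurable (lebesgue_on U)" using s(1) by measurable
    show "0 \<le> s x powr p" "s x powr p \<le> 1" for x using powr_mono2[of p "s x" 1] s(2,3) p by auto
  qed
  define \<nu> where "\<nu> S = (LINT x|lebesgue_on U. indicator S x * s x)" for S
  have \<nu>0: "\<nu> S \<ge> 0" for S unfolding \<nu>_def using s(2) by (intro Bochner_Integration.integral_nonneg) auto
  note intW = integral_indicator_lebesgue_on[OF sU lmW WU]
  note intWs = integrable_indicator_mult_unit[OF sU lmW WU s]
  have spU: "space (lebesgue_on U) = U" by (simp add: space_restrict_space)
  have indE: "indicator (E k) (u x) * f x = indicator (W k) x * f x" if "x \<in> U" for x k
    using that by (simp add: WE indicator_def)
  have Wf: "integrable (lebesgue_on U) (\<lambda>x. indicator (W k) x * f x)"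
    "(LINT x|lebesgue_on U. indicator (W k) x * f x) \<le> l ^ m" for k
  proof -
    have "integrable (lebesgue_on U) (\<lambda>x. indicator (E k) (u x) * f x) \<longleftrightarrow> integrable (lebesgue_on U) (\<lambda>x. indicator (W k) x * f x)"
      by (rule Bochner_Integration.integrable_cong) (simp_all add: spU indE)
    then show "integrable (lebesgue_on U) (\<lambda>x. indicator (W k) x * f x)" using area(1)[OF borE measE(1)] by blast
    have "(LINT x|lebesgue_on U. indicator (E k) (u x) * f x) = (LINT x|lebesgue_on U. indicator (W k) x * f x)"
      by (rule Bochner_Integration.integral_cong) (simp_all add: spU indE)
    then show "(LINT x|lebesgue_on U. indicator (W k) x * f x) \<le> l ^ m"
      using area(2)[OF borE measE(1), of k] measE(2)[of k] by linarith
  qed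
  \<comment> \<open>Of the two volume bounds, this crude one limits the measure of a row, over which
    Jensen averages; the next one measures the true excess over a cube.\<close>
  have Wlam: "measure lebesgue (W k) \<le> l ^ m / lam" for k
  proof -
    have "lam * measure lebesgue (W k) = (LINT x|lebesgue_on U. lam * indicator (W k) x)"
      by (simp only: integral_mult_right_zero intW(2))
    also have "\<dots> \<le> (LINT x|lebesgue_on U. indicator (W k) x * f x)"
    proof (rule integral_mono_AE)
      show "integrable (lebesgue_on U) (\<lambda>x. lam * indicator (W k) x)"
        using intW(1) by (rule Bochner_Integration.integrable_mult_right)
      show "AE x in lebesgue_on U. lam * indicator (W k) x \<le> indicator (W k) x * f x"
        using lf by eventually_elim (simp add: indicator_def)
    qed (rule Wf(1))
    finally show ?thesis using Wf(2)[of k] lam by (simp add: field_simps)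
  qed
  have W\<nu>: "measure lebesgue (W k) \<le> l ^ m + \<nu> (W k)" for k
  proof -
    have "measure lebesgue (W k) = (LINT x|lebesgue_on U. indicator (W k) x)" by (simp only: intW(2))
    also have "\<dots> \<le> (LINT x|lebesgue_on U. indicator (W k) x * f x + indicator (W k) x * s x)"
    proof (rule integral_mono_AE[OF intW(1) Bochner_Integration.integrable_add[OF Wf(1) intWs]])
      show "AE x in lebesgue_on U. indicator (W k) x \<le> indicator (W k) x * f x + indicator (W k) x * s x"
        using lf by eventually_elim (use lam in \<open>auto simp: indicator_def s_def min_def max_def\<close>)
    qed
    also have "\<dots> = (LINT x|lebesgue_on U. indicator (W k) x * f x) + \<nu> (W k)"
      unfolding Bochner_Integration.integral_add[OF Wf(1) intWs] \<nu>_def ..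
    finally show ?thesis using Wf(2)[of k] by linarith
  qed
  define KK where "KK = \<kappa> ` U"
  have KK0: "0 \<le> k i" "k i < int K" if "k \<in> KK" for k i using that \<kappa>0 by (auto simp: KK_def)
  have finKK: "finite KK"
  proof (rule finite_subset)
    show "KK \<subseteq> Pi\<^sub>E UNIV (\<lambda>_. {0..<int K})" using KK0 by (auto simp: PiE_iff)
    show "finite (Pi\<^sub>E (UNIV :: ('n + 'n) set) (\<lambda>_. {0..<int K}))" by (intro finite_PiE) auto
  qed
  have disW: "disjoint_family W" by (auto simp: disjoint_family_on_def W_def)
  have UW: "U = (\<Union>k\<in>KK. W k)" by (auto simp: W_def KK_def)
  have neW: "W k \<noteq> {}" if "k \<in> KK" for k using that by (auto simp: W_def KK_def)
  define i1 :: "'n + 'n" where "i1 = Inl undefined"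
  \<comment> \<open>A row is represented by its cube with \<open>i1\<close>-coordinate 0;
    \<open>V r\<close> is the part of \<open>U\<close> that is mapped into row
    \<open>r\<close>.\<close>
  define \<rho> where "\<rho> k = k(i1 := 0)" for k :: "'n + 'n \<Rightarrow> int"
  define V where "V r = {x \<in> U. \<rho> (\<kappa> x) = r}" for r
  have VU: "V r \<subseteq> U" for r by (auto simp: V_def)
  have V\<rho>: "V (\<rho> k) = (\<Union>j\<in>{0..<int K}. W (k(i1 := j)))" for k
  proof
    show "V (\<rho> k) \<subseteq> (\<Union>j\<in>{0..<int K}. W (k(i1 := j)))"
    proof
      fix x assume x: "x \<in> V (\<rho> k)"
      then have xU: "x \<in> U" and eq: "(\<kappa> x)(i1 := 0) = k(i1 := 0)" by (auto simp: V_def \<rho>_def)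
      have "\<kappa> x i = k i" if "i \<noteq> i1" for i using fun_cong[OF eq, of i] that by simp
      then have "\<kappa> x = k(i1 := \<kappa> x i1)" by (auto simp: fun_eq_iff)
      then show "x \<in> (\<Union>j\<in>{0..<int K}. W (k(i1 := j)))" using xU \<kappa>0[OF xU, of i1] by (auto simp: W_def)
    qed
    show "(\<Union>j\<in>{0..<int K}. W (k(i1 := j))) \<subseteq> V (\<rho> k)" by (auto simp: V_def W_def \<rho>_def)
  qed
  have sV: "V r \<in> sets lebesgue" for r
  proof -
    have "V r = (\<Union>k\<in>{k \<in> KK. \<rho> k = r}. W k)" by (auto simp: V_def W_def KK_def)
    then show ?thesis using finKK sW by (auto intro!: sets.finite_UN)
  qed
  note lmV = lmS[OF sV VU]
  define H where "H = real K * (l ^ m / lam)"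
  have H: "H > 0" using rK l lam by (simp add: H_def)
  have inj_upd: "inj_on (\<lambda>j. k(i1 := j)) A" for k :: "'n + 'n \<Rightarrow> int" and A
    by (rule inj_onI) (metis fun_upd_same)
  have disj: "disjoint_family_on (\<lambda>j. W (k(i1 := j))) {0..<int K}" for k
    by (auto simp: disjoint_family_on_def W_def dest: fun_cong[of _ _ i1])
  have measV: "measure lebesgue (V (\<rho> k)) \<le> H" for k
  proof -
    have "measure lebesgue (V (\<rho> k)) \<le> (\<Sum>j\<in>{0..<int K}. measure lebesgue (W (k(i1 := j))))"
      unfolding V\<rho> using sW by (intro measure_UNION_le) auto
    also have "\<dots> \<le> (\<Sum>j\<in>{0..<int K}. l ^ m / lam)" by (intro sum_mono Wlam)
    also have "\<dots> = H" by (simp add: H_def)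
    finally show ?thesis .
  qed
  have \<nu>V: "\<nu> (V (\<rho> k)) = (\<Sum>j\<in>{0..<int K}. \<nu> (W (k(i1 := j))))" for k
  proof -
    have "indicator (V (\<rho> k)) x * s x = (\<Sum>j\<in>{0..<int K}. indicator (W (k(i1 := j))) x * s x)" for x
      unfolding V\<rho> indicator_UN_disjoint[OF finite_atLeastLessThan_int disj] by (simp only: sum_distrib_right)
    then show ?thesis unfolding \<nu>_def by (simp only: Bochner_Integration.integral_sum[OF intWs])
  qed
  \<comment> \<open>The relative excess to be stacked. The additional \<open>1 / real K\<close>
    supplies the reserve volume \<open>l ^ m / real K\<close> that the approximation lemma demands;
    over a whole row it adds up to a single cube side.\<close>
  define g where "g k = \<nu> (W k) / l ^ m + 1 / real K" for k
  have g0: "g k \<ge> 0" for k using \<nu>0[of "W k"] l by (simp add: g_def)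
  define b where "b k = l * (\<Sum>j\<in>{0..<int K}. g (k(i1 := j))) + 2 * real m * l" for k
  have b0: "b k \<ge> 0" for k unfolding b_def using g0 l by (intro add_nonneg_nonneg mult_nonneg_nonneg sum_nonneg) auto
  have targets: "\<exists>h D. 0 < h \<and> h < h0 \<and> (\<forall>k\<in>KK. finite (D k)) \<and> disjoint_family_on D KK \<and>
      (\<forall>k\<in>KK. measure lebesgue (W k) + l ^ m / real K \<le> real (card (D k)) * h ^ CARD('n + 'n)) \<and>
      (\<forall>k\<in>KK. \<forall>x\<in>W k. \<forall>z. cell_index h z \<in> D k \<longrightarrow> norm (z - u x) \<le> b k)" if h0: "h0 > 0" for h0
  proof -
    \<comment> \<open>\<open>K \<le> N\<close> keeps the rounding errors of a row below
      \<open>l\<close>; the other entry brings the mesh \<open>l / real N\<close> below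
      \<open>h0\<close>.\<close>
    define N where "N = max K (nat \<lceil>l / h0\<rceil> + 1)"
    have N: "K \<le> N" "N \<ge> 1" "l / h0 < real N"
    proof -
      show "K \<le> N" "N \<ge> 1" by (auto simp: N_def)
      have "real (nat \<lceil>l / h0\<rceil> + 1) \<le> real N" by (simp only: N_def of_nat_le_iff max.cobounded2)
      then show "l / h0 < real N" by linarith
    qed
    define h where "h = l / real N"
    have h: "0 < h" "h < h0" "l = real N * h" using l N h0 by (simp_all add: h_def field_simps)
    define n where "n k = nat \<lceil>real N * (1 + g k)\<rceil>" for k
    define \<beta> where "\<beta> i = \<lfloor>\<alpha> i / h\<rfloor>" for i
    define F where "F k = (\<Sum>j\<in>{0..<k i1}. int (n (k(i1 := j))))" for k
    define D where "D k = Pi\<^sub>E UNIV (\<lambda>i. if i = i1 then {\<beta> i1 + F k..<\<beta> i1 + F k + int (n k)}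
      else {\<beta> i + int N * k i..<\<beta> i + int N * k i + int N})" for k
    note st = stacked_cells[where n = n and \<beta> = \<beta> and N = N and ?i1.0 = i1, folded F_def, folded D_def]
    have vol: "measure lebesgue (W k) + l ^ m / real K \<le> real (card (D k)) * h ^ CARD('n + 'n)" for k
    proof -
      have lh: "l ^ m = real N * (real N ^ (m - 1) * h ^ m)"
      proof -
        have "real N ^ m = real N * real N ^ (m - 1)" using m by (cases m) auto
        then show ?thesis by (simp add: h(3) power_mult_distrib)
      qed
      have "real N * (1 + g k) \<le> real (n k)" unfolding n_def by linarith
      then have "(real N * (1 + g k)) * (real N ^ (m - 1) * h ^ m) \<le> real (n k) * (real N ^ (m - 1) * h ^ m)"
        using h(1) by (intro mult_right_mono) auto
      also have "\<dots> = real (card (D k)) * h ^ m" by (simp add: st(2) m_def mult_ac)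
      finally have "(1 + g k) * l ^ m \<le> real (card (D k)) * h ^ m" by (simp add: lh mult_ac)
      moreover have "(1 + g k) * l ^ m = l ^ m + \<nu> (W k) + l ^ m / real K"
        using l by (simp add: g_def distrib_right)
      ultimately show ?thesis using W\<nu>[of k] by (simp add: m_def)
    qed
    have dst: "norm (z - u x) \<le> b k" if k: "k \<in> KK" and x: "x \<in> W k" and z: "cell_index h z \<in> D k" for k x z
    proof -
      have "u x \<in> E k" using x by (simp add: WE)
      then have y: "\<alpha> i + l * of_int (k i) \<le> u x $ i" "u x $ i \<le> \<alpha> i + l * of_int (k i) + l" for i
        by (auto simp: E_def less_imp_le)
      show ?thesis unfolding b_def m_def
        by (rule stacked_cells_distance[OF h(1) h(3) N(1) KK0[OF k] g0 y z[unfolded D_def F_def n_def \<beta>_def]])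
    qed
    have "disjoint_family_on D KK" using st(3) by (rule disjoint_family_on_mono[rotated]) (use KK0 in blast)
    then show ?thesis using h(1,2) st(1) vol dst by (intro exI[of _ h] exI[of _ D]) blast
  qed
  obtain r0 where r0: "\<And>x. x \<in> U \<Longrightarrow> norm x \<le> r0" "r0 > 0"
    using bounded_pos[THEN iffD1, OF U(2)] by blast
  have e: "l ^ m / real K > 0" using l rK by simp
  have p0: "p > 0" using p by simp
  have "\<exists>\<Phi>. symplectic_diffeo \<Phi> \<and>
     (LINT x|lebesgue_on U. norm (u x - \<Phi> x) powr p) \<le> (\<Sum>k\<in>KK. b k powr p * measure lebesgue (W k)) + \<tau>"
    by (rule approximation_by_symplectic_diffeo[OF sU r0(2) r0(1) R[rule_format] finKK sW
        disjoint_family_on_mono[OF subset_UNIV disW] UW neW b0 e p0 \<tau> targets])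
  then obtain \<Phi> where \<Phi>: "symplectic_diffeo \<Phi>"
    "(LINT x|lebesgue_on U. norm (u x - \<Phi> x) powr p) \<le> (\<Sum>k\<in>KK. b k powr p * measure lebesgue (W k)) + \<tau>" by blast
  \<comment> \<open>Each \<open>b k\<close> splits into \<open>A\<close>, which depends on the row
    only, and a constant of order \<open>l\<close>, which disappears as \<open>K\<close> grows. The
    summand 1 in \<open>c\<close> stems from the reserves \<open>1 / real K\<close>.\<close>
  define c where "c = (2 * real m + 1) * l"
  define A where "A r = l / l ^ m * \<nu> (V r)" for r
  have c0: "c \<ge> 0" using l by (simp add: c_def)
  have A0: "A r \<ge> 0" for r using l \<nu>0[of "V r"] by (simp add: A_def)
  have bA: "b k = A (\<rho> k) + c" for k
  proof -
    have "(\<Sum>j\<in>{0..<int K}. g (k(i1 := j))) = \<nu> (V (\<rho> k)) / l ^ m + 1"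
      unfolding g_def sum.distrib \<nu>V sum_divide_distrib using rK by simp
    then show ?thesis by (simp add: b_def A_def c_def algebra_simps)
  qed
  have sumW: "(\<Sum>k\<in>L. measure lebesgue (W k)) = measure lebesgue (\<Union>k\<in>L. W k)" if "L \<subseteq> KK" for L
    using finite_subset[OF that finKK] sW fmeasurableD2[OF lmW] disjoint_family_on_mono[OF subset_UNIV disW]
    by (intro measure_finite_Union[symmetric]) auto
  have VL: "(\<Union>k\<in>{k \<in> KK. \<rho> k = r}. W k) = V r" for r by (auto simp: V_def W_def KK_def)
  define RR where "RR = \<rho> ` KK"
  have finRR: "finite RR" using finKK by (simp add: RR_def)
  have rowint: "integrable (lebesgue_on U) (\<lambda>x. indicator (V r) x * s x powr p)" for r
    by (rule integrable_indicator_mult_unit[OF sU lmV VU sp])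
  \<comment> \<open>\<open>H\<close> is \<open>K\<close> times the crude volume bound of one cube,
    so in \<open>l / l ^ m * H\<close> the powers of \<open>l\<close> cancel down to the length
    \<open>l * real K\<close> of the row; this is where \<open>d / lam\<close> comes from.\<close>
  have row: "A r powr p * measure lebesgue (V r) \<le>
      ((d + 1 / real K) / lam) powr p * (LINT x|lebesgue_on U. indicator (V r) x * s x powr p)" if r: "r \<in> RR" for r
  proof -
    obtain k where k: "r = \<rho> k" using r by (auto simp: RR_def)
    have "A r powr p * measure lebesgue (V r) \<le> A r powr p * H"
      unfolding k by (intro mult_left_mono measV) auto
    also have "\<dots> = (l / l ^ m) powr p * (\<nu> (V r) powr p * H)"
      unfolding A_def using l \<nu>0[of "V r"] by (subst powr_mult) auto
    also have "\<dots> \<le> (l / l ^ m) powr p * (H powr p * (LINT x|lebesgue_on U. indicator (V r) x * s x powr p))"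
      unfolding \<nu>_def k by (intro mult_left_mono integral_powr_le[OF sU lmV VU measV H s p]) auto
    also have "\<dots> = (l / l ^ m * H) powr p * (LINT x|lebesgue_on U. indicator (V r) x * s x powr p)"
      using l H by (subst powr_mult) auto
    also have "l / l ^ m * H = (d + 1 / real K) / lam"
      using l lam lK by (simp add: H_def field_simps)
    finally show ?thesis .
  qed
  have "(\<Sum>k\<in>KK. A (\<rho> k) powr p * measure lebesgue (W k)) =
      (\<Sum>r\<in>RR. \<Sum>k\<in>{k \<in> KK. \<rho> k = r}. A (\<rho> k) powr p * measure lebesgue (W k))"
    by (rule sum.group[symmetric, OF finKK finRR]) (simp add: RR_def)
  also have "\<dots> = (\<Sum>r\<in>RR. A r powr p * measure lebesgue (V r))"
  proof (rule sum.cong[OF refl])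
    fix r
    have "(\<Sum>k\<in>{k \<in> KK. \<rho> k = r}. A (\<rho> k) powr p * measure lebesgue (W k)) =
        (\<Sum>k\<in>{k \<in> KK. \<rho> k = r}. A r powr p * measure lebesgue (W k))" by (rule sum.cong) auto
    also have "\<dots> = A r powr p * measure lebesgue (V r)"
      unfolding sum_distrib_left[symmetric] by (subst sumW) (auto simp: VL)
    finally show "(\<Sum>k\<in>{k \<in> KK. \<rho> k = r}. A (\<rho> k) powr p * measure lebesgue (W k)) = A r powr p * measure lebesgue (V r)" .
  qed
  also have "\<dots> \<le> (\<Sum>r\<in>RR. ((d + 1 / real K) / lam) powr p * (LINT x|lebesgue_on U. indicator (V r) x * s x powr p))"
    by (rule sum_mono[OF row])
  also have "\<dots> = ((d + 1 / real K) / lam) powr p * (LINT x|lebesgue_on U. (\<Sum>r\<in>RR. indicator (V r) x * s x powr p))"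
    by (simp only: sum_distrib_left[symmetric] Bochner_Integration.integral_sum[OF rowint])
  also have "(LINT x|lebesgue_on U. (\<Sum>r\<in>RR. indicator (V r) x * s x powr p)) = (LINT x|lebesgue_on U. s x powr p)"
  proof (rule Bochner_Integration.integral_cong[OF refl])
    fix x assume "x \<in> space (lebesgue_on U)"
    then have x: "x \<in> U" by (simp add: spU)
    have dV: "disjoint_family_on V RR" by (auto simp: disjoint_family_on_def V_def)
    have "x \<in> (\<Union>r\<in>RR. V r)" using x by (auto simp: V_def RR_def KK_def)
    then have "(\<Sum>r\<in>RR. indicator (V r) x) = (1::real)"
      by (simp add: indicator_UN_disjoint[OF finRR dV, symmetric])
    then show "(\<Sum>r\<in>RR. indicator (V r) x * s x powr p) = s x powr p"
      by (simp only: sum_distrib_right[symmetric] mult_1_left)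
  qed
  finally have rows: "(\<Sum>k\<in>KK. A (\<rho> k) powr p * measure lebesgue (W k)) \<le>
      ((d + 1 / real K) / lam) powr p * (LINT x|lebesgue_on U. s x powr p)" .
  have "(\<Sum>k\<in>KK. b k powr p * measure lebesgue (W k)) \<le>
      (\<Sum>k\<in>KK. 2 powr p * (A (\<rho> k) powr p * measure lebesgue (W k)) + 2 powr p * (c powr p * measure lebesgue (W k)))"
  proof (rule sum_mono)
    fix k
    have "b k powr p * measure lebesgue (W k) \<le> (2 powr p * (A (\<rho> k) powr p + c powr p)) * measure lebesgue (W k)"
      unfolding bA using p by (intro mult_right_mono powr_add_le A0 c0) auto
    then show "b k powr p * measure lebesgue (W k) \<le>
        2 powr p * (A (\<rho> k) powr p * measure lebesgue (W k)) + 2 powr p * (c powr p * measure lebesgue (W k))"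
      by (simp add: algebra_simps)
  qed
  also have "\<dots> = 2 powr p * (\<Sum>k\<in>KK. A (\<rho> k) powr p * measure lebesgue (W k)) + 2 powr p * (c powr p * measure lebesgue U)"
    unfolding sum.distrib sum_distrib_left[symmetric] sumW[OF order.refl] UW[symmetric] ..
  also have "\<dots> \<le> 2 powr p * (((d + 1 / real K) / lam) powr p * (LINT x|lebesgue_on U. s x powr p)) + 2 powr p * (c powr p * measure lebesgue U)"
    using rows by (intro add_right_mono mult_left_mono) auto
  finally have "(LINT x|lebesgue_on U. norm (u x - \<Phi> x) powr p) \<le>
    2 powr p * (((d + 1 / real K) / lam) powr p * (LINT x|lebesgue_on U. s x powr p) + c powr p * measure lebesgue U) + \<tau>"
    using \<Phi>(2) by (simp add: distrib_left)
  moreover have "c = (2 * real CARD('n + 'n) + 1) * ((d + 1 / real K) / real K)" by (simp only: c_def m_def l_def)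
  ultimately show ?thesis using \<Phi>(1) by (intro exI[of _ \<Phi>]) (simp add: add.commute)
qed

section \<open>The approximation theorem\<close>

text \<open>The constant at scale \<open>K\<close> converges as \<open>K\<close> grows, so one
  sufficiently large \<open>K\<close> reaches the limit value up to \<open>\<tau> / 2\<close>; no
  limit of symplectic maps has to be formed.\<close>

lemma symplectic_approximation:
  fixes U :: "(real ^ ('n::finite + 'n)) set" and u :: "real ^ ('n + 'n) \<Rightarrow> real ^ ('n + 'n)"
    and f :: "real ^ ('n + 'n) \<Rightarrow> real"
  assumes U: "open U" "bounded U" "U \<noteq> {}" and cont: "continuous_on U u" and R: "\<forall>x\<in>U. norm (u x) \<le> R"
    and f: "f \<in> borel_measurable (lebesgue_on U)" and lam: "lam > 0" and lf: "AE x in lebesgue_on U. lam \<le> f x"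
    and area: "\<And>A. A \<in> sets borel \<Longrightarrow> A \<in> lmeasurable \<Longrightarrow> integrable (lebesgue_on U) (\<lambda>x. indicator A (u x) * f x)"
      "\<And>A. A \<in> sets borel \<Longrightarrow> A \<in> lmeasurable \<Longrightarrow> (LINT x|lebesgue_on U. indicator A (u x) * f x) \<le> measure lebesgue A"
    and p: "p \<ge> 1" and diam: "diameter (u ` U) \<le> d" and \<tau>: "\<tau> > 0"
  shows "\<exists>\<Phi>. symplectic_diffeo \<Phi> \<and> (LINT x|lebesgue_on U. norm (u x - \<Phi> x) powr p) \<le>
    2 powr p * ((d / lam) powr p * (LINT x|lebesgue_on U. min 1 (max 0 (1 - f x)) powr p)) + \<tau>"
proof -
  define S where "S = (LINT x|lebesgue_on U. min 1 (max 0 (1 - f x)) powr p)"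
  define C where "C = 2 * real CARD('n + 'n) + 1"
  have bdu: "bounded (u ` U)" using R by (auto simp: bounded_iff)
  have d: "d \<ge> 0" using diameter_ge_0[OF bdu] diam by linarith
  define \<psi> where "\<psi> K = 2 powr p * (((d + 1 / real K) / lam) powr p * S + (C * ((d + 1 / real K) * (1 / real K))) powr p * measure lebesgue U)" for K
  have l0: "(\<lambda>K. 1 / real K) \<longlonglongrightarrow> 0" by (rule lim_1_over_n)
  have "(\<lambda>K. (d + 1 / real K) / lam) \<longlonglongrightarrow> (d + 0) / lam"
    using lam by (intro tendsto_divide tendsto_add tendsto_const l0) simp
  then have t1: "(\<lambda>K. ((d + 1 / real K) / lam) powr p) \<longlonglongrightarrow> ((d + 0) / lam) powr p"
  proof (rule tendsto_powr'[OF _ tendsto_const])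
    \<comment> \<open>When \<open>d = 0\<close> the power is continuous at its base 0, since
      \<open>p\<close> is positive and the approximating bases are nonnegative.\<close>
    show "(d + 0) / lam \<noteq> 0 \<or> 0 < p \<and> (\<forall>\<^sub>F K in sequentially. 0 \<le> (d + 1 / real K) / lam)"
      using lam d p by (intro disjI2 conjI always_eventually allI) auto
  qed
  have "(\<lambda>K. C * ((d + 1 / real K) * (1 / real K))) \<longlonglongrightarrow> C * ((d + 0) * 0)"
    by (intro tendsto_mult tendsto_add tendsto_const l0)
  then have t2: "(\<lambda>K. (C * ((d + 1 / real K) * (1 / real K))) powr p) \<longlonglongrightarrow> (C * ((d + 0) * 0)) powr p"
  proof (rule tendsto_powr'[OF _ tendsto_const])
    show "C * ((d + 0) * 0) \<noteq> 0 \<or> 0 < p \<and> (\<forall>\<^sub>F K in sequentially. 0 \<le> C * ((d + 1 / real K) * (1 / real K)))"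
      using d p unfolding C_def by (intro disjI2 conjI always_eventually allI) auto
  qed
  have "\<psi> \<longlonglongrightarrow> 2 powr p * (((d + 0) / lam) powr p * S + (C * ((d + 0) * 0)) powr p * measure lebesgue U)"
    unfolding \<psi>_def
    by (rule tendsto_mult[OF tendsto_const tendsto_add[OF tendsto_mult[OF t1 tendsto_const] tendsto_mult[OF t2 tendsto_const]]])
  then have "\<psi> \<longlonglongrightarrow> 2 powr p * ((d / lam) powr p * S)" by simp
  then have "\<forall>\<^sub>F K in sequentially. \<psi> K < 2 powr p * ((d / lam) powr p * S) + \<tau> / 2"
    using \<tau> by (intro order_tendstoD(2)) auto
  then have "\<forall>\<^sub>F K in sequentially. \<psi> K < 2 powr p * ((d / lam) powr p * S) + \<tau> / 2 \<and> K \<ge> 1"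
    using eventually_ge_at_top[of 1] by eventually_elim blast
  then obtain K where K: "\<psi> K < 2 powr p * ((d / lam) powr p * S) + \<tau> / 2" "K \<ge> 1"
    unfolding eventually_sequentially by blast
  have \<tau>2: "\<tau> / 2 > 0" using \<tau> by simp
  obtain \<Phi> where \<Phi>: "symplectic_diffeo \<Phi>" "(LINT x|lebesgue_on U. norm (u x - \<Phi> x) powr p) \<le>
      2 powr p * (((d + 1 / K) / lam) powr p * S + ((2 * CARD('n + 'n) + 1) * ((d + 1 / K) / K)) powr p * measure lebesgue U) + \<tau> / 2"
    using symplectic_approximation_at_scale[OF U cont R f lam lf area p diam K(2) \<tau>2] unfolding S_def by blast
  have "2 powr p * (((d + 1 / K) / lam) powr p * S + ((2 * CARD('n + 'n) + 1) * ((d + 1 / K) / K)) powr p * measure lebesgue U) = \<psi> K"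
    by (simp add: \<psi>_def C_def add.commute)
  then have "(LINT x|lebesgue_on U. norm (u x - \<Phi> x) powr p) \<le> 2 powr p * ((d / lam) powr p * S) + \<tau>"
    using \<Phi>(2) K(1) by linarith
  then show ?thesis unfolding S_def using \<Phi>(1) by (intro exI[of _ \<Phi>] conjI)
qed

text \<open>An empty domain has multiplicity 0 everywhere, against the normalization to 1.
  Nonemptiness is what makes \<open>lam \<le> Lam\<close> follow and the image of \<open>U\<close>
  have positive measure.\<close>

lemma essentially_injective_nonempty:
  fixes U :: "(real ^ 'm::finite) set"
  assumes "essentially_injective U u"
  shows "U \<noteq> {}"
proof
  assume "U = {}"
  then have eq: "multiplicity_on U u = (\<lambda>_. 0)" by (simp add: multiplicity_on_def fun_eq_iff)
  have "esssup lebesgue (\<lambda>_ :: real ^ 'm. 0 :: ennreal) = 1" using assms unfolding essentially_injective_def eq .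
  moreover have "esssup lebesgue (\<lambda>_ :: real ^ 'm. 0 :: ennreal) \<le> 0" by (rule esssup_I) auto
  ultimately show False using not_one_le_zero by metis
qed

lemma continuous_on_symplectic_defect:
  "continuous_on UNIV (\<lambda>M :: real ^ ('n::finite + 'n) ^ ('n + 'n). transpose M ** symplectic_J ** M - symplectic_J)"
  unfolding matrix_matrix_mult_def transpose_def by (intro continuous_intros)

text \<open>Integrability matters for the case distinction on the defect: the Bochner integral of a
  non-integrable function is 0 by convention, so otherwise a vanishing integral would say nothing
  about \<open>u\<close>. It holds because the defect is a continuous function of an essentially
  bounded matrix field.\<close>

lemma integrable_symplectic_defect:
  fixes D :: "real ^ ('n::finite + 'n) \<Rightarrow> real ^ ('n + 'n) ^ ('n + 'n)"
  assumes U: "U \<in> sets lebesgue" "bounded U" and D: "D \<in> borel_measurable (lebesgue_on U)"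
    and B: "AE x in lebesgue_on U. norm (D x) \<le> B" and p: "p \<ge> 0"
  shows "integrable (lebesgue_on U) (\<lambda>x. norm (transpose (D x) ** symplectic_J ** D x - symplectic_J) powr p)"
proof -
  let ?F = "\<lambda>M :: real ^ ('n + 'n) ^ ('n + 'n). transpose M ** symplectic_J ** M - symplectic_J"
  have "compact (?F ` cball 0 B)"
    by (intro compact_continuous_image continuous_on_subset[OF continuous_on_symplectic_defect]) auto
  then obtain c where c: "\<forall>y\<in>?F ` cball 0 B. norm y \<le> c"
    using compact_imp_bounded[of "?F ` cball 0 B"] unfolding bounded_iff by blast
  have lm: "U \<in> lmeasurable" using U by (simp add: bounded_set_imp_lmeasurable)
  have "integrable (lebesgue_on U) (indicator U :: _ \<Rightarrow> real)"
    by (rule integral_indicator_lebesgue_on(1)[OF U(1) lm order.refl])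
  then have i: "integrable (lebesgue_on U) (\<lambda>x. c powr p * indicator U x)"
    by (rule Bochner_Integration.integrable_mult_right)
  show ?thesis
  proof (rule Bochner_Integration.integrable_bound[OF i])
    have "(\<lambda>x. ?F (D x)) \<in> borel_measurable (lebesgue_on U)"
      by (rule borel_measurable_continuous_on[OF continuous_on_symplectic_defect D])
    then show "(\<lambda>x. norm (?F (D x)) powr p) \<in> borel_measurable (lebesgue_on U)" by measurable
    have "AE x in lebesgue_on U. x \<in> U" by (intro AE_I2) (simp add: space_restrict_space)
    then show "AE x in lebesgue_on U. norm (norm (?F (D x)) powr p) \<le> norm (c powr p * indicator U x)"
      using B
    proof eventually_elim
      case (elim x)
      then have "norm (?F (D x)) \<le> c" using c by (simp add: dist_norm)
      then show ?case using elim(1) p by (simp add: powr_mono2)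
    qed
  qed
qed

text \<open>For \<open>lam < 1\<close> the root of \<open>lam\<close> is at most 1, so the middle
  factor is at least \<open>d powr p\<close>. The missing power of \<open>lam\<close> is supplied by
  the summand \<open>1 / lam powr p\<close> of the last factor, which is multiplied by a number that
  is at least 1.\<close>

lemma admissible_constant_ge:
  fixes n :: nat and p d lam Lam :: real
  assumes p: "p \<ge> 1" and lam: "0 < lam" "lam < 1" "lam \<le> Lam" and d: "d \<ge> 0"
  shows "(d / lam) powr p \<le> (1 + Lam) ^ (2 * n - 1) * (d / lam powr (1 / real n)) powr p *
    (1 + 1 / lam powr p * (Lam / lam) powr (2 * p - 2))"
proof -
  have a: "1 \<le> (1 + Lam) ^ (2 * n - 1)" using lam by (intro one_le_power) simp
  have "lam powr (1 / real n) \<le> lam powr 0" using lam by (intro powr_mono') auto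
  then have "d / 1 \<le> d / lam powr (1 / real n)" using lam d by (intro divide_left_mono) auto
  then have b: "d powr p \<le> (d / lam powr (1 / real n)) powr p" using d p by (intro powr_mono2) auto
  have "1 \<le> (Lam / lam) powr (2 * p - 2)" using lam p by (intro ge_one_powr_ge_zero) auto
  then have "1 / lam powr p * 1 \<le> 1 / lam powr p * (Lam / lam) powr (2 * p - 2)" using lam by (intro mult_left_mono) auto
  then have c: "1 / lam powr p \<le> 1 + 1 / lam powr p * (Lam / lam) powr (2 * p - 2)" by simp
  have "(d / lam) powr p = 1 * d powr p * (1 / lam powr p)" using d lam by (simp add: powr_divide)
  also have "\<dots> \<le> (1 + Lam) ^ (2 * n - 1) * (d / lam powr (1 / real n)) powr p *
      (1 + 1 / lam powr p * (Lam / lam) powr (2 * p - 2))"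
    using a b c by (intro mult_mono) auto
  finally show ?thesis .
qed

theorem proposition4p7:
  fixes p :: real
  assumes "1 \<le> p"
  shows "\<exists>C7::real. \<forall>(U :: (real ^ ('n::finite + 'n)) set) u Du (d::real) (lam::real) (Lam::real).
     open U \<longrightarrow> bounded U \<longrightarrow> connected U \<longrightarrow> lipschitz_boundary U \<longrightarrow>
     u \<in> W_1_infty U \<longrightarrow> weak_jacobian U u Du \<longrightarrow> essentially_injective U u \<longrightarrow>
     diameter (u ` U) \<le> d \<longrightarrow> 0 < lam \<longrightarrow>
     (AE x in lebesgue_on U. lam \<le> det (Du x) \<and> det (Du x) \<le> Lam) \<longrightarrow>
     (\<exists>S DS. S \<in> W_1_infty U \<and> weak_jacobian U S DS \<and> essentially_injective U S \<and>
        (AE x in lebesgue_on U. transpose (DS x) ** symplectic_J ** DS x = symplectic_J) \<and>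
        (LINT x|lebesgue_on U. norm (u x - S x) powr p) \<le>
          C7 * (1 + (1 + Lam) ^ (2 * CARD('n) - 1) * (d / lam powr (1 / real CARD('n))) powr p *
                  (1 + 1 / lam powr p * (Lam / lam) powr (2 * p - 2))) *
          (LINT x|lebesgue_on U.
             norm (transpose (Du x) ** symplectic_J ** Du x - symplectic_J) powr p))"
proof -
  define Cn where "Cn = real (card {q. q permutes (UNIV :: ('n + 'n) set)}) * (2 ^ CARD('n + 'n) * real CARD('n + 'n)) + 1"
  have Cn: "Cn > 0" unfolding Cn_def by (intro add_nonneg_pos) auto
  \<comment> \<open>The 1 pays for the additional error. In the product, \<open>2 powr p\<close>
    comes from splitting a sum inside the power and \<open>Cn powr p\<close> from bounding
    \<open>1 - det (Du x)\<close> by the defect.\<close>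
  define C7 where "C7 = 1 + 2 powr p * Cn powr p"
  have C7: "C7 \<ge> 1" by (simp add: C7_def)
  have main: "\<exists>S DS. S \<in> W_1_infty U \<and> weak_jacobian U S DS \<and> essentially_injective U S \<and>
        (AE x in lebesgue_on U. transpose (DS x) ** symplectic_J ** DS x = symplectic_J) \<and>
        (LINT x|lebesgue_on U. norm (u x - S x) powr p) \<le>
          C7 * (1 + (1 + Lam) ^ (2 * CARD('n) - 1) * (d / lam powr (1 / real CARD('n))) powr p *
                  (1 + 1 / lam powr p * (Lam / lam) powr (2 * p - 2))) *
          (LINT x|lebesgue_on U.
             norm (transpose (Du x) ** symplectic_J ** Du x - symplectic_J) powr p)"
    if U: "open U" "bounded U" and u: "u \<in> W_1_infty U" and Du: "weak_jacobian U u Du"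
      and inj: "essentially_injective U u" and diam: "diameter (u ` U) \<le> d" and lam: "0 < lam"
      and det: "AE x in lebesgue_on U. lam \<le> det (Du x) \<and> det (Du x) \<le> Lam"
    for U :: "(real ^ ('n + 'n)) set" and u Du d lam Lam
  proof -
    define G where "G x = norm (transpose (Du x) ** symplectic_J ** Du x - symplectic_J)" for x
    define I where "I = (LINT x|lebesgue_on U. G x powr p)"
    define Q where "Q = (1 + Lam) ^ (2 * CARD('n) - 1) * (d / lam powr (1 / real CARD('n))) powr p *
        (1 + 1 / lam powr p * (Lam / lam) powr (2 * p - 2))"
    have ne: "U \<noteq> {}" by (rule essentially_injective_nonempty[OF inj])
    have sU: "U \<in> sets lebesgue" by (rule open_sets_lebesgue[OF U(1)])
    obtain B where B: "Du \<in> borel_measurable (lebesgue_on U)" "AE x in lebesgue_on U. norm (Du x) \<le> B"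
      by (rule weak_jacobian_essentially_bounded[OF U(1) u Du])
    have cont: "continuous_on U u" using u by (simp add: W_1_infty_def)
    obtain R where R: "\<forall>x\<in>U. norm (u x) \<le> R" by (rule W_1_infty_bounded[OF U(1) u])
    have bdu: "bounded (u ` U)" using R by (auto simp: bounded_iff)
    have d: "d \<ge> 0" using diameter_ge_0[OF bdu] diam by linarith
    \<comment> \<open>A property that holds almost everywhere on a nonempty open set holds at some
      point. The resulting \<open>lam \<le> Lam\<close> makes \<open>Q\<close> nonnegative.\<close>
    have LL: "lam \<le> Lam"
    proof (rule ccontr)
      assume *: "\<not> lam \<le> Lam"
      have "AE x in lebesgue_on U. False" using det by eventually_elim (use * in linarith)
      then have "negligible {x \<in> U. \<not> False}" unfolding AE_lebesgue_on_iff_negligible[OF sU] .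
      then show False using open_not_negligible[OF U(1) ne] by simp
    qed
    have Q: "Q \<ge> 0" unfolding Q_def using lam LL by (intro mult_nonneg_nonneg add_nonneg_nonneg) auto
    have iG: "integrable (lebesgue_on U) (\<lambda>x. G x powr p)"
      unfolding G_def by (rule integrable_symplectic_defect[OF sU U(2) B]) (use assms in simp)
    have I: "I \<ge> 0" unfolding I_def by (intro Bochner_Integration.integral_nonneg) simp
    have "\<exists>S DS. S \<in> W_1_infty U \<and> weak_jacobian U S DS \<and> essentially_injective U S \<and>
        (AE x in lebesgue_on U. transpose (DS x) ** symplectic_J ** DS x = symplectic_J) \<and>
        (LINT x|lebesgue_on U. norm (u x - S x) powr p) \<le> C7 * (1 + Q) * I"
    proof (cases "I = 0")
      case True
      then have "AE x in lebesgue_on U. G x powr p = 0"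
        unfolding I_def using integral_nonneg_eq_0_iff_AE[OF iG] by simp
      then have "AE x in lebesgue_on U. transpose (Du x) ** symplectic_J ** Du x = symplectic_J"
        by eventually_elim (simp add: G_def)
      then show ?thesis using u Du inj True by (intro exI[of _ u] exI[of _ Du]) simp
    next
      case False
      then have I: "I > 0" using I by simp
      define s where "s x = min 1 (max 0 (1 - det (Du x)))" for x
      have lf: "AE x in lebesgue_on U. lam \<le> det (Du x)" using det by eventually_elim blast
      note area = area_inequality[OF U cont inj B(1) weak_jacobian_has_derivative_AE[OF U u Du] lam det]
      obtain \<Phi> where \<Phi>: "symplectic_diffeo \<Phi>"
        "(LINT x|lebesgue_on U. norm (u x - \<Phi> x) powr p) \<le> 2 powr p * ((d / lam) powr p * (LINT x|lebesgue_on U. s x powr p)) + I"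
        using symplectic_approximation[OF U ne cont R borel_measurable_det[OF B(1)] lam lf area(2) area(1) assms diam I]
        unfolding s_def by blast
      have "(LINT x|lebesgue_on U. s x powr p) \<le> (LINT x|lebesgue_on U. Cn powr p * G x powr p)"
      proof (rule integral_mono_AE')
        show "integrable (lebesgue_on U) (\<lambda>x. Cn powr p * G x powr p)"
          using iG by (rule Bochner_Integration.integrable_mult_right)
        show "AE x in lebesgue_on U. s x powr p \<le> Cn powr p * G x powr p"
          using lf
        proof eventually_elim
          case (elim x)
          then have "1 - det (Du x) \<le> Cn * G x"
            unfolding Cn_def G_def using lam by (intro one_minus_det_le) simp
          moreover have "0 \<le> Cn * G x" using Cn by (simp add: G_def)
          ultimately have "s x \<le> Cn * G x" by (simp add: s_def min.coboundedI2)
          then have "s x powr p \<le> (Cn * G x) powr p" using assms by (intro powr_mono2) (auto simp: s_def)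
          then show ?case using Cn by (simp add: powr_mult G_def)
        qed
        show "AE x in lebesgue_on U. 0 \<le> Cn powr p * G x powr p" by simp
      qed
      then have sI: "(LINT x|lebesgue_on U. s x powr p) \<le> Cn powr p * I" by (simp add: I_def)
      have "2 powr p * ((d / lam) powr p * (LINT x|lebesgue_on U. s x powr p)) \<le> 2 powr p * Cn powr p * Q * I"
      proof (cases "lam < 1")
        case True
        have "(d / lam) powr p \<le> Q" unfolding Q_def by (rule admissible_constant_ge[OF assms lam True LL d])
        then have "(d / lam) powr p * (LINT x|lebesgue_on U. s x powr p) \<le> Q * (Cn powr p * I)"
          using sI Q by (intro mult_mono) auto
        then have "2 powr p * ((d / lam) powr p * (LINT x|lebesgue_on U. s x powr p)) \<le> 2 powr p * (Q * (Cn powr p * I))"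
          by (intro mult_left_mono) auto
        then show ?thesis by (simp add: mult_ac)
      next
        case False
        have "AE x in lebesgue_on U. s x powr p = 0"
          using lf by eventually_elim (use False in \<open>auto simp: s_def\<close>)
        then have "(LINT x|lebesgue_on U. s x powr p) = 0" by (rule integral_eq_zero_AE)
        then show ?thesis using Q I by simp
      qed
      also have "\<dots> \<le> (C7 - 1) * (1 + Q) * I"
        unfolding C7_def using Q I by (intro mult_right_mono mult_mono) auto
      finally have "(LINT x|lebesgue_on U. norm (u x - \<Phi> x) powr p) \<le> (C7 - 1) * (1 + Q) * I + I" using \<Phi>(2) by linarith
      also have "\<dots> \<le> (C7 - 1) * (1 + Q) * I + (1 + Q) * I" using Q I by simp
      also have "\<dots> = C7 * (1 + Q) * I" by (simp add: algebra_simps)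
      finally have est: "(LINT x|lebesgue_on U. norm (u x - \<Phi> x) powr p) \<le> C7 * (1 + Q) * I" .
      obtain D where "\<Phi> \<in> W_1_infty U" "weak_jacobian U \<Phi> D" "essentially_injective U \<Phi>"
        "\<And>x. transpose (D x) ** symplectic_J ** D x = symplectic_J"
        using symplectic_diffeo_admissible[OF U ne \<Phi>(1)] by blast
      then show ?thesis using est by (intro exI[of _ \<Phi>] exI[of _ D]) simp
    qed
    then show ?thesis unfolding Q_def I_def G_def .
  qed
  show ?thesis by (rule exI[of _ C7]) (intro allI impI main)
qed

end
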